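(* Let $(\lambda_1,\lambda_2)$ be in the unstable regime. There exists $a_0>0$ such that for every $a\in(0,a_0]$ small data scattering does not hold for $$i\partial_t\psi=-\tfrac12\Delta\psi+\tfrac{a^2}{2}|x|^2\psi+\lambda_1|\psi|^2\psi+\lambda_2(K\star|\psi|^2)\psi,\qquad x\in\mathbb{R}^3;$$ that is, there is no $\delta>0$ such that for every $\psi_0\in\Sigma$ with $\|\psi_0\|_\Sigma<\delta$ the solution $\psi$ with $\psi(0)=\psi_0$ scatters.
   Context: $f\mapsto K\star f$ is the Fourier multiplier with symbol $\hat K(\xi)=\frac43\pi\,\frac{2\xi_3^2-\xi_1^2-\xi_2^2}{|\xi|^2}$ (convolution with the dipolar kernel $K(x)=\frac{1-3\cos^2\theta}{|x|^3}$, $\theta$ the angle between $x$ and $(0,0,1)$). The pair $(\lambda_1,\lambda_2)\in\mathbb{R}^2$ with $\lambda_2\ne0$ is in the unstable regime if $\lambda_1-\frac43\pi\lambda_2<0$ when $\lambda_2>0$, and $\lambda_1+\frac83\pi\lambda_2<0$ when $\lambda_2<0$. $\Sigma=\{u\in H^1(\mathbb{R}^3,\mathbb{C}):\int|x|^2|u|^2dx<\infty\}$ with norm $\|u\|_\Sigma^2=\|u\|_{H^1}^2+\||x|u\|_2^2$. Solutions are the unique maximal $\Sigma$-valued continuous solutions given by the known local theory. A solution $\psi$ scatters if it is global and there exist $\psi_\pm\in H^1(\mathbb{R}^3,\mathbb{C})$ such that $\lim_{t\to\pm\infty}\|\psi(t)-e^{it\frac{\Delta}{2}}\psi_\pm\|_{H^1}=0$.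 *)

theory Defs
  imports "HOL-Analysis.Analysis"
begin

text \<open>
  Elements of Lebesgue spaces on R^3 are represented by Borel measurable functions. Every notion
  below is insensitive to changing a function on a null set.
\<close>

type_synonym field3 = "real ^ 3 \<Rightarrow> complex"

definition L2 :: "field3 set" where
  "L2 = {f \<in> borel_measurable lborel. integrable lborel (\<lambda>x. (cmod (f x))\<^sup>2)}"

definition L2_norm :: "field3 \<Rightarrow> real" where
  "L2_norm f = sqrt (LINT x|lborel. (cmod (f x))\<^sup>2)"


subsection \<open>Test functions and the Sobolev space\<close>

definition partial :: "3 \<Rightarrow> field3 \<Rightarrow> field3" where
  "partial j f x = frechet_derivative f (at x) (axis j 1)"

primrec C_class :: "nat \<Rightarrow> field3 set" where
  "C_class 0 = {f. continuous_on UNIV f}"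
| "C_class (Suc k) = {f. (\<forall>x. f differentiable (at x)) \<and> (\<forall>j. partial j f \<in> C_class k)}"

definition test_functions :: "field3 set" where
  "test_functions = {\<phi>. (\<forall>k. \<phi> \<in> C_class k) \<and> compact (closure {x. \<phi> x \<noteq> 0})}"

definition laplacian :: "field3 \<Rightarrow> field3" where
  "laplacian f x = (\<Sum>j\<in>UNIV. partial j (partial j f) x)"

definition is_weak_partial :: "3 \<Rightarrow> field3 \<Rightarrow> field3 \<Rightarrow> bool" where
  "is_weak_partial j u g \<longleftrightarrow>
     (\<forall>\<phi>\<in>test_functions. (LINT x|lborel. u x * partial j \<phi> x) = - (LINT x|lborel. g x * \<phi> x))"

definition H1 :: "field3 set" where
  "H1 = {u \<in> L2. \<forall>j. \<exists>g\<in>L2. is_weak_partial j u g}"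

text \<open>The choice is harmless, since weak derivatives are unique up to null sets.\<close>

definition weak_partial :: "3 \<Rightarrow> field3 \<Rightarrow> field3" where
  "weak_partial j u = (SOME g. g \<in> L2 \<and> is_weak_partial j u g)"

definition H1_norm :: "field3 \<Rightarrow> real" where
  "H1_norm u = sqrt ((L2_norm u)\<^sup>2 + (\<Sum>j\<in>UNIV. (L2_norm (weak_partial j u))\<^sup>2))"

definition Sigma_space :: "field3 set" where
  "Sigma_space = {u \<in> H1. integrable lborel (\<lambda>x. (norm x)\<^sup>2 * (cmod (u x))\<^sup>2)}"

definition Sigma_norm :: "field3 \<Rightarrow> real" where
  "Sigma_norm u = sqrt ((H1_norm u)\<^sup>2 + (LINT x|lborel. (norm x)\<^sup>2 * (cmod (u x))\<^sup>2))"


subsection \<open>Fourier multipliers\<close>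

text \<open>
  The Fourier transform on L2 is the L2 limit of the truncated integrals of
  \<open>f x * exp (- \<i> x \<bullet> \<xi>)\<close>; \<open>is_fourier f F\<close> says that \<open>F\<close> is a representative of it. With this
  convention \<open>\<Delta>\<close> has symbol \<open>- |\<xi>|\<^sup>2\<close>.
\<close>

definition is_fourier :: "field3 \<Rightarrow> field3 \<Rightarrow> bool" where
  "is_fourier f F \<longleftrightarrow> f \<in> L2 \<and> F \<in> L2 \<and>
     ((\<lambda>R. \<integral>\<^sup>+ \<xi>. ennreal ((cmod ((LINT x:cball 0 R|lborel. f x * cis (- (x \<bullet> \<xi>))) - F \<xi>))\<^sup>2) \<partial>lborel)
        \<longlongrightarrow> 0) at_top"

text \<open>
  For a bounded measurable symbol \<open>m\<close> and \<open>f\<close> in L2 the function chosen here exists by Plancherel's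
  theorem, and it is unique up to null sets.
\<close>

definition fourier_multiplier :: "field3 \<Rightarrow> field3 \<Rightarrow> field3" where
  "fourier_multiplier m f =
     (SOME h. \<exists>F. is_fourier f F \<and> is_fourier h (\<lambda>\<xi>. m \<xi> * F \<xi>))"

definition dipolar_symbol :: "real ^ 3 \<Rightarrow> real" where
  "dipolar_symbol \<xi> =
     4 / 3 * pi * ((2 * (\<xi> $ 3)\<^sup>2 - (\<xi> $ 1)\<^sup>2 - (\<xi> $ 2)\<^sup>2) / (norm \<xi>)\<^sup>2)"

text \<open>\<open>K \<star> f\<close>; it is only applied to squared moduli of H1 functions, which are in L2.\<close>

definition dipolar_conv :: "field3 \<Rightarrow> field3" where
  "dipolar_conv = fourier_multiplier (\<lambda>\<xi>. complex_of_real (dipolar_symbol \<xi>))"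

text \<open>The free Schroedinger group \<open>exp (i t \<Delta> / 2)\<close>.\<close>

definition free_evolution :: "real \<Rightarrow> field3 \<Rightarrow> field3" where
  "free_evolution t = fourier_multiplier (\<lambda>\<xi>. cis (- t * (norm \<xi>)\<^sup>2 / 2))"


subsection \<open>The equation\<close>

definition unstable_regime :: "real \<Rightarrow> real \<Rightarrow> bool" where
  "unstable_regime l1 l2 \<longleftrightarrow> l2 \<noteq> 0 \<and>
     (l2 > 0 \<longrightarrow> l1 - 4 / 3 * pi * l2 < 0) \<and>
     (l2 < 0 \<longrightarrow> l1 + 8 / 3 * pi * l2 < 0)"

definition modulus_sq :: "field3 \<Rightarrow> field3" where
  "modulus_sq u x = complex_of_real ((cmod (u x))\<^sup>2)"

text \<open>
  The right-hand side of the equation as a distribution, evaluated at the test function \<open>\<phi>\<close>.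
\<close>

definition gp_rhs :: "real \<Rightarrow> real \<Rightarrow> real \<Rightarrow> field3 \<Rightarrow> field3 \<Rightarrow> complex" where
  "gp_rhs a l1 l2 u \<phi> = (LINT x|lborel.
       - (1 / 2) * u x * laplacian \<phi> x
       + (complex_of_real (a\<^sup>2 / 2 * (norm x)\<^sup>2) * u x
          + complex_of_real l1 * modulus_sq u x * u x
          + complex_of_real l2 * dipolar_conv (modulus_sq u) x * u x) * \<phi> x)"

text \<open>
  A solution on an open interval is a continuous curve in the space \<open>\<Sigma>\<close> that satisfies
  the equation in the sense of distributions in space, at every time.
\<close>

definition gp_solution ::
    "real \<Rightarrow> real \<Rightarrow> real \<Rightarrow> field3 \<Rightarrow> real set \<Rightarrow> (real \<Rightarrow> field3) \<Rightarrow> bool" where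
  "gp_solution a l1 l2 \<psi>0 I \<psi> \<longleftrightarrow>
     open I \<and> is_interval I \<and> 0 \<in> I \<and>
     (\<forall>t\<in>I. \<psi> t \<in> Sigma_space) \<and>
     (\<forall>t\<in>I. ((\<lambda>s. Sigma_norm (\<lambda>x. \<psi> s x - \<psi> t x)) \<longlongrightarrow> 0) (at t)) \<and>
     (AE x in lborel. \<psi> 0 x = \<psi>0 x) \<and>
     (\<forall>\<phi>\<in>test_functions. \<forall>t\<in>I. \<exists>d.
        ((\<lambda>s. LINT x|lborel. \<psi> s x * \<phi> x) has_vector_derivative d) (at t) \<and>
        \<i> * d = gp_rhs a l1 l2 (\<psi> t) \<phi>)"

definition maximal_gp_solution ::
    "real \<Rightarrow> real \<Rightarrow> real \<Rightarrow> field3 \<Rightarrow> real set \<Rightarrow> (real \<Rightarrow> field3) \<Rightarrow> bool" where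
  "maximal_gp_solution a l1 l2 \<psi>0 I \<psi> \<longleftrightarrow>
     gp_solution a l1 l2 \<psi>0 I \<psi> \<and>
     (\<forall>J \<eta>. gp_solution a l1 l2 \<psi>0 J \<eta> \<and> I \<subseteq> J \<and> (\<forall>t\<in>I. AE x in lborel. \<eta> t x = \<psi> t x)
        \<longrightarrow> J = I)"

definition scatters :: "real set \<Rightarrow> (real \<Rightarrow> field3) \<Rightarrow> bool" where
  "scatters I \<psi> \<longleftrightarrow> I = UNIV \<and>
     (\<exists>\<psi>p\<in>H1. ((\<lambda>t. H1_norm (\<lambda>x. \<psi> t x - free_evolution t \<psi>p x)) \<longlongrightarrow> 0) at_top) \<and>
     (\<exists>\<psi>m\<in>H1. ((\<lambda>t. H1_norm (\<lambda>x. \<psi> t x - free_evolution t \<psi>m x)) \<longlongrightarrow> 0) at_bot)"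

end

theory Submission
  imports Defs "HOL-Probability.Probability"
begin

text \<open>
  Scattering fails because of small standing waves. The harmonic oscillator has the Gaussian ground
  state, at energy \<open>3 a / 2\<close>, and bifurcation from it produces periodic solutions
  \<open>\<psi> t x = e * cis (- \<omega> * t) * u x\<close> that are as small in \<open>\<Sigma>\<close> as desired: after a Lyapunov-Schmidt
  reduction the profile \<open>u\<close> comes from a contraction on the unit ball of L2, since the reduced resolvent
  of the oscillator, given by the time integral of the Mehler kernel, maps L2 to bounded functions.
  If such a wave were asymptotic to a free wave, then so would be its coefficient along the ground
  state, but the former rotates at constant modulus while the time averages of the latter, rotated
  back, tend to zero.
\<close>

subsection \<open>The space L2\<close>

text \<open>The obstacle is the nonlinearity. A cube leaves L2, and the dipolar convolution, whose
  symbol is discontinuous at the origin, acts on L2 but not on bounded functions. Every estimate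
  therefore pairs an L2 bound with a pointwise bound on the profile: the density is then in L2, the
  convolution keeps it there, and multiplication by the bounded profile is harmless. The pointwise
  bound comes from Cauchy-Schwarz, since a heat kernel at time t has L2 norm of order t to the -3/4
  in dimension three, which is integrable at 0. Taking the source, and not the profile, as the
  unknown thus replaces Sobolev embeddings and elliptic regularity. For large times it is the
  subtraction of the ground state projection that makes the time integral converge. The same kernel
  is used a second time: being Gaussian in each variable it shows that Gaussians are total in L2,
  and injectivity and inversion of the Fourier transform rest on this. Real-valuedness of the source
  is carried along because it makes the frequency real, so that the wave does rotate at constant
  modulus.\<close>

lemma ennreal_two_mult_le_weighted_squares:
  fixes u v :: ennreal
  assumes "0 < t"
  shows "2 * (u * v) \<le> ennreal t * u\<^sup>2 + ennreal (1 / t) * v\<^sup>2"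
proof (cases "u = \<top> \<or> v = \<top>")
  case True
  with assms show ?thesis
    by (auto simp: ennreal_mult_top ennreal_top_mult power2_eq_square)
next
  case False
  then obtain p q where p: "u = ennreal p" "0 \<le> p" and q: "v = ennreal q" "0 \<le> q"
    by (metis ennreal_cases)
  have "0 \<le> (t * p - q)\<^sup>2 / t" using assms by simp
  also have "\<dots> = t * p\<^sup>2 + 1 / t * q\<^sup>2 - 2 * (p * q)"
    using assms by (simp add: field_simps power2_eq_square)
  finally have "2 * (p * q) \<le> t * p\<^sup>2 + 1 / t * q\<^sup>2" by simp
  with p q assms have "ennreal (2 * (p * q)) \<le> ennreal (t * p\<^sup>2 + 1 / t * q\<^sup>2)"
    by (intro ennreal_leI)
  also have "ennreal (t * p\<^sup>2 + 1 / t * q\<^sup>2) = ennreal t * u\<^sup>2 + ennreal (1 / t) * v\<^sup>2"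
    using p q assms by (simp add: ennreal_power del: times_divide_eq_left flip: ennreal_mult)
  finally show ?thesis using p q by (simp add: ennreal_mult)
qed

text \<open>The weighted inequality is integrated and then optimised over the weight. The cases
  where a factor is zero or infinite are separated because the optimal weight degenerates there.
  Extended integrals are used so that the estimate can itself establish finiteness later on.\<close>

lemma nn_integral_Cauchy_Schwarz:
  assumes [measurable]: "u \<in> borel_measurable M" "v \<in> borel_measurable M"
  shows "(\<integral>\<^sup>+x. u x * v x \<partial>M)\<^sup>2 \<le> (\<integral>\<^sup>+x. (u x)\<^sup>2 \<partial>M) * (\<integral>\<^sup>+x. (v x)\<^sup>2 \<partial>M)"
    (is "?I\<^sup>2 \<le> ?A * ?B")
proof -
  have zero: "(\<integral>\<^sup>+x. f x * g x \<partial>M) = 0"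
    if "(\<integral>\<^sup>+x. (f x)\<^sup>2 \<partial>M) = 0" and [measurable]: "f \<in> borel_measurable M" "g \<in> borel_measurable M"
    for f g :: "_ \<Rightarrow> ennreal"
  proof -
    have "AE x in M. (f x)\<^sup>2 = 0" using that by (subst (asm) nn_integral_0_iff_AE) auto
    then have "AE x in M. f x * g x = 0" by eventually_elim auto
    then show ?thesis by (subst nn_integral_0_iff_AE) auto
  qed
  consider "?A = 0" | "?B = 0" | "?A \<noteq> 0" "?B \<noteq> 0" "?A = \<top> \<or> ?B = \<top>"
    | "?A \<noteq> 0" "?B \<noteq> 0" "?A \<noteq> \<top>" "?B \<noteq> \<top>" by blast
  then show ?thesis
  proof cases
    case 1
    then show ?thesis using zero[of u v] by simp
  next
    case 2
    then show ?thesis using zero[of v u] by (simp add: mult.commute)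
  next
    case 3
    then have "?A * ?B = \<top>" by (auto simp: ennreal_mult_eq_top_iff)
    then show ?thesis by simp
  next
    case 4
    then obtain A B where A: "?A = ennreal A" "0 \<le> A" and B: "?B = ennreal B" "0 \<le> B"
      by (metis ennreal_cases)
    with 4 have pos: "0 < A" "0 < B" by (auto simp: order_less_le)
    \<comment> \<open>This weight balances the two terms: both \<open>t * A\<close> and
      \<open>1 / t * B\<close> equal \<open>sqrt A * sqrt B\<close>.\<close>
    define t where "t = sqrt B / sqrt A"
    have t: "0 < t" using pos by (simp add: t_def)
    have "2 * ?I = (\<integral>\<^sup>+x. 2 * (u x * v x) \<partial>M)" by (simp add: nn_integral_cmult)
    also have "\<dots> \<le> (\<integral>\<^sup>+x. ennreal t * (u x)\<^sup>2 + ennreal (1 / t) * (v x)\<^sup>2 \<partial>M)"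
      by (intro nn_integral_mono ennreal_two_mult_le_weighted_squares t)
    also have "\<dots> = ennreal t * ?A + ennreal (1 / t) * ?B"
      by (simp add: nn_integral_add nn_integral_cmult)
    also have "\<dots> = ennreal (t * A + 1 / t * B)"
      using A B t by (simp add: ennreal_plus del: times_divide_eq_left flip: ennreal_mult)
    also have "t * A + 1 / t * B = 2 * (sqrt A * sqrt B)"
    proof -
      have "t * A = sqrt B * sqrt A" "1 / t * B = sqrt B * sqrt A"
        using pos by (simp_all add: t_def field_simps)
      then show ?thesis by simp
    qed
    finally have *: "2 * ?I \<le> ennreal (2 * (sqrt A * sqrt B))" .
    then have "?I \<noteq> \<top>" by (auto simp: ennreal_mult_top top_unique)
    then obtain I where I: "?I = ennreal I" "0 \<le> I" by (metis ennreal_cases)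
    from * I have "2 * I \<le> 2 * (sqrt A * sqrt B)"
      using pos by (subst (asm) I(1)) (simp add: ennreal_mult[symmetric] flip: ennreal_numeral)
    then have "I\<^sup>2 \<le> (sqrt A * sqrt B)\<^sup>2" using I by (intro power_mono) auto
    also have "\<dots> = A * B" using pos by (simp add: power_mult_distrib)
    finally have "ennreal (I\<^sup>2) \<le> ennreal (A * B)" by (rule ennreal_leI)
    then show ?thesis using I A B by (simp add: ennreal_power ennreal_mult)
  qed
qed

text \<open>Cauchy-Schwarz for the measure with density \<open>w\<close>, one factor being the
  constant 1. This is the form in which a positive kernel acts in Schur's test.\<close>

lemma nn_integral_weighted_Cauchy_Schwarz:
  assumes [measurable]: "w \<in> borel_measurable M" "v \<in> borel_measurable M"
  shows "(\<integral>\<^sup>+x. w x * v x \<partial>M)\<^sup>2 \<le> (\<integral>\<^sup>+x. w x \<partial>M) * (\<integral>\<^sup>+x. w x * (v x)\<^sup>2 \<partial>M)"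
  using nn_integral_Cauchy_Schwarz[of "\<lambda>_. 1" "density M w" v]
  by (simp add: nn_integral_density emeasure_density)

lemma L2_measurable [measurable_dest]: "f \<in> L2 \<Longrightarrow> f \<in> borel_measurable borel"
  by (simp add: L2_def)

lemma L2_integrable: "f \<in> L2 \<Longrightarrow> integrable lborel (\<lambda>x. (cmod (f x))\<^sup>2)"
  by (simp add: L2_def)

lemma L2_norm_nonneg [simp]: "0 \<le> L2_norm f"
  by (simp add: L2_norm_def)

lemma L2_norm_square: "(L2_norm f)\<^sup>2 = (LINT x|lborel. (cmod (f x))\<^sup>2)"
  by (simp add: L2_norm_def)

lemma nn_integral_L2:
  assumes "f \<in> L2"
  shows "(\<integral>\<^sup>+x. ennreal (cmod (f x)) ^ 2 \<partial>lborel) = ennreal (L2_norm f) ^ 2"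
  using L2_integrable[OF assms]
  by (simp add: ennreal_power L2_norm_square nn_integral_eq_integral)

text \<open>\<open>L2_norm\<close> is a Bochner integral and has the default value 0 on functions
  that are not square integrable, so it cannot certify membership by itself. A bound on the extended
  integral yields membership and the norm bound at once.\<close>

lemma L2_boundI:
  assumes [measurable]: "f \<in> borel_measurable borel" and C: "0 \<le> C"
    and le: "(\<integral>\<^sup>+x. ennreal (cmod (f x)) ^ 2 \<partial>lborel) \<le> ennreal C ^ 2"
  shows "f \<in> L2" "L2_norm f \<le> C"
proof -
  have "(\<integral>\<^sup>+x. ennreal (norm ((cmod (f x))\<^sup>2)) \<partial>lborel) \<le> ennreal (C\<^sup>2)"
    using le C by (simp add: ennreal_power)
  also have "\<dots> < \<infinity>" by simp
  finally have "integrable lborel (\<lambda>x. (cmod (f x))\<^sup>2)"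
    by (intro integrableI_bounded) auto
  then show L2: "f \<in> L2" by (simp add: L2_def)
  from nn_integral_L2[OF this] le have "ennreal ((L2_norm f)\<^sup>2) \<le> ennreal (C\<^sup>2)"
    using C by (simp add: ennreal_power)
  then have "(L2_norm f)\<^sup>2 \<le> C\<^sup>2" using C by simp
  then show "L2_norm f \<le> C" using C by (rule power2_le_imp_le)
qed

lemma L2_mono:
  assumes [measurable]: "f \<in> borel_measurable borel" and g: "g \<in> L2" and C: "0 \<le> C"
    and le: "AE x in lborel. cmod (f x) \<le> C * cmod (g x)"
  shows "f \<in> L2" "L2_norm f \<le> C * L2_norm g"
proof -
  note [measurable] = L2_measurable[OF g]
  have "(\<integral>\<^sup>+x. ennreal (cmod (f x)) ^ 2 \<partial>lborel) \<le> (\<integral>\<^sup>+x. (ennreal C * ennreal (cmod (g x)))\<^sup>2 \<partial>lborel)"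
  proof (intro nn_integral_mono_AE, use le in eventually_elim)
    case (elim x)
    then have "ennreal (cmod (f x)) \<le> ennreal (C * cmod (g x))" by (rule ennreal_leI)
    then show ?case using C by (intro power_mono) (auto simp: ennreal_mult)
  qed
  also have "\<dots> = ennreal (C * L2_norm g) ^ 2"
    using nn_integral_L2[OF g] C by (simp add: power_mult_distrib nn_integral_cmult ennreal_mult)
  finally show "f \<in> L2" "L2_norm f \<le> C * L2_norm g"
    using C by (auto intro!: L2_boundI[where C = "C * L2_norm g"])
qed

lemma L2_cong_AE:
  assumes g: "g \<in> L2" and f: "f \<in> borel_measurable borel" and eq: "AE x in lborel. f x = g x"
  shows "f \<in> L2" "L2_norm f = L2_norm g"
proof -
  have le1: "AE x in lborel. cmod (f x) \<le> 1 * cmod (g x)" using eq by eventually_elim simp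
  have le2: "AE x in lborel. cmod (g x) \<le> 1 * cmod (f x)" using eq by eventually_elim simp
  show L2: "f \<in> L2" by (rule L2_mono(1)[OF f g _ le1]) simp
  have "L2_norm f \<le> 1 * L2_norm g" by (rule L2_mono(2)[OF f g _ le1]) simp
  moreover have "L2_norm g \<le> 1 * L2_norm f" by (rule L2_mono(2)[OF L2_measurable[OF g] L2 _ le2]) simp
  ultimately show "L2_norm f = L2_norm g" by simp
qed

lemma L2_mult_integrable:
  assumes "f \<in> L2" "g \<in> L2"
  shows "integrable lborel (\<lambda>x. f x * g x)"
proof (rule Bochner_Integration.integrable_bound)
  show "integrable lborel (\<lambda>x. (cmod (f x))\<^sup>2 + (cmod (g x))\<^sup>2)"
    using assms by (intro Bochner_Integration.integrable_add L2_integrable)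
  show "(\<lambda>x. f x * g x) \<in> borel_measurable lborel"
    using assms by (auto dest!: L2_measurable)
  show "AE x in lborel. norm (f x * g x) \<le> norm ((cmod (f x))\<^sup>2 + (cmod (g x))\<^sup>2)"
  proof (intro AE_I2)
    fix x
    have "0 \<le> (cmod (f x) - cmod (g x))\<^sup>2" by simp
    moreover have "0 \<le> cmod (f x) * cmod (g x)" by simp
    ultimately show "norm (f x * g x) \<le> norm ((cmod (f x))\<^sup>2 + (cmod (g x))\<^sup>2)"
      by (simp only: norm_mult power2_diff real_norm_def)
  qed
qed

lemma ennreal_power2_le_cancel:
  fixes a :: ennreal
  assumes "a\<^sup>2 \<le> (ennreal b)\<^sup>2" "0 \<le> b"
  shows "a \<le> ennreal b"
proof (cases a)
  case (real r)
  with assms have "r\<^sup>2 \<le> b\<^sup>2" by (simp add: ennreal_power)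
  with real assms show ?thesis by (auto intro!: ennreal_leI power2_le_imp_le)
next
  case top
  with assms show ?thesis by (simp add: ennreal_power top_unique)
qed

lemma L2_Cauchy_Schwarz_nn:
  assumes "f \<in> L2" "g \<in> L2"
  shows "(\<integral>\<^sup>+x. ennreal (cmod (f x)) * ennreal (cmod (g x)) \<partial>lborel) \<le> ennreal (L2_norm f * L2_norm g)"
proof -
  note [measurable] = L2_measurable[OF assms(1)] L2_measurable[OF assms(2)]
  have "(\<integral>\<^sup>+x. ennreal (cmod (f x)) * ennreal (cmod (g x)) \<partial>lborel)\<^sup>2 \<le> (ennreal (L2_norm f * L2_norm g))\<^sup>2"
    using nn_integral_Cauchy_Schwarz[of "\<lambda>x. ennreal (cmod (f x))" lborel "\<lambda>x. ennreal (cmod (g x))"]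
    by (simp add: nn_integral_L2 assms power_mult_distrib ennreal_mult)
  then show ?thesis by (rule ennreal_power2_le_cancel) simp
qed

lemma L2_Cauchy_Schwarz_norm:
  assumes "f \<in> L2" "g \<in> L2"
  shows "(LINT x|lborel. cmod (f x) * cmod (g x)) \<le> L2_norm f * L2_norm g"
proof -
  have "integrable lborel (\<lambda>x. cmod (f x) * cmod (g x))"
    using integrable_norm[OF L2_mult_integrable[OF assms]] by (simp add: norm_mult)
  then have "ennreal (LINT x|lborel. cmod (f x) * cmod (g x))
      = (\<integral>\<^sup>+x. ennreal (cmod (f x)) * ennreal (cmod (g x)) \<partial>lborel)"
    by (simp add: nn_integral_eq_integral flip: ennreal_mult)
  also have "\<dots> \<le> ennreal (L2_norm f * L2_norm g)" by (rule L2_Cauchy_Schwarz_nn[OF assms])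
  finally show ?thesis by simp
qed

lemma L2_Cauchy_Schwarz:
  assumes "f \<in> L2" "g \<in> L2"
  shows "cmod (LINT x|lborel. f x * g x) \<le> L2_norm f * L2_norm g"
proof -
  have "cmod (LINT x|lborel. f x * g x) \<le> (LINT x|lborel. cmod (f x * g x))"
    by (rule integral_norm_bound)
  also have "\<dots> \<le> L2_norm f * L2_norm g" using L2_Cauchy_Schwarz_norm[OF assms] by (simp add: norm_mult)
  finally show ?thesis .
qed

lemma L2_add:
  assumes f: "f \<in> L2" and g: "g \<in> L2"
  shows "(\<lambda>x. f x + g x) \<in> L2" "L2_norm (\<lambda>x. f x + g x) \<le> L2_norm f + L2_norm g"
proof -
  note [measurable] = L2_measurable[OF f] L2_measurable[OF g]
  have fg: "integrable lborel (\<lambda>x. cmod (f x) * cmod (g x))"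
    using integrable_norm[OF L2_mult_integrable[OF assms]] by (simp add: norm_mult)
  have int: "integrable lborel (\<lambda>x. (cmod (f x))\<^sup>2 + 2 * (cmod (f x) * cmod (g x)) + (cmod (g x))\<^sup>2)"
    using f g fg by (intro Bochner_Integration.integrable_add integrable_mult_right L2_integrable)
  have le: "(cmod (f x + g x))\<^sup>2 \<le> (cmod (f x))\<^sup>2 + 2 * (cmod (f x) * cmod (g x)) + (cmod (g x))\<^sup>2" for x
  proof -
    have "(cmod (f x + g x))\<^sup>2 \<le> (cmod (f x) + cmod (g x))\<^sup>2"
      by (intro power_mono norm_triangle_ineq) simp
    then show ?thesis by (simp add: power2_sum algebra_simps)
  qed
  have "(\<integral>\<^sup>+x. ennreal (cmod (f x + g x)) ^ 2 \<partial>lborel)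
      \<le> (\<integral>\<^sup>+x. ennreal ((cmod (f x))\<^sup>2 + 2 * (cmod (f x) * cmod (g x)) + (cmod (g x))\<^sup>2) \<partial>lborel)"
    by (intro nn_integral_mono) (use le in \<open>simp add: ennreal_power ennreal_leI del: ennreal_plus\<close>)
  also have "\<dots> = ennreal (LINT x|lborel. (cmod (f x))\<^sup>2 + 2 * (cmod (f x) * cmod (g x)) + (cmod (g x))\<^sup>2)"
    by (intro nn_integral_eq_integral int) auto
  also have "(LINT x|lborel. (cmod (f x))\<^sup>2 + 2 * (cmod (f x) * cmod (g x)) + (cmod (g x))\<^sup>2)
      = (L2_norm f)\<^sup>2 + 2 * (LINT x|lborel. cmod (f x) * cmod (g x)) + (L2_norm g)\<^sup>2"
    using fg L2_integrable[OF f] L2_integrable[OF g] by (simp add: L2_norm_square)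
  also have "\<dots> \<le> (L2_norm f + L2_norm g)\<^sup>2"
    using L2_Cauchy_Schwarz_norm[OF f g] by (simp add: power2_sum)
  finally have "(\<integral>\<^sup>+x. ennreal (cmod (f x + g x)) ^ 2 \<partial>lborel) \<le> ennreal (L2_norm f + L2_norm g) ^ 2"
    by (simp add: ennreal_power ennreal_leI del: ennreal_plus)
  then show "(\<lambda>x. f x + g x) \<in> L2" "L2_norm (\<lambda>x. f x + g x) \<le> L2_norm f + L2_norm g"
    by (auto intro!: L2_boundI[where C = "L2_norm f + L2_norm g"])
qed

lemma L2_scale:
  assumes "f \<in> L2"
  shows "(\<lambda>x. c * f x) \<in> L2" "L2_norm (\<lambda>x. c * f x) = cmod c * L2_norm f"
  using L2_integrable[OF assms] L2_measurable[OF assms]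
  by (auto simp: L2_def L2_norm_def norm_mult power_mult_distrib real_sqrt_mult)

lemma L2_diff:
  assumes f: "f \<in> L2" and g: "g \<in> L2"
  shows "(\<lambda>x. f x - g x) \<in> L2" "L2_norm (\<lambda>x. f x - g x) \<le> L2_norm f + L2_norm g"
  using L2_add[OF f L2_scale(1)[OF g, of "-1"]] L2_scale(2)[OF g, of "-1"] by auto

lemma L2_norm_minus_commute: "L2_norm (\<lambda>x. f x - g x) = L2_norm (\<lambda>x. g x - f x)"
  by (simp add: L2_norm_def norm_minus_commute)

lemma L2_norm_triangle:
  assumes "f \<in> L2" "g \<in> L2" "h \<in> L2"
  shows "L2_norm (\<lambda>x. f x - h x) \<le> L2_norm (\<lambda>x. f x - g x) + L2_norm (\<lambda>x. g x - h x)"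
  using L2_add(2)[OF L2_diff(1)[OF assms(1,2)] L2_diff(1)[OF assms(2,3)]] by simp

lemma L2_zero [simp]: "(\<lambda>x. 0) \<in> L2" "L2_norm (\<lambda>x. 0) = 0"
  by (auto simp: L2_def L2_norm_def)

lemma L2_cnj:
  assumes "f \<in> L2" shows "(\<lambda>x. cnj (f x)) \<in> L2" "L2_norm (\<lambda>x. cnj (f x)) = L2_norm f"
proof -
  have "cnj \<in> borel_measurable borel" by (intro borel_measurable_continuous_onI continuous_intros)
  from measurable_compose[OF L2_measurable[OF assms] this] assms
  show "(\<lambda>x. cnj (f x)) \<in> L2" "L2_norm (\<lambda>x. cnj (f x)) = L2_norm f"
    by (auto simp: L2_def L2_norm_def)
qed

lemma L2_norm_eq_0_AE:
  assumes "f \<in> L2" "L2_norm f = 0" shows "AE x in lborel. f x = 0"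
proof -
  have "(\<integral>\<^sup>+x. ennreal (cmod (f x)) ^ 2 \<partial>lborel) = 0"
    using nn_integral_L2[OF assms(1)] assms(2) by simp
  moreover have "f \<in> borel_measurable borel" using assms by (auto dest: L2_measurable)
  ultimately have "AE x in lborel. ennreal (cmod (f x)) ^ 2 = 0"
    by (subst (asm) nn_integral_0_iff_AE) auto
  then show ?thesis by eventually_elim simp
qed

text \<open>Completeness for geometrically decaying increments: the whole sequence converges almost
  everywhere with no passage to a subsequence, and Fatou's lemma carries the Cauchy bounds over to
  the limit.\<close>

lemma L2_Cauchy_geometric:
  assumes f: "\<And>n. f n \<in> L2"
    and d: "\<And>n. L2_norm (\<lambda>x. f (Suc n) x - f n x) \<le> C * (1/2) ^ n"
  shows "\<exists>F\<in>L2. \<forall>n. L2_norm (\<lambda>x. f n x - F x) \<le> 2 * C * (1/2) ^ n"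
proof -
  note [measurable] = L2_measurable[OF f]
  have C: "0 \<le> C" using order.trans[OF L2_norm_nonneg d[of 0]] by simp
  have dist: "L2_norm (\<lambda>x. f (n + k) x - f n x) \<le> 2 * C * (1/2) ^ n" for n k
  proof -
    \<comment> \<open>The factor \<open>2 - 2 * (1/2) ^ k\<close> is the exact partial sum of the
      geometric series, which is what the induction on \<open>k\<close> can carry.\<close>
    have "L2_norm (\<lambda>x. f (n + k) x - f n x) \<le> C * (1/2) ^ n * (2 - 2 * (1/2) ^ k)"
    proof (induction k)
      case (Suc k)
      have "L2_norm (\<lambda>x. f (n + Suc k) x - f n x)
          \<le> C * (1/2) ^ (n + k) + C * (1/2) ^ n * (2 - 2 * (1/2) ^ k)"
        using L2_norm_triangle[OF f[of "n + Suc k"] f[of "n + k"] f[of n]] d[of "n + k"] Suc by simp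
      also have "\<dots> = C * (1/2) ^ n * (2 - 2 * (1/2) ^ Suc k)" by (simp add: power_add algebra_simps)
      finally show ?case .
    qed simp
    also have "\<dots> \<le> C * (1/2) ^ n * 2" using C by (intro mult_left_mono) auto
    finally show ?thesis by (simp add: mult_ac)
  qed
  \<comment> \<open>The squared increments have integrals of order \<open>(1/4) ^ n\<close>, so the
    weight \<open>2 ^ n\<close> still leaves a convergent series. Where its sum \<open>S\<close> is
    finite, each increment is at most \<open>sqrt S * sqrt (1/2) ^ n\<close>, which is
    summable.\<close>
  define s where "s n x = ennreal (2 ^ n) * ennreal (cmod (f (Suc n) x - f n x)) ^ 2" for n x
  have [measurable]: "s n \<in> borel_measurable borel" for n unfolding s_def by measurable
  have "(\<integral>\<^sup>+x. (\<Sum>n. s n x) \<partial>lborel) = (\<Sum>n. \<integral>\<^sup>+x. s n x \<partial>lborel)"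
    by (rule nn_integral_suminf) auto
  also have "\<dots> \<le> (\<Sum>n. ennreal (C\<^sup>2 * (1/2) ^ n))"
  proof (intro suminf_le summableI allI)
    fix n
    have "(\<integral>\<^sup>+x. s n x \<partial>lborel) = ennreal (2 ^ n) * ennreal (L2_norm (\<lambda>x. f (Suc n) x - f n x)) ^ 2"
      unfolding s_def by (simp add: nn_integral_cmult nn_integral_L2[OF L2_diff(1)[OF f f]])
    also have "\<dots> \<le> ennreal (2 ^ n) * ennreal (C * (1/2) ^ n) ^ 2"
      by (intro mult_left_mono power_mono ennreal_leI d) auto
    also have "\<dots> = ennreal (C\<^sup>2 * (1/2) ^ n)"
    proof -
      have "2 ^ n * (C * (1/2) ^ n)\<^sup>2 = C\<^sup>2 * (1/2) ^ n"
        by (simp add: power_mult_distrib power_divide power2_eq_square field_simps)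
      then show ?thesis using C by (simp add: ennreal_power flip: ennreal_mult)
    qed
    finally show "(\<integral>\<^sup>+x. s n x \<partial>lborel) \<le> ennreal (C\<^sup>2 * (1/2) ^ n)" .
  qed
  also have "\<dots> = ennreal (\<Sum>n. C\<^sup>2 * (1/2) ^ n)"
    using C by (intro suminf_ennreal2) auto
  finally have "(\<integral>\<^sup>+x. (\<Sum>n. s n x) \<partial>lborel) < \<infinity>" by (rule le_less_trans) simp
  then have "AE x in lborel. (\<Sum>n. s n x) \<noteq> \<infinity>"
    by (intro nn_integral_PInf_AE) auto
  then have conv: "AE x in lborel. convergent (\<lambda>n. f n x)"
  proof eventually_elim
    case (elim x)
    then obtain S where S: "(\<Sum>n. s n x) = ennreal S" "0 \<le> S" by (cases "\<Sum>n. s n x") auto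
    have "cmod (f (Suc n) x - f n x) \<le> sqrt S * (sqrt (1/2)) ^ n" for n
    proof -
      have "s n x \<le> (\<Sum>n. s n x)" using sum_le_suminf[OF summableI, of "{n}" "\<lambda>n. s n x"] by simp
      then have "ennreal (2 ^ n * (cmod (f (Suc n) x - f n x))\<^sup>2) \<le> ennreal S"
        using S by (simp add: s_def ennreal_power ennreal_mult)
      then have "2 ^ n * (cmod (f (Suc n) x - f n x))\<^sup>2 \<le> S" using S by simp
      then have "(cmod (f (Suc n) x - f n x))\<^sup>2 \<le> S * (1/2) ^ n" by (simp add: field_simps power_divide)
      then have "sqrt ((cmod (f (Suc n) x - f n x))\<^sup>2) \<le> sqrt (S * (1/2) ^ n)" by (rule real_sqrt_le_mono)
      then show ?thesis by (simp add: real_sqrt_mult real_sqrt_power)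
    qed
    moreover have "summable (\<lambda>n. sqrt S * (sqrt (1/2)) ^ n)"
      by (rule summable_mult, rule summable_geometric) simp
    ultimately have "summable (\<lambda>n. f (Suc n) x - f n x)"
      by (rule summable_comparison_test'[rotated])
    then have "convergent (\<lambda>n. \<Sum>i<n. (f (Suc i) x - f i x))"
      by (simp add: summable_iff_convergent)
    then have "convergent (\<lambda>n. (f n x - f 0 x) + f 0 x)"
      by (intro convergent_add convergent_const) (simp only: sum_lessThan_telescope[of "\<lambda>i. f i x"])
    then show ?case by simp
  qed
  define F where "F x = lim (\<lambda>n. f n x)" for x
  have [measurable]: "F \<in> borel_measurable borel" unfolding F_def by measurable
  have lim: "AE x in lborel. (\<lambda>n. f n x) \<longlonglongrightarrow> F x"
    using conv by eventually_elim (simp add: F_def convergent_LIMSEQ_iff)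
  \<comment> \<open>Fatou's lemma with \<open>n\<close> fixed and \<open>k\<close> tending to
    infinity. Membership of the difference in L2, and hence of \<open>F\<close>, is part of what it
    gives.\<close>
  have bound: "(\<lambda>x. f n x - F x) \<in> L2 \<and> L2_norm (\<lambda>x. f n x - F x) \<le> 2 * C * (1/2) ^ n" for n
  proof -
    have "(\<integral>\<^sup>+x. ennreal (cmod (f n x - F x)) ^ 2 \<partial>lborel)
        = (\<integral>\<^sup>+x. liminf (\<lambda>k. ennreal (cmod (f (n + k) x - f n x)) ^ 2) \<partial>lborel)"
    proof (intro nn_integral_cong_AE, use lim in eventually_elim)
      case (elim x)
      have "(\<lambda>k. f (n + k) x) \<longlonglongrightarrow> F x" using LIMSEQ_ignore_initial_segment[OF elim, of n] by (simp add: add.commute)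
      then have "(\<lambda>k. ennreal ((cmod (f (n + k) x - f n x))\<^sup>2)) \<longlonglongrightarrow> ennreal ((cmod (F x - f n x))\<^sup>2)"
        by (intro tendsto_intros)
      from lim_imp_Liminf[OF _ this] show ?case by (simp add: ennreal_power norm_minus_commute)
    qed
    also have "\<dots> \<le> liminf (\<lambda>k. \<integral>\<^sup>+x. ennreal (cmod (f (n + k) x - f n x)) ^ 2 \<partial>lborel)"
      by (rule nn_integral_liminf) auto
    also have "\<dots> \<le> limsup (\<lambda>k. \<integral>\<^sup>+x. ennreal (cmod (f (n + k) x - f n x)) ^ 2 \<partial>lborel)"
      by (rule Liminf_le_Limsup) simp
    also have "\<dots> \<le> ennreal (2 * C * (1/2) ^ n) ^ 2"
      by (intro Limsup_bounded always_eventually allI)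
         (auto simp: nn_integral_L2[OF L2_diff(1)[OF f f]] simp del: ennreal_power intro!: power_mono ennreal_leI dist)
    finally show ?thesis using C by (auto intro!: L2_boundI[where C = "2 * C * (1/2) ^ n"])
  qed
  have "F \<in> L2" using L2_diff(1)[OF f[of 0] conjunct1[OF bound[of 0]]] by simp
  with bound show ?thesis by blast
qed

subsection \<open>Test functions\<close>

lemma partial_eqI: "(f has_derivative D) (at x) \<Longrightarrow> partial j f x = D (axis j 1)"
  unfolding partial_def by (metis frechet_derivative_at)

lemma partial_add:
  assumes "f differentiable (at x)" "g differentiable (at x)"
  shows "partial j (\<lambda>x. f x + g x) x = partial j f x + partial j g x"
  using assms by (intro partial_eqI[THEN trans])
    (auto simp: partial_def frechet_derivative_works intro!: has_derivative_add)

lemma partial_mult: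
  assumes "f differentiable (at x)" "g differentiable (at x)"
  shows "partial j (\<lambda>x. f x * g x) x = f x * partial j g x + partial j f x * g x"
  using assms by (intro partial_eqI[THEN trans])
    (auto simp: partial_def frechet_derivative_works intro!: has_derivative_mult)

lemma partial_const [simp]: "partial j (\<lambda>x. c) = (\<lambda>x. 0)"
  by (rule ext, rule trans[OF partial_eqI[OF has_derivative_const]]) simp

lemma has_derivative_exp_complex:
  fixes f :: "'a::real_normed_vector \<Rightarrow> complex"
  assumes "(f has_derivative f') (at x)"
  shows "((\<lambda>x. exp (f x)) has_derivative (\<lambda>v. exp (f x) * f' v)) (at x)"
  using has_derivative_compose[OF assms DERIV_exp[of "f x", unfolded has_field_derivative_def]] .

section \<open>Closure properties of the smoothness classes\<close>

lemma C_class_mono: "f \<in> C_class (Suc k) \<Longrightarrow> f \<in> C_class k"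
proof (induction k arbitrary: f)
  case 0
  then show ?case
    by (auto simp: continuous_on_eq_continuous_at intro: differentiable_imp_continuous_within)
qed simp

lemma C_class_const: "(\<lambda>x. c) \<in> C_class k"
  by (induction k arbitrary: c) auto

lemma C_class_add: "f \<in> C_class k \<Longrightarrow> g \<in> C_class k \<Longrightarrow> (\<lambda>x. f x + g x) \<in> C_class k"
proof (induction k arbitrary: f g)
  case (Suc k)
  then have "partial j (\<lambda>x. f x + g x) = (\<lambda>x. partial j f x + partial j g x)" for j
    by (auto simp: partial_add)
  with Suc show ?case by auto
qed (auto intro: continuous_intros)

lemma C_class_mult: "f \<in> C_class k \<Longrightarrow> g \<in> C_class k \<Longrightarrow> (\<lambda>x. f x * g x) \<in> C_class k"
proof (induction k arbitrary: f g)
  case (Suc k)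
  then have "partial j (\<lambda>x. f x * g x) = (\<lambda>x. f x * partial j g x + partial j f x * g x)" for j
    by (auto simp: partial_mult)
  with Suc C_class_mono[OF Suc.prems(1)] C_class_mono[OF Suc.prems(2)] show ?case
    by (auto intro!: C_class_add)
qed (auto intro: continuous_intros)

lemma C_class_exp: "f \<in> C_class k \<Longrightarrow> (\<lambda>x. exp (f x)) \<in> C_class k"
proof (induction k arbitrary: f)
  case (Suc k)
  have *: "((\<lambda>x. exp (f x)) has_derivative (\<lambda>v. exp (f x) * frechet_derivative f (at x) v)) (at x)" for x
    using Suc.prems by (intro has_derivative_exp_complex) (simp flip: frechet_derivative_works)
  then have "partial j (\<lambda>x. exp (f x)) = (\<lambda>x. exp (f x) * partial j f x)" for j
    by (auto simp: partial_def dest: partial_eqI[of _ _ _ j])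
  with Suc.IH[OF C_class_mono[OF Suc.prems]] Suc.prems * show ?case
    by (auto intro!: C_class_mult simp: differentiable_def)
qed (auto intro: continuous_intros)

lemma C_class_prod: "finite I \<Longrightarrow> (\<And>i. i \<in> I \<Longrightarrow> f i \<in> C_class k) \<Longrightarrow> (\<lambda>x. \<Prod>i\<in>I. f i x) \<in> C_class k"
  by (induction I rule: finite_induct) (auto intro: C_class_const C_class_mult)

text \<open>The inequality \<open>y / m \<le> exp (y / m)\<close> raised to the power
  \<open>m\<close>. The constant is far from sharp but explicit. It serves both the flatness of the
  bump functions at the boundary and the absorption of polynomials by Gaussians.\<close>

lemma power_le_const_mult_exp:
  fixes y :: real
  assumes "0 \<le> y"
  shows "y ^ m \<le> real m ^ m * exp y"
proof (cases "m = 0")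
  case False
  have "y / m \<le> exp (y / m)" using exp_ge_add_one_self[of "y / m"] by linarith
  then have "(y / m) ^ m \<le> exp (y / m) ^ m" using assms by (intro power_mono) auto
  also have "\<dots> = exp y" using False by (simp flip: exp_of_nat_mult)
  finally show ?thesis using False by (simp add: power_divide field_simps)
qed (use assms in simp)

text \<open>The standard smooth cutoff \<open>exp (- (1 / t))\<close> divided by powers of
  \<open>t\<close>. Differentiation maps this family into linear combinations of itself, so carrying
  the exponent \<open>n\<close> lets the smoothness of all members be proved by a single
  induction.\<close>

definition bump_part :: "nat \<Rightarrow> real \<Rightarrow> real" where
  "bump_part n t = (if t \<le> 0 then 0 else exp (- (1 / t)) / t ^ n)"

text \<open>The power estimate is applied to \<open>1 / t\<close> with exponent
  \<open>n + 1\<close>, one more than boundedness would ask for; the spare factor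
  \<open>\<bar>t\<bar>\<close> gives the limit 0 at the origin.\<close>

lemma bump_part_bound: "\<bar>bump_part n t\<bar> \<le> real (Suc n) ^ Suc n * \<bar>t\<bar>"
proof (cases "t \<le> 0")
  case False
  then have "(1 / t) ^ Suc n \<le> real (Suc n) ^ Suc n * exp (1 / t)"
    by (intro power_le_const_mult_exp) simp
  with False have "1 \<le> real (Suc n) ^ Suc n * exp (1 / t) * t ^ Suc n"
    by (simp add: power_divide pos_divide_le_eq)
  with False have "exp (- (1 / t)) \<le> real (Suc n) ^ Suc n * t ^ Suc n"
    by (simp add: exp_minus field_simps)
  with False show ?thesis by (simp add: bump_part_def field_simps)
qed (simp add: bump_part_def mult_nonneg_nonpos)

lemma bump_part_has_derivative:
  "(bump_part n has_real_derivative bump_part (n + 2) t - real n * bump_part (n + 1) t) (at t)"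
proof -
  consider "t < 0" | "t = 0" | "0 < t" by linarith
  then show ?thesis
  proof cases
    case 1
    have "((\<lambda>_. 0) has_real_derivative 0) (at t)" by simp
    then have "(bump_part n has_real_derivative 0) (at t)"
      by (rule has_field_derivative_transform_within_open[where S = "{..<0}"])
         (use 1 in \<open>auto simp: bump_part_def\<close>)
    then show ?thesis using 1 by (simp add: bump_part_def)
  next
    case 2
    \<comment> \<open>At the origin the difference quotient of \<open>bump_part n\<close> is
      \<open>bump_part (n + 1)\<close> itself, so differentiability there is the decay of a later
      member of the family.\<close>
    have "((\<lambda>h. bump_part (n + 1) h) \<longlongrightarrow> 0) (at 0)"
    proof (rule Lim_null_comparison)
      show "\<forall>\<^sub>F h in at 0. norm (bump_part (n + 1) h) \<le> real (Suc (n + 1)) ^ Suc (n + 1) * \<bar>h\<bar>"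
        using bump_part_bound[of "n + 1"] by (intro always_eventually) auto
      show "((\<lambda>h. real (Suc (n + 1)) ^ Suc (n + 1) * \<bar>h\<bar>) \<longlongrightarrow> 0) (at 0)"
        by (intro tendsto_eq_intros) auto
    qed
    then have "((\<lambda>h. (bump_part n (0 + h) - bump_part n 0) / h) \<longlongrightarrow> 0) (at 0)"
      by (rule Lim_transform_eventually)
         (auto simp: bump_part_def eventually_at_filter field_simps)
    with 2 show ?thesis by (simp add: DERIV_def bump_part_def)
  next
    case 3
    have "((\<lambda>t. exp (- (1 / t)) / t ^ n) has_real_derivative
        (exp (- (1 / t)) / t ^ (n + 2) - real n * (exp (- (1 / t)) / t ^ (n + 1)))) (at t)"
    proof (cases n)
      case 0
      then show ?thesis using 3
        by (auto intro!: derivative_eq_intros simp: field_simps power2_eq_square)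
    next
      case (Suc m)
      have "((\<lambda>t. exp (- (1 / t))) has_real_derivative exp (- (1 / t)) * (1 / t\<^sup>2)) (at t)"
        using 3 by (auto intro!: derivative_eq_intros simp: field_simps power2_eq_square)
      from DERIV_divide[OF this DERIV_power_Suc[OF DERIV_ident]] 3
      have "((\<lambda>t. exp (- (1 / t)) / t ^ Suc m) has_real_derivative
          (exp (- (1 / t)) * (1 / t\<^sup>2) * t ^ Suc m - exp (- (1 / t)) * ((1 + of_nat m) * (1 * t ^ m))) / (t ^ Suc m * t ^ Suc m)) (at t)"
        by simp
      then show ?thesis unfolding Suc
        by (rule DERIV_cong) (use 3 in \<open>simp add: field_simps power2_eq_square\<close>)
    qed
    then have "(bump_part n has_real_derivative
        (exp (- (1 / t)) / t ^ (n + 2) - real n * (exp (- (1 / t)) / t ^ (n + 1)))) (at t)"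
      by (rule has_field_derivative_transform_within_open[where S = "{0<..}"])
         (use 3 in \<open>auto simp: bump_part_def\<close>)
    then show ?thesis using 3 by (simp add: bump_part_def)
  qed
qed

text \<open>The affine argument with \<open>s = 1\<close> and \<open>s = -1\<close> provides the
  cutoffs at the two ends of each edge of a box.\<close>

lemma C_class_bump_part:
  "(\<lambda>x. complex_of_real (bump_part n (s * (x $ j) + c))) \<in> C_class k"
proof (induction k arbitrary: n)
  case 0
  have "continuous_on UNIV (bump_part n)"
    using bump_part_has_derivative[of n]
    by (auto simp: continuous_on_eq_continuous_at intro: DERIV_isCont)
  then show ?case
    by (auto intro!: continuous_intros intro: continuous_on_compose2[of UNIV])
next
  case (Suc k)
  let ?f = "\<lambda>n x. complex_of_real (bump_part n (s * (x $ j) + c))"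
  let ?d = "\<lambda>t. bump_part (n + 2) t - real n * bump_part (n + 1) t"
  have "((\<lambda>x::real^3. s * (x $ j) + c) has_derivative (\<lambda>v. s * (v $ j))) (at x)" for x
    by (auto intro!: derivative_eq_intros bounded_linear_imp_has_derivative bounded_linear_vec_nth)
  from has_derivative_compose[OF this bump_part_has_derivative[of n, unfolded has_field_derivative_def]]
  have D: "(?f n has_derivative (\<lambda>v. complex_of_real (?d (s * (x $ j) + c) * (s * (v $ j))))) (at x)" for x
    by (rule has_derivative_of_real)
  have "partial i (?f n) = (\<lambda>x. (if i = j then complex_of_real s else 0) * (?f (n + 2) x + (- of_nat n) * ?f (n + 1) x))" for i
    by (rule ext, subst partial_eqI[OF D]) (auto simp: axis_def algebra_simps)
  moreover have "(\<lambda>x. (if i = j then complex_of_real s else 0) * (?f (n + 2) x + (- of_nat n) * ?f (n + 1) x)) \<in> C_class k" for i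
    by (intro C_class_mult C_class_add C_class_const Suc)
  ultimately show ?case using D by (auto simp: differentiable_def)
qed

section \<open>Smooth approximation of indicators of boxes\<close>

definition bump_base :: "real ^ 3 \<Rightarrow> real ^ 3 \<Rightarrow> real ^ 3 \<Rightarrow> real" where
  "bump_base a b x = (\<Prod>j\<in>UNIV. bump_part 0 (x $ j - a $ j) * bump_part 0 (b $ j - x $ j))"

text \<open>As \<open>m\<close> grows, \<open>1 - exp (- m * b)\<close> tends to 1 where
  \<open>b > 0\<close> and stays 0 where \<open>b = 0\<close>. The supports remain in one closed
  box, so a single formula gives a dominated sequence of test functions that converges to the
  indicator of the open box.\<close>

definition box_bump :: "nat \<Rightarrow> real ^ 3 \<Rightarrow> real ^ 3 \<Rightarrow> field3" where
  "box_bump m a b x = 1 - exp (- of_nat m * complex_of_real (bump_base a b x))"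

lemma bump_base_nonneg: "0 \<le> bump_base a b x"
  by (auto simp: bump_base_def bump_part_def intro!: prod_nonneg)

lemma bump_base_pos_iff: "0 < bump_base a b x \<longleftrightarrow> x \<in> box a b"
proof
  assume "x \<in> box a b"
  then show "0 < bump_base a b x"
    by (auto simp: bump_base_def bump_part_def mem_box_cart not_le intro!: prod_pos dest: spec leD)
next
  assume "0 < bump_base a b x"
  then have "(\<Prod>j\<in>UNIV. bump_part 0 (x $ j - a $ j) * bump_part 0 (b $ j - x $ j)) \<noteq> 0"
    unfolding bump_base_def by (rule less_imp_neq[symmetric])
  then have "bump_part 0 (x $ j - a $ j) * bump_part 0 (b $ j - x $ j) \<noteq> 0" for j
    by (simp add: prod_zero_iff)
  from this[of j for j] have "a $ j < x $ j \<and> x $ j < b $ j" for j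
    by (cases "a $ j < x $ j"; cases "x $ j < b $ j") (auto simp: bump_part_def dest!: meta_spec[of _ j])
  then show "x \<in> box a b" by (simp add: mem_box_cart)
qed

lemma box_bump_test: "box_bump m a b \<in> test_functions"
proof -
  have "box_bump m a b = (\<lambda>x. 1 + (-1) * exp ((- of_nat m) * (\<Prod>j\<in>UNIV.
      complex_of_real (bump_part 0 (1 * (x $ j) + (- a $ j))) *
      complex_of_real (bump_part 0 ((-1) * (x $ j) + b $ j)))))"
    by (auto simp: box_bump_def bump_base_def)
  also have "\<dots> \<in> C_class k" for k
    by (intro C_class_add C_class_mult C_class_exp C_class_const C_class_prod finite C_class_bump_part)
  finally have C: "box_bump m a b \<in> C_class k" for k .
  have "{x. box_bump m a b x \<noteq> 0} \<subseteq> cbox a b"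
  proof
    fix x assume "x \<in> {x. box_bump m a b x \<noteq> 0}"
    then have "bump_base a b x \<noteq> 0" by (auto simp: box_bump_def)
    then have "x \<in> box a b" using bump_base_nonneg[of a b x] by (simp flip: bump_base_pos_iff add: order_less_le)
    then show "x \<in> cbox a b" using box_subset_cbox by blast
  qed
  then have "bounded {x. box_bump m a b x \<noteq> 0}" using bounded_cbox bounded_subset by blast
  with C show ?thesis by (auto simp: test_functions_def)
qed

lemma box_bump_real: "box_bump m a b x = complex_of_real (1 - exp (- (real m * bump_base a b x)))"
  by (simp add: box_bump_def flip: exp_of_real)

lemma box_bump_le: "cmod (box_bump m a b x) \<le> indicator (cbox a b) x"
proof (cases "x \<in> box a b")
  case True
  then have "x \<in> cbox a b" using box_subset_cbox by blast
  moreover have "0 \<le> 1 - exp (- (real m * bump_base a b x))" using bump_base_nonneg[of a b x] by simp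
  ultimately show ?thesis by (simp add: box_bump_real del: of_real_diff)
next
  case False
  then have "bump_base a b x = 0" using bump_base_nonneg[of a b x] by (simp flip: bump_base_pos_iff add: order_less_le)
  then show ?thesis by (simp add: box_bump_def)
qed

lemma box_bump_tendsto: "(\<lambda>m. box_bump m a b x) \<longlonglongrightarrow> indicator (box a b) x"
proof (cases "x \<in> box a b")
  case True
  then have pos: "0 < bump_base a b x" by (simp add: bump_base_pos_iff)
  have "(\<lambda>m. complex_of_real (1 - exp (- bump_base a b x) ^ m)) \<longlonglongrightarrow> complex_of_real (1 - 0)"
    using pos by (intro tendsto_intros LIMSEQ_power_zero) auto
  with True show ?thesis by (simp add: box_bump_real exp_of_nat_mult[symmetric])
next
  case False
  then have "bump_base a b x = 0" using bump_base_nonneg[of a b x] by (simp flip: bump_base_pos_iff add: order_less_le)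
  with False show ?thesis by (simp add: box_bump_def)
qed

lemma L2_indicator_cbox: "(\<lambda>x. indicator (cbox a b) x) \<in> L2"
proof -
  have "integrable lborel (\<lambda>x::real^3. indicator (cbox a b) x :: real)"
    by (intro integrable_real_indicator emeasure_lborel_cbox_finite[folded infinity_ennreal_def]) auto
  moreover have "(\<lambda>x. (cmod (indicator (cbox a b) x))\<^sup>2) = (\<lambda>x::real^3. indicator (cbox a b) x :: real)"
    by (auto simp: indicator_def)
  ultimately show ?thesis by (simp add: L2_def)
qed

text \<open>An L2 function is integrable over a bounded box, so dominated convergence applies along
  the smooth bumps, with the closed box as common majorant.\<close>

lemma weakly_zero_box:
  assumes d: "d \<in> L2" and zero: "\<And>\<phi>. \<phi> \<in> test_functions \<Longrightarrow> (LINT x|lborel. d x * \<phi> x) = 0"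
  shows "(LINT x|lborel. d x * indicator (box a b) x) = 0"
proof -
  note [measurable] = L2_measurable[OF d]
  have meas [measurable]: "box_bump m a b \<in> borel_measurable borel" for m
    using box_bump_test[of m a b] by (intro borel_measurable_continuous_onI)
      (auto simp: test_functions_def dest: spec[of _ 0])
  have "(\<lambda>m. LINT x|lborel. d x * box_bump m a b x) \<longlonglongrightarrow> (LINT x|lborel. d x * indicator (box a b) x)"
  proof (rule integral_dominated_convergence)
    show "integrable lborel (\<lambda>x. norm (d x * indicator (cbox a b) x))"
      by (intro integrable_norm L2_mult_integrable d L2_indicator_cbox)
    show "AE x in lborel. (\<lambda>m. d x * box_bump m a b x) \<longlonglongrightarrow> d x * indicator (box a b) x"
      by (intro AE_I2 tendsto_intros box_bump_tendsto)
    show "AE x in lborel. norm (d x * box_bump m a b x) \<le> norm (d x * indicator (cbox a b) x)" for m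
    proof (intro AE_I2)
      fix x
      have "cmod (d x) * cmod (box_bump m a b x) \<le> cmod (d x) * indicator (cbox a b) x"
        by (intro mult_left_mono box_bump_le) simp
      then show "norm (d x * box_bump m a b x) \<le> norm (d x * indicator (cbox a b) x)"
        by (auto simp: norm_mult indicator_def split: if_splits)
    qed
  qed measurable
  then show ?thesis using zero[OF box_bump_test] by (simp add: LIMSEQ_const_iff)
qed

text \<open>The fundamental lemma of the calculus of variations. Open boxes are stable under
  intersection and generate the Borel sets, so vanishing integrals over boxes spread to all Borel
  sets. The restriction to \<open>D n\<close> is there because \<open>d\<close> is in L2 but need
  not be integrable on the whole space.\<close>

lemma weakly_zero_AE:
  assumes d: "d \<in> L2" and zero: "\<And>\<phi>. \<phi> \<in> test_functions \<Longrightarrow> (LINT x|lborel. d x * \<phi> x) = 0"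
  shows "AE x in lborel. d x = 0"
proof -
  note [measurable] = L2_measurable[OF d]
  define D :: "nat \<Rightarrow> (real ^ 3) set" where "D n = box (\<chi> j. - real n) (\<chi> j. real n)" for n
  have box0: "(LINT x|lborel. d x * indicator (box a b) x) = 0" for a b
    by (rule weakly_zero_box[OF d zero])
  have "AE x in lborel. d x * indicator (D n) x = 0" for n
  proof (rule sigma_finite_measure.density_zero[OF sigma_finite_lborel])
    have "integrable lborel (\<lambda>x. d x * indicator (cbox (\<chi> j. - real n) (\<chi> j. real n)) x)"
      by (intro L2_mult_integrable d L2_indicator_cbox)
    then show int: "integrable lborel (\<lambda>x. d x * indicator (D n) x)"
      using box_subset_cbox[of "\<chi> j. - real n" "\<chi> j::3. real n"]
      by (elim Bochner_Integration.integrable_bound) (auto simp: D_def indicator_def split: if_splits)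
    have setint: "set_integrable lborel A (\<lambda>x. d x * indicator (D n) x)" if "A \<in> sets borel" for A
      using int that unfolding set_integrable_def by (intro integrable_mult_indicator) auto
    fix A :: "(real ^ 3) set" assume "A \<in> sets lborel"
    then have A: "A \<in> sigma_sets UNIV (range (\<lambda>(a, b). box a b))"
      by (simp add: borel_eq_box)
    have "Int_stable (range (\<lambda>(a, b). box a b :: (real ^ 3) set))"
      by (auto simp: Int_stable_def box_Int_box)
    moreover have "range (\<lambda>(a, b). box a b :: (real ^ 3) set) \<subseteq> Pow UNIV" by simp
    ultimately show "(LINT x:A|lborel. d x * indicator (D n) x) = 0"
      using A
    proof (induction rule: sigma_sets_induct_disjoint)
      case (basic A)
      then obtain a b where "A = box a b" by auto
      then obtain a' b' where ab: "A \<inter> D n = box a' b'" by (auto simp: D_def box_Int_box)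
      have "(LINT x:A|lborel. d x * indicator (D n) x) = (LINT x|lborel. d x * indicator (A \<inter> D n) x)"
        unfolding set_lebesgue_integral_def by (intro Bochner_Integration.integral_cong) (auto simp: indicator_def)
      then show ?case using box0 by (simp add: ab)
    next
      \<comment> \<open>The whole space meets \<open>D n\<close> in \<open>D n\<close>, which is
        itself a box; this settles complements.\<close>
      case (compl A)
      then have A [measurable]: "A \<in> sets borel" by (simp add: borel_eq_box)
      have "(LINT x:UNIV - A|lborel. d x * indicator (D n) x)
          = (LINT x:UNIV|lborel. d x * indicator (D n) x) - (LINT x:A|lborel. d x * indicator (D n) x)"
        unfolding set_lebesgue_integral_def
        by (subst Bochner_Integration.integral_diff[symmetric, OF setint[unfolded set_integrable_def] setint[unfolded set_integrable_def]])
           (auto intro!: Bochner_Integration.integral_cong simp: indicator_def)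
      then show ?case using compl box0 by (simp add: D_def set_lebesgue_integral_def)
    next
      case (union A)
      then have A [measurable]: "A i \<in> sets borel" for i by (auto simp: borel_eq_box)
      show ?case
        using union A by (subst lebesgue_integral_countable_add[OF _ _ setint])
          (auto simp: disjoint_family_on_def)
    qed (auto simp: set_lebesgue_integral_def)
  qed
  then have "AE x in lborel. \<forall>n. d x * indicator (D n) x = 0" by (intro iffD2[OF AE_all_countable] allI)
  then show ?thesis
  proof eventually_elim
    case (elim x)
    obtain n where n: "norm x < real n" using reals_Archimedean2 by blast
    have "- real n < x $ j \<and> x $ j < real n" for j using component_le_norm_cart[of x j] n by linarith
    then have "x \<in> D n" by (simp add: D_def mem_box_cart)
    with elim show ?case by (auto simp: indicator_def dest: spec[of _ n])
  qed
qed

subsection \<open>Changes of variables and Schur's test\<close>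

lemma nn_integral_affine:
  fixes f :: "real ^ 3 \<Rightarrow> ennreal"
  assumes [measurable]: "f \<in> borel_measurable borel" and c: "c \<noteq> 0"
  shows "(\<integral>\<^sup>+x. f x \<partial>lborel) = ennreal (\<bar>c\<bar> ^ 3) * (\<integral>\<^sup>+x. f (t + c *\<^sub>R x) \<partial>lborel)"
proof -
  have "(\<integral>\<^sup>+x. f x \<partial>lborel) = (\<integral>\<^sup>+x. f x \<partial>density (distr lborel borel (\<lambda>x. t + c *\<^sub>R x)) (\<lambda>_. ennreal (\<bar>c\<bar> ^ DIM(real ^ 3))))"
    using lborel_affine[OF c, of t] by (rule arg_cong)
  also have "\<dots> = ennreal (\<bar>c\<bar> ^ 3) * (\<integral>\<^sup>+x. f (t + c *\<^sub>R x) \<partial>lborel)"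
    by (simp add: nn_integral_density nn_integral_distr nn_integral_cmult)
  finally show ?thesis .
qed

lemma integral_affine:
  fixes f :: "real ^ 3 \<Rightarrow> 'b::{banach, second_countable_topology}"
  assumes [measurable]: "f \<in> borel_measurable borel" and c: "c \<noteq> 0"
  shows "(LINT x|lborel. f x) = \<bar>c\<bar> ^ 3 *\<^sub>R (LINT x|lborel. f (t + c *\<^sub>R x))"
proof -
  have "(LINT x|lborel. f x) = integral\<^sup>L (density (distr lborel borel (\<lambda>x. t + c *\<^sub>R x)) (\<lambda>_. ennreal (\<bar>c\<bar> ^ DIM(real ^ 3)))) f"
    using lborel_affine[OF c, of t] by (rule arg_cong)
  also have "\<dots> = \<bar>c\<bar> ^ 3 *\<^sub>R (LINT x|lborel. f (t + c *\<^sub>R x))"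
    by (subst integral_density) (simp_all add: integral_distr)
  finally show ?thesis .
qed

lemma nn_integral_translate:
  fixes f :: "real ^ 3 \<Rightarrow> ennreal"
  assumes "f \<in> borel_measurable borel"
  shows "(\<integral>\<^sup>+x. f (x - t) \<partial>lborel) = (\<integral>\<^sup>+x. f x \<partial>lborel)"
  using nn_integral_affine[OF assms, of 1 "-t"] by simp

lemma nn_integral_reflect:
  fixes f :: "real ^ 3 \<Rightarrow> ennreal"
  assumes "f \<in> borel_measurable borel"
  shows "(\<integral>\<^sup>+x. f (t - x) \<partial>lborel) = (\<integral>\<^sup>+x. f x \<partial>lborel)"
  using nn_integral_affine[OF assms, of "-1" t] by simp

text \<open>The kernel \<open>W (x - y)\<close>, taken as a measure in \<open>y\<close>, has the
  same mass for every \<open>x\<close>. Weighted Cauchy-Schwarz extracts one factor of that mass and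
  Tonelli's theorem the other. Being stated for extended integrals, the lemma also proves
  convergence.\<close>

lemma Schur_test:
  fixes W v :: "real ^ 3 \<Rightarrow> ennreal"
  assumes [measurable]: "W \<in> borel_measurable borel" "v \<in> borel_measurable borel"
  shows "(\<integral>\<^sup>+x. (\<integral>\<^sup>+y. W (x - y) * v y \<partial>lborel)\<^sup>2 \<partial>lborel)
    \<le> (\<integral>\<^sup>+z. W z \<partial>lborel)\<^sup>2 * (\<integral>\<^sup>+y. (v y)\<^sup>2 \<partial>lborel)"
proof -
  let ?A = "\<integral>\<^sup>+z. W z \<partial>lborel"
  have "(\<integral>\<^sup>+x. (\<integral>\<^sup>+y. W (x - y) * v y \<partial>lborel)\<^sup>2 \<partial>lborel)
      \<le> (\<integral>\<^sup>+x. ?A * (\<integral>\<^sup>+y. W (x - y) * (v y)\<^sup>2 \<partial>lborel) \<partial>lborel)"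
    using nn_integral_weighted_Cauchy_Schwarz[of "\<lambda>y. W (x - y)" lborel v for x]
    by (intro nn_integral_mono) (simp add: nn_integral_reflect)
  also have "\<dots> = ?A * (\<integral>\<^sup>+x. \<integral>\<^sup>+y. W (x - y) * (v y)\<^sup>2 \<partial>lborel \<partial>lborel)"
    by (intro nn_integral_cmult) measurable
  also have "(\<integral>\<^sup>+x. \<integral>\<^sup>+y. W (x - y) * (v y)\<^sup>2 \<partial>lborel \<partial>lborel)
      = (\<integral>\<^sup>+y. \<integral>\<^sup>+x. W (x - y) * (v y)\<^sup>2 \<partial>lborel \<partial>lborel)"
    by (intro lborel_pair.Fubini') measurable
  also have "\<dots> = (\<integral>\<^sup>+y. ?A * (v y)\<^sup>2 \<partial>lborel)"
    by (simp add: nn_integral_multc nn_integral_translate)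
  also have "\<dots> = ?A * (\<integral>\<^sup>+y. (v y)\<^sup>2 \<partial>lborel)"
    by (intro nn_integral_cmult) measurable
  finally show ?thesis by (simp add: power2_eq_square mult.assoc)
qed

subsection \<open>Gaussian integrals\<close>

lemma product_sigma_finite_lborel: "product_sigma_finite (\<lambda>_. lborel :: real measure)"
  by (intro product_sigma_finite.intro sigma_finite_lborel)

text \<open>Lebesgue measure is the image of a product of one-dimensional measures indexed by the
  basis vectors, so a product function integrates factor by factor. Complex values are wanted for
  the oscillating Gaussians below.\<close>

lemma integral_lborel_prod:
  fixes f :: "real ^ 3 \<Rightarrow> real \<Rightarrow> complex"
  assumes f: "\<And>b. b \<in> Basis \<Longrightarrow> integrable lborel (f b)"
  shows "(LINT x|lborel. (\<Prod>b\<in>Basis. f b (x \<bullet> b))) = (\<Prod>b\<in>Basis. (LINT t|lborel. f b t))"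
    and "integrable lborel (\<lambda>x. \<Prod>b\<in>Basis. f b (x \<bullet> b))"
proof -
  interpret product_sigma_finite "\<lambda>_. lborel :: real measure" by (rule product_sigma_finite_lborel)
  have [measurable]: "f b \<in> borel_measurable borel" if "b \<in> Basis" for b
    using borel_measurable_integrable[OF f[OF that]] by simp
  have comp: "(\<Sum>b\<in>Basis. g b *\<^sub>R b) \<bullet> b = g b" if "b \<in> Basis" for g :: "real ^ 3 \<Rightarrow> real" and b
    using that by (simp add: inner_sum_left inner_Basis if_distrib cong: if_cong)
  have [measurable]: "(\<lambda>x. \<Prod>b\<in>Basis. f b (x \<bullet> b)) \<in> borel_measurable borel"
    by (intro borel_measurable_prod) measurable
  have T: "(\<lambda>g. \<Sum>b\<in>Basis. g b *\<^sub>R b) \<in> measurable (\<Pi>\<^sub>M b\<in>Basis. lborel) (borel :: (real ^ 3) measure)"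
    by measurable
  show "(LINT x|lborel. (\<Prod>b\<in>Basis. f b (x \<bullet> b))) = (\<Prod>b\<in>Basis. (LINT t|lborel. f b t))"
    unfolding arg_cong[OF lborel_eq, of "\<lambda>M. integral\<^sup>L M (\<lambda>x. \<Prod>b\<in>Basis. f b (x \<bullet> b))"]
    by (subst integral_distr[OF T]) (simp_all add: comp product_integral_prod f cong: prod.cong)
  show "integrable lborel (\<lambda>x. \<Prod>b\<in>Basis. f b (x \<bullet> b))"
    unfolding arg_cong[OF lborel_eq, of "\<lambda>M. integrable M (\<lambda>x. \<Prod>b\<in>Basis. f b (x \<bullet> b))"]
    by (subst integrable_distr_eq[OF T]) (simp_all add: comp product_integrable_prod f cong: prod.cong)
qed

text \<open>Read off from the characteristic function of the standard normal distribution by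
  scaling, which spares a contour shift or a differential equation in \<open>s\<close>.\<close>

lemma gaussian_fourier_1:
  fixes c s :: real
  assumes c: "0 < c"
  shows "integrable lborel (\<lambda>t. complex_of_real (exp (- c * t\<^sup>2)) * cis (t * s))"
    and "(LINT t|lborel. complex_of_real (exp (- c * t\<^sup>2)) * cis (t * s))
      = complex_of_real (sqrt (pi / c) * exp (- s\<^sup>2 / (4 * c)))"
proof -
  \<comment> \<open>With this scaling \<open>(k * t)\<^sup>2 / 2 = c * t\<^sup>2\<close>, so the
    normal density becomes the Gaussian of rate \<open>c\<close>.\<close>
  define k where "k = sqrt (2 * c)"
  have k: "0 < k" "k\<^sup>2 = 2 * c" using c by (simp_all add: k_def)
  let ?h = "\<lambda>x. std_normal_density x *\<^sub>R iexp (s / k * x)"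
  have "integrable lborel (\<lambda>x. std_normal_density x)" by (simp add: integrable_normal_density)
  then have int: "integrable lborel ?h"
    by (rule Bochner_Integration.integrable_bound) (auto simp: normal_density_nonneg)
  have "(LINT x|lborel. ?h x) = char std_normal_distribution (s / k)"
    unfolding char_def by (subst integral_density) (auto simp: normal_density_nonneg)
  also have "\<dots> = complex_of_real (exp (- (s / k)\<^sup>2 / 2))" by (simp add: char_std_normal_distribution)
  finally have val: "(LINT x|lborel. ?h x) = complex_of_real (exp (- s\<^sup>2 / (4 * c)))"
    using k by (simp add: power_divide)
  have eq: "?h (0 + k * t) = complex_of_real (1 / sqrt (2 * pi)) * (complex_of_real (exp (- c * t\<^sup>2)) * cis (t * s))" for t
    using k by (simp add: std_normal_density_def power_mult_distrib cis_conv_exp scaleR_conv_of_real field_simps)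
  have k0: "k \<noteq> 0" using k by simp
  have "integrable lborel (\<lambda>t. ?h (0 + k * t))" by (rule lborel_integrable_real_affine[OF int k0])
  then have "integrable lborel (\<lambda>t. complex_of_real (sqrt (2 * pi)) * ?h (0 + k * t))"
    by (rule integrable_mult_right)
  then show "integrable lborel (\<lambda>t. complex_of_real (exp (- c * t\<^sup>2)) * cis (t * s))"
    by (rule Bochner_Integration.integrable_cong[THEN iffD1, OF refl, rotated]) (subst eq, simp)
  have "complex_of_real (exp (- s\<^sup>2 / (4 * c))) = \<bar>k\<bar> *\<^sub>R (LINT t|lborel. ?h (0 + k * t))"
    unfolding val[symmetric] by (rule lborel_integral_real_affine[OF k0])
  also have "\<dots> = complex_of_real (k / sqrt (2 * pi)) * (LINT t|lborel. complex_of_real (exp (- c * t\<^sup>2)) * cis (t * s))"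
    unfolding eq using k by (simp add: scaleR_conv_of_real)
  finally have "complex_of_real (sqrt (2 * pi) / k) * complex_of_real (exp (- s\<^sup>2 / (4 * c)))
      = (complex_of_real (sqrt (2 * pi) / k) * complex_of_real (k / sqrt (2 * pi)))
        * (LINT t|lborel. complex_of_real (exp (- c * t\<^sup>2)) * cis (t * s))"
    by simp
  also have "complex_of_real (sqrt (2 * pi) / k) * complex_of_real (k / sqrt (2 * pi)) = 1"
    using k by (simp flip: of_real_mult)
  also have "sqrt (2 * pi) / k = sqrt (pi / c)"
    using c by (simp add: k_def real_sqrt_divide real_sqrt_mult)
  finally show "(LINT t|lborel. complex_of_real (exp (- c * t\<^sup>2)) * cis (t * s))
      = complex_of_real (sqrt (pi / c) * exp (- s\<^sup>2 / (4 * c)))"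
    by simp
qed

lemma gaussian_fourier:
  fixes \<xi> :: "real ^ 3"
  assumes c: "0 < c"
  shows "integrable lborel (\<lambda>x. complex_of_real (exp (- c * (norm x)\<^sup>2)) * cis (x \<bullet> \<xi>))"
    and "(LINT x|lborel. complex_of_real (exp (- c * (norm x)\<^sup>2)) * cis (x \<bullet> \<xi>))
      = complex_of_real (sqrt (pi / c) ^ 3 * exp (- (norm \<xi>)\<^sup>2 / (4 * c)))"
proof -
  have norm_sq: "(norm x)\<^sup>2 = (\<Sum>b\<in>Basis. (x \<bullet> b)\<^sup>2)" for x :: "real ^ 3"
    unfolding power2_norm_eq_inner by (subst euclidean_inner) (simp add: power2_eq_square)
  have cis_sum: "cis (\<Sum>b\<in>B. g b) = (\<Prod>b\<in>B. cis (g b))" if "finite B" for g :: "real ^ 3 \<Rightarrow> real" and B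
    using that by (induction B rule: finite_induct) (auto simp: cis_mult[symmetric])
  have split: "complex_of_real (exp (- c * (norm x)\<^sup>2)) * cis (x \<bullet> \<xi>)
      = (\<Prod>b\<in>Basis. complex_of_real (exp (- c * (x \<bullet> b)\<^sup>2)) * cis ((x \<bullet> b) * (\<xi> \<bullet> b)))" for x
    by (simp add: norm_sq euclidean_inner[of x \<xi>] sum_distrib_left exp_sum cis_sum prod.distrib)
  show "integrable lborel (\<lambda>x. complex_of_real (exp (- c * (norm x)\<^sup>2)) * cis (x \<bullet> \<xi>))"
    unfolding split by (intro integral_lborel_prod gaussian_fourier_1 c)
  have "(LINT x|lborel. complex_of_real (exp (- c * (norm x)\<^sup>2)) * cis (x \<bullet> \<xi>))
      = (\<Prod>b\<in>Basis. complex_of_real (sqrt (pi / c) * exp (- (\<xi> \<bullet> b)\<^sup>2 / (4 * c))))"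
    unfolding split by (subst integral_lborel_prod) (simp_all only: gaussian_fourier_1 c)
  also have "\<dots> = complex_of_real (sqrt (pi / c) ^ 3 * (\<Prod>b\<in>Basis. exp (- (\<xi> \<bullet> b)\<^sup>2 / (4 * c))))"
    by (simp only: of_real_prod[symmetric] prod.distrib prod_constant) simp
  also have "(\<Prod>b\<in>Basis. exp (- (\<xi> \<bullet> b)\<^sup>2 / (4 * c))) = exp (- (norm \<xi>)\<^sup>2 / (4 * c))"
    by (simp add: norm_sq exp_sum[symmetric] sum_divide_distrib sum_negf)
  finally show "(LINT x|lborel. complex_of_real (exp (- c * (norm x)\<^sup>2)) * cis (x \<bullet> \<xi>))
      = complex_of_real (sqrt (pi / c) ^ 3 * exp (- (norm \<xi>)\<^sup>2 / (4 * c)))" .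
qed

lemma gaussian_integral:
  assumes c: "0 < c"
  shows "integrable lborel (\<lambda>x::real^3. exp (- c * (norm x)\<^sup>2))"
    and "(LINT x|(lborel :: (real ^ 3) measure). exp (- c * (norm x)\<^sup>2)) = sqrt (pi / c) ^ 3"
    and "(\<integral>\<^sup>+x. ennreal (exp (- c * (norm x)\<^sup>2)) \<partial>(lborel :: (real ^ 3) measure)) = ennreal (sqrt (pi / c) ^ 3)"
proof -
  have "integrable lborel (\<lambda>x::real^3. complex_of_real (exp (- c * (norm x)\<^sup>2)))"
    using gaussian_fourier(1)[OF c, of 0] by (simp del: of_real_exp)
  then show int: "integrable lborel (\<lambda>x::real^3. exp (- c * (norm x)\<^sup>2))"
    by (simp only: complex_of_real_integrable_eq)
  show val: "(LINT x|(lborel :: (real ^ 3) measure). exp (- c * (norm x)\<^sup>2)) = sqrt (pi / c) ^ 3"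
    using gaussian_fourier(2)[OF c, of 0] by (simp del: of_real_exp of_real_power of_real_mult)
  show "(\<integral>\<^sup>+x. ennreal (exp (- c * (norm x)\<^sup>2)) \<partial>(lborel :: (real ^ 3) measure)) = ennreal (sqrt (pi / c) ^ 3)"
    using int by (subst nn_integral_eq_integral) (auto simp: val[simplified])
qed

lemma gaussian_L2:
  assumes "0 < c"
  shows "(\<lambda>x. complex_of_real (exp (- c * (norm x)\<^sup>2)) * cis (x \<bullet> b)) \<in> L2"
proof -
  have "(cmod (complex_of_real (exp (- c * (norm x)\<^sup>2)) * cis (x \<bullet> b)))\<^sup>2 = exp (- (2 * c) * (norm x)\<^sup>2)" for x :: "real ^ 3"
    by (simp add: norm_mult power2_eq_square flip: exp_add)
  with gaussian_integral(1)[of "2 * c"] gaussian_fourier(1)[OF assms, of b] assms show ?thesis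
    by (simp add: L2_def borel_measurable_integrable)
qed

subsection \<open>The Fourier transform on L2\<close>

lemma measurable_cis [measurable]: "cis \<in> borel_measurable borel"
  by (intro borel_measurable_continuous_onI continuous_intros)

lemma Fubini_swap:
  fixes F :: "'a::euclidean_space \<Rightarrow> 'b::euclidean_space \<Rightarrow> complex"
  assumes [measurable]: "case_prod F \<in> borel_measurable (lborel \<Otimes>\<^sub>M lborel)"
    and fin: "(\<integral>\<^sup>+x. \<integral>\<^sup>+y. ennreal (cmod (F x y)) \<partial>lborel \<partial>lborel) < \<infinity>"
  shows "(LINT x|lborel. (LINT y|lborel. F x y)) = (LINT y|lborel. (LINT x|lborel. F x y))"
    and "integrable lborel (\<lambda>x. LINT y|lborel. F x y)"
    and "integrable lborel (\<lambda>y. LINT x|lborel. F x y)"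
proof -
  have "(\<integral>\<^sup>+p. ennreal (norm (case_prod F p)) \<partial>(lborel \<Otimes>\<^sub>M lborel)) < \<infinity>"
    using fin by (subst lborel.nn_integral_fst[symmetric]) auto
  then have int: "integrable (lborel \<Otimes>\<^sub>M lborel) (case_prod F)"
    by (intro integrableI_bounded) auto
  show "(LINT x|lborel. (LINT y|lborel. F x y)) = (LINT y|lborel. (LINT x|lborel. F x y))"
    by (rule lborel_pair.Fubini_integral[OF int, symmetric])
  show "integrable lborel (\<lambda>x. LINT y|lborel. F x y)" using lborel_pair.integrable_fst[OF int] .
  show "integrable lborel (\<lambda>y. LINT x|lborel. F x y)" using lborel_pair.integrable_snd[OF int] .
qed

text \<open>The classical transform of an integrable function. Elements of L2 reach it only through
  truncation to balls, as in \<open>is_fourier\<close>.\<close>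

definition FT :: "field3 \<Rightarrow> field3" where
  "FT f \<xi> = (LINT x|lborel. f x * cis (- (x \<bullet> \<xi>)))"

lemma FT_measurable [measurable]:
  assumes [measurable]: "f \<in> borel_measurable borel"
  shows "FT f \<in> borel_measurable borel"
  unfolding FT_def by measurable

lemma integrable_FT_kernel:
  assumes "integrable lborel f"
  shows "integrable lborel (\<lambda>x. f x * cis (x \<bullet> \<xi>))" "integrable lborel (\<lambda>x. f x * cis (- (x \<bullet> \<xi>)))"
proof -
  note [measurable] = borel_measurable_integrable[OF assms]
  show "integrable lborel (\<lambda>x. f x * cis (x \<bullet> \<xi>))" "integrable lborel (\<lambda>x. f x * cis (- (x \<bullet> \<xi>)))"
    by (rule Bochner_Integration.integrable_bound[OF assms]; simp add: norm_mult)+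
qed

lemma FT_bound: "cmod (FT f \<xi>) \<le> (LINT x|lborel. cmod (f x))"
  unfolding FT_def using integral_norm_bound[of lborel "\<lambda>x. f x * cis (- (x \<bullet> \<xi>))"] by (simp add: norm_mult)

lemma FT_diff:
  assumes "integrable lborel f" "integrable lborel g"
  shows "FT (\<lambda>x. f x - g x) \<xi> = FT f \<xi> - FT g \<xi>"
  unfolding FT_def left_diff_distrib by (intro Bochner_Integration.integral_diff integrable_FT_kernel assms)

lemma integral_FT_mult:
  assumes f: "integrable lborel f" and h: "integrable lborel h"
  shows "(LINT \<xi>|lborel. FT f \<xi> * h \<xi>) = (LINT x|lborel. f x * FT h x)"
proof -
  note [measurable] = borel_measurable_integrable[OF f] borel_measurable_integrable[OF h]
  let ?F = "\<lambda>x \<xi>. f x * cis (- (x \<bullet> \<xi>)) * h \<xi>"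
  have "(\<integral>\<^sup>+x. \<integral>\<^sup>+\<xi>. ennreal (cmod (?F x \<xi>)) \<partial>lborel \<partial>lborel)
      = (\<integral>\<^sup>+x. ennreal (cmod (f x)) \<partial>lborel) * (\<integral>\<^sup>+\<xi>. ennreal (cmod (h \<xi>)) \<partial>lborel)"
    by (simp add: norm_mult ennreal_mult nn_integral_cmult nn_integral_multc)
  also have "\<dots> < \<infinity>"
    using f h by (simp add: integrable_iff_bounded ennreal_mult_less_top)
  finally have fin: "(\<integral>\<^sup>+x. \<integral>\<^sup>+\<xi>. ennreal (cmod (?F x \<xi>)) \<partial>lborel \<partial>lborel) < \<infinity>" .
  have "(LINT x|lborel. (LINT \<xi>|lborel. ?F x \<xi>)) = (LINT \<xi>|lborel. (LINT x|lborel. ?F x \<xi>))"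
    by (rule Fubini_swap(1)[OF _ fin]) measurable
  moreover have "(LINT \<xi>|lborel. FT f \<xi> * h \<xi>) = (LINT \<xi>|lborel. (LINT x|lborel. ?F x \<xi>))"
    by (simp add: FT_def)
  moreover have "(LINT \<xi>|lborel. ?F x \<xi>) = f x * FT h x" for x
    unfolding FT_def by (subst integral_mult_right_zero[symmetric]) (simp add: mult_ac inner_commute)
  ultimately show ?thesis by simp
qed

text \<open>Without damping, the triple integral behind Plancherel's identity does not converge
  absolutely. With a Gaussian factor it does, and the frequency integral becomes a heat kernel in
  \<open>x - y\<close>.\<close>

lemma integral_gaussian_FT_FT:
  assumes f: "integrable lborel f" and e: "0 < e"
  shows "(LINT \<xi>|lborel. FT f \<xi> * (cnj (FT f \<xi>) * complex_of_real (exp (- e * (norm \<xi>)\<^sup>2))))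
    = (LINT x|lborel. f x * (LINT y|lborel. cnj (f y) * complex_of_real (sqrt (pi / e) ^ 3 * exp (- (norm (x - y))\<^sup>2 / (4 * e)))))"
proof -
  note [measurable] = borel_measurable_integrable[OF f]
  define h where "h \<xi> = cnj (FT f \<xi>) * complex_of_real (exp (- e * (norm \<xi>)\<^sup>2))" for \<xi>
  have cnj [measurable]: "cnj \<in> borel_measurable borel"
    by (intro borel_measurable_continuous_onI continuous_intros)
  have [measurable]: "(\<lambda>\<xi>. cnj (FT f \<xi>)) \<in> borel_measurable borel" "(\<lambda>\<xi>. cnj (f \<xi>)) \<in> borel_measurable borel"
    by (rule measurable_compose[OF _ cnj], measurable)+
  have h: "integrable lborel h"
  proof (rule Bochner_Integration.integrable_bound)
    show "integrable lborel (\<lambda>\<xi>::real^3. (LINT x|lborel. cmod (f x)) * exp (- e * (norm \<xi>)\<^sup>2))"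
      by (intro integrable_mult_right gaussian_integral e)
    show "AE x in lborel. norm (h x) \<le> norm ((LINT x|lborel. cmod (f x)) * exp (- e * (norm x)\<^sup>2))"
      by (intro AE_I2) (auto simp: h_def norm_mult abs_mult intro!: mult_right_mono order.trans[OF FT_bound])
  qed (unfold h_def, measurable)
  have FTh: "FT h x = (LINT y|lborel. cnj (f y) * complex_of_real (sqrt (pi / e) ^ 3 * exp (- (norm (x - y))\<^sup>2 / (4 * e))))" for x
  proof -
    let ?F = "\<lambda>\<xi> y. cnj (f y) * (complex_of_real (exp (- e * (norm \<xi>)\<^sup>2)) * cis (\<xi> \<bullet> (y - x)))"
    have "(\<integral>\<^sup>+\<xi>. \<integral>\<^sup>+y. ennreal (cmod (?F \<xi> y)) \<partial>lborel \<partial>lborel)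
        = (\<integral>\<^sup>+y. ennreal (cmod (f y)) \<partial>lborel) * (\<integral>\<^sup>+\<xi>. ennreal (exp (- e * (norm \<xi>)\<^sup>2)) \<partial>(lborel :: (real ^ 3) measure))"
      by (simp add: norm_mult ennreal_mult nn_integral_cmult nn_integral_multc)
    also have "\<dots> < \<infinity>"
      using f gaussian_integral(3)[OF e] by (simp add: integrable_iff_bounded ennreal_mult_less_top)
    finally have fin: "(\<integral>\<^sup>+\<xi>. \<integral>\<^sup>+y. ennreal (cmod (?F \<xi> y)) \<partial>lborel \<partial>lborel) < \<infinity>" .
    have "FT h x = (LINT \<xi>|lborel. (LINT y|lborel. ?F \<xi> y))"
    proof -
      have "h \<xi> * cis (- (\<xi> \<bullet> x)) = (LINT y|lborel. ?F \<xi> y)" for \<xi>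
      proof -
        have "cnj (FT f \<xi>) = (LINT y|lborel. cnj (f y) * cis (\<xi> \<bullet> y))"
          unfolding FT_def by (subst Bochner_Integration.integral_cnj[symmetric]) (simp add: cis_cnj inner_commute)
        then have "h \<xi> * cis (- (\<xi> \<bullet> x))
            = (LINT y|lborel. cnj (f y) * cis (\<xi> \<bullet> y)) * (complex_of_real (exp (- e * (norm \<xi>)\<^sup>2)) * cis (- (\<xi> \<bullet> x)))"
          by (simp add: h_def)
        also have "\<dots> = (LINT y|lborel. ?F \<xi> y)"
          by (subst integral_mult_left_zero[symmetric], rule Bochner_Integration.integral_cong)
             (simp_all add: inner_diff_right cis_mult)
        finally show ?thesis .
      qed
      then show ?thesis by (simp add: FT_def)
    qed
    also have "\<dots> = (LINT y|lborel. (LINT \<xi>|lborel. ?F \<xi> y))"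
      by (rule Fubini_swap(1)[OF _ fin]) measurable
    also have "\<dots> = (LINT y|lborel. cnj (f y) * complex_of_real (sqrt (pi / e) ^ 3 * exp (- (norm (x - y))\<^sup>2 / (4 * e))))"
      by (intro Bochner_Integration.integral_cong refl)
         (simp only: integral_mult_right_zero gaussian_fourier(2)[OF e] norm_minus_commute)
    finally show ?thesis .
  qed
  show ?thesis using integral_FT_mult[OF f h] by (simp only: FTh) (simp add: h_def)
qed

definition plancherel_const :: real where "plancherel_const = sqrt ((2 * pi) ^ 3)"

lemma plancherel_const_pos: "0 < plancherel_const"
  by (simp add: plancherel_const_def)

lemma plancherel_const_square: "plancherel_const\<^sup>2 = (2 * pi) ^ 3"
  by (simp add: plancherel_const_def)

text \<open>The heat kernel \<open>G\<close> has total mass \<open>(2 * pi) ^ 3\<close> whatever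
  \<open>e\<close> is, so Cauchy-Schwarz followed by Schur's test bounds the damped norm uniformly
  in \<open>e\<close>.\<close>

lemma plancherel_gaussian_le:
  assumes L2: "f \<in> L2" and f: "integrable lborel f" and e: "0 < e"
  shows "(\<integral>\<^sup>+\<xi>. ennreal (cmod (FT f \<xi>)) ^ 2 * ennreal (exp (- e * (norm \<xi>)\<^sup>2)) \<partial>lborel)
    \<le> ennreal (plancherel_const * L2_norm f) ^ 2"
proof -
  note [measurable] = borel_measurable_integrable[OF f]
  define G where "G z = sqrt (pi / e) ^ 3 * exp (- (norm z)\<^sup>2 / (4 * e))" for z :: "real ^ 3"
  have G: "0 \<le> G z" for z using e by (simp add: G_def)
  have [measurable]: "G \<in> borel_measurable borel" unfolding G_def by measurable
  have G_int: "(\<integral>\<^sup>+z. ennreal (G z) \<partial>lborel) = ennreal ((2 * pi) ^ 3)"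
  proof -
    have "(\<integral>\<^sup>+z. ennreal (G z) \<partial>lborel) = (\<integral>\<^sup>+z. ennreal (sqrt (pi / e) ^ 3) * ennreal (exp (- (1 / (4 * e)) * (norm z)\<^sup>2)) \<partial>(lborel :: (real ^ 3) measure))"
      using e by (simp add: G_def flip: ennreal_mult)
    also have "\<dots> = ennreal (sqrt (pi / e) ^ 3 * sqrt (pi / (1 / (4 * e))) ^ 3)"
      using e by (subst nn_integral_cmult) (simp_all add: gaussian_integral(3)[of "1 / (4 * e)", simplified] ennreal_mult)
    also have "sqrt (pi / e) ^ 3 * sqrt (pi / (1 / (4 * e))) ^ 3 = (sqrt ((2 * pi)\<^sup>2)) ^ 3"
    proof -
      have "pi / e * (pi / (1 / (4 * e))) = (2 * pi)\<^sup>2" using e by (simp add: field_simps power2_eq_square)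
      then show ?thesis by (metis power_mult_distrib real_sqrt_mult)
    qed
    also have "sqrt ((2 * pi)\<^sup>2) = 2 * pi" by (rule real_sqrt_unique) auto
    finally show ?thesis .
  qed
  let ?q = "\<lambda>\<xi>. (cmod (FT f \<xi>))\<^sup>2 * exp (- e * (norm \<xi>)\<^sup>2)"
  have q: "complex_of_real (?q \<xi>) = FT f \<xi> * (cnj (FT f \<xi>) * complex_of_real (exp (- e * (norm \<xi>)\<^sup>2)))" for \<xi>
    by (simp add: mult.assoc[symmetric] complex_norm_square[symmetric])
  have "integrable lborel ?q"
  proof (rule Bochner_Integration.integrable_bound)
    show "integrable lborel (\<lambda>\<xi>::real^3. (LINT x|lborel. cmod (f x))\<^sup>2 * exp (- e * (norm \<xi>)\<^sup>2))"
      by (intro integrable_mult_right gaussian_integral e)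
    show "AE x in lborel. norm (?q x) \<le> norm ((LINT x|lborel. cmod (f x))\<^sup>2 * exp (- e * (norm x)\<^sup>2))"
      by (intro AE_I2) (auto simp: abs_mult intro!: mult_right_mono power_mono FT_bound)
  qed simp
  then have "(\<integral>\<^sup>+\<xi>. ennreal (?q \<xi>) \<partial>lborel) = ennreal (LINT \<xi>|lborel. ?q \<xi>)"
    by (rule nn_integral_eq_integral) simp
  also have "(LINT \<xi>|lborel. ?q \<xi>) = cmod (LINT \<xi>|lborel. complex_of_real (?q \<xi>))"
    by (simp del: of_real_mult add: integral_complex_of_real)
  also have "(LINT \<xi>|lborel. complex_of_real (?q \<xi>))
      = (LINT x|lborel. f x * (LINT y|lborel. cnj (f y) * complex_of_real (G (x - y))))"
    unfolding q integral_gaussian_FT_FT[OF f e] by (simp add: G_def)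
  also have "ennreal (cmod (LINT x|lborel. f x * (LINT y|lborel. cnj (f y) * complex_of_real (G (x - y)))))
      \<le> (\<integral>\<^sup>+x. ennreal (cmod (f x)) * (\<integral>\<^sup>+y. ennreal (G (x - y)) * ennreal (cmod (f y)) \<partial>lborel) \<partial>lborel)"
  proof -
    have norm_le: "ennreal (cmod (integral\<^sup>L lborel g)) \<le> (\<integral>\<^sup>+x. ennreal (cmod (g x)) \<partial>lborel)" for g :: "real ^ 3 \<Rightarrow> complex"
      by (cases "integrable lborel g") (auto simp: integral_norm_bound_ennreal not_integrable_integral_eq)
    show ?thesis
      by (rule order.trans[OF norm_le], rule nn_integral_mono, simp add: norm_mult ennreal_mult, rule mult_left_mono)
         (use norm_le[of "\<lambda>y. cnj (f y) * complex_of_real (G (x - y))" for x] G in \<open>simp_all add: norm_mult ennreal_mult mult.commute\<close>)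
  qed
  also have "\<dots> \<le> ennreal ((plancherel_const * L2_norm f)\<^sup>2)"
  proof (rule ennreal_power2_le_cancel)
    have "(\<integral>\<^sup>+x. ennreal (cmod (f x)) * (\<integral>\<^sup>+y. ennreal (G (x - y)) * ennreal (cmod (f y)) \<partial>lborel) \<partial>lborel)\<^sup>2
        \<le> (\<integral>\<^sup>+x. ennreal (cmod (f x)) ^ 2 \<partial>lborel) * (\<integral>\<^sup>+x. (\<integral>\<^sup>+y. ennreal (G (x - y)) * ennreal (cmod (f y)) \<partial>lborel)\<^sup>2 \<partial>lborel)"
      by (rule nn_integral_Cauchy_Schwarz) measurable
    also have "\<dots> \<le> (\<integral>\<^sup>+x. ennreal (cmod (f x)) ^ 2 \<partial>lborel) * ((\<integral>\<^sup>+z. ennreal (G z) \<partial>lborel)\<^sup>2 * (\<integral>\<^sup>+y. ennreal (cmod (f y)) ^ 2 \<partial>lborel))"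
      by (intro mult_left_mono Schur_test) auto
    also have "\<dots> = ennreal ((L2_norm f)\<^sup>2 * (((2 * pi) ^ 3)\<^sup>2 * (L2_norm f)\<^sup>2))"
      unfolding nn_integral_L2[OF L2] G_int by (simp add: ennreal_power ennreal_mult)
    also have "(L2_norm f)\<^sup>2 * (((2 * pi) ^ 3)\<^sup>2 * (L2_norm f)\<^sup>2) = ((plancherel_const * L2_norm f)\<^sup>2)\<^sup>2"
      by (simp add: power_mult_distrib plancherel_const_square)
    finally show "(\<integral>\<^sup>+x. ennreal (cmod (f x)) * (\<integral>\<^sup>+y. ennreal (G (x - y)) * ennreal (cmod (f y)) \<partial>lborel) \<partial>lborel)\<^sup>2
        \<le> (ennreal ((plancherel_const * L2_norm f)\<^sup>2))\<^sup>2"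
      by (simp add: ennreal_power)
  qed simp
  finally show ?thesis
    using plancherel_const_pos by (subst ennreal_power) (simp_all add: ennreal_power ennreal_mult'')
qed

text \<open>Fatou's lemma as the damping tends to 0. Only the inequality is proved at this point;
  the reverse one comes from inversion, for which the transform on L2 must be available
  first.\<close>

lemma plancherel_le:
  assumes L2: "f \<in> L2" and f: "integrable lborel f"
  shows "FT f \<in> L2" "L2_norm (FT f) \<le> plancherel_const * L2_norm f"
proof -
  note [measurable] = borel_measurable_integrable[OF f]
  define e where "e n = inverse (real (Suc n))" for n
  have e: "0 < e n" for n by (simp add: e_def)
  have lim: "e \<longlonglongrightarrow> 0" unfolding e_def by (rule LIMSEQ_inverse_real_of_nat)
  have "(\<integral>\<^sup>+\<xi>. ennreal (cmod (FT f \<xi>)) ^ 2 \<partial>lborel)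
      = (\<integral>\<^sup>+\<xi>. liminf (\<lambda>n. ennreal (cmod (FT f \<xi>)) ^ 2 * ennreal (exp (- e n * (norm \<xi>)\<^sup>2))) \<partial>lborel)"
  proof (intro nn_integral_cong)
    fix \<xi> :: "real ^ 3"
    have "(\<lambda>n. ennreal ((cmod (FT f \<xi>))\<^sup>2 * exp (- e n * (norm \<xi>)\<^sup>2))) \<longlonglongrightarrow> ennreal ((cmod (FT f \<xi>))\<^sup>2 * exp (- 0 * (norm \<xi>)\<^sup>2))"
      by (intro tendsto_intros lim)
    from lim_imp_Liminf[OF _ this]
    show "ennreal (cmod (FT f \<xi>)) ^ 2 = liminf (\<lambda>n. ennreal (cmod (FT f \<xi>)) ^ 2 * ennreal (exp (- e n * (norm \<xi>)\<^sup>2)))"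
      by (simp add: ennreal_power ennreal_mult)
  qed
  also have "\<dots> \<le> liminf (\<lambda>n. \<integral>\<^sup>+\<xi>. ennreal (cmod (FT f \<xi>)) ^ 2 * ennreal (exp (- e n * (norm \<xi>)\<^sup>2)) \<partial>lborel)"
    by (rule nn_integral_liminf) measurable
  also have "\<dots> \<le> limsup (\<lambda>n. \<integral>\<^sup>+\<xi>. ennreal (cmod (FT f \<xi>)) ^ 2 * ennreal (exp (- e n * (norm \<xi>)\<^sup>2)) \<partial>lborel)"
    by (rule Liminf_le_Limsup) simp
  also have "\<dots> \<le> ennreal (plancherel_const * L2_norm f) ^ 2"
    by (intro Limsup_bounded always_eventually allI plancherel_gaussian_le L2 f e)
  finally show "FT f \<in> L2" "L2_norm (FT f) \<le> plancherel_const * L2_norm f"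
    using plancherel_const_pos by (auto intro!: L2_boundI[where C = "plancherel_const * L2_norm f"])
qed

section \<open>The transform of square integrable functions\<close>

definition trunc :: "real \<Rightarrow> field3 \<Rightarrow> field3" where
  "trunc R f x = indicator (cball 0 R) x * f x"

lemma FT_trunc: "(LINT x:cball 0 R|lborel. f x * cis (- (x \<bullet> \<xi>))) = FT (trunc R f) \<xi>"
  unfolding set_lebesgue_integral_def FT_def trunc_def
  by (intro Bochner_Integration.integral_cong) (auto simp: indicator_def)

lemma L2_indicator:
  assumes "S \<in> sets borel" "bounded S"
  shows "(\<lambda>x. indicator S x) \<in> L2"
proof -
  have "integrable lborel (\<lambda>x::real^3. indicator S x :: real)"
    using assms emeasure_bounded_finite[OF assms(2)] by (intro integrable_real_indicator) auto
  moreover have "(\<lambda>x. (cmod (indicator S x))\<^sup>2) = (\<lambda>x::real^3. indicator S x :: real)"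
    by (auto simp: indicator_def)
  ultimately show ?thesis using assms by (simp add: L2_def)
qed

lemma FT_diff_fun:
  assumes "integrable lborel f" "integrable lborel g"
  shows "FT (\<lambda>x. f x - g x) = (\<lambda>\<xi>. FT f \<xi> - FT g \<xi>)"
  using FT_diff[OF assms] by auto

lemma trunc_L2:
  assumes f: "f \<in> L2"
  shows "trunc R f \<in> L2" "integrable lborel (trunc R f)" "L2_norm (trunc R f) \<le> L2_norm f"
proof -
  note [measurable] = L2_measurable[OF f]
  have m: "trunc R f \<in> borel_measurable borel"
    unfolding trunc_def[abs_def]
    by (intro borel_measurable_times borel_measurable_indicator L2_measurable f) simp
  have le: "AE x in lborel. cmod (trunc R f x) \<le> 1 * cmod (f x)"
    by (intro AE_I2) (auto simp: trunc_def norm_mult indicator_def)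
  show "trunc R f \<in> L2" by (rule L2_mono(1)[OF m f _ le]) simp
  show "L2_norm (trunc R f) \<le> L2_norm f" using L2_mono(2)[OF m f _ le] by simp
  show "integrable lborel (trunc R f)"
    unfolding trunc_def[abs_def] by (intro L2_mult_integrable f L2_indicator) auto
qed

lemma trunc_tendsto:
  assumes f: "f \<in> L2"
  shows "((\<lambda>R. L2_norm (\<lambda>x. trunc R f x - f x)) \<longlongrightarrow> 0) at_top"
proof -
  note [measurable] = L2_measurable[OF f]
  have "((\<lambda>R. LINT x|lborel. (cmod (trunc R f x - f x))\<^sup>2) \<longlongrightarrow> (LINT x|(lborel :: (real ^ 3) measure). 0)) at_top"
  proof (rule integral_dominated_convergence_at_top)
    show "integrable lborel (\<lambda>x. (cmod (f x))\<^sup>2)" by (rule L2_integrable[OF f])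
    show "\<forall>\<^sub>F R in at_top. AE x in lborel. norm ((cmod (trunc R f x - f x))\<^sup>2) \<le> (cmod (f x))\<^sup>2"
      by (intro always_eventually allI AE_I2) (auto simp: trunc_def indicator_def)
    show "AE x in lborel. ((\<lambda>R. (cmod (trunc R f x - f x))\<^sup>2) \<longlongrightarrow> 0) at_top"
    proof (intro AE_I2)
      fix x :: "real ^ 3"
      have "\<forall>\<^sub>F R in at_top. (cmod (trunc R f x - f x))\<^sup>2 = 0"
        using eventually_ge_at_top[of "norm x"] by eventually_elim (simp add: trunc_def)
      then show "((\<lambda>R. (cmod (trunc R f x - f x))\<^sup>2) \<longlongrightarrow> 0) at_top" by (rule tendsto_eventually)
    qed
    fix R
    note [measurable] = L2_measurable[OF trunc_L2(1)[OF f, of R]]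
    show "(\<lambda>x. (cmod (trunc R f x - f x))\<^sup>2) \<in> borel_measurable lborel" by measurable
  qed simp
  then have "((\<lambda>R. sqrt (LINT x|lborel. (cmod (trunc R f x - f x))\<^sup>2)) \<longlongrightarrow> sqrt 0) at_top"
    by (intro tendsto_real_sqrt) simp
  then show ?thesis by (simp add: L2_norm_def)
qed

text \<open>The definition measures convergence by an extended integral, which could be infinite.
  Truncations are both integrable and in L2, so by Plancherel's inequality the differences lie in L2
  and the extended integral is the square of a genuine norm.\<close>

lemma is_fourier_iff:
  "is_fourier f F \<longleftrightarrow> f \<in> L2 \<and> F \<in> L2 \<and> ((\<lambda>R. L2_norm (\<lambda>\<xi>. FT (trunc R f) \<xi> - F \<xi>)) \<longlongrightarrow> 0) at_top"
proof -
  have "((\<lambda>R. \<integral>\<^sup>+ \<xi>. ennreal ((cmod (FT (trunc R f) \<xi> - F \<xi>))\<^sup>2) \<partial>lborel) \<longlongrightarrow> 0) at_top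
      \<longleftrightarrow> ((\<lambda>R. L2_norm (\<lambda>\<xi>. FT (trunc R f) \<xi> - F \<xi>)) \<longlongrightarrow> 0) at_top"
    if f: "f \<in> L2" and F: "F \<in> L2"
  proof -
    have d: "(\<lambda>\<xi>. FT (trunc R f) \<xi> - F \<xi>) \<in> L2" for R
      by (intro L2_diff F plancherel_le trunc_L2 f)
    have eq: "(\<integral>\<^sup>+ \<xi>. ennreal ((cmod (FT (trunc R f) \<xi> - F \<xi>))\<^sup>2) \<partial>lborel) = ennreal ((L2_norm (\<lambda>\<xi>. FT (trunc R f) \<xi> - F \<xi>))\<^sup>2)" for R
      using nn_integral_L2[OF d[of R]] by (simp add: ennreal_power)
    have "((\<lambda>R. ennreal ((L2_norm (\<lambda>\<xi>. FT (trunc R f) \<xi> - F \<xi>))\<^sup>2)) \<longlongrightarrow> ennreal 0) at_top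
        \<longleftrightarrow> ((\<lambda>R. (L2_norm (\<lambda>\<xi>. FT (trunc R f) \<xi> - F \<xi>))\<^sup>2) \<longlongrightarrow> 0) at_top"
      by (rule tendsto_ennreal_iff) auto
    moreover have "((\<lambda>R. (L2_norm (\<lambda>\<xi>. FT (trunc R f) \<xi> - F \<xi>))\<^sup>2) \<longlongrightarrow> 0) at_top
        \<longleftrightarrow> ((\<lambda>R. L2_norm (\<lambda>\<xi>. FT (trunc R f) \<xi> - F \<xi>)) \<longlongrightarrow> 0) at_top"
      using tendsto_power[of "\<lambda>R. L2_norm (\<lambda>\<xi>. FT (trunc R f) \<xi> - F \<xi>)" 0 at_top 2]
        tendsto_real_sqrt[of "\<lambda>R. (L2_norm (\<lambda>\<xi>. FT (trunc R f) \<xi> - F \<xi>))\<^sup>2" 0 at_top]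
      by auto
    ultimately show ?thesis by (simp add: eq)
  qed
  then show ?thesis unfolding is_fourier_def FT_trunc by auto
qed

lemma is_fourierD:
  assumes "is_fourier f F"
  shows "f \<in> L2" "F \<in> L2" "((\<lambda>R. L2_norm (\<lambda>\<xi>. FT (trunc R f) \<xi> - F \<xi>)) \<longlongrightarrow> 0) at_top"
  using assms by (auto simp: is_fourier_iff)

lemma FT_L2: "f \<in> L2 \<Longrightarrow> FT (trunc R f) \<in> L2"
  by (intro plancherel_le trunc_L2)

lemma FT_trunc_diff_le:
  assumes f: "f \<in> L2"
  shows "L2_norm (\<lambda>\<xi>. FT (trunc R f) \<xi> - FT (trunc S f) \<xi>)
    \<le> plancherel_const * (L2_norm (\<lambda>x. trunc R f x - f x) + L2_norm (\<lambda>x. trunc S f x - f x))"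
proof -
  have "L2_norm (\<lambda>\<xi>. FT (trunc R f) \<xi> - FT (trunc S f) \<xi>) = L2_norm (FT (\<lambda>x. trunc R f x - trunc S f x))"
    by (simp add: FT_diff_fun trunc_L2 f)
  also have "\<dots> \<le> plancherel_const * L2_norm (\<lambda>x. trunc R f x - trunc S f x)"
    by (intro plancherel_le L2_diff Bochner_Integration.integrable_diff trunc_L2 f)
  also have "\<dots> \<le> plancherel_const * (L2_norm (\<lambda>x. trunc R f x - f x) + L2_norm (\<lambda>x. f x - trunc S f x))"
    using plancherel_const_pos by (intro mult_left_mono L2_norm_triangle trunc_L2 f) auto
  finally show ?thesis by (simp add: L2_norm_minus_commute[of f])
qed

lemma is_fourier_exists:
  assumes f: "f \<in> L2"
  shows "\<exists>F. is_fourier f F"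
proof -
  let ?D = "\<lambda>R. L2_norm (\<lambda>x. trunc R f x - f x)"
  have "\<exists>N. \<forall>R\<ge>N. ?D R < (1/2) ^ n" for n
    using order_tendstoD(2)[OF trunc_tendsto[OF f], of "(1/2) ^ n"] by (simp add: eventually_at_top_linorder)
  then obtain N where N: "\<And>n R. N n \<le> R \<Longrightarrow> ?D R < (1/2) ^ n" by metis
  \<comment> \<open>Taking the maximum makes the radii increasing, so that the radius for
    \<open>Suc n\<close> also satisfies the bound with index \<open>n\<close>.\<close>
  define r where "r n = Max (N ` {..n})" for n
  have r: "r n \<le> R \<Longrightarrow> ?D R < (1/2) ^ n" for n R
    by (rule N) (auto simp: r_def)
  have r_mono: "r n \<le> r (Suc n)" for n unfolding r_def by (intro Max_mono) auto
  have FT_diff_le: "L2_norm (\<lambda>\<xi>. FT (trunc R f) \<xi> - FT (trunc S f) \<xi>) \<le> 2 * plancherel_const * (1/2) ^ n"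
    if "r n \<le> R" "r n \<le> S" for R S n
  proof -
    have "L2_norm (\<lambda>\<xi>. FT (trunc R f) \<xi> - FT (trunc S f) \<xi>) \<le> plancherel_const * (?D R + ?D S)"
      by (rule FT_trunc_diff_le[OF f])
    also have "\<dots> \<le> plancherel_const * ((1/2) ^ n + (1/2) ^ n)"
      using r[OF that(1)] r[OF that(2)] plancherel_const_pos by (intro mult_left_mono) auto
    finally show ?thesis by simp
  qed
  \<comment> \<open>Completeness doubles the constant \<open>2 * plancherel_const\<close> of the
    increments. Together with the distance of a later radius from \<open>r n\<close> this gives the
    factor 6 below.\<close>
  obtain F where F: "F \<in> L2" and lim: "\<And>n. L2_norm (\<lambda>x. FT (trunc (r n) f) x - F x) \<le> 2 * (2 * plancherel_const) * (1/2) ^ n"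
    using L2_Cauchy_geometric[of "\<lambda>n. FT (trunc (r n) f)" "2 * plancherel_const"] FT_L2[OF f] FT_diff_le r_mono by blast
  have "((\<lambda>R. L2_norm (\<lambda>\<xi>. FT (trunc R f) \<xi> - F \<xi>)) \<longlongrightarrow> 0) at_top"
  proof (rule order_tendstoI)
    fix e :: real assume "0 < e"
    have "(\<lambda>n. 6 * plancherel_const * (1/2) ^ n) \<longlonglongrightarrow> 6 * plancherel_const * 0"
      by (intro tendsto_intros LIMSEQ_power_zero) simp
    then have "\<forall>\<^sub>F n in sequentially. 6 * plancherel_const * (1/2) ^ n < e"
      using \<open>0 < e\<close> by (intro order_tendstoD) auto
    then obtain n where n: "6 * plancherel_const * (1/2) ^ n < e" by (auto simp: eventually_sequentially)
    show "\<forall>\<^sub>F R in at_top. L2_norm (\<lambda>\<xi>. FT (trunc R f) \<xi> - F \<xi>) < e"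
      using eventually_ge_at_top[of "r n"]
    proof eventually_elim
      case (elim R)
      have "L2_norm (\<lambda>\<xi>. FT (trunc R f) \<xi> - F \<xi>) \<le> 2 * plancherel_const * (1/2) ^ n + 2 * (2 * plancherel_const) * (1/2) ^ n"
        by (rule order.trans[OF L2_norm_triangle[OF FT_L2[OF f] FT_L2[OF f, of "r n"] F]])
           (intro add_mono FT_diff_le lim elim order_refl)
      with n show ?case by simp
    qed
  qed (auto intro!: always_eventually intro: less_le_trans[OF _ L2_norm_nonneg])
  with f F show ?thesis by (auto simp: is_fourier_iff)
qed

lemma tendsto_zero_L2_le:
  fixes a :: real
  assumes lim: "((\<lambda>R. g R) \<longlongrightarrow> 0) (at_top :: real filter)" and le: "\<And>R. a \<le> b + g R"
  shows "a \<le> b"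
proof -
  have "((\<lambda>R. b + g R) \<longlongrightarrow> b + 0) at_top" by (intro tendsto_intros lim)
  then show ?thesis using le by (intro tendsto_lowerbound[of _ _ at_top]) auto
qed

lemma is_fourier_norm_le:
  assumes "is_fourier f F"
  shows "L2_norm F \<le> plancherel_const * L2_norm f"
proof (rule tendsto_zero_L2_le[OF is_fourierD(3)[OF assms]])
  note D = is_fourierD[OF assms]
  fix R
  have "L2_norm F = L2_norm (\<lambda>\<xi>. FT (trunc R f) \<xi> - (FT (trunc R f) \<xi> - F \<xi>))" by simp
  also have "\<dots> \<le> L2_norm (FT (trunc R f)) + L2_norm (\<lambda>\<xi>. FT (trunc R f) \<xi> - F \<xi>)"
    by (intro L2_diff FT_L2 D)
  also have "L2_norm (FT (trunc R f)) \<le> plancherel_const * L2_norm (trunc R f)"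
    by (intro plancherel_le trunc_L2 D)
  also have "\<dots> \<le> plancherel_const * L2_norm f"
    using plancherel_const_pos by (intro mult_left_mono trunc_L2 D) auto
  finally show "L2_norm F \<le> plancherel_const * L2_norm f + L2_norm (\<lambda>\<xi>. FT (trunc R f) \<xi> - F \<xi>)" by simp
qed

lemma is_fourier_diff:
  assumes "is_fourier f F" "is_fourier g G"
  shows "is_fourier (\<lambda>x. f x - g x) (\<lambda>\<xi>. F \<xi> - G \<xi>)"
proof -
  note f = is_fourierD[OF assms(1)] and g = is_fourierD[OF assms(2)]
  have "((\<lambda>R. L2_norm (\<lambda>\<xi>. FT (trunc R (\<lambda>x. f x - g x)) \<xi> - (F \<xi> - G \<xi>))) \<longlongrightarrow> 0) at_top"
  proof (rule tendsto_sandwich[OF _ _ tendsto_const])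
    show "((\<lambda>R. L2_norm (\<lambda>\<xi>. FT (trunc R f) \<xi> - F \<xi>) + L2_norm (\<lambda>\<xi>. FT (trunc R g) \<xi> - G \<xi>)) \<longlongrightarrow> 0) at_top"
      using tendsto_add[OF f(3) g(3)] by simp
    have "L2_norm (\<lambda>\<xi>. FT (trunc R (\<lambda>x. f x - g x)) \<xi> - (F \<xi> - G \<xi>))
        = L2_norm (\<lambda>\<xi>. (FT (trunc R f) \<xi> - F \<xi>) - (FT (trunc R g) \<xi> - G \<xi>))" for R
    proof -
      have "trunc R (\<lambda>x. f x - g x) = (\<lambda>x. trunc R f x - trunc R g x)"
        by (auto simp: trunc_def algebra_simps)
      then show ?thesis by (simp add: FT_diff trunc_L2 f(1) g(1) algebra_simps)
    qed
    then show "\<forall>\<^sub>F R in at_top. L2_norm (\<lambda>\<xi>. FT (trunc R (\<lambda>x. f x - g x)) \<xi> - (F \<xi> - G \<xi>))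
        \<le> L2_norm (\<lambda>\<xi>. FT (trunc R f) \<xi> - F \<xi>) + L2_norm (\<lambda>\<xi>. FT (trunc R g) \<xi> - G \<xi>)"
      by (intro always_eventually allI) (simp only:, intro L2_diff FT_L2 f g)
  qed simp
  with f g show ?thesis by (simp add: is_fourier_iff L2_diff)
qed

text \<open>The difference of two transforms of \<open>f\<close> is a transform of
  \<open>f - f\<close>, whose norm is 0.\<close>

lemma is_fourier_unique:
  assumes "is_fourier f F" "is_fourier f F'"
  shows "AE \<xi> in lborel. F \<xi> = F' \<xi>"
proof -
  have d: "is_fourier (\<lambda>x. f x - f x) (\<lambda>\<xi>. F \<xi> - F' \<xi>)" by (rule is_fourier_diff[OF assms])
  have "L2_norm (\<lambda>\<xi>. F \<xi> - F' \<xi>) = 0"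
    using is_fourier_norm_le[OF d] by (simp add: order_antisym)
  from L2_norm_eq_0_AE[OF is_fourierD(2)[OF d] this] show ?thesis by eventually_elim simp
qed

lemma is_fourier_cong_AE:
  assumes "is_fourier f F" "AE \<xi> in lborel. F' \<xi> = F \<xi>" "F' \<in> borel_measurable borel"
  shows "is_fourier f F'"
proof -
  note D = is_fourierD[OF assms(1)]
  have F': "F' \<in> L2" by (rule L2_cong_AE(1)[OF D(2) assms(3,2)])
  have "L2_norm (\<lambda>\<xi>. FT (trunc R f) \<xi> - F' \<xi>) = L2_norm (\<lambda>\<xi>. FT (trunc R f) \<xi> - F \<xi>)" for R
    using assms(2)
    by (intro L2_cong_AE(2)[OF L2_diff(1)[OF FT_L2[OF D(1)] D(2)] L2_measurable[OF L2_diff(1)[OF FT_L2[OF D(1)] F']]])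
       (auto elim!: eventually_mono)
  with D F' show ?thesis by (simp add: is_fourier_iff)
qed

lemma is_fourier_FT:
  assumes "f \<in> L2" "integrable lborel f"
  shows "is_fourier f (FT f)"
proof -
  have "((\<lambda>R. L2_norm (\<lambda>\<xi>. FT (trunc R f) \<xi> - FT f \<xi>)) \<longlongrightarrow> 0) at_top"
  proof (rule tendsto_sandwich[OF _ _ tendsto_const])
    show "((\<lambda>R. plancherel_const * L2_norm (\<lambda>x. trunc R f x - f x)) \<longlongrightarrow> 0) at_top"
      using tendsto_mult_left[OF trunc_tendsto[OF assms(1)], of plancherel_const] by simp
    show "\<forall>\<^sub>F R in at_top. L2_norm (\<lambda>\<xi>. FT (trunc R f) \<xi> - FT f \<xi>) \<le> plancherel_const * L2_norm (\<lambda>x. trunc R f x - f x)"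
    proof (intro always_eventually allI)
      fix R
      have "L2_norm (FT (\<lambda>x. trunc R f x - f x)) \<le> plancherel_const * L2_norm (\<lambda>x. trunc R f x - f x)"
        by (intro plancherel_le L2_diff Bochner_Integration.integrable_diff trunc_L2 assms)
      then show "L2_norm (\<lambda>\<xi>. FT (trunc R f) \<xi> - FT f \<xi>) \<le> plancherel_const * L2_norm (\<lambda>x. trunc R f x - f x)"
        by (simp add: FT_diff_fun trunc_L2 assms)
    qed
  qed simp
  with assms plancherel_le[OF assms] show ?thesis by (simp add: is_fourier_iff)
qed

lemma L2_tendsto_integral_mult:
  assumes f: "\<And>R. f R \<in> L2" "F \<in> L2" "((\<lambda>R. L2_norm (\<lambda>x. f R x - F x)) \<longlongrightarrow> 0) at_top"
    and g: "\<And>R. g R \<in> L2" "G \<in> L2" "((\<lambda>R. L2_norm (\<lambda>x. g R x - G x)) \<longlongrightarrow> 0) at_top"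
    and bound: "\<And>R. L2_norm (g R) \<le> C"
  shows "((\<lambda>R. LINT x|lborel. f R x * g R x) \<longlongrightarrow> (LINT x|lborel. F x * G x)) at_top"
proof -
  have "((\<lambda>R. (LINT x|lborel. f R x * g R x) - (LINT x|lborel. F x * G x)) \<longlongrightarrow> 0) at_top"
  proof (rule Lim_null_comparison)
    show "((\<lambda>R. L2_norm (\<lambda>x. f R x - F x) * C + L2_norm F * L2_norm (\<lambda>x. g R x - G x)) \<longlongrightarrow> 0) at_top"
      using tendsto_add[OF tendsto_mult_right[OF f(3), of C] tendsto_mult_left[OF g(3), of "L2_norm F"]] by simp
    show "\<forall>\<^sub>F R in at_top. norm ((LINT x|lborel. f R x * g R x) - (LINT x|lborel. F x * G x))
        \<le> L2_norm (\<lambda>x. f R x - F x) * C + L2_norm F * L2_norm (\<lambda>x. g R x - G x)"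
    proof (intro always_eventually allI)
      fix R
      have "(LINT x|lborel. f R x * g R x) - (LINT x|lborel. F x * G x)
          = (LINT x|lborel. (f R x - F x) * g R x) + (LINT x|lborel. F x * (g R x - G x))"
        by (subst Bochner_Integration.integral_add[symmetric] Bochner_Integration.integral_diff[symmetric];
            (intro L2_mult_integrable L2_diff f g)?)+
           (simp add: algebra_simps)
      also have "norm \<dots> \<le> L2_norm (\<lambda>x. f R x - F x) * L2_norm (g R) + L2_norm F * L2_norm (\<lambda>x. g R x - G x)"
        by (intro order.trans[OF norm_triangle_ineq] add_mono L2_Cauchy_Schwarz L2_diff f g)
      also have "\<dots> \<le> L2_norm (\<lambda>x. f R x - F x) * C + L2_norm F * L2_norm (\<lambda>x. g R x - G x)"
        by (intro add_mono mult_left_mono bound) auto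
      finally show "norm ((LINT x|lborel. f R x * g R x) - (LINT x|lborel. F x * G x))
          \<le> L2_norm (\<lambda>x. f R x - F x) * C + L2_norm F * L2_norm (\<lambda>x. g R x - G x)" .
    qed
  qed
  then show ?thesis by (simp add: LIM_zero_iff)
qed

text \<open>The multiplication formula, extended to L2 through truncations. It is the main
  instrument of the Fourier part: choosing \<open>g\<close> with a known Gaussian transform converts
  statements about \<open>F\<close> into statements about \<open>f\<close>.\<close>

lemma is_fourier_integral_mult:
  assumes f: "is_fourier f F" and g: "is_fourier g G"
  shows "(LINT \<xi>|lborel. F \<xi> * g \<xi>) = (LINT x|lborel. f x * G x)"
proof -
  note f = is_fourierD[OF f] and g = is_fourierD[OF g]
  have "((\<lambda>R. LINT \<xi>|lborel. FT (trunc R f) \<xi> * trunc R g \<xi>) \<longlongrightarrow> (LINT \<xi>|lborel. F \<xi> * g \<xi>)) at_top"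
    by (rule L2_tendsto_integral_mult[where C = "L2_norm g"]) (intro FT_L2 f g trunc_L2 trunc_tendsto)+
  moreover have "((\<lambda>R. LINT \<xi>|lborel. FT (trunc R g) \<xi> * trunc R f \<xi>) \<longlongrightarrow> (LINT \<xi>|lborel. G \<xi> * f \<xi>)) at_top"
    by (rule L2_tendsto_integral_mult[where C = "L2_norm f"]) (intro FT_L2 f g trunc_L2 trunc_tendsto)+
  moreover have "(LINT \<xi>|lborel. FT (trunc R f) \<xi> * trunc R g \<xi>) = (LINT \<xi>|lborel. FT (trunc R g) \<xi> * trunc R f \<xi>)" for R
    by (subst integral_FT_mult) (simp_all add: trunc_L2 f(1) g(1) mult.commute)
  ultimately show ?thesis
    using tendsto_unique[OF trivial_limit_at_top_linorder] by (simp add: mult.commute)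
qed

subsection \<open>Integration by parts against test functions\<close>

lemma test_C_class: "\<phi> \<in> test_functions \<Longrightarrow> \<phi> \<in> C_class k"
  by (simp add: test_functions_def)

lemma test_continuous: "\<phi> \<in> test_functions \<Longrightarrow> continuous_on UNIV \<phi>"
  using test_C_class[of \<phi> 0] by simp

lemma test_measurable: "\<phi> \<in> test_functions \<Longrightarrow> \<phi> \<in> borel_measurable borel"
  by (intro borel_measurable_continuous_onI test_continuous)

lemma test_differentiable: "\<phi> \<in> test_functions \<Longrightarrow> \<phi> differentiable (at x)"
  using test_C_class[of \<phi> "Suc 0"] by simp

lemma test_bounded_support:
  assumes "\<phi> \<in> test_functions"
  obtains \<rho> where "0 < \<rho>" "\<And>x. \<rho> < norm x \<Longrightarrow> \<phi> x = 0"
proof -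
  have "compact (closure {x. \<phi> x \<noteq> 0})" using assms by (simp add: test_functions_def)
  then have "bounded {x. \<phi> x \<noteq> 0}"
    by (rule bounded_subset[OF compact_imp_bounded closure_subset])
  then obtain \<rho> where "0 < \<rho>" "\<And>x. \<phi> x \<noteq> 0 \<Longrightarrow> norm x \<le> \<rho>" unfolding bounded_pos by blast
  then show ?thesis by (intro that[of \<rho>]) force+
qed

lemma partial_eq_0_outside:
  assumes "\<And>x. \<rho> < norm x \<Longrightarrow> f x = 0" "\<rho> < norm x"
  shows "partial j f x = 0"
proof -
  have "((\<lambda>_. 0) has_derivative (\<lambda>_. 0)) (at x)" by simp
  then have "(f has_derivative (\<lambda>_. 0)) (at x)"
    by (rule has_derivative_transform_within_open[where s = "- cball 0 \<rho>"]) (use assms in auto)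
  then show ?thesis by (rule partial_eqI)
qed

lemma test_partial:
  assumes "\<phi> \<in> test_functions"
  shows "partial j \<phi> \<in> test_functions"
proof -
  obtain \<rho> where \<rho>: "\<And>x. \<rho> < norm x \<Longrightarrow> \<phi> x = 0" by (rule test_bounded_support[OF assms]) blast
  have "{x. partial j \<phi> x \<noteq> 0} \<subseteq> cball 0 \<rho>" using partial_eq_0_outside[of \<rho> \<phi>, OF \<rho>] by force
  then have "bounded {x. partial j \<phi> x \<noteq> 0}" using bounded_cball bounded_subset by blast
  moreover have "partial j \<phi> \<in> C_class k" for k using test_C_class[OF assms, of "Suc k"] by simp
  ultimately show ?thesis by (simp add: test_functions_def)
qed

lemma integrable_continuous_bounded_support:
  fixes F :: field3
  assumes F: "continuous_on UNIV F" and supp: "\<And>x. \<rho> < norm x \<Longrightarrow> F x = 0"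
  shows "integrable lborel F"
proof -
  have "integrable lborel (\<lambda>x. indicator (cball 0 \<rho>) x *\<^sub>R F x)"
    by (intro borel_integrable_compact continuous_on_subset[OF F]) auto
  moreover have "indicator (cball 0 \<rho>) x *\<^sub>R F x = F x" for x
    using supp[of x] by (auto simp: indicator_def)
  ultimately show ?thesis by simp
qed

lemma bounded_continuous_bounded_support:
  fixes F :: field3
  assumes F: "continuous_on UNIV F" and supp: "\<And>x. \<rho> < norm x \<Longrightarrow> F x = 0"
  obtains M where "0 \<le> M" "\<And>x. cmod (F x) \<le> M"
proof -
  have "bounded (F ` cball 0 \<rho>)"
    by (intro compact_imp_bounded compact_continuous_image continuous_on_subset[OF F]) auto
  then obtain M where M: "0 < M" "\<And>x. x \<in> cball 0 \<rho> \<Longrightarrow> cmod (F x) \<le> M"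
    unfolding bounded_pos by auto
  have "cmod (F x) \<le> M" for x using M supp[of x] by (cases "norm x \<le> \<rho>") auto
  with M show ?thesis by (intro that[of M]) auto
qed

text \<open>By translation invariance every difference quotient has integral 0, and the quotients
  converge to the partial derivative boundedly on a fixed ball. This avoids singling out a
  coordinate for Fubini's theorem.\<close>

lemma integral_partial_eq_0:
  fixes F :: field3
  assumes diff: "\<And>x. F differentiable (at x)" and cont: "continuous_on UNIV (partial j F)"
    and supp: "\<And>x. \<rho> < norm x \<Longrightarrow> F x = 0"
  shows "(LINT x|lborel. partial j F x) = 0"
proof -
  let ?e = "axis j 1 :: real ^ 3"
  have Fc: "continuous_on UNIV F"
    using diff by (simp add: continuous_on_eq_continuous_at differentiable_imp_continuous_within)
  have [measurable]: "F \<in> borel_measurable borel" by (rule borel_measurable_continuous_onI[OF Fc])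
  have Fi: "integrable lborel F" by (rule integrable_continuous_bounded_support[OF Fc supp])
  obtain M where M: "0 \<le> M" "\<And>x. cmod (partial j F x) \<le> M"
    by (rule bounded_continuous_bounded_support[OF cont partial_eq_0_outside[OF supp]]) blast+
  have deriv: "((\<lambda>t. F (x + t *\<^sub>R ?e)) has_derivative (\<lambda>s. s *\<^sub>R partial j F (x + t *\<^sub>R ?e))) (at t)" for x t
  proof -
    have L: "(F has_derivative frechet_derivative F (at (x + t *\<^sub>R ?e))) (at (x + t *\<^sub>R ?e))"
      using diff by (simp add: frechet_derivative_works[symmetric])
    moreover have "((\<lambda>t. x + t *\<^sub>R ?e) has_derivative (\<lambda>s. s *\<^sub>R ?e)) (at t)"
      by (auto intro!: derivative_eq_intros)
    ultimately have "((\<lambda>t. F (x + t *\<^sub>R ?e)) has_derivative (\<lambda>s. frechet_derivative F (at (x + t *\<^sub>R ?e)) (s *\<^sub>R ?e))) (at t)"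
      by (rule has_derivative_compose[rotated])
    moreover have "frechet_derivative F (at (x + t *\<^sub>R ?e)) (s *\<^sub>R ?e) = s *\<^sub>R partial j F (x + t *\<^sub>R ?e)" for s
      unfolding partial_def
      by (rule linear_scale[OF has_derivative_linear[OF L]])
    ultimately show ?thesis by simp
  qed
  have Lip: "cmod (F (x + h *\<^sub>R ?e) - F x) \<le> M * h" if "0 \<le> h" for x h
  proof -
    have "cmod (F (x + h *\<^sub>R ?e) - F (x + 0 *\<^sub>R ?e)) \<le> M * norm (h - 0)"
    proof (rule differentiable_bound[of UNIV "\<lambda>t. F (x + t *\<^sub>R ?e)"])
      show "((\<lambda>t. F (x + t *\<^sub>R ?e)) has_derivative (\<lambda>s. s *\<^sub>R partial j F (x + t *\<^sub>R ?e))) (at t within UNIV)" for t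
        using deriv by simp
      show "onorm (\<lambda>s. s *\<^sub>R partial j F (x + t *\<^sub>R ?e)) \<le> M" for t
        by (rule onorm_bound) (use M in \<open>auto simp: mult.commute[of "\<bar>_\<bar>"] intro!: mult_right_mono\<close>)
    qed auto
    then show ?thesis using that by simp
  qed
  define h where "h n = inverse (real (Suc n))" for n
  have h: "0 < h n" "h n \<le> 1" for n by (auto simp: h_def field_simps)
  have h0: "h \<longlonglongrightarrow> 0" unfolding h_def by (rule LIMSEQ_inverse_real_of_nat)
  define D where "D n x = (1 / h n) *\<^sub>R (F (x + h n *\<^sub>R ?e) - F x)" for n x
  have "(\<lambda>n. LINT x|lborel. D n x) \<longlonglongrightarrow> (LINT x|lborel. partial j F x)"
  proof (rule integral_dominated_convergence)
    \<comment> \<open>The radius is enlarged by 1 because the steps \<open>h n\<close> are at most 1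
      and move the support by no more than that.\<close>
    show "integrable lborel (\<lambda>x. M * indicator (cball 0 (\<rho> + 1)) x)"
      using emeasure_bounded_finite[OF bounded_cball, of 0 "\<rho> + 1"]
      by (intro integrable_mult_right integrable_real_indicator) auto
    show "AE x in lborel. (\<lambda>n. D n x) \<longlonglongrightarrow> partial j F x"
    proof (intro AE_I2)
      fix x
      let ?d = "partial j F x"
      have "((\<lambda>t. F (x + t *\<^sub>R ?e)) has_derivative (\<lambda>s. s *\<^sub>R ?d)) (at 0)"
        using deriv[of x 0] by simp
      then have "((\<lambda>t. norm ((F (x + t *\<^sub>R ?e) - F (x + 0 *\<^sub>R ?e)) - (t - 0) *\<^sub>R ?d) / norm (t - 0)) \<longlongrightarrow> 0) (at 0)"
        unfolding has_derivative_iff_norm by blast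
      moreover have "filterlim h (at 0) sequentially"
        using h0 h by (auto simp: filterlim_at order_less_le)
      ultimately have "(\<lambda>n. norm ((F (x + h n *\<^sub>R ?e) - F (x + 0 *\<^sub>R ?e)) - (h n - 0) *\<^sub>R ?d) / norm (h n - 0)) \<longlonglongrightarrow> 0"
        by (rule filterlim_compose)
      moreover have "norm ((F (x + h n *\<^sub>R ?e) - F (x + 0 *\<^sub>R ?e)) - (h n - 0) *\<^sub>R ?d) / norm (h n - 0) = norm (D n x - ?d)" for n
      proof -
        have "D n x - ?d = (1 / h n) *\<^sub>R ((F (x + h n *\<^sub>R ?e) - F x) - h n *\<^sub>R ?d)"
          using h[of n] by (simp add: D_def scaleR_diff_right)
        then show ?thesis using h[of n] by simp
      qed
      ultimately have "(\<lambda>n. norm (D n x - ?d)) \<longlonglongrightarrow> 0" by simp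
      then show "(\<lambda>n. D n x) \<longlonglongrightarrow> ?d" by (rule LIM_zero_cancel[OF tendsto_norm_zero_cancel])
    qed
    show "AE x in lborel. norm (D n x) \<le> M * indicator (cball 0 (\<rho> + 1)) x" for n
    proof (intro AE_I2)
      fix x
      show "norm (D n x) \<le> M * indicator (cball 0 (\<rho> + 1)) x"
      proof (cases "norm x \<le> \<rho> + 1")
        case True
        have "norm (D n x) \<le> (1 / h n) * (M * h n)"
          unfolding D_def using h[of n] Lip[of "h n" x] by (simp add: pos_divide_le_eq)
        then show ?thesis using True h[of n] by simp
      next
        case False
        have "norm x \<le> norm (x + h n *\<^sub>R ?e) + norm (h n *\<^sub>R ?e)" using norm_triangle_ineq4[of "x + h n *\<^sub>R ?e" "h n *\<^sub>R ?e"] by simp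
        then have "\<rho> < norm (x + h n *\<^sub>R ?e)" using h[of n] False by (simp add: norm_axis_1)
        then show ?thesis using False supp by (simp add: D_def)
      qed
    qed
    show "partial j F \<in> borel_measurable lborel" using borel_measurable_continuous_onI[OF cont] by simp
    show "D n \<in> borel_measurable lborel" for n unfolding D_def[abs_def] by measurable
  qed
  moreover have "(LINT x|lborel. D n x) = 0" for n
  proof -
    have shift: "(LINT x|lborel. F (x + h n *\<^sub>R ?e)) = (LINT x|lborel. F x)"
      using integral_affine[of F 1 "h n *\<^sub>R ?e"] by (simp add: add.commute)
    have "integrable lborel (\<lambda>x. F (x + h n *\<^sub>R ?e))"
    proof (rule integrable_continuous_bounded_support)
      show "continuous_on UNIV (\<lambda>x. F (x + h n *\<^sub>R ?e))"
        by (intro continuous_on_compose2[OF Fc] continuous_intros) auto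
      fix x :: "real ^ 3" assume x: "\<rho> + h n < norm x"
      have "norm x \<le> norm (x + h n *\<^sub>R ?e) + norm (h n *\<^sub>R ?e)" using norm_triangle_ineq4[of "x + h n *\<^sub>R ?e" "h n *\<^sub>R ?e"] by simp
      with x show "F (x + h n *\<^sub>R ?e) = 0" using h[of n] by (intro supp) (simp add: norm_axis_1)
    qed
    with Fi shift show ?thesis by (simp add: D_def)
  qed
  ultimately show ?thesis by (simp add: LIMSEQ_const_iff)
qed

lemma integrable_continuous_mult_test:
  assumes "continuous_on UNIV p" "\<phi> \<in> test_functions"
  shows "integrable lborel (\<lambda>x. p x * \<phi> x)"
proof -
  obtain \<rho> where \<rho>: "\<And>x. \<rho> < norm x \<Longrightarrow> \<phi> x = 0" by (rule test_bounded_support[OF assms(2)]) blast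
  show ?thesis
    by (rule integrable_continuous_bounded_support[of _ \<rho>])
       (use \<rho> in \<open>auto intro!: continuous_intros assms(1) test_continuous[OF assms(2)]\<close>)
qed

text \<open>The compact support of the test function removes all boundary terms, so \<open>p\<close>
  may grow arbitrarily. Oscillator kernels are moved through derivatives in this way.\<close>

lemma integral_by_parts_test:
  fixes p :: "real ^ 3 \<Rightarrow> real"
  assumes p: "\<And>x. (p has_derivative p' x) (at x)" and cont: "continuous_on UNIV (\<lambda>x. p' x (axis j 1))"
    and \<phi>: "\<phi> \<in> test_functions"
  shows "(LINT x|lborel. complex_of_real (p x) * partial j \<phi> x) = - (LINT x|lborel. complex_of_real (p' x (axis j 1)) * \<phi> x)"
proof -
  let ?F = "\<lambda>x. complex_of_real (p x) * \<phi> x"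
  obtain \<rho> where \<rho>: "\<And>x. \<rho> < norm x \<Longrightarrow> \<phi> x = 0" by (rule test_bounded_support[OF \<phi>]) blast
  have pc: "continuous_on UNIV (\<lambda>x. complex_of_real (p x))"
    using p by (intro continuous_intros has_derivative_continuous_on[of UNIV p p']) (auto intro: has_derivative_at_withinI)
  have D: "(?F has_derivative (\<lambda>v. complex_of_real (p x) * frechet_derivative \<phi> (at x) v + complex_of_real (p' x v) * \<phi> x)) (at x)" for x
    using test_differentiable[OF \<phi>, of x] by (intro has_derivative_mult has_derivative_of_real p) (simp flip: frechet_derivative_works)
  then have part: "partial j ?F = (\<lambda>x. complex_of_real (p x) * partial j \<phi> x + complex_of_real (p' x (axis j 1)) * \<phi> x)"
    by (intro ext, subst partial_eqI[OF D]) (simp add: partial_def)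
  have "(LINT x|lborel. partial j ?F x) = 0"
  proof (rule integral_partial_eq_0)
    show "?F differentiable (at x)" for x using D by (auto simp: differentiable_def)
    show "continuous_on UNIV (partial j ?F)" unfolding part
      by (intro continuous_intros pc cont test_continuous test_partial \<phi>)
  qed (use \<rho> in auto)
  moreover have "integrable lborel (\<lambda>x. complex_of_real (p x) * partial j \<phi> x)"
    by (intro integrable_continuous_mult_test pc test_partial \<phi>)
  moreover have "integrable lborel (\<lambda>x. complex_of_real (p' x (axis j 1)) * \<phi> x)"
    by (intro integrable_continuous_mult_test continuous_intros cont \<phi>)
  ultimately show ?thesis unfolding part by (simp add: add_eq_0_iff)
qed

lemma test_L2:
  assumes "\<phi> \<in> test_functions" shows "\<phi> \<in> L2"
proof -
  obtain \<rho> where \<rho>: "\<And>x. \<rho> < norm x \<Longrightarrow> \<phi> x = 0" by (rule test_bounded_support[OF assms]) blast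
  have "integrable lborel (\<lambda>x. complex_of_real ((cmod (\<phi> x))\<^sup>2))"
    by (rule integrable_continuous_bounded_support[of _ \<rho>])
       (use \<rho> in \<open>auto intro!: continuous_intros test_continuous[OF assms]\<close>)
  then show ?thesis using test_measurable[OF assms] by (simp only: L2_def complex_of_real_integrable_eq) simp
qed

subsection \<open>The Mehler kernel\<close>

text \<open>
  With \<open>\<theta> = tanh (a t / 2)\<close> the kernel of \<open>exp (- t (H - 3 a / 2))\<close>, where
  \<open>H = - \<Delta> / 2 + a\<^sup>2 |x|\<^sup>2 / 2\<close>, becomes \<open>mehler a \<theta>\<close>; \<open>\<theta> = 1\<close> is the
  projection onto the ground state.
\<close>

definition mehler :: "real \<Rightarrow> real \<Rightarrow> real ^ 3 \<Rightarrow> real ^ 3 \<Rightarrow> real" where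
  "mehler a \<theta> x y = sqrt (a / pi) ^ 3 * (1 + \<theta>) ^ 3 / 8 * \<theta> powr (- (3 / 2)) *
     exp (- (a / 4) * (\<theta> * ((x + y) \<bullet> (x + y)) + (x - y) \<bullet> (x - y) / \<theta>))"

text \<open>Up to the factor \<open>- (a / 2)\<close>, the logarithmic derivative of the Mehler
  kernel in the coordinate \<open>x $ j\<close>.\<close>

definition mehler_slope :: "3 \<Rightarrow> real \<Rightarrow> real ^ 3 \<Rightarrow> real ^ 3 \<Rightarrow> real" where
  "mehler_slope j \<theta> x y = \<theta> * (x + y) $ j + (x - y) $ j / \<theta>"

definition mehler_x :: "real \<Rightarrow> 3 \<Rightarrow> real \<Rightarrow> real ^ 3 \<Rightarrow> real ^ 3 \<Rightarrow> real" where
  "mehler_x a j \<theta> x y = - (a / 2) * (mehler_slope j \<theta> x y * mehler a \<theta> x y)"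

definition mehler_xx :: "real \<Rightarrow> 3 \<Rightarrow> real \<Rightarrow> real ^ 3 \<Rightarrow> real ^ 3 \<Rightarrow> real" where
  "mehler_xx a j \<theta> x y = - (a / 2) * ((\<theta> + 1 / \<theta>) * mehler a \<theta> x y + mehler_slope j \<theta> x y * mehler_x a j \<theta> x y)"

text \<open>The logarithmic derivative of the Mehler kernel in \<theta>: the terms stem from the
  factor \<open>(1 + \<theta>) ^ 3\<close>, from the power of \<theta> and from the
  exponent.\<close>

definition mehler_rate :: "real \<Rightarrow> real \<Rightarrow> real ^ 3 \<Rightarrow> real ^ 3 \<Rightarrow> real" where
  "mehler_rate a \<theta> x y = 3 / (1 + \<theta>) - 3 / (2 * \<theta>) - (a / 4) * ((x + y) \<bullet> (x + y) - (x - y) \<bullet> (x - y) / \<theta>\<^sup>2)"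

definition mehler_t :: "real \<Rightarrow> real \<Rightarrow> real ^ 3 \<Rightarrow> real ^ 3 \<Rightarrow> real" where
  "mehler_t a \<theta> x y = mehler_rate a \<theta> x y * mehler a \<theta> x y"

text \<open>The oscillator minus its lowest eigenvalue \<open>3 * a / 2\<close>. The ground state
  lies in the kernel, and a small standing wave is a perturbation of that kernel.\<close>

definition osc_operator :: "real \<Rightarrow> field3 \<Rightarrow> field3" where
  "osc_operator a \<phi> x = - (1 / 2) * laplacian \<phi> x + complex_of_real (a\<^sup>2 / 2 * (norm x)\<^sup>2 - 3 * a / 2) * \<phi> x"

lemma mehler_has_derivative:
  assumes "\<theta> \<noteq> 0"
  shows "((\<lambda>x. mehler a \<theta> x y) has_derivative
    (\<lambda>v. - (a / 2) * (\<theta> * ((x + y) \<bullet> v) + (x - y) \<bullet> v / \<theta>) * mehler a \<theta> x y)) (at x)"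
proof -
  have 1: "((\<lambda>x. (x + y) \<bullet> (x + y)) has_derivative (\<lambda>v. 2 * ((x + y) \<bullet> v))) (at x)"
    "((\<lambda>x. (x - y) \<bullet> (x - y) / \<theta>) has_derivative (\<lambda>v. 2 * ((x - y) \<bullet> v / \<theta>))) (at x)"
    using assms by (auto intro!: derivative_eq_intros simp: inner_commute)
  let ?K = "sqrt (a / pi) ^ 3 * (1 + \<theta>) ^ 3 / 8 * \<theta> powr (- (3 / 2))"
  show ?thesis unfolding mehler_def
    by (rule has_derivative_eq_rhs, rule has_derivative_mult_right, rule has_derivative_exp,
        rule has_derivative_mult_right, rule has_derivative_add, rule has_derivative_mult_right, rule 1, rule 1)
       (auto simp: algebra_simps)
qed

lemma inner_axis_one: "x \<bullet> axis j 1 = (x :: real ^ 3) $ j"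
  by (simp add: inner_axis)

lemma mehler_x_eq: "- (a / 2) * (\<theta> * ((x + y) \<bullet> axis j 1) + (x - y) \<bullet> axis j 1 / \<theta>) * mehler a \<theta> x y = mehler_x a j \<theta> x y"
  by (simp add: mehler_x_def mehler_slope_def inner_axis_one)

lemma mehler_slope_has_derivative:
  assumes "\<theta> \<noteq> 0"
  shows "((\<lambda>x. mehler_slope j \<theta> x y) has_derivative (\<lambda>v. (\<theta> + 1 / \<theta>) * v $ j)) (at x)"
proof -
  have "((\<lambda>x :: real ^ 3. x $ j) has_derivative (\<lambda>v. v $ j)) (at x)"
    by (intro bounded_linear_imp_has_derivative bounded_linear_vec_nth)
  from has_derivative_add[OF has_derivative_mult_right[OF this, of "\<theta> + 1 / \<theta>"] has_derivative_const[of "(\<theta> - 1 / \<theta>) * y $ j"]]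
  have "((\<lambda>x. (\<theta> + 1 / \<theta>) * x $ j + (\<theta> - 1 / \<theta>) * y $ j) has_derivative (\<lambda>v. (\<theta> + 1 / \<theta>) * v $ j)) (at x)"
    by simp
  moreover have "(\<theta> + 1 / \<theta>) * x $ j + (\<theta> - 1 / \<theta>) * y $ j = mehler_slope j \<theta> x y" for x
    using assms by (simp add: mehler_slope_def field_simps)
  ultimately show ?thesis by simp
qed

lemma mehler_x_has_derivative:
  assumes "\<theta> \<noteq> 0"
  shows "((\<lambda>x. mehler_x a j \<theta> x y) has_derivative
    (\<lambda>v. - (a / 2) * (mehler_slope j \<theta> x y * (- (a / 2) * (\<theta> * ((x + y) \<bullet> v) + (x - y) \<bullet> v / \<theta>) * mehler a \<theta> x y)
       + (\<theta> + 1 / \<theta>) * v $ j * mehler a \<theta> x y))) (at x)"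
  unfolding mehler_x_def
  by (intro has_derivative_mult_right has_derivative_mult mehler_slope_has_derivative mehler_has_derivative assms)

lemma mehler_xx_eq: "- (a / 2) * (mehler_slope j \<theta> x y * (- (a / 2) * (\<theta> * ((x + y) \<bullet> axis j 1) + (x - y) \<bullet> axis j 1 / \<theta>) * mehler a \<theta> x y)
       + (\<theta> + 1 / \<theta>) * axis j 1 $ j * mehler a \<theta> x y) = mehler_xx a j \<theta> x y"
  unfolding mehler_x_eq by (simp add: mehler_xx_def axis_def)

lemma continuous_mehler [continuous_intros]: "\<theta> \<noteq> 0 \<Longrightarrow> continuous_on S (\<lambda>x. mehler a \<theta> x y)"
  by (rule has_derivative_continuous_on[OF has_derivative_at_withinI[OF mehler_has_derivative]])

lemma continuous_mehler_slope [continuous_intros]: "\<theta> \<noteq> 0 \<Longrightarrow> continuous_on S (\<lambda>x. mehler_slope j \<theta> x y)"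
  by (rule has_derivative_continuous_on[OF has_derivative_at_withinI[OF mehler_slope_has_derivative]])

lemma continuous_mehler_x [continuous_intros]: "\<theta> \<noteq> 0 \<Longrightarrow> continuous_on S (\<lambda>x. mehler_x a j \<theta> x y)"
  unfolding mehler_x_def by (intro continuous_on_mult continuous_on_const continuous_mehler continuous_mehler_slope)

lemma continuous_mehler_xx [continuous_intros]: "\<theta> \<noteq> 0 \<Longrightarrow> continuous_on S (\<lambda>x. mehler_xx a j \<theta> x y)"
  unfolding mehler_xx_def
  by (intro continuous_on_mult continuous_on_add continuous_on_const continuous_mehler continuous_mehler_slope continuous_mehler_x)

lemma sum_UNIV_3: "(\<Sum>j\<in>(UNIV :: 3 set). f j) = f 1 + f 2 + f 3"
  by (rule sum_3)

lemma inner_vec_3: "(x :: real ^ 3) \<bullet> y = x $ 1 * y $ 1 + x $ 2 * y $ 2 + x $ 3 * y $ 3"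
  by (simp add: inner_vec_def sum_UNIV_3)

text \<open>This is the heat equation for the shifted oscillator: \<open>tanh (a * t / 2)\<close>
  has time derivative \<open>a / 2 * (1 - \<theta>\<^sup>2)\<close>, which explains the factor on
  the right. At \<theta> = 1 the factor vanishes and the kernel is stationary.\<close>

lemma mehler_equation:
  assumes "0 < \<theta>"
  shows "1 / 2 * (\<Sum>j\<in>UNIV. mehler_xx a j \<theta> x y) - (a\<^sup>2 / 2 * (norm x)\<^sup>2 - 3 * a / 2) * mehler a \<theta> x y
    = a / 2 * (1 - \<theta>\<^sup>2) * mehler_t a \<theta> x y"
proof -
  have one: "0 < 1 + \<theta>" using assms by simp
  have slope: "(\<Sum>j\<in>UNIV. (mehler_slope j \<theta> x y)\<^sup>2)
      = \<theta>\<^sup>2 * ((x + y) \<bullet> (x + y)) + (x - y) \<bullet> (x - y) / \<theta>\<^sup>2 + 2 * (x \<bullet> x - y \<bullet> y)"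
    using assms by (simp add: sum_UNIV_3 mehler_slope_def inner_vec_3 field_simps power2_eq_square)
  have "(\<Sum>j\<in>UNIV. mehler_xx a j \<theta> x y)
      = (\<Sum>j\<in>UNIV. (a\<^sup>2 / 4 * (mehler_slope j \<theta> x y)\<^sup>2 - a / 2 * (\<theta> + 1 / \<theta>)) * mehler a \<theta> x y)"
    by (intro sum.cong refl) (simp add: mehler_xx_def mehler_x_def power2_eq_square algebra_simps)
  also have "\<dots> = (a\<^sup>2 / 4 * (\<Sum>j\<in>UNIV. (mehler_slope j \<theta> x y)\<^sup>2) - 3 * a / 2 * (\<theta> + 1 / \<theta>)) * mehler a \<theta> x y"
    unfolding sum_UNIV_3 using assms by (simp add: field_simps)
  finally have sum: "(\<Sum>j\<in>UNIV. mehler_xx a j \<theta> x y)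
      = (a\<^sup>2 / 4 * (\<Sum>j\<in>UNIV. (mehler_slope j \<theta> x y)\<^sup>2) - 3 * a / 2 * (\<theta> + 1 / \<theta>)) * mehler a \<theta> x y" .
  \<comment> \<open>Abstracting \<open>1 / \<theta>\<close> and \<open>3 / (1 + \<theta>)\<close> to
    variables with polynomial relations turns the identity into a question about polynomial ideals.
    The third relation is the parallelogram law.\<close>
  have alg: "1 / 2 * (a\<^sup>2 / 4 * (\<theta>\<^sup>2 * p + s * i\<^sup>2 + 2 * (X - Y)) - 3 * a / 2 * (\<theta> + i)) - (a\<^sup>2 / 2 * X - 3 * a / 2)
      = a / 2 * (1 - \<theta>\<^sup>2) * (k - 3 / 2 * i - a / 4 * (p - s * i\<^sup>2))"
    if "\<theta> * i = 1" "k * (1 + \<theta>) = 3" "p + s = 2 * X + 2 * Y" for p s X Y i k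
  proof -
    have "a\<^sup>2 * (\<theta>\<^sup>2 * p + s * i\<^sup>2 + 2 * (X - Y)) - 6 * a * (\<theta> + i) - 4 * a\<^sup>2 * X + 12 * a
        = 4 * a * (1 - \<theta>\<^sup>2) * k - 6 * a * (1 - \<theta>\<^sup>2) * i - a\<^sup>2 * (1 - \<theta>\<^sup>2) * (p - s * i\<^sup>2)"
      using that by algebra
    then show ?thesis by (simp add: field_simps power2_eq_square)
  qed
  have "(x + y) \<bullet> (x + y) + (x - y) \<bullet> (x - y) = 2 * (x \<bullet> x) + 2 * (y \<bullet> y)"
    by (simp add: inner_add inner_diff inner_commute)
  moreover have "\<theta> * (1 / \<theta>) = 1" "3 / (1 + \<theta>) * (1 + \<theta>) = 3" using assms one by (auto simp: field_simps)
  ultimately have "1 / 2 * (a\<^sup>2 / 4 * (\<Sum>j\<in>UNIV. (mehler_slope j \<theta> x y)\<^sup>2) - 3 * a / 2 * (\<theta> + 1 / \<theta>)) - (a\<^sup>2 / 2 * (norm x)\<^sup>2 - 3 * a / 2)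
      = a / 2 * (1 - \<theta>\<^sup>2) * mehler_rate a \<theta> x y"
    using alg[of "1 / \<theta>" "3 / (1 + \<theta>)" "(x + y) \<bullet> (x + y)" "(x - y) \<bullet> (x - y)" "x \<bullet> x" "y \<bullet> y"]
    by (simp add: slope mehler_rate_def power2_norm_eq_inner power_divide)
  moreover have "1 / 2 * (c * M) - v * M = (1 / 2 * c - v) * M" for c v M :: real
    by (simp add: algebra_simps)
  ultimately show ?thesis unfolding sum mehler_t_def by (simp only: mult.assoc)
qed

lemma continuous_osc_operator:
  assumes "\<phi> \<in> test_functions"
  shows "continuous_on UNIV (osc_operator a \<phi>)"
  unfolding osc_operator_def[abs_def] laplacian_def
  by (intro continuous_intros test_continuous test_partial assms)

text \<open>The Laplacian is moved onto the kernel by two integrations by parts, where the heat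
  equation turns it into a \<theta>-derivative. Sign and factor are those with which the resolvent
  later telescopes.\<close>

lemma integral_mehler_osc_operator:
  assumes \<theta>: "0 < \<theta>" and \<phi>: "\<phi> \<in> test_functions"
  shows "(LINT x|lborel. complex_of_real (mehler a \<theta> x y) * osc_operator a \<phi> x)
    = - (LINT x|lborel. complex_of_real (a / 2 * (1 - \<theta>\<^sup>2) * mehler_t a \<theta> x y) * \<phi> x)"
proof -
  let ?M = "\<lambda>x. complex_of_real (mehler a \<theta> x y)"
  let ?V = "\<lambda>x :: real ^ 3. complex_of_real (a\<^sup>2 / 2 * (norm x)\<^sup>2 - 3 * a / 2)"
  have \<theta>0: "\<theta> \<noteq> 0" using \<theta> by simp
  have ibp: "(LINT x|lborel. ?M x * partial j (partial j \<phi>) x) = (LINT x|lborel. complex_of_real (mehler_xx a j \<theta> x y) * \<phi> x)" for j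
  proof -
    have "(LINT x|lborel. ?M x * partial j (partial j \<phi>) x) = - (LINT x|lborel. complex_of_real (mehler_x a j \<theta> x y) * partial j \<phi> x)"
      using integral_by_parts_test[OF mehler_has_derivative[OF \<theta>0] _ test_partial[OF \<phi>], of a y j]
      unfolding mehler_x_eq by (simp add: continuous_mehler_x[OF \<theta>0])
    also have "(LINT x|lborel. complex_of_real (mehler_x a j \<theta> x y) * partial j \<phi> x)
        = - (LINT x|lborel. complex_of_real (mehler_xx a j \<theta> x y) * \<phi> x)"
      using integral_by_parts_test[OF mehler_x_has_derivative[OF \<theta>0] _ \<phi>, of a j y j]
      unfolding mehler_xx_eq by (simp add: continuous_mehler_xx[OF \<theta>0])
    finally show ?thesis by simp
  qed
  have c1: "continuous_on UNIV ?M"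
    by (rule continuous_on_of_real[OF continuous_mehler[OF \<theta>0]])
  have c2: "continuous_on UNIV (\<lambda>x. complex_of_real (mehler_xx a j \<theta> x y))" for j
    by (rule continuous_on_of_real[OF continuous_mehler_xx[OF \<theta>0]])
  have "continuous_on UNIV (\<lambda>x :: real ^ 3. complex_of_real (c * (norm x)\<^sup>2 - d))" for c d
    by (intro continuous_intros)
  then have c3: "continuous_on UNIV ?V" .
  have int: "integrable lborel (\<lambda>x. ?M x * partial j (partial j \<phi>) x)"
    "integrable lborel (\<lambda>x. complex_of_real (mehler_xx a j \<theta> x y) * \<phi> x)"
    "integrable lborel (\<lambda>x. ?M x * (?V x * \<phi> x))" for j
    unfolding mult.assoc[symmetric]
    by (intro integrable_continuous_mult_test continuous_on_mult c1 c2 c3 test_partial \<phi>)+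
  have "(LINT x|lborel. ?M x * osc_operator a \<phi> x)
      = (LINT x|lborel. (- (1 / 2)) * (\<Sum>j\<in>UNIV. ?M x * partial j (partial j \<phi>) x) + ?M x * (?V x * \<phi> x))"
    by (intro Bochner_Integration.integral_cong refl)
       (simp add: osc_operator_def laplacian_def algebra_simps sum_distrib_left)
  also have "\<dots> = (- (1 / 2)) * (\<Sum>j\<in>UNIV. (LINT x|lborel. ?M x * partial j (partial j \<phi>) x)) + (LINT x|lborel. ?M x * (?V x * \<phi> x))"
    using int by (subst Bochner_Integration.integral_add)
      (auto intro!: integrable_mult_right Bochner_Integration.integrable_sum simp: Bochner_Integration.integral_sum simp del: minus_divide_left of_real_diff)
  also have "\<dots> = (LINT x|lborel. (- (1 / 2)) * (\<Sum>j\<in>UNIV. complex_of_real (mehler_xx a j \<theta> x y) * \<phi> x) + ?M x * (?V x * \<phi> x))"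
    unfolding ibp using int by (subst Bochner_Integration.integral_add)
      (auto intro!: integrable_mult_right Bochner_Integration.integrable_sum simp: Bochner_Integration.integral_sum simp del: minus_divide_left of_real_diff)
  also have "\<dots> = (LINT x|lborel. - (complex_of_real (a / 2 * (1 - \<theta>\<^sup>2) * mehler_t a \<theta> x y) * \<phi> x))"
    unfolding mehler_equation[OF \<theta>, symmetric]
  proof (intro Bochner_Integration.integral_cong refl)
    fix x
    have "(\<Sum>j\<in>UNIV. complex_of_real (mehler_xx a j \<theta> x y) * \<phi> x) = complex_of_real (\<Sum>j\<in>UNIV. mehler_xx a j \<theta> x y) * \<phi> x"
      by (simp add: sum_distrib_right)
    then show "(- (1 / 2)) * (\<Sum>j\<in>UNIV. complex_of_real (mehler_xx a j \<theta> x y) * \<phi> x) + ?M x * (?V x * \<phi> x)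
        = - (complex_of_real (1 / 2 * (\<Sum>j\<in>UNIV. mehler_xx a j \<theta> x y) - (a\<^sup>2 / 2 * (norm x)\<^sup>2 - 3 * a / 2) * mehler a \<theta> x y) * \<phi> x)"
      by (simp only: of_real_diff of_real_mult of_real_divide) (simp add: algebra_simps)
  qed
  finally show ?thesis by simp
qed

lemma mehler_has_derivative_t:
  assumes "0 < \<theta>"
  shows "((\<lambda>\<theta>. mehler a \<theta> x y) has_real_derivative mehler_t a \<theta> x y) (at \<theta>)"
proof -
  let ?T = "\<lambda>\<theta>. \<theta> * ((x + y) \<bullet> (x + y)) + (x - y) \<bullet> (x - y) / \<theta>"
  let ?c = "sqrt (a / pi) ^ 3 / 8"
  have 1: "((\<lambda>\<theta>. (1 + \<theta>) ^ 3) has_real_derivative 3 / (1 + \<theta>) * (1 + \<theta>) ^ 3) (at \<theta>)"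
    using assms by (auto intro!: derivative_eq_intros simp: field_simps power_numeral_reduce)
  have 2: "((\<lambda>\<theta>. \<theta> powr (- (3 / 2))) has_real_derivative - (3 / (2 * \<theta>)) * \<theta> powr (- (3 / 2))) (at \<theta>)"
    using assms powr_diff[of \<theta> "- (3 / 2)" 1] by (auto intro!: derivative_eq_intros)
  have 3: "((\<lambda>\<theta>. exp (- (a / 4) * ?T \<theta>)) has_real_derivative
      (- (a / 4) * ((x + y) \<bullet> (x + y) - (x - y) \<bullet> (x - y) / \<theta>\<^sup>2)) * exp (- (a / 4) * ?T \<theta>)) (at \<theta>)"
    using assms by (auto intro!: derivative_eq_intros simp: power2_eq_square)
  let ?f = "\<lambda>\<theta>. ?c * ((1 + \<theta>) ^ 3 * \<theta> powr (- (3 / 2)) * exp (- (a / 4) * ?T \<theta>))"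
  have gen: "c * ((k * u * W + - l * W * u) * E + m * E * (u * W)) = (k - l + m) * (c * (u * W * E))"
    for c k u W l E m :: real
    by (simp add: algebra_simps)
  have "(?f has_real_derivative (3 / (1 + \<theta>) - 3 / (2 * \<theta>) + - (a / 4) * ((x + y) \<bullet> (x + y) - (x - y) \<bullet> (x - y) / \<theta>\<^sup>2)) * ?f \<theta>) (at \<theta>)"
    by (rule DERIV_cong[OF DERIV_cmult[OF DERIV_mult[OF DERIV_mult[OF 1 2] 3]] gen])
  moreover have "?f t = mehler a t x y" for t by (simp add: mehler_def)
  moreover have "3 / (1 + \<theta>) - 3 / (2 * \<theta>) + - (a / 4) * ((x + y) \<bullet> (x + y) - (x - y) \<bullet> (x - y) / \<theta>\<^sup>2) = mehler_rate a \<theta> x y"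
    by (simp add: mehler_rate_def)
  ultimately show ?thesis by (simp only: mehler_t_def)
qed

subsection \<open>Bounds for the resolvent kernel\<close>

text \<open>The substitution \<open>\<theta> = tanh (a * t / 2)\<close> has Jacobian
  \<open>2 / (a * (1 - \<theta>\<^sup>2))\<close>. Large times correspond to \<theta> near 1, where
  removing the ground state projection \<open>mehler a 1\<close> makes up for the pole.\<close>

definition resolvent_density :: "real \<Rightarrow> real \<Rightarrow> real ^ 3 \<Rightarrow> real ^ 3 \<Rightarrow> real" where
  "resolvent_density a \<theta> x y = 2 / (a * (1 - \<theta>\<^sup>2)) * (mehler a \<theta> x y - mehler a 1 x y)"

definition resolvent_density_x :: "real \<Rightarrow> 3 \<Rightarrow> real \<Rightarrow> real ^ 3 \<Rightarrow> real ^ 3 \<Rightarrow> real" where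
  "resolvent_density_x a j \<theta> x y = 2 / (a * (1 - \<theta>\<^sup>2)) * (mehler_x a j \<theta> x y - mehler_x a j 1 x y)"

text \<open>A Gaussian of variance of order \<theta>, for the singularity at small times, plus a
  fixed one for \<theta> near 1. Both depend on \<open>x - y\<close> only, so that convolution
  estimates apply. The exponent is \<open>3 / 2\<close> for the kernel itself and 2 once a
  derivative or a weight \<open>norm x\<close> has cost half a power. The rate \<open>a / 32\<close>
  leaves room below the rate \<open>a / 4\<close> of the kernel to absorb polynomials.\<close>

definition majorant :: "real \<Rightarrow> real \<Rightarrow> real \<Rightarrow> real ^ 3 \<Rightarrow> real" where
  "majorant a k \<theta> z = \<theta> powr (- k) * exp (- (a / 32) * (z \<bullet> z) / \<theta>) + exp (- (a / 32) * (z \<bullet> z))"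

text \<open>The surplus rate \<open>d - c\<close> dominates the polynomial. Every polynomial factor
  in front of a Gaussian is removed in this way below.\<close>

lemma power_absorbed_by_exp:
  fixes c d :: real
  assumes "c < d"
  shows "\<exists>C>0. \<forall>t\<ge>0. (1 + t) ^ k * exp (- d * t) \<le> C * exp (- c * t)"
proof (intro exI conjI allI impI)
  let ?e = "d - c" and ?C = "real k ^ k / (d - c) ^ k * exp (d - c) + 1"
  have e: "0 < ?e" using assms by simp
  then show "0 < ?C" by (intro add_nonneg_pos mult_nonneg_nonneg divide_nonneg_pos) auto
  fix t :: real assume t: "0 \<le> t"
  have "(?e * (1 + t)) ^ k \<le> real k ^ k * exp (?e * (1 + t))"
    using e t by (intro power_le_const_mult_exp) simp
  then have "(1 + t) ^ k \<le> real k ^ k / ?e ^ k * exp (?e * (1 + t))"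
    using e by (subst (asm) power_mult_distrib) (simp add: pos_le_divide_eq mult.commute)
  also have "exp (?e * (1 + t)) = exp ?e * exp (?e * t)" by (simp add: algebra_simps flip: exp_add)
  also have "real k ^ k / ?e ^ k * (exp ?e * exp (?e * t)) \<le> ?C * exp (?e * t)"
    by (simp only: distrib_right mult.assoc) simp
  finally have "(1 + t) ^ k \<le> ?C * exp (?e * t)" .
  then have "(1 + t) ^ k * exp (- d * t) \<le> ?C * exp (?e * t) * exp (- d * t)"
    by (intro mult_right_mono) auto
  also have "\<dots> = ?C * exp (- c * t)" by (simp add: mult.assoc algebra_simps flip: exp_add)
  finally show "(1 + t) ^ k * exp (- d * t) \<le> ?C * exp (- c * t)" .
qed

lemma mehler_nonneg: "0 < a \<Longrightarrow> 0 \<le> \<theta> \<Longrightarrow> 0 \<le> mehler a \<theta> x y"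
  by (simp add: mehler_def)

lemma mehler_le:
  assumes a: "0 < a" and \<theta>: "0 < \<theta>" "\<theta> \<le> 1"
  shows "mehler a \<theta> x y \<le> sqrt (a / pi) ^ 3 * \<theta> powr (- (3 / 2)) *
    exp (- (a / 4) * (\<theta> * ((x + y) \<bullet> (x + y)) + (x - y) \<bullet> (x - y) / \<theta>))"
proof -
  have "(1 + \<theta>) ^ 3 \<le> 2 ^ 3" using \<theta> by (intro power_mono) auto
  then have "sqrt (a / pi) ^ 3 * (1 + \<theta>) ^ 3 / 8 \<le> sqrt (a / pi) ^ 3 * 1"
    using a by (simp add: field_simps mult_left_mono)
  then show ?thesis unfolding mehler_def by (intro mult_right_mono) auto
qed

lemma norm_le_half_sum: "norm x \<le> (norm (x + y) + norm (x - y)) / 2" for x y :: "real ^ 3"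
proof -
  have "(x + y) + (x - y) = 2 *\<^sub>R x" by (simp add: scaleR_2)
  then have "2 * norm x = norm ((x + y) + (x - y))" by (simp only: norm_scaleR)
  also have "\<dots> \<le> norm (x + y) + norm (x - y)" by (rule norm_triangle_ineq)
  finally show ?thesis by simp
qed

text \<open>Let \<open>t\<close> be the quadratic form in the exponent. Both \<open>norm x\<close>
  and the slope are at most a constant times \<theta> to the power -1/2 times \<open>1 + t\<close>,
  and the factor \<open>1 + t\<close> is paid for by giving up part of the exponential. What remains
  of the exponential is estimated by its \<open>x - y\<close> part alone.\<close>

lemma mehler_small_bounds:
  assumes a: "0 < a"
  shows "\<exists>C>0. \<forall>\<theta> x y j. 0 < \<theta> \<longrightarrow> \<theta> \<le> 1 \<longrightarrow>
    mehler a \<theta> x y \<le> C * (\<theta> powr (- (3 / 2)) * exp (- (a / 32) * ((x - y) \<bullet> (x - y)) / \<theta>)) \<and>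
    norm x * mehler a \<theta> x y \<le> C * (\<theta> powr (- 2) * exp (- (a / 32) * ((x - y) \<bullet> (x - y)) / \<theta>)) \<and>
    \<bar>mehler_x a j \<theta> x y\<bar> \<le> C * (\<theta> powr (- 2) * exp (- (a / 32) * ((x - y) \<bullet> (x - y)) / \<theta>))"
proof -
  define A where "A = sqrt (a / pi) ^ 3"
  have A: "0 < A" using a by (simp add: A_def)
  obtain C where C: "0 < C" "\<And>t. 0 \<le> t \<Longrightarrow> (1 + t) ^ 1 * exp (- (a / 4) * t) \<le> C * exp (- (a / 32) * t)"
    using power_absorbed_by_exp[of "a / 32" "a / 4" 1] a by auto
  have "mehler a \<theta> x y \<le> (A * C * (1 + a)) * (\<theta> powr (- (3 / 2)) * exp (- (a / 32) * ((x - y) \<bullet> (x - y)) / \<theta>)) \<and>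
    norm x * mehler a \<theta> x y \<le> (A * C * (1 + a)) * (\<theta> powr (- 2) * exp (- (a / 32) * ((x - y) \<bullet> (x - y)) / \<theta>)) \<and>
    \<bar>mehler_x a j \<theta> x y\<bar> \<le> (A * C * (1 + a)) * (\<theta> powr (- 2) * exp (- (a / 32) * ((x - y) \<bullet> (x - y)) / \<theta>))"
    if \<theta>: "0 < \<theta>" "\<theta> \<le> 1" for \<theta> x y j
  proof -
    define p where "p = (x + y) \<bullet> (x + y)"
    define s where "s = (x - y) \<bullet> (x - y)"
    define t where "t = \<theta> * p + s / \<theta>"
    define r where "r = \<theta> powr (- (1 / 2))"
    define E where "E = exp (- (a / 32) * s / \<theta>)"
    define W where "W = \<theta> powr (- (3 / 2))"
    have ps: "0 \<le> p" "0 \<le> s" by (simp_all add: p_def s_def)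
    have t: "0 \<le> t" "\<theta> * p \<le> t" "s / \<theta> \<le> t" using ps \<theta> by (auto simp: t_def)
    have r: "0 < r" "r * r = 1 / \<theta>" "r * W = \<theta> powr (- 2)" and W: "0 < W"
      using \<theta> by (simp_all add: r_def W_def powr_add[symmetric] powr_minus_divide)
    have tsq: "t \<le> (1 + t)\<^sup>2" using t by (simp add: power2_eq_square algebra_simps)
    \<comment> \<open>One estimate for the three vectors \<open>x + y\<close>, \<open>x - y\<close>
      and \<open>(1 / \<theta>) *\<^sub>R (x - y)\<close>: in each case \<theta> times the squared
      norm is at most \<open>t\<close>, with \<open>\<theta> \<le> 1\<close> used for the
      second.\<close>
    have root: "norm z \<le> r * (1 + t)" if "\<theta> * (z \<bullet> z) \<le> (1 + t)\<^sup>2" for z :: "real ^ 3"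
    proof (rule power2_le_imp_le)
      have "(norm z)\<^sup>2 \<le> (1 + t)\<^sup>2 / \<theta>" using that \<theta> by (simp add: power2_norm_eq_inner field_simps)
      also have "\<dots> = (r * (1 + t))\<^sup>2" using r(2) by (simp add: power_mult_distrib power2_eq_square[of r])
      finally show "(norm z)\<^sup>2 \<le> (r * (1 + t))\<^sup>2" .
    qed (use r t in simp)
    have n1: "norm (x + y) \<le> r * (1 + t)" using t tsq by (intro root) (simp flip: p_def)
    have "s \<le> s / \<theta>" "\<theta> * s \<le> s" using ps \<theta> by (simp_all add: field_simps mult_left_le_one_le mult_left_le)
    then have n2: "norm (x - y) \<le> r * (1 + t)" using t tsq by (intro root) (simp flip: s_def)
    have "norm ((1 / \<theta>) *\<^sub>R (x - y)) \<le> r * (1 + t)"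
      using t tsq \<theta> by (intro root) (simp add: s_def)
    then have n3: "norm (x - y) / \<theta> \<le> r * (1 + t)" using \<theta> by simp
    have "exp (- (a / 32) * t) \<le> E" using mult_left_mono[OF t(3), of a] a by (simp add: E_def)
    then have CE: "(1 + t) * exp (- (a / 4) * t) \<le> C * E"
      using C(2)[OF t(1)] C(1) by (smt (verit) mult_left_mono power_one_right)
    have M: "mehler a \<theta> x y \<le> A * W * exp (- (a / 4) * t)"
      using mehler_le[OF a \<theta>, of x y] by (simp add: A_def W_def t_def p_def s_def)
    have M0: "0 \<le> mehler a \<theta> x y" using a \<theta> by (intro mehler_nonneg) auto
    have M1: "(1 + t) * mehler a \<theta> x y \<le> A * C * (W * E)"
    proof -
      have "(1 + t) * mehler a \<theta> x y \<le> (1 + t) * (A * W * exp (- (a / 4) * t))"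
        using M t by (intro mult_left_mono) auto
      also have "\<dots> = A * W * ((1 + t) * exp (- (a / 4) * t))" by simp
      also have "\<dots> \<le> A * W * (C * E)" using CE A W by (intro mult_left_mono) auto
      finally show ?thesis by (simp add: mult_ac)
    qed
    have K: "A * C \<le> A * C * (1 + a)" "A * C * a \<le> A * C * (1 + a)" using A C a by (simp_all add: algebra_simps)
    have WE: "0 \<le> W * E" "0 \<le> \<theta> powr (- 2) * E" using W by (simp_all add: E_def)
    have "mehler a \<theta> x y \<le> (1 + t) * mehler a \<theta> x y" using M0 t by (simp add: algebra_simps)
    also have "\<dots> \<le> A * C * (1 + a) * (W * E)" using M1 K(1) WE by (smt (verit) mult_right_mono)
    finally have 1: "mehler a \<theta> x y \<le> A * C * (1 + a) * (W * E)" .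
    have rM: "r * (1 + t) * mehler a \<theta> x y \<le> A * C * (\<theta> powr (- 2) * E)"
      using mult_left_mono[OF M1, of r] r by (simp add: mult_ac flip: r(3))
    have "norm x \<le> r * (1 + t)" using norm_le_half_sum[of x y] n1 n2 by simp
    then have "norm x * mehler a \<theta> x y \<le> r * (1 + t) * mehler a \<theta> x y" using M0 by (rule mult_right_mono)
    also have "\<dots> \<le> A * C * (1 + a) * (\<theta> powr (- 2) * E)" using rM K(1) WE by (smt (verit) mult_right_mono)
    finally have 2: "norm x * mehler a \<theta> x y \<le> A * C * (1 + a) * (\<theta> powr (- 2) * E)" .
    have "\<bar>mehler_slope j \<theta> x y\<bar> \<le> \<theta> * \<bar>(x + y) $ j\<bar> + \<bar>(x - y) $ j\<bar> / \<theta>"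
      unfolding mehler_slope_def using \<theta> by (intro order.trans[OF abs_triangle_ineq]) (simp add: abs_mult)
    also have "\<dots> \<le> 1 * norm (x + y) + norm (x - y) / \<theta>"
      using \<theta> by (intro add_mono mult_mono divide_right_mono component_le_norm_cart) auto
    finally have slope: "\<bar>mehler_slope j \<theta> x y\<bar> \<le> 2 * (r * (1 + t))" using n1 n3 by simp
    have "\<bar>mehler_x a j \<theta> x y\<bar> = a / 2 * \<bar>mehler_slope j \<theta> x y\<bar> * mehler a \<theta> x y"
      using a M0 by (simp add: mehler_x_def abs_mult)
    also have "\<dots> \<le> a / 2 * (2 * (r * (1 + t))) * mehler a \<theta> x y"
      using slope a M0 by (intro mult_right_mono mult_left_mono) auto
    also have "\<dots> = a * (r * (1 + t) * mehler a \<theta> x y)" by simp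
    also have "\<dots> \<le> a * (A * C * (\<theta> powr (- 2) * E))" using rM a by (intro mult_left_mono) auto
    also have "\<dots> = A * C * a * (\<theta> powr (- 2) * E)" by simp
    also have "\<dots> \<le> A * C * (1 + a) * (\<theta> powr (- 2) * E)" using K(2) WE by (intro mult_right_mono) auto
    finally have 3: "\<bar>mehler_x a j \<theta> x y\<bar> \<le> A * C * (1 + a) * (\<theta> powr (- 2) * E)" .
    from 1 2 3 show ?thesis by (simp add: E_def s_def W_def)
  qed
  moreover have "0 < A * C * (1 + a)" using A C a by simp
  ultimately show ?thesis by blast
qed

lemma mehler_slope_has_derivative_t:
  assumes "0 < \<theta>"
  shows "((\<lambda>\<theta>. mehler_slope j \<theta> x y) has_real_derivative ((x + y) $ j - (x - y) $ j / \<theta>\<^sup>2)) (at \<theta>)"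
  unfolding mehler_slope_def using assms by (auto intro!: derivative_eq_intros simp: power2_eq_square field_simps)

text \<open>The mean value theorem in \<theta> supplies the factor \<open>1 - \<theta>\<close>,
  which will cancel the pole of the Jacobian. With the weight included, the derivatives cost at most
  \<open>(1 + u)\<^sup>2\<close>, where \<open>u\<close> is the sum of the squared norms of
  \<open>x + y\<close> and \<open>x - y\<close>; the exponential absorbs this. Staying above
  \<theta> = 1/2 keeps negative powers of \<theta> bounded.\<close>

lemma mehler_large_bounds:
  assumes a: "0 < a"
  shows "\<exists>C>0. \<forall>\<theta> x y j. 1 / 2 \<le> \<theta> \<longrightarrow> \<theta> < 1 \<longrightarrow>
    (1 + norm x) * \<bar>mehler a \<theta> x y - mehler a 1 x y\<bar> \<le> C * (1 - \<theta>) * exp (- (a / 32) * ((x - y) \<bullet> (x - y))) \<and>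
    \<bar>mehler_x a j \<theta> x y - mehler_x a j 1 x y\<bar> \<le> C * (1 - \<theta>) * exp (- (a / 32) * ((x - y) \<bullet> (x - y)))"
proof -
  \<comment> \<open>The factor 4 bounds \<theta> to the power -3/2 on the interval from 1/2 to
    1.\<close>
  define A where "A = 4 * sqrt (a / pi) ^ 3"
  have A: "0 < A" using a by (simp add: A_def)
  obtain C where C: "0 < C" "\<And>t. 0 \<le> t \<Longrightarrow> (1 + t) ^ 2 * exp (- (a / 8) * t) \<le> C * exp (- (a / 32) * t)"
    using power_absorbed_by_exp[of "a / 32" "a / 8" 2] a by auto
  define K where "K = 2 * (6 + a) * A + a / 2 * ((5 + 3 * (6 + a)) * A)"
  have K: "0 < K" using A a by (auto simp: K_def intro!: add_pos_pos mult_pos_pos)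
  have K1: "2 * (6 + a) * A \<le> K" and K2: "a / 2 * ((5 + 3 * (6 + a)) * A) \<le> K"
    using A a by (simp_all add: K_def)
  have "(1 + norm x) * \<bar>mehler a \<theta> x y - mehler a 1 x y\<bar> \<le> K * C * (1 - \<theta>) * exp (- (a / 32) * ((x - y) \<bullet> (x - y))) \<and>
    \<bar>mehler_x a j \<theta> x y - mehler_x a j 1 x y\<bar> \<le> K * C * (1 - \<theta>) * exp (- (a / 32) * ((x - y) \<bullet> (x - y)))"
    if \<theta>: "1 / 2 \<le> \<theta>" "\<theta> < 1" for \<theta> x y j
  proof -
    define p where "p = (x + y) \<bullet> (x + y)"
    define s where "s = (x - y) \<bullet> (x - y)"
    define u where "u = p + s"
    \<comment> \<open>The rate \<open>a / 8\<close> instead of \<open>a / 4\<close> pays for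
      replacing \<open>\<tau> * p\<close> by its lower bound \<open>p / 2\<close>.\<close>
    define E where "E = exp (- (a / 8) * u)"
    have ps: "0 \<le> p" "0 \<le> s" by (simp_all add: p_def s_def)
    then have u: "0 \<le> u" "p \<le> u" "s \<le> u" by (auto simp: u_def)
    have root: "norm z \<le> 1 + u" if "z \<bullet> z \<le> u" for z :: "real ^ 3"
    proof (rule power2_le_imp_le)
      have "u \<le> (1 + u)\<^sup>2" using u by (simp add: power2_eq_square algebra_simps)
      with that show "(norm z)\<^sup>2 \<le> (1 + u)\<^sup>2" by (simp add: power2_norm_eq_inner)
    qed (use u in simp)
    have n1: "norm (x + y) \<le> 1 + u" and n2: "norm (x - y) \<le> 1 + u"
      using u by (auto intro!: root simp flip: p_def s_def)
    have nx: "norm x \<le> 1 + u" using norm_le_half_sum[of x y] n1 n2 by simp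
    have E: "0 < E" by (simp add: E_def)
    have absorb: "(1 + u) ^ 2 * E \<le> C * exp (- (a / 32) * s)"
    proof -
      have "(1 + u) ^ 2 * E \<le> C * exp (- (a / 32) * u)" using C(2)[OF u(1)] by (simp add: E_def)
      also have "\<dots> \<le> C * exp (- (a / 32) * s)" using C(1) a u by (intro mult_left_mono) auto
      finally show ?thesis .
    qed
    \<comment> \<open>Uniform in \<tau>, because the intermediate points delivered by the mean value
      theorem below are not known explicitly.\<close>
    have bounds: "0 \<le> mehler a \<tau> x y" "mehler a \<tau> x y \<le> A * E" "\<bar>mehler_t a \<tau> x y\<bar> \<le> (6 + a) * (1 + u) * (A * E)"
        "\<bar>mehler_slope j \<tau> x y\<bar> \<le> 3 * (1 + u)" "\<bar>(x + y) $ j - (x - y) $ j / \<tau>\<^sup>2\<bar> \<le> 5 * (1 + u)"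
      if \<tau>: "1 / 2 \<le> \<tau>" "\<tau> \<le> 1" for \<tau>
    proof -
      have \<tau>0: "0 < \<tau>" using \<tau> by simp
      have "\<tau> powr (- (3 / 2)) \<le> (1 / 2) powr (- (3 / 2))" using \<tau> by (intro powr_mono2') auto
      also have "\<dots> = 2 powr (3 / 2)" by (simp add: powr_minus powr_divide)
      also have "\<dots> \<le> 2 powr 2" by (intro powr_mono) auto
      finally have W: "\<tau> powr (- (3 / 2)) \<le> 4" by simp
      have p1: "1 / 2 * p \<le> \<tau> * p" using \<tau> ps by (intro mult_right_mono) auto
      have s1: "s \<le> s / \<tau>" "s / \<tau>\<^sup>2 \<le> 4 * s"
      proof -
        show "s \<le> s / \<tau>" using \<tau> ps by (simp add: field_simps mult_left_le_one_le)
        have "1 / 4 \<le> \<tau>\<^sup>2" using power_mono[OF \<tau>(1), of 2] by (simp add: power2_eq_square)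
        then show "s / \<tau>\<^sup>2 \<le> 4 * s" using mult_left_mono[of 1 "4 * \<tau>\<^sup>2" s] \<tau>0 ps by (simp add: pos_divide_le_eq mult_ac)
      qed
      show M0: "0 \<le> mehler a \<tau> x y" using a \<tau>0 by (intro mehler_nonneg) auto
      have "mehler a \<tau> x y \<le> sqrt (a / pi) ^ 3 * \<tau> powr (- (3 / 2)) * exp (- (a / 4) * (\<tau> * p + s / \<tau>))"
        using mehler_le[OF a \<tau>0 \<tau>(2), of x y] by (simp add: p_def s_def)
      also have "\<dots> \<le> sqrt (a / pi) ^ 3 * 4 * E"
      proof (intro mult_mono mult_left_mono W)
        have "u / 2 \<le> A + B" if "1 / 2 * p \<le> A" "s \<le> B" for A B using that ps by (simp add: u_def)
        from this[OF p1 s1(1)] have "u / 2 \<le> \<tau> * p + s / \<tau>" .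
        then have "a / 4 * (u / 2) \<le> a / 4 * (\<tau> * p + s / \<tau>)" using a by (intro mult_left_mono) auto
        then show "exp (- (a / 4) * (\<tau> * p + s / \<tau>)) \<le> E" by (simp add: E_def)
      qed (use a in auto)
      finally show M: "mehler a \<tau> x y \<le> A * E" by (simp add: A_def)
      have "\<bar>mehler_rate a \<tau> x y\<bar> \<le> \<bar>3 / (1 + \<tau>)\<bar> + \<bar>3 / (2 * \<tau>)\<bar> + \<bar>a / 4 * (p - s / \<tau>\<^sup>2)\<bar>"
        unfolding mehler_rate_def p_def[symmetric] s_def[symmetric] by linarith
      also have "\<dots> \<le> 3 + 3 + a / 4 * (4 * u)"
      proof (intro add_mono)
        show "\<bar>3 / (1 + \<tau>)\<bar> \<le> 3" "\<bar>3 / (2 * \<tau>)\<bar> \<le> 3" using \<tau> by (auto simp: field_simps)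
        have "\<bar>p - s / \<tau>\<^sup>2\<bar> \<le> 4 * u" using ps s1(2) \<tau>0 unfolding u_def abs_le_iff by (smt (verit) divide_nonneg_nonneg zero_le_power2)
        then show "\<bar>a / 4 * (p - s / \<tau>\<^sup>2)\<bar> \<le> a / 4 * (4 * u)" using a by (simp add: abs_mult mult_left_mono)
      qed
      also have "\<dots> \<le> (6 + a) * (1 + u)" using a u by (simp add: algebra_simps)
      finally have "\<bar>mehler_rate a \<tau> x y\<bar> * mehler a \<tau> x y \<le> (6 + a) * (1 + u) * (A * E)"
        using M M0 a u by (intro mult_mono) auto
      then show "\<bar>mehler_t a \<tau> x y\<bar> \<le> (6 + a) * (1 + u) * (A * E)" using M0 by (simp add: mehler_t_def abs_mult)
      have xj: "\<bar>(x + y) $ j\<bar> \<le> 1 + u" "\<bar>(x - y) $ j\<bar> \<le> 1 + u"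
        using n1 n2 component_le_norm_cart[of "x + y" j] component_le_norm_cart[of "x - y" j] by linarith+
      have q: "c / \<tau> \<le> 2 * c" "c / \<tau>\<^sup>2 \<le> 4 * c" if "0 \<le> c" for c :: real
      proof -
        show "c / \<tau> \<le> 2 * c" using mult_left_mono[of 1 "2 * \<tau>" c] \<tau> that by (simp add: pos_divide_le_eq mult_ac)
        have "1 / 4 \<le> \<tau>\<^sup>2" using power_mono[OF \<tau>(1), of 2] by (simp add: power2_eq_square)
        then show "c / \<tau>\<^sup>2 \<le> 4 * c" using mult_left_mono[of 1 "4 * \<tau>\<^sup>2" c] \<tau>0 that by (simp add: pos_divide_le_eq mult_ac)
      qed
      have h1: "\<bar>\<tau> * (x + y) $ j\<bar> \<le> 1 * (1 + u)"
        unfolding abs_mult using \<tau> xj by (intro mult_mono) auto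
      have h2: "\<bar>(x - y) $ j / \<tau>\<bar> \<le> 2 * (1 + u)"
        using q(1)[of "\<bar>(x - y) $ j\<bar>"] xj \<tau>0 by simp
      have h4: "\<bar>(x - y) $ j / \<tau>\<^sup>2\<bar> \<le> 4 * (1 + u)"
        using q(2)[of "\<bar>(x - y) $ j\<bar>"] xj \<tau>0 by simp
      have tri: "\<bar>A + B\<bar> \<le> 3 * (1 + u)" if "\<bar>A\<bar> \<le> 1 * (1 + u)" "\<bar>B\<bar> \<le> 2 * (1 + u)" for A B
        using that by linarith
      show "\<bar>mehler_slope j \<tau> x y\<bar> \<le> 3 * (1 + u)"
        unfolding mehler_slope_def by (rule tri[OF h1 h2])
      have tri': "\<bar>A - B\<bar> \<le> 5 * (1 + u)" if "\<bar>A\<bar> \<le> 1 + u" "\<bar>B\<bar> \<le> 4 * (1 + u)" for A B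
        using that abs_triangle_ineq4[of A B] by argo
      show "\<bar>(x + y) $ j - (x - y) $ j / \<tau>\<^sup>2\<bar> \<le> 5 * (1 + u)" by (rule tri'[OF xj(1) h4])
    qed
    obtain \<tau> where \<tau>: "\<theta> < \<tau>" "\<tau> < 1" "mehler a 1 x y - mehler a \<theta> x y = (1 - \<theta>) * mehler_t a \<tau> x y"
      using MVT2[of \<theta> 1 "\<lambda>\<theta>. mehler a \<theta> x y" "\<lambda>\<theta>. mehler_t a \<theta> x y"] mehler_has_derivative_t \<theta> by (auto simp: )
    have u1: "1 + u \<le> (1 + u)\<^sup>2" using u by (simp add: power2_eq_square algebra_simps)
    have "\<bar>mehler a \<theta> x y - mehler a 1 x y\<bar> = (1 - \<theta>) * \<bar>mehler_t a \<tau> x y\<bar>"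
      using \<tau>(3) \<theta> by (subst abs_minus_commute) (simp add: abs_mult)
    also have "\<dots> \<le> (1 - \<theta>) * ((6 + a) * (1 + u) * (A * E))"
      using \<theta> \<tau> by (intro mult_left_mono bounds) auto
    finally have "(1 + norm x) * \<bar>mehler a \<theta> x y - mehler a 1 x y\<bar> \<le> (2 * (1 + u)) * ((1 - \<theta>) * ((6 + a) * (1 + u) * (A * E)))"
      using nx u \<theta> a A E by (intro mult_mono) auto
    also have "\<dots> = (2 * (6 + a) * A) * (1 - \<theta>) * ((1 + u) ^ 2 * E)" by (simp add: power2_eq_square algebra_simps)
    also have "\<dots> \<le> K * (1 - \<theta>) * (C * exp (- (a / 32) * s))"
      using K1 K \<theta> E by (intro mult_mono[OF mult_right_mono absorb]) auto
    finally have 1: "(1 + norm x) * \<bar>mehler a \<theta> x y - mehler a 1 x y\<bar> \<le> K * C * (1 - \<theta>) * exp (- (a / 32) * s)"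
      by (simp add: mult_ac)
    let ?D = "\<lambda>\<theta>. - (a / 2) * (((x + y) $ j - (x - y) $ j / \<theta>\<^sup>2) * mehler a \<theta> x y + mehler_t a \<theta> x y * mehler_slope j \<theta> x y)"
    have "((\<lambda>\<theta>. mehler_x a j \<theta> x y) has_real_derivative ?D \<theta>) (at \<theta>)" if "0 < \<theta>" for \<theta>
      unfolding mehler_x_def
      by (intro DERIV_cmult DERIV_mult mehler_slope_has_derivative_t mehler_has_derivative_t that)
    then obtain \<sigma> where \<sigma>: "\<theta> < \<sigma>" "\<sigma> < 1" "mehler_x a j 1 x y - mehler_x a j \<theta> x y = (1 - \<theta>) * ?D \<sigma>"
      using MVT2[of \<theta> 1 "\<lambda>\<theta>. mehler_x a j \<theta> x y" ?D] \<theta> by auto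
    have \<sigma>': "1 / 2 \<le> \<sigma>" "\<sigma> \<le> 1" using \<sigma> \<theta> by auto
    have "\<bar>((x + y) $ j - (x - y) $ j / \<sigma>\<^sup>2) * mehler a \<sigma> x y\<bar> \<le> (5 * (1 + u)) * (A * E)"
      unfolding abs_mult using bounds[OF \<sigma>'] u by (intro mult_mono) auto
    also have "\<dots> \<le> (5 * (1 + u)\<^sup>2) * (A * E)" using u1 A E by (intro mult_right_mono) auto
    finally have d1: "\<bar>((x + y) $ j - (x - y) $ j / \<sigma>\<^sup>2) * mehler a \<sigma> x y\<bar> \<le> (5 * (1 + u)\<^sup>2) * (A * E)" .
    have d2: "\<bar>mehler_t a \<sigma> x y * mehler_slope j \<sigma> x y\<bar> \<le> ((6 + a) * (1 + u) * (A * E)) * (3 * (1 + u))"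
      unfolding abs_mult using bounds[OF \<sigma>'] u a A E by (intro mult_mono) auto
    have "\<bar>mehler_x a j \<theta> x y - mehler_x a j 1 x y\<bar> = (1 - \<theta>) * \<bar>?D \<sigma>\<bar>"
      using \<sigma>(3) \<theta> by (subst abs_minus_commute) (simp add: abs_mult del: mult_minus_left)
    also have "\<bar>?D \<sigma>\<bar> \<le> a / 2 * ((5 * (1 + u)\<^sup>2) * (A * E) + ((6 + a) * (1 + u) * (A * E)) * (3 * (1 + u)))"
      unfolding abs_mult using a d1 d2 by (intro mult_mono order.trans[OF abs_triangle_ineq] add_mono) auto
    also have "(1 - \<theta>) * (a / 2 * ((5 * (1 + u)\<^sup>2) * (A * E) + ((6 + a) * (1 + u) * (A * E)) * (3 * (1 + u))))
        = (a / 2 * ((5 + 3 * (6 + a)) * A)) * (1 - \<theta>) * ((1 + u) ^ 2 * E)"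
      by (simp add: power2_eq_square field_simps)
    also have "\<dots> \<le> K * (1 - \<theta>) * (C * exp (- (a / 32) * s))"
      using K2 K \<theta> E by (intro mult_mono[OF mult_right_mono absorb]) auto
    finally have 2: "\<bar>mehler_x a j \<theta> x y - mehler_x a j 1 x y\<bar> \<le> K * C * (1 - \<theta>) * exp (- (a / 32) * s)"
      using \<theta> by (simp add: mult_ac)
    from 1 2 show ?thesis by (simp add: s_def)
  qed
  moreover have "0 < K * C" using K C by simp
  ultimately show ?thesis by blast
qed

lemma exp_scaled_le_majorant:
  "\<theta> powr (- k) * exp (- (a / 32) * (z \<bullet> z) / \<theta>) \<le> majorant a k \<theta> z" "exp (- (a / 32) * (z \<bullet> z)) \<le> majorant a k \<theta> z"
  by (simp_all add: majorant_def)

lemma majorant_nonneg: "0 \<le> majorant a k \<theta> z"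
  by (simp add: majorant_def)

text \<open>The interval is split at \<theta> = 1/2. Below, the Jacobian is at most
  \<open>3 / a\<close> and the two kernels are bounded separately. Above, the difference of the
  kernels carries the factor \<open>1 - \<theta>\<close>, and only \<open>1 + \<theta>\<close> is
  left in the denominator.\<close>

lemma resolvent_density_bounds:
  assumes a: "0 < a"
  shows "\<exists>C>0. \<forall>\<theta> x y j. 0 < \<theta> \<longrightarrow> \<theta> < 1 \<longrightarrow>
    \<bar>resolvent_density a \<theta> x y\<bar> \<le> C * majorant a (3 / 2) \<theta> (x - y) \<and>
    norm x * \<bar>resolvent_density a \<theta> x y\<bar> \<le> C * majorant a 2 \<theta> (x - y) \<and>
    \<bar>resolvent_density_x a j \<theta> x y\<bar> \<le> C * majorant a 2 \<theta> (x - y)"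
proof -
  obtain C1 where C1: "0 < C1" and small: "\<And>\<theta> x y j. 0 < \<theta> \<Longrightarrow> \<theta> \<le> 1 \<Longrightarrow>
    mehler a \<theta> x y \<le> C1 * (\<theta> powr (- (3 / 2)) * exp (- (a / 32) * ((x - y) \<bullet> (x - y)) / \<theta>)) \<and>
    norm x * mehler a \<theta> x y \<le> C1 * (\<theta> powr (- 2) * exp (- (a / 32) * ((x - y) \<bullet> (x - y)) / \<theta>)) \<and>
    \<bar>mehler_x a j \<theta> x y\<bar> \<le> C1 * (\<theta> powr (- 2) * exp (- (a / 32) * ((x - y) \<bullet> (x - y)) / \<theta>))"
    using mehler_small_bounds[OF a] by metis
  obtain C2 where C2: "0 < C2" and large: "\<And>\<theta> x y j. 1 / 2 \<le> \<theta> \<Longrightarrow> \<theta> < 1 \<Longrightarrow>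
    (1 + norm x) * \<bar>mehler a \<theta> x y - mehler a 1 x y\<bar> \<le> C2 * (1 - \<theta>) * exp (- (a / 32) * ((x - y) \<bullet> (x - y))) \<and>
    \<bar>mehler_x a j \<theta> x y - mehler_x a j 1 x y\<bar> \<le> C2 * (1 - \<theta>) * exp (- (a / 32) * ((x - y) \<bullet> (x - y)))"
    using mehler_large_bounds[OF a] by metis
  let ?C = "3 / a * (C1 + C2)"
  have "\<bar>resolvent_density a \<theta> x y\<bar> \<le> ?C * majorant a (3 / 2) \<theta> (x - y) \<and>
    norm x * \<bar>resolvent_density a \<theta> x y\<bar> \<le> ?C * majorant a 2 \<theta> (x - y) \<and>
    \<bar>resolvent_density_x a j \<theta> x y\<bar> \<le> ?C * majorant a 2 \<theta> (x - y)"
    if \<theta>: "0 < \<theta>" "\<theta> < 1" for \<theta> x y j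
  proof -
    let ?q = "2 / (a * (1 - \<theta>\<^sup>2))"
    have sq: "\<theta>\<^sup>2 < 1" using \<theta> by (simp add: power_less_one_iff)
    then have q: "0 < ?q" using a by simp
    have reduce: "?q * D \<le> ?C * majorant a k \<theta> (x - y)"
      if sm: "\<theta> \<le> 1 / 2 \<Longrightarrow> D \<le> C1 * majorant a k \<theta> (x - y)" and lg: "1 / 2 \<le> \<theta> \<Longrightarrow> D \<le> C2 * (1 - \<theta>) * majorant a k \<theta> (x - y)"
      for D k
    proof (cases "\<theta> \<le> 1 / 2")
      case True
      have "\<theta>\<^sup>2 \<le> (1 / 2)\<^sup>2" using True \<theta> by (intro power_mono) auto
      then have "?q \<le> 3 / a" using a sq by (simp add: field_simps power2_eq_square)
      then have "?q * D \<le> 3 / a * (C1 * majorant a k \<theta> (x - y))"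
        using q sm[OF True] C1 majorant_nonneg[of a k \<theta> "x - y"]
        by (meson mult_left_mono mult_right_mono less_imp_le mult_nonneg_nonneg order_trans)
      also have "\<dots> \<le> ?C * majorant a k \<theta> (x - y)"
        using C2 a majorant_nonneg[of a k \<theta> "x - y"] by (simp add: field_simps)
      finally show ?thesis .
    next
      case False
      have "?q * D \<le> ?q * (C2 * (1 - \<theta>) * majorant a k \<theta> (x - y))"
        using q lg False by (intro mult_left_mono) auto
      also have "\<dots> = (?q * (1 - \<theta>)) * (C2 * majorant a k \<theta> (x - y))" by simp
      also have "?q * (1 - \<theta>) = 2 / (a * (1 + \<theta>))"
      proof -
        have e: "1 - \<theta>\<^sup>2 = (1 - \<theta>) * (1 + \<theta>)" by (simp add: power2_eq_square algebra_simps)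
        have "1 + \<theta> \<noteq> 0" "1 - \<theta> \<noteq> 0" "a \<noteq> 0" using \<theta> a by auto
        then show ?thesis unfolding e by (simp add: divide_simps)
      qed
      also have "2 / (a * (1 + \<theta>)) * (C2 * majorant a k \<theta> (x - y)) \<le> 3 / a * (C2 * majorant a k \<theta> (x - y))"
      proof (intro mult_right_mono)
        show "2 / (a * (1 + \<theta>)) \<le> 3 / a" using \<theta> a by (intro frac_le) auto
      qed (use C2 majorant_nonneg[of a k \<theta> "x - y"] in simp)
      also have "\<dots> \<le> ?C * majorant a k \<theta> (x - y)"
        using C1 a majorant_nonneg[of a k \<theta> "x - y"] by (simp add: field_simps)
      finally show ?thesis .
    qed
    \<comment> \<open>The bound of the stationary kernel, taken at \<theta> = 1, is exactly the
      second Gaussian of the majorant.\<close>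
    have maj: "C1 * (\<theta> powr (- k) * exp (- (a / 32) * ((x - y) \<bullet> (x - y)) / \<theta>)) + C1 * (1 powr (- k) * exp (- (a / 32) * ((x - y) \<bullet> (x - y)) / 1))
        = C1 * majorant a k \<theta> (x - y)" for k
      by (simp add: majorant_def distrib_left)
    have large': "D \<le> C2 * (1 - \<theta>) * majorant a k \<theta> (x - y)"
      if "D \<le> C2 * (1 - \<theta>) * exp (- (a / 32) * ((x - y) \<bullet> (x - y)))" for D k
      using that exp_scaled_le_majorant(2)[of a "x - y" k \<theta>] C2 \<theta>
      by (smt (verit) mult_left_mono mult_nonneg_nonneg)
    have M0: "0 \<le> mehler a \<theta> x y" "0 \<le> mehler a 1 x y" using a \<theta> by (auto intro: mehler_nonneg)
    have s1: "\<bar>mehler a \<theta> x y - mehler a 1 x y\<bar> \<le> C1 * majorant a (3 / 2) \<theta> (x - y)"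
      using small[of \<theta> x y j] small[of 1 x y j] \<theta> M0 unfolding maj[symmetric] by (auto intro: abs_leI)
    have s2: "norm x * \<bar>mehler a \<theta> x y - mehler a 1 x y\<bar> \<le> C1 * majorant a 2 \<theta> (x - y)"
    proof -
      have "norm x * \<bar>mehler a \<theta> x y - mehler a 1 x y\<bar> \<le> norm x * (mehler a \<theta> x y + mehler a 1 x y)"
        using M0 by (intro mult_left_mono) auto
      also have "\<dots> \<le> C1 * majorant a 2 \<theta> (x - y)"
        using small[of \<theta> x y j] small[of 1 x y j] \<theta> unfolding maj[symmetric] distrib_left by (intro add_mono) auto
      finally show ?thesis .
    qed
    have s3: "\<bar>mehler_x a j \<theta> x y - mehler_x a j 1 x y\<bar> \<le> C1 * majorant a 2 \<theta> (x - y)"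
      using small[of \<theta> x y j] small[of 1 x y j] \<theta> unfolding maj[symmetric]
      by (intro order.trans[OF abs_triangle_ineq4] add_mono) auto
    have l: "\<bar>mehler a \<theta> x y - mehler a 1 x y\<bar> \<le> C2 * (1 - \<theta>) * exp (- (a / 32) * ((x - y) \<bullet> (x - y)))"
      "norm x * \<bar>mehler a \<theta> x y - mehler a 1 x y\<bar> \<le> C2 * (1 - \<theta>) * exp (- (a / 32) * ((x - y) \<bullet> (x - y)))"
      "\<bar>mehler_x a j \<theta> x y - mehler_x a j 1 x y\<bar> \<le> C2 * (1 - \<theta>) * exp (- (a / 32) * ((x - y) \<bullet> (x - y)))"
      if "1 / 2 \<le> \<theta>"
    proof -
      have D: "0 \<le> \<bar>mehler a \<theta> x y - mehler a 1 x y\<bar>" "0 \<le> norm x * \<bar>mehler a \<theta> x y - mehler a 1 x y\<bar>" by auto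
      from large[OF that \<theta>(2), of x y j]
      have e: "\<bar>mehler a \<theta> x y - mehler a 1 x y\<bar> + norm x * \<bar>mehler a \<theta> x y - mehler a 1 x y\<bar>
          \<le> C2 * (1 - \<theta>) * exp (- (a / 32) * ((x - y) \<bullet> (x - y)))"
        by (simp add: distrib_right)
      show "\<bar>mehler a \<theta> x y - mehler a 1 x y\<bar> \<le> C2 * (1 - \<theta>) * exp (- (a / 32) * ((x - y) \<bullet> (x - y)))"
        by (rule order.trans[OF _ e]) (use D in simp)
      show "norm x * \<bar>mehler a \<theta> x y - mehler a 1 x y\<bar> \<le> C2 * (1 - \<theta>) * exp (- (a / 32) * ((x - y) \<bullet> (x - y)))"
        by (rule order.trans[OF _ e]) (use D in simp)
      show "\<bar>mehler_x a j \<theta> x y - mehler_x a j 1 x y\<bar> \<le> C2 * (1 - \<theta>) * exp (- (a / 32) * ((x - y) \<bullet> (x - y)))"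
        using large[OF that \<theta>(2), of x y j] by blast
    qed
    have abs: "\<bar>?q * D\<bar> = ?q * \<bar>D\<bar>" for D by (simp only: abs_mult abs_of_pos[OF q])
    have "\<bar>resolvent_density a \<theta> x y\<bar> = ?q * \<bar>mehler a \<theta> x y - mehler a 1 x y\<bar>"
      "norm x * \<bar>resolvent_density a \<theta> x y\<bar> = ?q * (norm x * \<bar>mehler a \<theta> x y - mehler a 1 x y\<bar>)"
      "\<bar>resolvent_density_x a j \<theta> x y\<bar> = ?q * \<bar>mehler_x a j \<theta> x y - mehler_x a j 1 x y\<bar>"
      unfolding resolvent_density_def resolvent_density_x_def abs by (rule refl, rule mult.left_commute, rule refl)
    then show ?thesis
      using reduce[OF s1 large'[OF l(1)]] reduce[OF s2 large'[OF l(2)]] reduce[OF s3 large'[OF l(3)]] by presburger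
  qed
  moreover have "0 < ?C" using a C1 C2 by simp
  ultimately show ?thesis by blast
qed

section \<open>Integrals of the majorant over space and over \<theta>\<close>

lemma nn_integral_powr:
  assumes "-1 < p"
  shows "(\<integral>\<^sup>+\<theta>. indicator {0<..<1} \<theta> * ennreal (\<theta> powr p) \<partial>lborel) = ennreal (1 / (p + 1))"
proof -
  have "((\<lambda>x. x powr p) has_integral (1 powr (p + 1) / (p + 1))) {0..1}"
    by (rule has_integral_powr_from_0[OF assms]) simp
  then have "((\<lambda>x. if x \<in> {0..1} then x powr p else 0) has_integral (1 / (p + 1))) UNIV"
    by (subst has_integral_restrict_UNIV) simp
  then have "(\<integral>\<^sup>+x. ennreal (if x \<in> {0..1} then x powr p else 0) \<partial>lborel) = ennreal (1 / (p + 1))"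
    by (intro nn_integral_has_integral_lborel) auto
  also have "(\<integral>\<^sup>+x. ennreal (if x \<in> {0..1} then x powr p else 0) \<partial>lborel)
      = (\<integral>\<^sup>+\<theta>. indicator {0<..<1} \<theta> * ennreal (\<theta> powr p) \<partial>lborel)"
  proof (rule nn_integral_cong_AE)
    have "AE x in lborel. x \<noteq> (0::real)" "AE x in lborel. x \<noteq> (1::real)" by (rule AE_lborel_singleton)+
    then show "AE x in lborel. ennreal (if x \<in> {0..1} then x powr p else 0) = indicator {0<..<1} x * ennreal (x powr p)"
      by eventually_elim (auto simp: indicator_def)
  qed
  finally show ?thesis by simp
qed

definition majorant_mass :: "real \<Rightarrow> real \<Rightarrow> real ^ 3 \<Rightarrow> ennreal" where
  "majorant_mass a k z = (\<integral>\<^sup>+\<theta>. indicator {0<..<1} \<theta> * ennreal (majorant a k \<theta> z) \<partial>lborel)"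

lemma measurable_majorant [measurable]:
  assumes [measurable]: "f \<in> borel_measurable M" "g \<in> borel_measurable M"
  shows "(\<lambda>x. majorant a k (f x) (g x)) \<in> borel_measurable M"
  unfolding majorant_def by measurable

lemma measurable_majorant_mass [measurable]: "majorant_mass a k \<in> borel_measurable borel"
  unfolding majorant_mass_def[abs_def] by measurable

lemma sqrt_power3_powr: "0 < x \<Longrightarrow> sqrt x ^ 3 = x powr (3 / 2)"
  by (simp add: powr_half_sqrt[symmetric] powr_powr flip: powr_realpow)

lemma majorant_integral:
  assumes a: "0 < a" and \<theta>: "0 < \<theta>"
  shows "(\<integral>\<^sup>+z. ennreal (majorant a k \<theta> z) \<partial>lborel) = ennreal ((32 * pi / a) powr (3 / 2) * (\<theta> powr (3 / 2 - k) + 1))"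
proof -
  have c: "0 < a / 32 / \<theta>" "0 < a / 32" using a \<theta> by auto
  have "(\<integral>\<^sup>+z. ennreal (majorant a k \<theta> z) \<partial>lborel)
      = (\<integral>\<^sup>+z. ennreal (\<theta> powr (- k)) * ennreal (exp (- (a / 32 / \<theta>) * (norm z)\<^sup>2)) + ennreal (exp (- (a / 32) * (norm z)\<^sup>2)) \<partial>(lborel :: (real ^ 3) measure))"
    by (intro nn_integral_cong) (simp add: majorant_def power2_norm_eq_inner ennreal_mult)
  also have "\<dots> = ennreal (\<theta> powr (- k)) * ennreal (sqrt (pi / (a / 32 / \<theta>)) ^ 3) + ennreal (sqrt (pi / (a / 32)) ^ 3)"
    using gaussian_integral(3)[OF c(1)] gaussian_integral(3)[OF c(2)]
    by (subst nn_integral_add) (simp_all add: nn_integral_cmult)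
  also have "\<dots> = ennreal (\<theta> powr (- k) * sqrt (pi / (a / 32 / \<theta>)) ^ 3 + sqrt (pi / (a / 32)) ^ 3)"
    using a \<theta> by (simp add: ennreal_mult)
  also have "\<theta> powr (- k) * sqrt (pi / (a / 32 / \<theta>)) ^ 3 + sqrt (pi / (a / 32)) ^ 3
      = (32 * pi / a) powr (3 / 2) * (\<theta> powr (3 / 2 - k) + 1)"
  proof -
    have e: "pi / (a / 32 / \<theta>) = (32 * pi / a) * \<theta>" "pi / (a / 32) = 32 * pi / a" by simp_all
    have "sqrt (pi / (a / 32 / \<theta>)) ^ 3 = (32 * pi / a) powr (3 / 2) * \<theta> powr (3 / 2)"
      unfolding e using a \<theta>
      by (subst sqrt_power3_powr) (simp_all add: powr_mult del: times_divide_eq_left times_divide_eq_right)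
    moreover have "sqrt (pi / (a / 32)) ^ 3 = (32 * pi / a) powr (3 / 2)"
      unfolding e using a by (subst sqrt_power3_powr) simp_all
    moreover have "\<theta> powr (3 / 2 - k) = \<theta> powr (3 / 2) * \<theta> powr (- k)"
      by (simp flip: powr_add)
    ultimately show ?thesis by (simp add: algebra_simps)
  qed
  finally show ?thesis .
qed

text \<open>A Gaussian of variance of order \<theta> has integral of order \<theta> to the 3/2, so
  exponent 2 leaves the power -1/2, whose integral over the unit interval is 2. The fixed Gaussian
  adds 1, whence the factor 3. This mass is the constant in Schur's test.\<close>

lemma majorant_mass_integral:
  assumes a: "0 < a"
  shows "\<exists>A\<ge>0. (\<integral>\<^sup>+z. majorant_mass a 2 z \<partial>lborel) = ennreal A"
proof -
  let ?D = "(32 * pi / a) powr (3 / 2)"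
  have "(\<integral>\<^sup>+z. majorant_mass a 2 z \<partial>lborel)
      = (\<integral>\<^sup>+\<theta>. \<integral>\<^sup>+z. indicator {0<..<1} \<theta> * ennreal (majorant a 2 \<theta> z) \<partial>lborel \<partial>lborel)"
    unfolding majorant_mass_def by (rule lborel_pair.Fubini') measurable
  also have "\<dots> = (\<integral>\<^sup>+\<theta>. ennreal ?D * (indicator {0<..<1} \<theta> * ennreal (\<theta> powr (- (1 / 2))) + indicator {0<..<1} \<theta> * ennreal (\<theta> powr 0)) \<partial>lborel)"
    by (intro nn_integral_cong) (auto simp: nn_integral_cmult majorant_integral[OF a] indicator_def ennreal_mult)
  also have "\<dots> = ennreal ?D * (ennreal (1 / (- (1 / 2) + 1)) + ennreal (1 / (0 + 1)))"
    by (subst nn_integral_cmult, measurable, subst nn_integral_add, measurable, subst (1 2) nn_integral_powr) auto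
  also have "\<dots> = ennreal (?D * 3)"
    by (simp add: ennreal_mult flip: ennreal_plus)
  finally show ?thesis by (intro exI[of _ "?D * 3"]) auto
qed

lemma majorant_mass_mono:
  "majorant_mass a (3 / 2) z \<le> majorant_mass a 2 z"
  unfolding majorant_mass_def majorant_def
  by (intro nn_integral_mono)
     (auto simp: indicator_def intro!: ennreal_leI mult_right_mono powr_mono')

text \<open>By Cauchy-Schwarz: the L2 norm of the Gaussian is of order \<theta> to the 3/4, so of
  the singular power -3/2 only -3/4 is left.\<close>

lemma majorant_L2_pairing:
  assumes a: "0 < a" and \<theta>: "0 < \<theta>" and f: "f \<in> L2"
  shows "(\<integral>\<^sup>+y. ennreal (majorant a (3 / 2) \<theta> (x - y)) * ennreal (cmod (f y)) \<partial>lborel)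
    \<le> ennreal ((16 * pi / a) powr (3 / 4) * (\<theta> powr (- (3 / 4)) + 1) * L2_norm f)"
proof -
  note [measurable] = L2_measurable[OF f]
  have gauss: "(\<integral>\<^sup>+y. ennreal (exp (- (a / 32) * ((x - y) \<bullet> (x - y)) / \<tau>)) * ennreal (cmod (f y)) \<partial>lborel)
      \<le> ennreal ((16 * pi / a) powr (3 / 4) * \<tau> powr (3 / 4) * L2_norm f)" if \<tau>: "0 < \<tau>" for \<tau>
  proof (rule ennreal_power2_le_cancel)
    have c: "0 < a / 16 / \<tau>" using a \<tau> by simp
    have "(\<integral>\<^sup>+y. ennreal (exp (- (a / 32) * ((x - y) \<bullet> (x - y)) / \<tau>)) ^ 2 \<partial>lborel)
        = (\<integral>\<^sup>+y. ennreal (exp (- (a / 16 / \<tau>) * (norm (x - y))\<^sup>2)) \<partial>lborel)"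
      by (intro nn_integral_cong) (simp add: ennreal_power power2_norm_eq_inner flip: exp_of_nat_mult)
    also have "\<dots> = ennreal (sqrt (pi / (a / 16 / \<tau>)) ^ 3)"
      using nn_integral_reflect[of "\<lambda>z. ennreal (exp (- (a / 16 / \<tau>) * (norm z)\<^sup>2))" x] gaussian_integral(3)[OF c] by simp
    also have "sqrt (pi / (a / 16 / \<tau>)) ^ 3 = ((16 * pi / a) powr (3 / 4) * \<tau> powr (3 / 4))\<^sup>2"
    proof -
      have e: "pi / (a / 16 / \<tau>) = (16 * pi / a) * \<tau>" by simp
      have "((16 * pi / a) * \<tau>) powr (3 / 2) = (16 * pi / a) powr (3 / 2) * \<tau> powr (3 / 2)"
        using a \<tau> by (simp add: powr_mult del: times_divide_eq_left times_divide_eq_right)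
      moreover have "((16 * pi / a) powr (3 / 4) * \<tau> powr (3 / 4))\<^sup>2 = (16 * pi / a) powr (3 / 2) * \<tau> powr (3 / 2)"
      proof -
        have "(u powr (3 / 4))\<^sup>2 = u powr (3 / 2)" for u :: real by (simp add: power2_eq_square flip: powr_add)
        then show ?thesis by (simp only: power_mult_distrib)
      qed
      ultimately show ?thesis unfolding e using a \<tau>
        by (subst sqrt_power3_powr) (simp_all del: times_divide_eq_left times_divide_eq_right)
    qed
    finally have G: "(\<integral>\<^sup>+y. ennreal (exp (- (a / 32) * ((x - y) \<bullet> (x - y)) / \<tau>)) ^ 2 \<partial>lborel)
        = ennreal (((16 * pi / a) powr (3 / 4) * \<tau> powr (3 / 4))\<^sup>2)" .
    show "(\<integral>\<^sup>+y. ennreal (exp (- (a / 32) * ((x - y) \<bullet> (x - y)) / \<tau>)) * ennreal (cmod (f y)) \<partial>lborel)\<^sup>2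
        \<le> (ennreal ((16 * pi / a) powr (3 / 4) * \<tau> powr (3 / 4) * L2_norm f))\<^sup>2"
      using nn_integral_Cauchy_Schwarz[of "\<lambda>y. ennreal (exp (- (a / 32) * ((x - y) \<bullet> (x - y)) / \<tau>))" lborel "\<lambda>y. ennreal (cmod (f y))"]
      unfolding G nn_integral_L2[OF f] by (simp add: ennreal_power ennreal_mult power_mult_distrib)
  qed simp
  have "(\<integral>\<^sup>+y. ennreal (majorant a (3 / 2) \<theta> (x - y)) * ennreal (cmod (f y)) \<partial>lborel)
      = (\<integral>\<^sup>+y. ennreal (\<theta> powr (- (3 / 2))) * (ennreal (exp (- (a / 32) * ((x - y) \<bullet> (x - y)) / \<theta>)) * ennreal (cmod (f y)))
          + ennreal (exp (- (a / 32) * ((x - y) \<bullet> (x - y)) / 1)) * ennreal (cmod (f y)) \<partial>lborel)"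
    by (intro nn_integral_cong) (simp add: majorant_def ennreal_mult distrib_right mult.assoc)
  also have "\<dots> = ennreal (\<theta> powr (- (3 / 2))) * (\<integral>\<^sup>+y. ennreal (exp (- (a / 32) * ((x - y) \<bullet> (x - y)) / \<theta>)) * ennreal (cmod (f y)) \<partial>lborel)
      + (\<integral>\<^sup>+y. ennreal (exp (- (a / 32) * ((x - y) \<bullet> (x - y)) / 1)) * ennreal (cmod (f y)) \<partial>lborel)"
    by (subst nn_integral_add) (simp_all add: nn_integral_cmult)
  also have "\<dots> \<le> ennreal (\<theta> powr (- (3 / 2))) * ennreal ((16 * pi / a) powr (3 / 4) * \<theta> powr (3 / 4) * L2_norm f)
      + ennreal ((16 * pi / a) powr (3 / 4) * 1 powr (3 / 4) * L2_norm f)"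
    by (intro add_mono mult_left_mono gauss \<theta>) auto
  also have "\<dots> = ennreal (\<theta> powr (- (3 / 2)) * ((16 * pi / a) powr (3 / 4) * \<theta> powr (3 / 4) * L2_norm f)
      + (16 * pi / a) powr (3 / 4) * L2_norm f)"
    by (simp add: ennreal_mult ennreal_plus)
  also have "\<theta> powr (- (3 / 2)) * ((16 * pi / a) powr (3 / 4) * \<theta> powr (3 / 4) * L2_norm f) + (16 * pi / a) powr (3 / 4) * L2_norm f
      = (16 * pi / a) powr (3 / 4) * (\<theta> powr (- (3 / 4)) + 1) * L2_norm f"
  proof -
    have "\<theta> powr (- (3 / 2)) * \<theta> powr (3 / 4) = \<theta> powr (- (3 / 4))" by (simp flip: powr_add)
    then show ?thesis by (simp add: algebra_simps)
  qed
  finally show ?thesis .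
qed

text \<open>The power -3/4 is integrable on the unit interval, with integral 4, and the fixed
  Gaussian adds 1. This is the point where the dimension matters: in dimension d the power would be
  -d/4. It corresponds to the local square integrability of \<open>1 / norm x\<close> in three
  dimensions.\<close>

lemma majorant_mass_L2_pairing:
  assumes a: "0 < a"
  shows "\<exists>B\<ge>0. \<forall>f\<in>L2. \<forall>x. (\<integral>\<^sup>+y. majorant_mass a (3 / 2) (x - y) * ennreal (cmod (f y)) \<partial>lborel) \<le> ennreal (B * L2_norm f)"
proof -
  let ?D = "(16 * pi / a) powr (3 / 4)"
  have "(\<integral>\<^sup>+y. majorant_mass a (3 / 2) (x - y) * ennreal (cmod (f y)) \<partial>lborel) \<le> ennreal (?D * 5 * L2_norm f)"
    if f: "f \<in> L2" for f x
  proof -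
    note [measurable] = L2_measurable[OF f]
    have "(\<integral>\<^sup>+y. majorant_mass a (3 / 2) (x - y) * ennreal (cmod (f y)) \<partial>lborel)
        = (\<integral>\<^sup>+y. \<integral>\<^sup>+\<theta>. indicator {0<..<1} \<theta> * (ennreal (majorant a (3 / 2) \<theta> (x - y)) * ennreal (cmod (f y))) \<partial>lborel \<partial>lborel)"
      unfolding majorant_mass_def by (intro nn_integral_cong) (simp add: mult.assoc flip: nn_integral_multc)
    also have "\<dots> = (\<integral>\<^sup>+\<theta>. \<integral>\<^sup>+y. indicator {0<..<1} \<theta> * (ennreal (majorant a (3 / 2) \<theta> (x - y)) * ennreal (cmod (f y))) \<partial>lborel \<partial>lborel)"
      by (rule lborel_pair.Fubini') measurable
    also have "\<dots> \<le> (\<integral>\<^sup>+\<theta>. ennreal (?D * L2_norm f) * (indicator {0<..<1} \<theta> * ennreal (\<theta> powr (- (3 / 4))) + indicator {0<..<1} \<theta> * ennreal (\<theta> powr 0)) \<partial>lborel)"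
    proof (intro nn_integral_mono)
      fix \<theta> :: real
      show "(\<integral>\<^sup>+y. indicator {0<..<1} \<theta> * (ennreal (majorant a (3 / 2) \<theta> (x - y)) * ennreal (cmod (f y))) \<partial>lborel)
          \<le> ennreal (?D * L2_norm f) * (indicator {0<..<1} \<theta> * ennreal (\<theta> powr (- (3 / 4))) + indicator {0<..<1} \<theta> * ennreal (\<theta> powr 0))"
      proof (cases "0 < \<theta> \<and> \<theta> < 1")
        case True
        have "(\<integral>\<^sup>+y. ennreal (majorant a (3 / 2) \<theta> (x - y)) * ennreal (cmod (f y)) \<partial>lborel)
            \<le> ennreal (?D * (\<theta> powr (- (3 / 4)) + 1) * L2_norm f)"
          using True by (intro majorant_L2_pairing a f) auto
        also have "?D * (\<theta> powr (- (3 / 4)) + 1) * L2_norm f = (?D * L2_norm f) * (\<theta> powr (- (3 / 4)) + 1)" by simp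
        finally show ?thesis using True by (simp add: ennreal_mult)
      qed simp
    qed
    also have "\<dots> = ennreal (?D * L2_norm f) * (ennreal (1 / (- (3 / 4) + 1)) + ennreal (1 / (0 + 1)))"
      by (subst nn_integral_cmult, measurable, subst nn_integral_add, measurable, subst (1 2) nn_integral_powr) auto
    also have "\<dots> = ennreal (?D * 5 * L2_norm f)"
      by (simp add: ennreal_mult mult_ac flip: ennreal_plus)
    finally show ?thesis .
  qed
  then show ?thesis by (intro exI[of _ "?D * 5"]) auto
qed

subsection \<open>Integral operators\<close>

definition kernel_op :: "(real ^ 3 \<Rightarrow> real ^ 3 \<Rightarrow> real) \<Rightarrow> field3 \<Rightarrow> field3" where
  "kernel_op K f x = (LINT y|lborel. complex_of_real (K x y) * f y)"

text \<open>For a function that is not integrable the left-hand side is 0 by convention, so the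
  estimate can be applied before integrability is settled.\<close>

lemma norm_integral_le_nn_integral:
  fixes g :: "'a \<Rightarrow> 'b::{banach, second_countable_topology}"
  shows "ennreal (norm (integral\<^sup>L M g)) \<le> (\<integral>\<^sup>+x. ennreal (norm (g x)) \<partial>M)"
  by (cases "integrable M g") (auto simp: integral_norm_bound_ennreal not_integrable_integral_eq)

lemma kernel_op_le:
  assumes W: "\<And>y. ennreal \<bar>K x y\<bar> \<le> W (x - y)"
  shows "ennreal (cmod (kernel_op K f x)) \<le> (\<integral>\<^sup>+y. W (x - y) * ennreal (cmod (f y)) \<partial>lborel)"
  unfolding kernel_op_def
  by (rule order.trans[OF norm_integral_le_nn_integral], rule nn_integral_mono)
     (simp add: norm_mult ennreal_mult mult_right_mono[OF W])

text \<open>A kernel dominated by a convolution kernel inherits its Schur bound. The Mehler kernel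
  is not translation invariant, but its majorant is.\<close>

lemma kernel_op_L2:
  assumes [measurable]: "case_prod K \<in> borel_measurable (lborel \<Otimes>\<^sub>M lborel)" "W \<in> borel_measurable borel"
    and W: "\<And>x y. ennreal \<bar>K x y\<bar> \<le> W (x - y)" and A: "(\<integral>\<^sup>+z. W z \<partial>lborel) \<le> ennreal A" "0 \<le> A" and f: "f \<in> L2"
  shows "kernel_op K f \<in> L2" "L2_norm (kernel_op K f) \<le> A * L2_norm f"
proof -
  note [measurable] = L2_measurable[OF f]
  have m: "kernel_op K f \<in> borel_measurable borel" unfolding kernel_op_def[abs_def] by measurable
  have "(\<integral>\<^sup>+x. ennreal (cmod (kernel_op K f x)) ^ 2 \<partial>lborel)
      \<le> (\<integral>\<^sup>+x. (\<integral>\<^sup>+y. W (x - y) * ennreal (cmod (f y)) \<partial>lborel)\<^sup>2 \<partial>lborel)"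
    by (intro nn_integral_mono power_mono kernel_op_le W) auto
  also have "\<dots> \<le> (\<integral>\<^sup>+z. W z \<partial>lborel)\<^sup>2 * (\<integral>\<^sup>+y. ennreal (cmod (f y)) ^ 2 \<partial>lborel)"
    by (rule Schur_test) measurable
  also have "\<dots> \<le> (ennreal A)\<^sup>2 * ennreal (L2_norm f) ^ 2"
    unfolding nn_integral_L2[OF f] by (intro mult_right_mono power_mono A) auto
  also have "\<dots> = ennreal (A * L2_norm f) ^ 2" using A by (simp add: ennreal_mult power_mult_distrib)
  finally show "kernel_op K f \<in> L2" "L2_norm (kernel_op K f) \<le> A * L2_norm f"
    using A by (auto intro!: L2_boundI[OF m, of "A * L2_norm f"])
qed

text \<open>The transposition formula through which derivatives of, and equations for, an integral
  operator are reduced to those of its kernel at fixed \<open>y\<close>. Absolute convergence comes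
  from Schur's test.\<close>

lemma kernel_op_integral_mult:
  assumes [measurable]: "case_prod K \<in> borel_measurable (lborel \<Otimes>\<^sub>M lborel)" "W \<in> borel_measurable borel"
    and W: "\<And>x y. ennreal \<bar>K x y\<bar> \<le> W (x - y)" and A: "(\<integral>\<^sup>+z. W z \<partial>lborel) \<le> ennreal A"
    and f: "f \<in> L2" and g: "g \<in> L2"
  shows "(LINT x|lborel. kernel_op K f x * g x) = (LINT y|lborel. f y * (LINT x|lborel. complex_of_real (K x y) * g x))"
proof -
  note [measurable] = L2_measurable[OF f] L2_measurable[OF g]
  let ?F = "\<lambda>x y. complex_of_real (K x y) * f y * g x"
  have "(\<integral>\<^sup>+x. \<integral>\<^sup>+y. ennreal (cmod (?F x y)) \<partial>lborel \<partial>lborel)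
      \<le> (\<integral>\<^sup>+x. (\<integral>\<^sup>+y. W (x - y) * ennreal (cmod (f y)) \<partial>lborel) * ennreal (cmod (g x)) \<partial>lborel)"
  proof (intro nn_integral_mono)
    fix x
    have "(\<integral>\<^sup>+y. ennreal (cmod (?F x y)) \<partial>lborel) \<le> (\<integral>\<^sup>+y. W (x - y) * ennreal (cmod (f y)) * ennreal (cmod (g x)) \<partial>lborel)"
      by (intro nn_integral_mono) (simp add: norm_mult ennreal_mult mult_right_mono W)
    then show "(\<integral>\<^sup>+y. ennreal (cmod (?F x y)) \<partial>lborel) \<le> (\<integral>\<^sup>+y. W (x - y) * ennreal (cmod (f y)) \<partial>lborel) * ennreal (cmod (g x))"
      by (simp add: nn_integral_multc)
  qed
  also have "\<dots> < \<infinity>"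
  proof -
    let ?I = "\<integral>\<^sup>+x. (\<integral>\<^sup>+y. W (x - y) * ennreal (cmod (f y)) \<partial>lborel) * ennreal (cmod (g x)) \<partial>lborel"
    have "?I\<^sup>2 \<le> (\<integral>\<^sup>+x. (\<integral>\<^sup>+y. W (x - y) * ennreal (cmod (f y)) \<partial>lborel)\<^sup>2 \<partial>lborel) * (\<integral>\<^sup>+x. ennreal (cmod (g x)) ^ 2 \<partial>lborel)"
      by (rule nn_integral_Cauchy_Schwarz) measurable
    also have "\<dots> \<le> ((\<integral>\<^sup>+z. W z \<partial>lborel)\<^sup>2 * (\<integral>\<^sup>+y. ennreal (cmod (f y)) ^ 2 \<partial>lborel)) * (\<integral>\<^sup>+x. ennreal (cmod (g x)) ^ 2 \<partial>lborel)"
      by (intro mult_right_mono Schur_test) auto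
    also have "\<dots> < \<infinity>"
      unfolding nn_integral_L2[OF f] nn_integral_L2[OF g] using le_less_trans[OF A ennreal_less_top]
      by (simp add: ennreal_mult_less_top ennreal_power power_less_top_ennreal)
    finally show ?thesis by (simp add: power_less_top_ennreal)
  qed
  finally have fin: "(\<integral>\<^sup>+x. \<integral>\<^sup>+y. ennreal (cmod (?F x y)) \<partial>lborel \<partial>lborel) < \<infinity>" .
  have "(LINT x|lborel. (LINT y|lborel. ?F x y)) = (LINT y|lborel. (LINT x|lborel. ?F x y))"
    by (rule Fubini_swap(1)[OF _ fin]) measurable
  moreover have "(LINT x|lborel. kernel_op K f x * g x) = (LINT x|lborel. (LINT y|lborel. ?F x y))"
    by (simp add: kernel_op_def)
  moreover have "(LINT x|lborel. ?F x y) = f y * (LINT x|lborel. complex_of_real (K x y) * g x)" for y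
    by (subst integral_mult_right_zero[symmetric]) (simp add: mult_ac)
  ultimately show ?thesis by simp
qed

subsection \<open>The reduced resolvent of the harmonic oscillator\<close>

text \<open>Kept generic in the integrand, so that the resolvent kernel, its weighted version and
  its derivative share the lemmas on domination and exchange of integrals.\<close>

definition theta_integral :: "(real \<Rightarrow> real ^ 3 \<Rightarrow> real ^ 3 \<Rightarrow> real) \<Rightarrow> real ^ 3 \<Rightarrow> real ^ 3 \<Rightarrow> real" where
  "theta_integral D x y = (LINT \<theta>|lborel. indicator {0<..<1} \<theta> * D \<theta> x y)"

definition resolvent_kernel :: "real \<Rightarrow> real ^ 3 \<Rightarrow> real ^ 3 \<Rightarrow> real" where
  "resolvent_kernel a = theta_integral (resolvent_density a)"

definition resolvent_kernel_x :: "real \<Rightarrow> 3 \<Rightarrow> real ^ 3 \<Rightarrow> real ^ 3 \<Rightarrow> real" where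
  "resolvent_kernel_x a j = theta_integral (resolvent_density_x a j)"

lemma measurable_mehler [measurable]:
  assumes [measurable]: "t \<in> borel_measurable M" "f \<in> borel_measurable M" "g \<in> borel_measurable M"
  shows "(\<lambda>p. mehler a (t p) (f p) (g p)) \<in> borel_measurable M"
  unfolding mehler_def by measurable

lemma measurable_mehler_x [measurable]:
  assumes [measurable]: "t \<in> borel_measurable M" "f \<in> borel_measurable M" "g \<in> borel_measurable M"
  shows "(\<lambda>p. mehler_x a j (t p) (f p) (g p)) \<in> borel_measurable M"
  unfolding mehler_x_def mehler_slope_def inner_axis_one[symmetric] by measurable

lemma measurable_resolvent_density [measurable]:
  assumes [measurable]: "t \<in> borel_measurable M" "f \<in> borel_measurable M" "g \<in> borel_measurable M"
  shows "(\<lambda>p. resolvent_density a (t p) (f p) (g p)) \<in> borel_measurable M"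
    "(\<lambda>p. resolvent_density_x a j (t p) (f p) (g p)) \<in> borel_measurable M"
  unfolding resolvent_density_def resolvent_density_x_def by measurable

lemma measurable_resolvent_kernel [measurable]:
  assumes [measurable]: "f \<in> borel_measurable M" "g \<in> borel_measurable M"
  shows "(\<lambda>p. resolvent_kernel a (f p) (g p)) \<in> borel_measurable M"
    "(\<lambda>p. resolvent_kernel_x a j (f p) (g p)) \<in> borel_measurable M"
  unfolding resolvent_kernel_def resolvent_kernel_x_def theta_integral_def by measurable

lemma theta_integral_le:
  assumes "\<And>\<theta>. 0 < \<theta> \<Longrightarrow> \<theta> < 1 \<Longrightarrow> \<bar>D \<theta> x y\<bar> \<le> C * majorant a k \<theta> (x - y)" and C: "0 \<le> C"
  shows "(\<integral>\<^sup>+\<theta>. ennreal \<bar>indicator {0<..<1} \<theta> * D \<theta> x y\<bar> \<partial>lborel) \<le> ennreal C * majorant_mass a k (x - y)"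
    and "ennreal \<bar>theta_integral D x y\<bar> \<le> ennreal C * majorant_mass a k (x - y)"
proof -
  have "(\<integral>\<^sup>+\<theta>. ennreal \<bar>indicator {0<..<1} \<theta> * D \<theta> x y\<bar> \<partial>lborel)
      \<le> (\<integral>\<^sup>+\<theta>. ennreal C * (indicator {0<..<1} \<theta> * ennreal (majorant a k \<theta> (x - y))) \<partial>lborel)"
    using assms by (intro nn_integral_mono)
      (auto simp: indicator_def ennreal_mult[symmetric] majorant_nonneg intro!: ennreal_leI)
  also have "\<dots> = ennreal C * majorant_mass a k (x - y)"
    unfolding majorant_mass_def by (rule nn_integral_cmult) measurable
  finally show *: "(\<integral>\<^sup>+\<theta>. ennreal \<bar>indicator {0<..<1} \<theta> * D \<theta> x y\<bar> \<partial>lborel) \<le> ennreal C * majorant_mass a k (x - y)" .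
  show "ennreal \<bar>theta_integral D x y\<bar> \<le> ennreal C * majorant_mass a k (x - y)"
    using order.trans[OF norm_integral_le_nn_integral[of lborel "\<lambda>\<theta>. indicator {0<..<1} \<theta> * D \<theta> x y"]] *
    by (simp add: theta_integral_def)
qed

text \<open>Integrability of the inner integrals in \<theta> is recorded as well, because the
  integral over the unit interval is later approached from cut-off intervals.\<close>

lemma theta_integral_swap:
  assumes D: "\<And>\<theta> x. 0 < \<theta> \<Longrightarrow> \<theta> < 1 \<Longrightarrow> \<bar>D \<theta> x y\<bar> \<le> C * majorant a k \<theta> (x - y)" and C: "0 \<le> C"
    and [measurable]: "(\<lambda>(x, \<theta>). D \<theta> x y) \<in> borel_measurable (lborel \<Otimes>\<^sub>M lborel)" "g \<in> borel_measurable borel"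
    and fin: "(\<integral>\<^sup>+x. majorant_mass a k (x - y) * ennreal (cmod (g x)) \<partial>lborel) < \<infinity>"
  shows "(LINT x|lborel. complex_of_real (theta_integral D x y) * g x)
      = (LINT \<theta>|lborel. complex_of_real (indicator {0<..<1} \<theta>) * (LINT x|lborel. complex_of_real (D \<theta> x y) * g x))"
    and "integrable lborel (\<lambda>\<theta>. complex_of_real (indicator {0<..<1} \<theta>) * (LINT x|lborel. complex_of_real (D \<theta> x y) * g x))"
proof -
  let ?F = "\<lambda>x \<theta>. complex_of_real (indicator {0<..<1} \<theta> * D \<theta> x y) * g x"
  have "(\<integral>\<^sup>+x. \<integral>\<^sup>+\<theta>. ennreal (cmod (?F x \<theta>)) \<partial>lborel \<partial>lborel)
      \<le> (\<integral>\<^sup>+x. ennreal C * (majorant_mass a k (x - y) * ennreal (cmod (g x))) \<partial>lborel)"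
  proof (intro nn_integral_mono)
    fix x
    have "(\<integral>\<^sup>+\<theta>. ennreal (cmod (?F x \<theta>)) \<partial>lborel) = (\<integral>\<^sup>+\<theta>. ennreal \<bar>indicator {0<..<1} \<theta> * D \<theta> x y\<bar> * ennreal (cmod (g x)) \<partial>lborel)"
      by (intro nn_integral_cong) (simp add: norm_mult ennreal_mult abs_mult)
    also have "\<dots> = (\<integral>\<^sup>+\<theta>. ennreal \<bar>indicator {0<..<1} \<theta> * D \<theta> x y\<bar> \<partial>lborel) * ennreal (cmod (g x))"
      by (rule nn_integral_multc) measurable
    also have "\<dots> \<le> (ennreal C * majorant_mass a k (x - y)) * ennreal (cmod (g x))"
      by (intro mult_right_mono theta_integral_le D C) auto
    finally show "(\<integral>\<^sup>+\<theta>. ennreal (cmod (?F x \<theta>)) \<partial>lborel) \<le> ennreal C * (majorant_mass a k (x - y) * ennreal (cmod (g x)))"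
      by (simp add: mult.assoc)
  qed
  also have "\<dots> < \<infinity>" using fin by (simp add: nn_integral_cmult ennreal_mult_less_top)
  finally have fin': "(\<integral>\<^sup>+x. \<integral>\<^sup>+\<theta>. ennreal (cmod (?F x \<theta>)) \<partial>lborel \<partial>lborel) < \<infinity>" .
  have m: "case_prod ?F \<in> borel_measurable (lborel \<Otimes>\<^sub>M lborel)" by measurable
  have 1: "(LINT \<theta>|lborel. ?F x \<theta>) = complex_of_real (theta_integral D x y) * g x" for x
    unfolding theta_integral_def by (simp only: integral_mult_left_zero integral_complex_of_real)
  have 2: "(LINT x|lborel. ?F x \<theta>) = complex_of_real (indicator {0<..<1} \<theta>) * (LINT x|lborel. complex_of_real (D \<theta> x y) * g x)" for \<theta>
    by (simp only: of_real_mult mult.assoc integral_mult_right_zero)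
  show "(LINT x|lborel. complex_of_real (theta_integral D x y) * g x)
      = (LINT \<theta>|lborel. complex_of_real (indicator {0<..<1} \<theta>) * (LINT x|lborel. complex_of_real (D \<theta> x y) * g x))"
    using Fubini_swap(1)[OF m fin'] unfolding 1 2 .
  show "integrable lborel (\<lambda>\<theta>. complex_of_real (indicator {0<..<1} \<theta>) * (LINT x|lborel. complex_of_real (D \<theta> x y) * g x))"
    using Fubini_swap(3)[OF m fin'] unfolding 2 .
qed

lemma majorant_minus: "majorant a k \<theta> (x - y) = majorant a k \<theta> (y - x)"
  by (simp add: majorant_def inner_diff inner_commute algebra_simps)

lemma majorant_mass_minus: "majorant_mass a k (x - y) = majorant_mass a k (y - x)"
  by (simp add: majorant_mass_def majorant_minus[of a k _ x y])

definition resolvent :: "real \<Rightarrow> field3 \<Rightarrow> field3" where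
  "resolvent a = kernel_op (resolvent_kernel a)"

definition resolvent_x :: "real \<Rightarrow> 3 \<Rightarrow> field3 \<Rightarrow> field3" where
  "resolvent_x a j = kernel_op (resolvent_kernel_x a j)"

text \<open>The kernel, the kernel weighted by \<open>norm x\<close> and the derivative kernel are
  all dominated by the mass with exponent 2, the first one through monotonicity of the mass in the
  exponent. A single Schur constant therefore serves all of them.\<close>

lemma resolvent_L2_bounds:
  assumes a: "0 < a"
  shows "\<exists>A\<ge>0. \<forall>f\<in>L2. \<forall>j. resolvent a f \<in> L2 \<and> L2_norm (resolvent a f) \<le> A * L2_norm f \<and>
    (\<lambda>x. complex_of_real (norm x) * resolvent a f x) \<in> L2 \<and> L2_norm (\<lambda>x. complex_of_real (norm x) * resolvent a f x) \<le> A * L2_norm f \<and>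
    resolvent_x a j f \<in> L2 \<and> L2_norm (resolvent_x a j f) \<le> A * L2_norm f \<and>
    (\<forall>g\<in>L2. (LINT x|lborel. resolvent a f x * g x) = (LINT y|lborel. f y * (LINT x|lborel. complex_of_real (resolvent_kernel a x y) * g x))) \<and>
    (\<forall>g\<in>L2. (LINT x|lborel. resolvent_x a j f x * g x) = (LINT y|lborel. f y * (LINT x|lborel. complex_of_real (resolvent_kernel_x a j x y) * g x)))"
proof -
  obtain C where C: "0 < C" and bd: "\<And>\<theta> x y j. 0 < \<theta> \<Longrightarrow> \<theta> < 1 \<Longrightarrow>
      \<bar>resolvent_density a \<theta> x y\<bar> \<le> C * majorant a (3 / 2) \<theta> (x - y) \<and>
      norm x * \<bar>resolvent_density a \<theta> x y\<bar> \<le> C * majorant a 2 \<theta> (x - y) \<and>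
      \<bar>resolvent_density_x a j \<theta> x y\<bar> \<le> C * majorant a 2 \<theta> (x - y)"
    using resolvent_density_bounds[OF a] by metis
  obtain A where A: "0 \<le> A" "(\<integral>\<^sup>+z. majorant_mass a 2 z \<partial>lborel) = ennreal A"
    using majorant_mass_integral[OF a] by auto
  let ?W = "\<lambda>z. ennreal C * majorant_mass a 2 z"
  have Wm: "?W \<in> borel_measurable borel" by measurable
  have WA: "(\<integral>\<^sup>+z. ?W z \<partial>lborel) \<le> ennreal (C * A)"
    using A C by (simp add: nn_integral_cmult ennreal_mult)
  have CA: "0 \<le> C * A" using A C by simp
  have K1: "ennreal \<bar>resolvent_kernel a x y\<bar> \<le> ?W (x - y)" for x y
  proof -
    have "ennreal \<bar>resolvent_kernel a x y\<bar> \<le> ennreal C * majorant_mass a (3 / 2) (x - y)"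
      unfolding resolvent_kernel_def using bd C by (intro theta_integral_le) auto
    also have "\<dots> \<le> ?W (x - y)" by (intro mult_left_mono majorant_mass_mono) auto
    finally show ?thesis .
  qed
  have K2: "ennreal \<bar>norm x * resolvent_kernel a x y\<bar> \<le> ?W (x - y)" for x y
  proof -
    have "norm x * resolvent_kernel a x y = theta_integral (\<lambda>\<theta> x y. norm x * resolvent_density a \<theta> x y) x y"
      unfolding resolvent_kernel_def theta_integral_def
      by (subst integral_mult_right_zero[symmetric]) (simp add: mult_ac)
    moreover have "ennreal \<bar>theta_integral (\<lambda>\<theta> x y. norm x * resolvent_density a \<theta> x y) x y\<bar> \<le> ?W (x - y)"
      using bd C by (intro theta_integral_le) (auto simp: abs_mult)
    ultimately show ?thesis by simp
  qed
  have K3: "ennreal \<bar>resolvent_kernel_x a j x y\<bar> \<le> ?W (x - y)" for j x y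
    unfolding resolvent_kernel_x_def using bd C by (intro theta_integral_le) auto
  have m: "case_prod (resolvent_kernel a) \<in> borel_measurable (lborel \<Otimes>\<^sub>M lborel)"
    "case_prod (\<lambda>x y. norm x * resolvent_kernel a x y) \<in> borel_measurable (lborel \<Otimes>\<^sub>M lborel)"
    "case_prod (resolvent_kernel_x a j) \<in> borel_measurable (lborel \<Otimes>\<^sub>M lborel)" for j
    by measurable
  have xR: "(\<lambda>x. complex_of_real (norm x) * resolvent a f x) = kernel_op (\<lambda>x y. norm x * resolvent_kernel a x y) f" for f
    unfolding resolvent_def kernel_op_def by (intro ext, subst integral_mult_right_zero[symmetric]) (simp add: mult_ac)
  show ?thesis
    unfolding xR unfolding resolvent_def resolvent_x_def
    by (intro exI[of _ "C * A"] conjI ballI allI CA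
        kernel_op_L2[OF m(1) Wm K1 WA CA] kernel_op_L2[OF m(2) Wm K2 WA CA] kernel_op_L2[OF m(3) Wm K3 WA CA]
        kernel_op_integral_mult[OF m(1) Wm K1 WA] kernel_op_integral_mult[OF m(3) Wm K3 WA])
qed

text \<open>Here the better exponent \<open>3 / 2\<close> of the unweighted kernel is decisive,
  since exponent 2 would leave the non-integrable power -5/4. The defining integral converges at
  every point, which makes the operator linear pointwise and not just almost everywhere.\<close>

lemma resolvent_sup_bound:
  assumes a: "0 < a"
  shows "\<exists>B\<ge>0. \<forall>f\<in>L2. \<forall>x. integrable lborel (\<lambda>y. complex_of_real (resolvent_kernel a x y) * f y) \<and> cmod (resolvent a f x) \<le> B * L2_norm f"
proof -
  obtain C where C: "0 < C" and bd: "\<And>\<theta> x y. 0 < \<theta> \<Longrightarrow> \<theta> < 1 \<Longrightarrow>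
      \<bar>resolvent_density a \<theta> x y\<bar> \<le> C * majorant a (3 / 2) \<theta> (x - y)"
    using resolvent_density_bounds[OF a] by metis
  obtain B where B: "0 \<le> B" and pair: "\<And>f x. f \<in> L2 \<Longrightarrow>
      (\<integral>\<^sup>+y. majorant_mass a (3 / 2) (x - y) * ennreal (cmod (f y)) \<partial>lborel) \<le> ennreal (B * L2_norm f)"
    using majorant_mass_L2_pairing[OF a] by blast
  have "integrable lborel (\<lambda>y. complex_of_real (resolvent_kernel a x y) * f y) \<and> cmod (resolvent a f x) \<le> C * B * L2_norm f"
    if f: "f \<in> L2" for f x
  proof -
    note [measurable] = L2_measurable[OF f]
    have K: "ennreal \<bar>resolvent_kernel a x y\<bar> \<le> ennreal C * majorant_mass a (3 / 2) (x - y)" for y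
      unfolding resolvent_kernel_def using bd C by (intro theta_integral_le) auto
    have I: "(\<integral>\<^sup>+y. ennreal C * majorant_mass a (3 / 2) (x - y) * ennreal (cmod (f y)) \<partial>lborel) \<le> ennreal (C * B * L2_norm f)"
    proof -
      have "(\<integral>\<^sup>+y. ennreal C * majorant_mass a (3 / 2) (x - y) * ennreal (cmod (f y)) \<partial>lborel)
          = ennreal C * (\<integral>\<^sup>+y. majorant_mass a (3 / 2) (x - y) * ennreal (cmod (f y)) \<partial>lborel)"
        unfolding mult.assoc by (rule nn_integral_cmult) measurable
      also have "\<dots> \<le> ennreal C * ennreal (B * L2_norm f)" by (intro mult_left_mono pair f) auto
      finally show ?thesis using C B by (simp add: ennreal_mult mult.assoc)
    qed
    have "(\<integral>\<^sup>+y. ennreal (cmod (complex_of_real (resolvent_kernel a x y) * f y)) \<partial>lborel)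
        \<le> (\<integral>\<^sup>+y. ennreal C * majorant_mass a (3 / 2) (x - y) * ennreal (cmod (f y)) \<partial>lborel)"
      by (intro nn_integral_mono) (simp add: norm_mult ennreal_mult mult_right_mono K)
    also note I
    also have "ennreal (C * B * L2_norm f) < \<infinity>" by simp
    finally have "integrable lborel (\<lambda>y. complex_of_real (resolvent_kernel a x y) * f y)"
      by (intro integrableI_bounded) auto
    moreover have "ennreal (cmod (resolvent a f x)) \<le> ennreal (C * B * L2_norm f)"
      unfolding resolvent_def by (rule order.trans[OF kernel_op_le[where x = x and K = "resolvent_kernel a" and W = "\<lambda>z. ennreal C * majorant_mass a (3 / 2) z", OF K] I])
    moreover have "0 \<le> C * B * L2_norm f" using C B by simp
    ultimately show ?thesis by simp
  qed
  then show ?thesis using C B by (intro exI[of _ "C * B"]) auto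
qed

lemma L2_continuous_bounded_support:
  fixes F :: field3
  assumes F: "continuous_on UNIV F" and supp: "\<And>x. \<rho> < norm x \<Longrightarrow> F x = 0"
  shows "F \<in> L2"
proof -
  have "integrable lborel (\<lambda>x. complex_of_real ((cmod (F x))\<^sup>2))"
    by (rule integrable_continuous_bounded_support[of _ \<rho>]) (use supp in \<open>auto intro!: continuous_intros F\<close>)
  then show ?thesis
    using borel_measurable_continuous_onI[OF F] by (simp only: L2_def complex_of_real_integrable_eq) simp
qed

lemma osc_operator_L2:
  assumes \<phi>: "\<phi> \<in> test_functions"
  shows "osc_operator a \<phi> \<in> L2"
proof -
  obtain \<rho> where \<rho>: "\<And>x. \<rho> < norm x \<Longrightarrow> \<phi> x = 0" by (rule test_bounded_support[OF \<phi>]) blast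
  have "\<rho> < norm x \<Longrightarrow> osc_operator a \<phi> x = 0" for x
    using partial_eq_0_outside[of \<rho> "partial j \<phi>" for j, OF partial_eq_0_outside[OF \<rho>]] \<rho>
    by (simp add: osc_operator_def laplacian_def)
  then show ?thesis by (rule L2_continuous_bounded_support[OF continuous_osc_operator[OF \<phi>]])
qed

text \<open>The constant is \<open>(a / pi) powr (3 / 4)\<close> written with roots; its square is
  the constant in front of the Mehler kernel at \<theta> = 1.\<close>

definition ground_state :: "real \<Rightarrow> real ^ 3 \<Rightarrow> real" where
  "ground_state a x = sqrt (sqrt (a / pi) ^ 3) * exp (- (a / 2) * (x \<bullet> x))"

text \<open>The parallelogram law separates the variables in the exponent, so the limit kernel is
  the rank one projection onto the ground state.\<close>

lemma mehler_one:
  assumes "0 < a"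
  shows "mehler a 1 x y = ground_state a x * ground_state a y"
proof -
  have "(x + y) \<bullet> (x + y) + (x - y) \<bullet> (x - y) / 1 = 2 * (x \<bullet> x) + 2 * (y \<bullet> y)"
    by (simp add: inner_add inner_diff inner_commute)
  then have "- (a / 4) * (1 * ((x + y) \<bullet> (x + y)) + (x - y) \<bullet> (x - y) / 1) = - (a / 2) * (x \<bullet> x) + - (a / 2) * (y \<bullet> y)"
    by (simp add: algebra_simps)
  then have E: "exp (- (a / 4) * (1 * ((x + y) \<bullet> (x + y)) + (x - y) \<bullet> (x - y) / 1)) = exp (- (a / 2) * (x \<bullet> x)) * exp (- (a / 2) * (y \<bullet> y))"
    by (simp only: exp_add)
  have S: "sqrt (sqrt (a / pi) ^ 3) * sqrt (sqrt (a / pi) ^ 3) = sqrt (a / pi) ^ 3" using assms by simp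
  have "ground_state a x * ground_state a y
      = (sqrt (sqrt (a / pi) ^ 3) * sqrt (sqrt (a / pi) ^ 3)) * (exp (- (a / 2) * (x \<bullet> x)) * exp (- (a / 2) * (y \<bullet> y)))"
    by (simp only: ground_state_def mult_ac)
  then show ?thesis unfolding mehler_def E S by simp
qed

lemma mehler_commute: "mehler a \<theta> x y = mehler a \<theta> y x"
  by (simp add: mehler_def inner_diff inner_commute add.commute algebra_simps)

text \<open>The kernel is an approximate identity. Substituting \<open>x = y + sqrt e * z\<close>
  removes the singular power of \<open>e\<close> and leaves a Gaussian profile of total mass 1 in
  the limit, so dominated convergence applies.\<close>

lemma mehler_tendsto:
  assumes a: "0 < a" and \<phi>: "\<phi> \<in> test_functions" and e: "e \<longlonglongrightarrow> 0" "\<And>n. 0 < e n" "\<And>n. e n \<le> 1"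
  shows "(\<lambda>n. LINT x|lborel. complex_of_real (mehler a (e n) x y) * \<phi> x) \<longlonglongrightarrow> \<phi> y"
proof -
  note [measurable] = test_measurable[OF \<phi>]
  have \<phi>c: "isCont \<phi> x" for x using test_continuous[OF \<phi>] by (simp add: continuous_on_eq_continuous_at)
  obtain \<rho> where \<rho>: "\<And>x. \<rho> < norm x \<Longrightarrow> \<phi> x = 0" by (rule test_bounded_support[OF \<phi>]) blast
  obtain M where M: "0 \<le> M" "\<And>x. cmod (\<phi> x) \<le> M"
    by (rule bounded_continuous_bounded_support[OF test_continuous[OF \<phi>] \<rho>]) blast+
  define A where "A = sqrt (a / pi) ^ 3"
  have A: "0 < A" using a by (simp add: A_def)
  let ?g = "\<lambda>e z. A * (1 + e) ^ 3 / 8 * exp (- (a / 4) * (e * ((y + sqrt e *\<^sub>R z + y) \<bullet> (y + sqrt e *\<^sub>R z + y)) + z \<bullet> z))"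
  have sub: "(LINT x|lborel. complex_of_real (mehler a (e n) x y) * \<phi> x)
      = (LINT z|lborel. complex_of_real (?g (e n) z) * \<phi> (y + sqrt (e n) *\<^sub>R z))" for n
  proof -
    have s: "sqrt (e n) \<noteq> 0" "0 < sqrt (e n)" using e(2)[of n] by auto
    have "sqrt (e n) ^ 3 * e n powr (- (3 / 2)) = 1"
      using e(2)[of n] by (simp add: sqrt_power3_powr flip: powr_add)
    then have "sqrt (e n) ^ 3 * mehler a (e n) (y + sqrt (e n) *\<^sub>R z) y = ?g (e n) z" for z
    proof -
      have q: "(sqrt (e n) *\<^sub>R z) \<bullet> (sqrt (e n) *\<^sub>R z) / e n = z \<bullet> z"
        using e(2)[of n] by (simp add: mult.assoc[symmetric])
      assume one: "sqrt (e n) ^ 3 * e n powr (- (3 / 2)) = 1"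
      have "sqrt (e n) ^ 3 * mehler a (e n) (y + sqrt (e n) *\<^sub>R z) y
          = (sqrt (e n) ^ 3 * e n powr (- (3 / 2))) * (A * (1 + e n) ^ 3 / 8 * exp (- (a / 4) * (e n * ((y + sqrt (e n) *\<^sub>R z + y) \<bullet> (y + sqrt (e n) *\<^sub>R z + y)) + z \<bullet> z)))"
        unfolding mehler_def A_def[symmetric] add_diff_cancel_left' q by (simp only: mult_ac times_divide_eq_left times_divide_eq_right)
      then show ?thesis unfolding one by simp
    qed
    then have g: "complex_of_real (?g (e n) z) * \<phi> (y + sqrt (e n) *\<^sub>R z)
        = sqrt (e n) ^ 3 *\<^sub>R (complex_of_real (mehler a (e n) (y + sqrt (e n) *\<^sub>R z) y) * \<phi> (y + sqrt (e n) *\<^sub>R z))" for z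
      by (simp only: scaleR_conv_of_real mult.assoc[symmetric] of_real_mult[symmetric])
    have "(LINT x|lborel. complex_of_real (mehler a (e n) x y) * \<phi> x)
        = \<bar>sqrt (e n)\<bar> ^ 3 *\<^sub>R (LINT z|lborel. complex_of_real (mehler a (e n) (y + sqrt (e n) *\<^sub>R z) y) * \<phi> (y + sqrt (e n) *\<^sub>R z))"
      by (rule integral_affine[OF _ s(1)]) measurable
    then show ?thesis unfolding g using s by simp
  qed
  have "(\<lambda>n. LINT z|lborel. complex_of_real (?g (e n) z) * \<phi> (y + sqrt (e n) *\<^sub>R z))
      \<longlonglongrightarrow> (LINT z|(lborel :: (real ^ 3) measure). complex_of_real (A / 8 * exp (- (a / 4) * (norm z)\<^sup>2)) * \<phi> y)"
  proof (rule integral_dominated_convergence)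
    show "integrable lborel (\<lambda>z::real^3. A * M * exp (- (a / 4) * (norm z)\<^sup>2))"
      using a by (intro integrable_mult_right gaussian_integral) simp
    show "AE z in lborel. (\<lambda>n. complex_of_real (?g (e n) z) * \<phi> (y + sqrt (e n) *\<^sub>R z))
        \<longlonglongrightarrow> complex_of_real (A / 8 * exp (- (a / 4) * (norm z)\<^sup>2)) * \<phi> y"
    proof (intro AE_I2)
      fix z :: "real ^ 3"
      have y: "(\<lambda>n. y + sqrt (e n) *\<^sub>R z) \<longlonglongrightarrow> y + sqrt 0 *\<^sub>R z"
        by (intro tendsto_intros e)
      have \<phi>_lim: "(\<lambda>n. \<phi> (y + sqrt (e n) *\<^sub>R z)) \<longlonglongrightarrow> \<phi> y"
        using isCont_tendsto_compose[OF \<phi>c y] by simp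
      have "(\<lambda>n. ?g (e n) z) \<longlonglongrightarrow> A * (1 + 0) ^ 3 / 8 * exp (- (a / 4) * (0 * ((y + sqrt 0 *\<^sub>R z + y) \<bullet> (y + sqrt 0 *\<^sub>R z + y)) + z \<bullet> z))"
        by (intro tendsto_intros e) auto
      then have g_lim: "(\<lambda>n. ?g (e n) z) \<longlonglongrightarrow> A / 8 * exp (- (a / 4) * (norm z)\<^sup>2)"
        by (simp add: power2_norm_eq_inner)
      show "(\<lambda>n. complex_of_real (?g (e n) z) * \<phi> (y + sqrt (e n) *\<^sub>R z))
          \<longlonglongrightarrow> complex_of_real (A / 8 * exp (- (a / 4) * (norm z)\<^sup>2)) * \<phi> y"
        by (rule tendsto_mult[OF tendsto_of_real[OF g_lim] \<phi>_lim])
    qed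
    show "AE z in lborel. norm (complex_of_real (?g (e n) z) * \<phi> (y + sqrt (e n) *\<^sub>R z)) \<le> A * M * exp (- (a / 4) * (norm z)\<^sup>2)" for n
    proof (intro AE_I2)
      fix z :: "real ^ 3"
      have e3: "(1 + e n) ^ 3 \<le> 2 ^ 3" using e(2,3)[of n] by (intro power_mono) auto
      have "?g (e n) z \<le> A * 1 * exp (- (a / 4) * (norm z)\<^sup>2)"
      proof (intro mult_mono)
        show "A * (1 + e n) ^ 3 / 8 \<le> A * 1" using e3 A by (simp add: field_simps)
        show "exp (- (a / 4) * (e n * ((y + sqrt (e n) *\<^sub>R z + y) \<bullet> (y + sqrt (e n) *\<^sub>R z + y)) + z \<bullet> z)) \<le> exp (- (a / 4) * (norm z)\<^sup>2)"
          using a e(2)[of n] by (simp add: power2_norm_eq_inner distrib_left)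
      qed (use A in auto)
      moreover have "0 \<le> ?g (e n) z" using A e(2)[of n] by simp
      ultimately have "\<bar>?g (e n) z\<bar> * cmod (\<phi> (y + sqrt (e n) *\<^sub>R z)) \<le> (A * 1 * exp (- (a / 4) * (norm z)\<^sup>2)) * M"
        using A by (intro mult_mono M) auto
      then show "norm (complex_of_real (?g (e n) z) * \<phi> (y + sqrt (e n) *\<^sub>R z)) \<le> A * M * exp (- (a / 4) * (norm z)\<^sup>2)"
        by (simp only: norm_mult norm_of_real) (simp add: mult_ac)
    qed
  qed measurable
  also have "(LINT z|(lborel :: (real ^ 3) measure). complex_of_real (A / 8 * exp (- (a / 4) * (norm z)\<^sup>2)) * \<phi> y)
      = complex_of_real (LINT z|(lborel :: (real ^ 3) measure). A / 8 * exp (- (a / 4) * (norm z)\<^sup>2)) * \<phi> y"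
    by (simp only: integral_mult_left_zero integral_complex_of_real)
  also have "(LINT z|(lborel :: (real ^ 3) measure). A / 8 * exp (- (a / 4) * (norm z)\<^sup>2)) = 1"
  proof -
    have "(LINT z|(lborel :: (real ^ 3) measure). A / 8 * exp (- (a / 4) * (norm z)\<^sup>2)) = A / 8 * sqrt (pi / (a / 4)) ^ 3"
      using gaussian_integral(2)[of "a / 4"] a by (simp only: integral_mult_right_zero)
    also have "\<dots> = (sqrt (a / pi) * sqrt (pi / (a / 4))) ^ 3 / 8" by (simp add: A_def power_mult_distrib)
    also have "sqrt (a / pi) * sqrt (pi / (a / 4)) = sqrt (2\<^sup>2)"
      using a by (simp flip: real_sqrt_mult)
    also have "sqrt (2\<^sup>2) = (2::real)" by (rule real_sqrt_unique) auto
    finally show ?thesis by simp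
  qed
  finally show ?thesis by (simp add: sub)
qed

text \<open>The fundamental theorem of calculus in \<theta> under the space integral. The lower end
  \<open>e > 0\<close> keeps the integrand bounded on the support of the test function, since the
  kernel degenerates at \<theta> = 0.\<close>

lemma mehler_t_integral:
  assumes a: "0 < a" and e: "0 < e" "e \<le> 1" and \<phi>: "\<phi> \<in> test_functions"
  shows "(LINT \<theta>|lborel. complex_of_real (indicator {e..1} \<theta>) * (LINT x|lborel. complex_of_real (mehler_t a \<theta> x y) * \<phi> x))
      = (LINT x|lborel. complex_of_real (mehler a 1 x y) * \<phi> x) - (LINT x|lborel. complex_of_real (mehler a e x y) * \<phi> x)"
    and "integrable lborel (\<lambda>\<theta>. complex_of_real (indicator {e..1} \<theta>) * (LINT x|lborel. complex_of_real (mehler_t a \<theta> x y) * \<phi> x))"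
proof -
  note [measurable] = test_measurable[OF \<phi>]
  obtain \<rho> where \<rho>: "\<And>x. \<rho> < norm x \<Longrightarrow> \<phi> x = 0" by (rule test_bounded_support[OF \<phi>]) blast
  obtain M where M: "0 \<le> M" "\<And>x. cmod (\<phi> x) \<le> M"
    by (rule bounded_continuous_bounded_support[OF test_continuous[OF \<phi>] \<rho>]) blast+
  have [measurable]: "(\<lambda>(x, \<theta>). mehler_t a \<theta> x y) \<in> borel_measurable (lborel \<Otimes>\<^sub>M lborel)"
    unfolding mehler_t_def mehler_rate_def by measurable
  have cont: "continuous_on (cball 0 \<rho> \<times> {e..1}) (\<lambda>p. mehler_t a (snd p) (fst p) y)"
    unfolding mehler_t_def mehler_rate_def mehler_def
    using e by (intro continuous_intros continuous_on_powr) (auto simp: )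
  have "bounded ((\<lambda>p. mehler_t a (snd p) (fst p) y) ` (cball 0 \<rho> \<times> {e..1}))"
    by (intro compact_imp_bounded compact_continuous_image cont compact_Times) auto
  then obtain B where B: "0 < B" "\<And>x \<theta>. norm x \<le> \<rho> \<Longrightarrow> e \<le> \<theta> \<Longrightarrow> \<theta> \<le> 1 \<Longrightarrow> \<bar>mehler_t a \<theta> x y\<bar> \<le> B"
    unfolding bounded_pos by force
  let ?F = "\<lambda>x \<theta>. complex_of_real (mehler_t a \<theta> x y * indicator {e..1} \<theta>) * \<phi> x"
  have F_le: "ennreal (cmod (?F x \<theta>)) \<le> ennreal (B * M) * indicator (cball 0 \<rho>) x * indicator {e..1} \<theta>" for x \<theta>
  proof (cases "norm x \<le> \<rho> \<and> e \<le> \<theta> \<and> \<theta> \<le> 1")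
    case True
    then have "cmod (?F x \<theta>) \<le> B * M"
      unfolding norm_mult norm_of_real using B M by (intro mult_mono) auto
    then show ?thesis using True by (simp add: ennreal_leI)
  qed (use \<rho> in \<open>auto simp: not_le\<close>)
  have "(\<integral>\<^sup>+x. \<integral>\<^sup>+\<theta>. ennreal (cmod (?F x \<theta>)) \<partial>lborel \<partial>lborel)
      \<le> (\<integral>\<^sup>+x. \<integral>\<^sup>+\<theta>. ennreal (B * M) * indicator (cball (0::real^3) \<rho>) x * indicator {e..1} \<theta> \<partial>lborel \<partial>lborel)"
    by (intro nn_integral_mono F_le)
  also have "\<dots> = ennreal (B * M) * emeasure lborel (cball (0::real^3) \<rho>) * emeasure lborel {e..1}"
  proof -
    have "(\<integral>\<^sup>+x. k * indicator S x * l \<partial>lborel) = k * emeasure lborel S * l" if "S \<in> sets borel" for k l and S :: "(real ^ 3) set"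
      using that by (subst nn_integral_multc) (simp_all add: nn_integral_cmult_indicator)
    then show ?thesis by (simp add: nn_integral_cmult_indicator)
  qed
  also have "\<dots> < \<infinity>"
    using emeasure_bounded_finite[OF bounded_cball, of "0::real^3" \<rho>] e by (simp add: ennreal_mult_less_top)
  finally have fin: "(\<integral>\<^sup>+x. \<integral>\<^sup>+\<theta>. ennreal (cmod (?F x \<theta>)) \<partial>lborel \<partial>lborel) < \<infinity>" .
  have m: "case_prod ?F \<in> borel_measurable (lborel \<Otimes>\<^sub>M lborel)" by measurable
  have 1: "(LINT \<theta>|lborel. ?F x \<theta>) = complex_of_real (mehler a 1 x y) * \<phi> x - complex_of_real (mehler a e x y) * \<phi> x" for x
  proof -
    have "(LINT \<theta>|lborel. mehler_t a \<theta> x y * indicator {e..1} \<theta>) = mehler a 1 x y - mehler a e x y"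
    proof (rule integral_FTC_Icc_real)
      fix \<theta> assume \<theta>: "e \<le> \<theta>" "\<theta> \<le> 1"
      then show "((\<lambda>\<theta>. mehler a \<theta> x y) has_real_derivative mehler_t a \<theta> x y) (at \<theta>)"
        using e by (intro mehler_has_derivative_t) auto
      show "isCont (\<lambda>\<theta>. mehler_t a \<theta> x y) \<theta>"
        unfolding mehler_t_def mehler_rate_def using e \<theta>
        by (intro continuous_intros DERIV_isCont[OF mehler_has_derivative_t]) auto
    qed (use e in auto)
    then show ?thesis
      by (simp only: integral_mult_left_zero integral_complex_of_real) (simp add: left_diff_distrib)
  qed
  have 2: "(LINT x|lborel. ?F x \<theta>) = complex_of_real (indicator {e..1} \<theta>) * (LINT x|lborel. complex_of_real (mehler_t a \<theta> x y) * \<phi> x)" for \<theta>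
    by (subst integral_mult_right_zero[symmetric]) (simp add: mult_ac)
  have int: "integrable lborel (\<lambda>x. complex_of_real (mehler a \<theta> x y) * \<phi> x)" if "0 < \<theta>" for \<theta>
    using that by (intro integrable_continuous_mult_test continuous_on_of_real continuous_mehler \<phi>) auto
  show "(LINT \<theta>|lborel. complex_of_real (indicator {e..1} \<theta>) * (LINT x|lborel. complex_of_real (mehler_t a \<theta> x y) * \<phi> x))
      = (LINT x|lborel. complex_of_real (mehler a 1 x y) * \<phi> x) - (LINT x|lborel. complex_of_real (mehler a e x y) * \<phi> x)"
    using Fubini_swap(1)[OF m fin] int[of 1] int[of e] e unfolding 1 2 by (simp add: Bochner_Integration.integral_diff)
  show "integrable lborel (\<lambda>\<theta>. complex_of_real (indicator {e..1} \<theta>) * (LINT x|lborel. complex_of_real (mehler_t a \<theta> x y) * \<phi> x))"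
    using Fubini_swap(3)[OF m fin] unfolding 2 .
qed

text \<open>The oscillator turns each density into minus the \<theta>-derivative of the kernel,
  because the factor \<open>a / 2 * (1 - \<theta>\<^sup>2)\<close> of the heat equation is the
  inverse of the Jacobian. Hence the integral over \<theta> telescopes to the delta function at
  \<theta> = 0 minus the ground state projection at \<theta> = 1.\<close>

lemma resolvent_kernel_equation:
  assumes a: "0 < a" and \<phi>: "\<phi> \<in> test_functions"
  shows "(LINT x|lborel. complex_of_real (resolvent_kernel a x y) * osc_operator a \<phi> x)
    = \<phi> y - complex_of_real (ground_state a y) * (LINT x|lborel. complex_of_real (ground_state a x) * \<phi> x)"
proof -
  have L2: "osc_operator a \<phi> \<in> L2" by (rule osc_operator_L2[OF \<phi>])
  note [measurable] = L2_measurable[OF L2]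
  let ?q = "\<lambda>\<theta>. LINT x|lborel. complex_of_real (mehler_t a \<theta> x y) * \<phi> x"
  obtain C where C: "0 < C" and bd: "\<And>\<theta> x y. 0 < \<theta> \<Longrightarrow> \<theta> < 1 \<Longrightarrow>
      \<bar>resolvent_density a \<theta> x y\<bar> \<le> C * majorant a (3 / 2) \<theta> (x - y)"
    using resolvent_density_bounds[OF a] by metis
  obtain B where "(\<integral>\<^sup>+x. majorant_mass a (3 / 2) (y - x) * ennreal (cmod (osc_operator a \<phi> x)) \<partial>lborel) \<le> ennreal B"
    using majorant_mass_L2_pairing[OF a] L2 by blast
  then have fin: "(\<integral>\<^sup>+x. majorant_mass a (3 / 2) (x - y) * ennreal (cmod (osc_operator a \<phi> x)) \<partial>lborel) < \<infinity>"
    unfolding majorant_mass_minus[of a "3 / 2" _ y] by (rule le_less_trans) simp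
  have inner: "(LINT x|lborel. complex_of_real (resolvent_density a \<theta> x y) * osc_operator a \<phi> x) = - ?q \<theta>"
    if \<theta>: "0 < \<theta>" "\<theta> < 1" for \<theta>
  proof -
    let ?c = "complex_of_real (2 / (a * (1 - \<theta>\<^sup>2)))"
    have "\<theta>\<^sup>2 < 1" using \<theta> by (simp add: power_less_one_iff)
    then have c: "?c * complex_of_real (a / 2 * (1 - \<theta>\<^sup>2)) = 1" using a by (simp flip: of_real_mult)
    have int: "integrable lborel (\<lambda>x. complex_of_real (mehler a \<tau> x y) * osc_operator a \<phi> x)" if "0 < \<tau>" for \<tau>
    proof -
      obtain \<rho> where \<rho>: "\<And>x. \<rho> < norm x \<Longrightarrow> \<phi> x = 0" by (rule test_bounded_support[OF \<phi>]) blast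
      have "\<rho> < norm x \<Longrightarrow> osc_operator a \<phi> x = 0" for x
        using partial_eq_0_outside[of \<rho> "partial j \<phi>" for j, OF partial_eq_0_outside[OF \<rho>]] \<rho>
        by (simp add: osc_operator_def laplacian_def)
      then show ?thesis using that
        by (intro integrable_continuous_bounded_support[of _ \<rho>] continuous_on_mult continuous_on_of_real continuous_mehler continuous_osc_operator \<phi>) auto
    qed
    have "(LINT x|lborel. complex_of_real (resolvent_density a \<theta> x y) * osc_operator a \<phi> x)
        = ?c * (LINT x|lborel. complex_of_real (mehler a \<theta> x y) * osc_operator a \<phi> x - complex_of_real (mehler a 1 x y) * osc_operator a \<phi> x)"
      by (subst integral_mult_right_zero[symmetric])
         (simp add: resolvent_density_def algebra_simps del: times_divide_eq_left times_divide_eq_right of_real_divide)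
    also have "\<dots> = ?c * ((LINT x|lborel. complex_of_real (mehler a \<theta> x y) * osc_operator a \<phi> x) - (LINT x|lborel. complex_of_real (mehler a 1 x y) * osc_operator a \<phi> x))"
      using int \<theta> by (subst Bochner_Integration.integral_diff) auto
    also have "(LINT x|lborel. complex_of_real (mehler a 1 x y) * osc_operator a \<phi> x) = 0"
      using integral_mehler_osc_operator[OF _ \<phi>, of 1 a y] by simp
    also have "(LINT x|lborel. complex_of_real (mehler a \<theta> x y) * osc_operator a \<phi> x) = - (complex_of_real (a / 2 * (1 - \<theta>\<^sup>2)) * ?q \<theta>)"
      unfolding integral_mehler_osc_operator[OF \<theta>(1) \<phi>]
      by (subst integral_mult_right_zero[symmetric]) (simp only: of_real_mult mult.assoc)
    finally show ?thesis using c by (simp add: mult.assoc[symmetric] del: of_real_mult of_real_divide)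
  qed
  have eq: "complex_of_real (indicator {0<..<1} \<theta>) * (LINT x|lborel. complex_of_real (resolvent_density a \<theta> x y) * osc_operator a \<phi> x)
      = - (complex_of_real (indicator {0<..<1} \<theta>) * ?q \<theta>)" for \<theta>
    using inner by (auto simp: indicator_def)
  have m: "(\<lambda>(x, \<theta>). resolvent_density a \<theta> x y) \<in> borel_measurable (lborel \<Otimes>\<^sub>M lborel)" by measurable
  note swap = theta_integral_swap[of "resolvent_density a" y C a "3 / 2", OF bd less_imp_le[OF C] m _ fin]
  have int: "integrable lborel (\<lambda>\<theta>. complex_of_real (indicator {0<..<1} \<theta>) * ?q \<theta>)"
    using swap(2) unfolding eq by simp
  have lhs: "(LINT x|lborel. complex_of_real (resolvent_kernel a x y) * osc_operator a \<phi> x)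
      = - (LINT \<theta>|lborel. complex_of_real (indicator {0<..<1} \<theta>) * ?q \<theta>)"
    using swap(1) unfolding eq resolvent_kernel_def by simp
  \<comment> \<open>The integral over the open unit interval is approached from cut-off intervals,
    on which the fundamental theorem is available.\<close>
  define e where "e n = inverse (real (Suc n))" for n
  have e: "0 < e n" "e n \<le> 1" for n by (auto simp: e_def field_simps)
  have e0: "e \<longlonglongrightarrow> 0" unfolding e_def by (rule LIMSEQ_inverse_real_of_nat)
  have "(\<lambda>n. LINT \<theta>|lborel. complex_of_real (indicator {e n..1} \<theta>) * ?q \<theta>)
      \<longlonglongrightarrow> (LINT \<theta>|lborel. complex_of_real (indicator {0<..<1} \<theta>) * ?q \<theta>)"
  proof (rule integral_dominated_convergence)
    show "integrable lborel (\<lambda>\<theta>. norm (complex_of_real (indicator {0<..<1} \<theta>) * ?q \<theta>))" by (intro integrable_norm int)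
    have ne: "AE \<theta> in lborel. \<theta> \<noteq> (1::real)" by (rule AE_lborel_singleton)
    then show "AE \<theta> in lborel. norm (complex_of_real (indicator {e n..1} \<theta>) * ?q \<theta>) \<le> norm (complex_of_real (indicator {0<..<1} \<theta>) * ?q \<theta>)" for n
      by eventually_elim (use e[of n] in \<open>auto simp: indicator_def norm_mult\<close>)
    show "AE \<theta> in lborel. (\<lambda>n. complex_of_real (indicator {e n..1} \<theta>) * ?q \<theta>) \<longlonglongrightarrow> complex_of_real (indicator {0<..<1} \<theta>) * ?q \<theta>"
      using ne
    proof eventually_elim
      case (elim \<theta>)
      have "\<forall>\<^sub>F n in sequentially. indicator {e n..1} \<theta> = (indicator {0<..<1} \<theta> :: real)"
      proof (cases "0 < \<theta>")
        case True
        from order_tendstoD(2)[OF e0 this] show ?thesis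
          by eventually_elim (use elim True in \<open>auto simp: indicator_def\<close>)
      next
        case False
        then have "\<not> e n \<le> \<theta>" for n using e(1)[of n] by linarith
        with False show ?thesis by (intro always_eventually) (auto simp: indicator_def)
      qed
      then have "\<forall>\<^sub>F n in sequentially. complex_of_real (indicator {e n..1} \<theta>) * ?q \<theta> = complex_of_real (indicator {0<..<1} \<theta>) * ?q \<theta>"
        by eventually_elim simp
      then show ?case by (rule tendsto_eventually)
    qed
    show "(\<lambda>\<theta>. complex_of_real (indicator {0<..<1} \<theta>) * ?q \<theta>) \<in> borel_measurable lborel"
      using borel_measurable_integrable[OF int] .
    show "(\<lambda>\<theta>. complex_of_real (indicator {e n..1} \<theta>) * ?q \<theta>) \<in> borel_measurable lborel" for n
      using borel_measurable_integrable[OF mehler_t_integral(2)[OF a e \<phi>]] .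
  qed
  then have "(\<lambda>n. (LINT x|lborel. complex_of_real (mehler a 1 x y) * \<phi> x) - (LINT x|lborel. complex_of_real (mehler a (e n) x y) * \<phi> x))
      \<longlonglongrightarrow> (LINT \<theta>|lborel. complex_of_real (indicator {0<..<1} \<theta>) * ?q \<theta>)"
    unfolding mehler_t_integral(1)[OF a e \<phi>] .
  moreover have "(\<lambda>n. (LINT x|lborel. complex_of_real (mehler a 1 x y) * \<phi> x) - (LINT x|lborel. complex_of_real (mehler a (e n) x y) * \<phi> x))
      \<longlonglongrightarrow> (LINT x|lborel. complex_of_real (mehler a 1 x y) * \<phi> x) - \<phi> y"
    by (intro tendsto_intros mehler_tendsto a \<phi> e0 e)
  ultimately have "(LINT \<theta>|lborel. complex_of_real (indicator {0<..<1} \<theta>) * ?q \<theta>) = (LINT x|lborel. complex_of_real (mehler a 1 x y) * \<phi> x) - \<phi> y"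
    by (rule LIMSEQ_unique)
  moreover have "(LINT x|lborel. complex_of_real (mehler a 1 x y) * \<phi> x) = complex_of_real (ground_state a y) * (LINT x|lborel. complex_of_real (ground_state a x) * \<phi> x)"
    by (subst integral_mult_right_zero[symmetric]) (simp add: mehler_one[OF a] mult_ac)
  ultimately show ?thesis unfolding lhs by simp
qed

section \<open>Weak derivatives of the resolvent\<close>

lemma resolvent_density_has_derivative:
  assumes "\<theta> \<noteq> 0"
  shows "((\<lambda>x. resolvent_density a \<theta> x y) has_derivative
    (\<lambda>v. 2 / (a * (1 - \<theta>\<^sup>2)) * (- (a / 2) * (\<theta> * ((x + y) \<bullet> v) + (x - y) \<bullet> v / \<theta>) * mehler a \<theta> x y
       - - (a / 2) * (1 * ((x + y) \<bullet> v) + (x - y) \<bullet> v / 1) * mehler a 1 x y))) (at x)"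
  unfolding resolvent_density_def
  by (intro has_derivative_mult_right has_derivative_diff mehler_has_derivative assms one_neq_zero)

text \<open>The kernel is singular on the diagonal and is not differentiated directly: for fixed
  \<theta> the density is smooth and is integrated by parts, and the result is then integrated over
  \<theta>.\<close>

lemma resolvent_kernel_by_parts:
  assumes a: "0 < a" and \<phi>: "\<phi> \<in> test_functions"
  shows "(LINT x|lborel. complex_of_real (resolvent_kernel a x y) * partial j \<phi> x)
    = - (LINT x|lborel. complex_of_real (resolvent_kernel_x a j x y) * \<phi> x)"
proof -
  note [measurable] = test_measurable[OF \<phi>] test_measurable[OF test_partial[OF \<phi>]]
  obtain \<rho> where \<rho>: "\<And>x. \<rho> < norm x \<Longrightarrow> \<phi> x = 0" by (rule test_bounded_support[OF \<phi>]) blast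
  obtain M where M: "0 \<le> M" "\<And>x. cmod (\<phi> x) \<le> M"
    by (rule bounded_continuous_bounded_support[OF test_continuous[OF \<phi>] \<rho>]) blast+
  obtain C where C: "0 < C" and bd: "\<And>\<theta> x y j. 0 < \<theta> \<Longrightarrow> \<theta> < 1 \<Longrightarrow>
      \<bar>resolvent_density a \<theta> x y\<bar> \<le> C * majorant a (3 / 2) \<theta> (x - y) \<and>
      norm x * \<bar>resolvent_density a \<theta> x y\<bar> \<le> C * majorant a 2 \<theta> (x - y) \<and>
      \<bar>resolvent_density_x a j \<theta> x y\<bar> \<le> C * majorant a 2 \<theta> (x - y)"
    using resolvent_density_bounds[OF a] by metis
  have bd1: "\<And>\<theta> x. 0 < \<theta> \<Longrightarrow> \<theta> < 1 \<Longrightarrow> \<bar>resolvent_density a \<theta> x y\<bar> \<le> C * majorant a (3 / 2) \<theta> (x - y)"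
    and bd2: "\<And>\<theta> x. 0 < \<theta> \<Longrightarrow> \<theta> < 1 \<Longrightarrow> \<bar>resolvent_density_x a j \<theta> x y\<bar> \<le> C * majorant a 2 \<theta> (x - y)"
    using bd by blast+
  \<comment> \<open>The derivative kernel has exponent 2, for which the L2 pairing would produce the
    non-integrable power -5/4. Its finite mass is paired with the bounded test function
    instead.\<close>
  obtain A where A: "(\<integral>\<^sup>+z. majorant_mass a 2 z \<partial>lborel) = ennreal A"
    using majorant_mass_integral[OF a] by auto
  obtain B where "(\<integral>\<^sup>+x. majorant_mass a (3 / 2) (y - x) * ennreal (cmod (partial j \<phi> x)) \<partial>lborel) \<le> ennreal B"
    using majorant_mass_L2_pairing[OF a] test_L2[OF test_partial[OF \<phi>]] by blast
  then have fin1: "(\<integral>\<^sup>+x. majorant_mass a (3 / 2) (x - y) * ennreal (cmod (partial j \<phi> x)) \<partial>lborel) < \<infinity>"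
    unfolding majorant_mass_minus[of a "3 / 2" _ y] by (rule le_less_trans) simp
  have "(\<integral>\<^sup>+x. majorant_mass a 2 (x - y) * ennreal (cmod (\<phi> x)) \<partial>lborel) \<le> (\<integral>\<^sup>+x. majorant_mass a 2 (x - y) * ennreal M \<partial>lborel)"
    by (intro nn_integral_mono mult_left_mono ennreal_leI M) auto
  also have "\<dots> = ennreal A * ennreal M"
    using nn_integral_translate[of "majorant_mass a 2" y] A by (simp add: nn_integral_multc)
  also have "\<dots> < \<infinity>" by (simp add: ennreal_mult_less_top)
  finally have fin2: "(\<integral>\<^sup>+x. majorant_mass a 2 (x - y) * ennreal (cmod (\<phi> x)) \<partial>lborel) < \<infinity>" .
  have m: "(\<lambda>(x, \<theta>). resolvent_density a \<theta> x y) \<in> borel_measurable (lborel \<Otimes>\<^sub>M lborel)"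
    "(\<lambda>(x, \<theta>). resolvent_density_x a j \<theta> x y) \<in> borel_measurable (lborel \<Otimes>\<^sub>M lborel)" by measurable
  \<comment> \<open>For \<theta> equal to 1 or -1 the prefactor is a division by zero, hence 0, and
    both sides vanish.\<close>
  have inner: "(LINT x|lborel. complex_of_real (resolvent_density a \<theta> x y) * partial j \<phi> x)
      = - (LINT x|lborel. complex_of_real (resolvent_density_x a j \<theta> x y) * \<phi> x)" if \<theta>: "\<theta> \<noteq> 0" for \<theta>
  proof -
    have eq: "2 / (a * (1 - \<theta>\<^sup>2)) * (- (a / 2) * (\<theta> * ((x + y) \<bullet> axis j 1) + (x - y) \<bullet> axis j 1 / \<theta>) * mehler a \<theta> x y
       - - (a / 2) * (1 * ((x + y) \<bullet> axis j 1) + (x - y) \<bullet> axis j 1 / 1) * mehler a 1 x y) = resolvent_density_x a j \<theta> x y" for x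
      unfolding mehler_x_eq resolvent_density_x_def ..
    have "continuous_on UNIV (\<lambda>x. resolvent_density_x a j \<theta> x y)"
      unfolding resolvent_density_x_def
      by (intro continuous_on_mult_left continuous_on_diff continuous_mehler_x \<theta> one_neq_zero)
    then show ?thesis
      using integral_by_parts_test[OF resolvent_density_has_derivative[OF \<theta>] _ \<phi>, of a y j] unfolding eq by simp
  qed
  have "(LINT x|lborel. complex_of_real (resolvent_kernel a x y) * partial j \<phi> x)
      = (LINT \<theta>|lborel. complex_of_real (indicator {0<..<1} \<theta>) * (LINT x|lborel. complex_of_real (resolvent_density a \<theta> x y) * partial j \<phi> x))"
    unfolding resolvent_kernel_def by (rule theta_integral_swap(1)[where D = "resolvent_density a" and y = y and g = "partial j \<phi>", OF bd1 less_imp_le[OF C] m(1) _ fin1]) measurable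
  also have "\<dots> = (LINT \<theta>|lborel. - (complex_of_real (indicator {0<..<1} \<theta>) * (LINT x|lborel. complex_of_real (resolvent_density_x a j \<theta> x y) * \<phi> x)))"
    by (intro Bochner_Integration.integral_cong refl) (auto simp: indicator_def inner)
  also have "\<dots> = - (LINT x|lborel. complex_of_real (resolvent_kernel_x a j x y) * \<phi> x)"
    unfolding resolvent_kernel_x_def
    by (subst theta_integral_swap(1)[where D = "resolvent_density_x a j" and y = y and g = \<phi>, OF bd2 less_imp_le[OF C] m(2) _ fin2]) simp_all
  finally show ?thesis .
qed

lemma resolvent_weak_partial:
  assumes a: "0 < a" and f: "f \<in> L2"
  shows "is_weak_partial j (resolvent a f) (resolvent_x a j f)"
  unfolding is_weak_partial_def
proof
  fix \<phi> assume \<phi>: "\<phi> \<in> test_functions"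
  have 1: "(LINT x|lborel. resolvent a f x * partial j \<phi> x) = (LINT y|lborel. f y * (LINT x|lborel. complex_of_real (resolvent_kernel a x y) * partial j \<phi> x))"
    using resolvent_L2_bounds[OF a] f test_L2[OF test_partial[OF \<phi>]] by blast
  have 2: "(LINT x|lborel. resolvent_x a j f x * \<phi> x) = (LINT y|lborel. f y * (LINT x|lborel. complex_of_real (resolvent_kernel_x a j x y) * \<phi> x))"
    using resolvent_L2_bounds[OF a] f test_L2[OF \<phi>] by blast
  show "(LINT x|lborel. resolvent a f x * partial j \<phi> x) = - (LINT x|lborel. resolvent_x a j f x * \<phi> x)"
    unfolding 1 2 resolvent_kernel_by_parts[OF a \<phi>] by simp
qed

section \<open>Weak equations for the resolvent and the ground state\<close>

lemma ground_state_L2: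
  assumes "0 < a"
  shows "(\<lambda>x. complex_of_real (ground_state a x)) \<in> L2"
proof -
  have "(\<lambda>x. complex_of_real (sqrt (sqrt (a / pi) ^ 3)) * (complex_of_real (exp (- (a / 2) * (norm x)\<^sup>2)) * cis (x \<bullet> 0))) \<in> L2"
    by (rule L2_scale(1)[OF gaussian_L2]) (use assms in simp)
  then show ?thesis by (simp add: ground_state_def power2_norm_eq_inner)
qed

lemma resolvent_equation:
  assumes a: "0 < a" and f: "f \<in> L2" and \<phi>: "\<phi> \<in> test_functions"
  shows "(LINT x|lborel. resolvent a f x * osc_operator a \<phi> x)
    = (LINT y|lborel. f y * \<phi> y) - (LINT y|lborel. f y * complex_of_real (ground_state a y)) * (LINT x|lborel. complex_of_real (ground_state a x) * \<phi> x)"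
proof -
  have "(LINT x|lborel. resolvent a f x * osc_operator a \<phi> x) = (LINT y|lborel. f y * (LINT x|lborel. complex_of_real (resolvent_kernel a x y) * osc_operator a \<phi> x))"
    using resolvent_L2_bounds[OF a] f osc_operator_L2[OF \<phi>] by blast
  also have "\<dots> = (LINT y|lborel. f y * \<phi> y - f y * complex_of_real (ground_state a y) * (LINT x|lborel. complex_of_real (ground_state a x) * \<phi> x))"
    unfolding resolvent_kernel_equation[OF a \<phi>] by (simp add: right_diff_distrib mult.assoc)
  also have "\<dots> = (LINT y|lborel. f y * \<phi> y) - (LINT y|lborel. f y * complex_of_real (ground_state a y)) * (LINT x|lborel. complex_of_real (ground_state a x) * \<phi> x)"
    using L2_mult_integrable[OF f test_L2[OF \<phi>]] L2_mult_integrable[OF f ground_state_L2[OF a]]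
    by (subst Bochner_Integration.integral_diff) auto
  finally show ?thesis .
qed

text \<open>At \<theta> = 1 and \<open>y = 0\<close> the Mehler kernel is a nonzero multiple of the
  ground state, and the right-hand side of the integrated heat equation vanishes there.\<close>

lemma ground_state_equation:
  assumes a: "0 < a" and \<phi>: "\<phi> \<in> test_functions"
  shows "(LINT x|lborel. complex_of_real (ground_state a x) * osc_operator a \<phi> x) = 0"
proof -
  have "(LINT x|lborel. complex_of_real (mehler a 1 x 0) * osc_operator a \<phi> x) = 0"
    using integral_mehler_osc_operator[OF _ \<phi>, of 1 a 0] by simp
  moreover have "(LINT x|lborel. complex_of_real (mehler a 1 x 0) * osc_operator a \<phi> x)
      = complex_of_real (ground_state a 0) * (LINT x|lborel. complex_of_real (ground_state a x) * osc_operator a \<phi> x)"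
    by (subst integral_mult_right_zero[symmetric]) (simp add: mehler_one[OF a] mult_ac)
  moreover have "ground_state a 0 \<noteq> 0" using a by (simp add: ground_state_def)
  ultimately show ?thesis by simp
qed

lemma ground_state_normalized:
  assumes a: "0 < a"
  shows "(LINT x|lborel. complex_of_real (ground_state a x) * complex_of_real (ground_state a x)) = 1"
proof -
  have g: "ground_state a x * ground_state a x = sqrt (a / pi) ^ 3 * exp (- a * (norm x)\<^sup>2)" for x
  proof -
    have S: "sqrt (sqrt (a / pi) ^ 3) * sqrt (sqrt (a / pi) ^ 3) = sqrt (a / pi) ^ 3" using a by simp
    have E: "exp (- (a / 2) * (x \<bullet> x)) * exp (- (a / 2) * (x \<bullet> x)) = exp (- a * (norm x)\<^sup>2)"
      by (simp add: power2_norm_eq_inner flip: exp_add)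
    have "ground_state a x * ground_state a x
      = (sqrt (sqrt (a / pi) ^ 3) * sqrt (sqrt (a / pi) ^ 3)) * (exp (- (a / 2) * (x \<bullet> x)) * exp (- (a / 2) * (x \<bullet> x)))"
      by (simp only: ground_state_def mult_ac)
    then show ?thesis unfolding S E .
  qed
  have "(LINT x|lborel. complex_of_real (ground_state a x) * complex_of_real (ground_state a x))
      = complex_of_real (LINT x|(lborel :: (real ^ 3) measure). sqrt (a / pi) ^ 3 * exp (- a * (norm x)\<^sup>2))"
    by (simp only: of_real_mult[symmetric] g integral_complex_of_real)
  also have "(LINT x|(lborel :: (real ^ 3) measure). sqrt (a / pi) ^ 3 * exp (- a * (norm x)\<^sup>2)) = sqrt (a / pi) ^ 3 * sqrt (pi / a) ^ 3"
    using gaussian_integral(2)[OF a] by (simp only: integral_mult_right_zero)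
  also have "\<dots> = (sqrt (a / pi) * sqrt (pi / a)) ^ 3" by (simp add: power_mult_distrib)
  also have "\<dots> = 1" using a by (simp flip: real_sqrt_mult)
  finally show ?thesis by simp
qed

text \<open>In each variable the Mehler kernel is a Gaussian, so a function that pairs to zero with
  all Gaussians is annihilated by every kernel, hence by the resolvent, and has no ground state
  component. The resolvent equation then makes it zero against test functions. No Fourier theory
  enters, so the result can serve to prove injectivity of the transform.\<close>

lemma weakly_zero_gaussian:
  assumes d: "d \<in> L2"
    and zero: "\<And>c b. 0 < c \<Longrightarrow> (LINT y|lborel. d y * complex_of_real (exp (- c * (y \<bullet> y) + b \<bullet> y))) = 0"
  shows "AE x in lborel. d x = 0"
proof (rule weakly_zero_AE[OF d])
  fix \<phi> assume \<phi>: "\<phi> \<in> test_functions"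
  note [measurable] = L2_measurable[OF d]
  obtain C where C: "0 < C" and bd: "\<And>\<theta> x y. 0 < \<theta> \<Longrightarrow> \<theta> < 1 \<Longrightarrow>
      \<bar>resolvent_density 1 \<theta> x y\<bar> \<le> C * majorant 1 (3 / 2) \<theta> (x - y)"
    using resolvent_density_bounds[OF zero_less_one] by metis
  have mehler0: "(LINT y|lborel. complex_of_real (mehler 1 \<theta> y x) * d y) = 0" if \<theta>: "0 < \<theta>" for \<theta> x
  proof -
    \<comment> \<open>Coefficients of the exponent of the Mehler kernel, sorted by powers of
      \<open>y\<close>; the part in \<open>x\<close> alone goes into the constant
      \<open>K\<close>.\<close>
    define c where "c = (\<theta> + 1 / \<theta>) / 4"
    define b where "b = - ((\<theta> - 1 / \<theta>) / 2) *\<^sub>R x"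
    define K where "K = sqrt (1 / pi) ^ 3 * (1 + \<theta>) ^ 3 / 8 * \<theta> powr (- (3 / 2)) * exp (- c * (x \<bullet> x))"
    have "0 < c" using \<theta> by (simp add: c_def add_pos_pos)
    have "- (1 / 4) * (\<theta> * ((y + x) \<bullet> (y + x)) + (y - x) \<bullet> (y - x) / \<theta>) = - c * (x \<bullet> x) + (- c * (y \<bullet> y) + b \<bullet> y)" for y
      using \<theta> by (simp add: c_def b_def inner_add inner_diff inner_commute field_simps)
    then have "mehler 1 \<theta> y x = K * exp (- c * (y \<bullet> y) + b \<bullet> y)" for y
      unfolding mehler_def K_def by (simp only: exp_add mult_ac)
    then have "(LINT y|lborel. complex_of_real (mehler 1 \<theta> y x) * d y)
        = complex_of_real K * (LINT y|lborel. d y * complex_of_real (exp (- c * (y \<bullet> y) + b \<bullet> y)))"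
      by (subst integral_mult_right_zero[symmetric]) (simp only: of_real_mult mult_ac)
    then show ?thesis using zero[OF \<open>0 < c\<close>] by simp
  qed
  have mehler_int: "integrable lborel (\<lambda>y. complex_of_real (mehler 1 \<theta> y x) * d y)" if \<theta>: "0 < \<theta>" "\<theta> \<le> 1" for \<theta> x
  proof -
    have E: "(\<lambda>y. complex_of_real (exp (- (1 / 4 / \<theta>) * (norm (y - x))\<^sup>2))) \<in> L2"
    proof -
      have m: "(\<lambda>y. complex_of_real (exp (- (1 / 4 / \<theta>) * (norm (y - x))\<^sup>2))) \<in> borel_measurable borel" by measurable
      have "(\<integral>\<^sup>+y. ennreal (cmod (complex_of_real (exp (- (1 / 4 / \<theta>) * (norm (y - x))\<^sup>2)))) ^ 2 \<partial>lborel)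
          = (\<integral>\<^sup>+y. ennreal (exp (- (1 / 2 / \<theta>) * (norm (y - x))\<^sup>2)) \<partial>lborel)"
        by (intro nn_integral_cong) (simp add: ennreal_power flip: exp_of_nat_mult)
      also have "\<dots> = ennreal (sqrt (pi / (1 / 2 / \<theta>)) ^ 3)"
        using nn_integral_translate[of "\<lambda>z. ennreal (exp (- (1 / 2 / \<theta>) * (norm z)\<^sup>2))" x] gaussian_integral(3)[of "1 / 2 / \<theta>"] \<theta> by simp
      also have "\<dots> = (ennreal (sqrt (sqrt (pi / (1 / 2 / \<theta>)) ^ 3)))\<^sup>2"
        using \<theta> by (simp add: ennreal_power)
      finally show ?thesis by (intro L2_boundI(1)[OF m, of "sqrt (sqrt (pi / (1 / 2 / \<theta>)) ^ 3)"]) (use \<theta> in auto)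
    qed
    have "(\<lambda>y. complex_of_real (mehler 1 \<theta> y x)) \<in> L2"
    proof (rule L2_mono(1)[OF _ E])
      show "AE y in lborel. cmod (complex_of_real (mehler 1 \<theta> y x)) \<le> (sqrt (1 / pi) ^ 3 * \<theta> powr (- (3 / 2))) * cmod (complex_of_real (exp (- (1 / 4 / \<theta>) * (norm (y - x))\<^sup>2)))"
      proof (intro AE_I2)
        fix y
        have "mehler 1 \<theta> y x \<le> sqrt (1 / pi) ^ 3 * \<theta> powr (- (3 / 2)) * exp (- (1 / 4) * (\<theta> * ((y + x) \<bullet> (y + x)) + (y - x) \<bullet> (y - x) / \<theta>))"
          by (rule mehler_le[OF _ \<theta>]) simp
        also have "\<dots> \<le> sqrt (1 / pi) ^ 3 * \<theta> powr (- (3 / 2)) * exp (- (1 / 4 / \<theta>) * (norm (y - x))\<^sup>2)"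
          using \<theta> by (intro mult_left_mono) (simp_all add: power2_norm_eq_inner field_simps)
        finally show "cmod (complex_of_real (mehler 1 \<theta> y x)) \<le> (sqrt (1 / pi) ^ 3 * \<theta> powr (- (3 / 2))) * cmod (complex_of_real (exp (- (1 / 4 / \<theta>) * (norm (y - x))\<^sup>2)))"
          using mehler_nonneg[of 1 \<theta> y x] \<theta> by simp
      qed
    qed (simp, measurable)
    then show ?thesis by (rule L2_mult_integrable[OF _ d])
  qed
  have R0: "resolvent 1 d x = 0" for x
  proof -
    obtain B where "(\<integral>\<^sup>+y. majorant_mass 1 (3 / 2) (x - y) * ennreal (cmod (d y)) \<partial>lborel) \<le> ennreal B"
      using majorant_mass_L2_pairing[of 1] d by auto
    then have fin: "(\<integral>\<^sup>+y. majorant_mass 1 (3 / 2) (y - x) * ennreal (cmod (d y)) \<partial>lborel) < \<infinity>"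
      unfolding majorant_mass_minus[of 1 "3 / 2" _ x] by (rule le_less_trans) simp
    have m: "(\<lambda>(y, \<theta>). resolvent_density 1 \<theta> y x) \<in> borel_measurable (lborel \<Otimes>\<^sub>M lborel)" by measurable
    have "resolvent 1 d x = (LINT y|lborel. complex_of_real (theta_integral (resolvent_density 1) y x) * d y)"
      unfolding resolvent_def kernel_op_def resolvent_kernel_def theta_integral_def resolvent_density_def
      by (simp add: mehler_commute[of 1 _ x])
    also have "\<dots> = (LINT \<theta>|lborel. complex_of_real (indicator {0<..<1} \<theta>) * (LINT y|lborel. complex_of_real (resolvent_density 1 \<theta> y x) * d y))"
      by (rule theta_integral_swap(1)[where D = "resolvent_density 1" and y = x and g = d, OF bd less_imp_le[OF C] m _ fin]) measurable
    also have "\<dots> = (LINT \<theta>|(lborel :: real measure). 0)"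
    proof (intro Bochner_Integration.integral_cong refl)
      fix \<theta> :: real
      show "complex_of_real (indicator {0<..<1} \<theta>) * (LINT y|lborel. complex_of_real (resolvent_density 1 \<theta> y x) * d y) = 0"
      proof (cases "0 < \<theta> \<and> \<theta> < 1")
        case True
        have "(LINT y|lborel. complex_of_real (resolvent_density 1 \<theta> y x) * d y)
            = complex_of_real (2 / (1 - \<theta>\<^sup>2)) * (LINT y|lborel. complex_of_real (mehler 1 \<theta> y x) * d y - complex_of_real (mehler 1 1 y x) * d y)"
          by (subst integral_mult_right_zero[symmetric])
             (simp add: resolvent_density_def algebra_simps del: times_divide_eq_left times_divide_eq_right of_real_divide)
        also have "\<dots> = 0"
          using mehler_int[of \<theta> x] mehler_int[of 1 x] mehler0 True by (simp add: Bochner_Integration.integral_diff)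
        finally show ?thesis by simp
      qed auto
    qed
    finally show ?thesis by simp
  qed
  have g0: "(LINT y|lborel. d y * complex_of_real (ground_state 1 y)) = 0"
  proof -
    have "(LINT y|lborel. d y * complex_of_real (ground_state 1 y))
        = complex_of_real (sqrt (sqrt (1 / pi) ^ 3)) * (LINT y|lborel. d y * complex_of_real (exp (- (1 / 2) * (y \<bullet> y) + 0 \<bullet> y)))"
      by (subst integral_mult_right_zero[symmetric]) (simp add: ground_state_def mult_ac)
    then show ?thesis using zero[of "1 / 2" 0] by simp
  qed
  show "(LINT x|lborel. d x * \<phi> x) = 0"
    using resolvent_equation[of 1, OF _ d \<phi>] R0 g0 by simp
qed

subsection \<open>Fourier inversion and multipliers\<close>

text \<open>Modulation by \<open>y\<close> in space becomes translation by \<open>y\<close> in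
  frequency, so these functions transform into multiples of all shifted Gaussians.\<close>

definition gaussian_wave :: "real \<Rightarrow> real ^ 3 \<Rightarrow> field3" where
  "gaussian_wave c y x = complex_of_real (exp (- c * (norm x)\<^sup>2)) * cis (x \<bullet> y)"

lemma gaussian_wave_fourier:
  assumes c: "0 < c"
  shows "is_fourier (gaussian_wave c y) (\<lambda>\<xi>. complex_of_real (sqrt (pi / c) ^ 3 * exp (- (norm (y - \<xi>))\<^sup>2 / (4 * c))))"
proof -
  have "FT (gaussian_wave c y) = (\<lambda>\<xi>. complex_of_real (sqrt (pi / c) ^ 3 * exp (- (norm (y - \<xi>))\<^sup>2 / (4 * c))))"
  proof
    fix \<xi>
    have "FT (gaussian_wave c y) \<xi> = (LINT x|lborel. complex_of_real (exp (- c * (norm x)\<^sup>2)) * cis (x \<bullet> (y - \<xi>)))"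
      unfolding FT_def gaussian_wave_def
      by (intro Bochner_Integration.integral_cong refl) (simp add: inner_diff_right cis_mult mult.assoc)
    then show "FT (gaussian_wave c y) \<xi> = complex_of_real (sqrt (pi / c) ^ 3 * exp (- (norm (y - \<xi>))\<^sup>2 / (4 * c)))"
      by (simp only: gaussian_fourier(2)[OF c])
  qed
  moreover have "is_fourier (gaussian_wave c y) (FT (gaussian_wave c y))"
    unfolding gaussian_wave_def[abs_def] by (intro is_fourier_FT gaussian_L2 gaussian_fourier c)
  ultimately show ?thesis by simp
qed

lemma exp_quadratic_shift:
  fixes x b :: "real ^ 3"
  assumes "0 < c"
  shows "exp (- c * (x \<bullet> x) + b \<bullet> x) = exp (b \<bullet> b / (4 * c)) * exp (- c * (norm ((1 / (2 * c)) *\<^sub>R b - x))\<^sup>2)"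
proof -
  have "- c * (norm ((1 / (2 * c)) *\<^sub>R b - x))\<^sup>2 = - (b \<bullet> b / (4 * c)) + (- c * (x \<bullet> x) + b \<bullet> x)"
    using assms by (simp add: power2_norm_eq_inner inner_diff inner_commute field_simps)
  then show ?thesis by (simp flip: exp_add)
qed

lemma weakly_zero_shifted_gaussian:
  assumes d: "d \<in> L2"
    and zero: "\<And>c y. 0 < c \<Longrightarrow> (LINT x|lborel. d x * complex_of_real (exp (- c * (norm (y - x))\<^sup>2))) = 0"
  shows "AE x in lborel. d x = 0"
proof (rule weakly_zero_gaussian[OF d])
  fix c :: real and b :: "real ^ 3" assume c: "0 < c"
  have "(LINT y|lborel. d y * complex_of_real (exp (- c * (y \<bullet> y) + b \<bullet> y)))
      = complex_of_real (exp (b \<bullet> b / (4 * c))) * (LINT x|lborel. d x * complex_of_real (exp (- c * (norm ((1 / (2 * c)) *\<^sub>R b - x))\<^sup>2)))"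
    unfolding exp_quadratic_shift[OF c]
    by (subst integral_mult_right_zero[symmetric]) (simp only: of_real_mult mult_ac)
  then show "(LINT y|lborel. d y * complex_of_real (exp (- c * (y \<bullet> y) + b \<bullet> y))) = 0"
    using zero[OF c] by simp
qed

text \<open>The multiplication formula against modulated Gaussians moves the transform from
  \<open>d\<close> to the Gaussians, so \<open>d\<close> pairs to zero with every shifted
  Gaussian.\<close>

lemma is_fourier_AE_zero:
  assumes F: "is_fourier d D" and zero: "AE \<xi> in lborel. D \<xi> = 0"
  shows "AE x in lborel. d x = 0"
proof (rule weakly_zero_shifted_gaussian)
  show "d \<in> L2" by (rule is_fourierD[OF F])
  fix c :: real and y :: "real ^ 3" assume c: "0 < c"
  \<comment> \<open>The reciprocal rate, chosen so that the transform of the wave decays with the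
    given rate \<open>c\<close>.\<close>
  let ?c = "1 / (4 * c)"
  have c': "0 < ?c" using c by simp
  have "(LINT \<xi>|lborel. D \<xi> * gaussian_wave ?c y \<xi>) = (LINT \<xi>|(lborel :: (real ^ 3) measure). 0)"
  proof (rule integral_cong_AE)
    show "AE x in lborel. D x * gaussian_wave ?c y x = 0" using zero by eventually_elim simp
    show "(\<lambda>x. D x * gaussian_wave ?c y x) \<in> borel_measurable lborel"
      by (rule borel_measurable_integrable[OF L2_mult_integrable[OF is_fourierD(2)[OF F] is_fourierD(1)[OF gaussian_wave_fourier[OF c']]]])
  qed simp
  then have "0 = (LINT x|lborel. d x * complex_of_real (sqrt (pi / ?c) ^ 3 * exp (- (norm (y - x))\<^sup>2 / (4 * ?c))))"
    unfolding is_fourier_integral_mult[OF F gaussian_wave_fourier[OF c']] by simp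
  also have "\<dots> = complex_of_real (sqrt (pi / ?c) ^ 3) * (LINT x|lborel. d x * complex_of_real (exp (- c * (norm (y - x))\<^sup>2)))"
    using c by (subst integral_mult_right_zero[symmetric]) (simp add: mult_ac)
  finally show "(LINT x|lborel. d x * complex_of_real (exp (- c * (norm (y - x))\<^sup>2))) = 0" using c by simp
qed

lemma shifted_gaussian_fourier:
  assumes c: "0 < c"
  shows "is_fourier (\<lambda>x. complex_of_real (exp (- c * (norm (y - x))\<^sup>2)))
    (\<lambda>\<xi>. complex_of_real (sqrt (pi / c) ^ 3) * cnj (gaussian_wave (1 / (4 * c)) y \<xi>))"
proof -
  let ?E = "\<lambda>x. complex_of_real (exp (- c * (norm (y - x))\<^sup>2))"
  have [measurable]: "?E \<in> borel_measurable borel" by measurable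
  \<comment> \<open>The exponents 1 and 2 give membership in L1 and in L2 from one
    computation.\<close>
  have E: "(\<integral>\<^sup>+x. ennreal (cmod (?E x)) ^ k \<partial>lborel) < \<infinity>" if "0 < k" for k :: nat
  proof -
    have "(\<integral>\<^sup>+x. ennreal (cmod (?E x)) ^ k \<partial>lborel) = (\<integral>\<^sup>+x. ennreal (exp (- (real k * c) * (norm (y - x))\<^sup>2)) \<partial>lborel)"
      by (intro nn_integral_cong) (simp add: ennreal_power mult.assoc flip: exp_of_nat_mult)
    also have "\<dots> = (\<integral>\<^sup>+z. ennreal (exp (- (real k * c) * (norm z)\<^sup>2)) \<partial>(lborel :: (real ^ 3) measure))"
      by (rule nn_integral_reflect[of "\<lambda>z. ennreal (exp (- (real k * c) * (norm z)\<^sup>2))" y]) measurable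
    also have "\<dots> < \<infinity>" using gaussian_integral(3)[of "real k * c"] c that by simp
    finally show ?thesis .
  qed
  have L2: "?E \<in> L2"
  proof -
    have "integrable lborel (\<lambda>x. (cmod (?E x))\<^sup>2)"
      using E[of 2] by (intro integrableI_bounded) (auto simp: ennreal_power)
    then show ?thesis by (simp add: L2_def)
  qed
  have L1: "integrable lborel ?E" using E[of 1] by (intro integrableI_bounded) auto
  have "FT ?E = (\<lambda>\<xi>. complex_of_real (sqrt (pi / c) ^ 3) * cnj (gaussian_wave (1 / (4 * c)) y \<xi>))"
  proof
    fix \<xi>
    have "FT ?E \<xi> = \<bar>1\<bar> ^ 3 *\<^sub>R (LINT z|lborel. ?E (y + 1 *\<^sub>R z) * cis (- ((y + 1 *\<^sub>R z) \<bullet> \<xi>)))"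
      unfolding FT_def by (rule integral_affine) auto
    also have "\<dots> = (LINT z|lborel. cis (- (y \<bullet> \<xi>)) * (complex_of_real (exp (- c * (norm z)\<^sup>2)) * cis (z \<bullet> (- \<xi>))))"
    proof -
      have "cis (- ((y + 1 *\<^sub>R z) \<bullet> \<xi>)) = cis (- (y \<bullet> \<xi>)) * cis (z \<bullet> (- \<xi>))" for z
        by (simp add: inner_add_left cis_mult)
      then show ?thesis by (simp add: mult.left_commute)
    qed
    also have "\<dots> = cis (- (y \<bullet> \<xi>)) * complex_of_real (sqrt (pi / c) ^ 3 * exp (- (norm \<xi>)\<^sup>2 / (4 * c)))"
      unfolding integral_mult_right_zero gaussian_fourier(2)[OF c] by simp
    also have "\<dots> = complex_of_real (sqrt (pi / c) ^ 3) * cnj (gaussian_wave (1 / (4 * c)) y \<xi>)"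
      by (simp add: gaussian_wave_def cis_cnj inner_commute)
    finally show "FT ?E \<xi> = complex_of_real (sqrt (pi / c) ^ 3) * cnj (gaussian_wave (1 / (4 * c)) y \<xi>)" .
  qed
  with is_fourier_FT[OF L2 L1] show ?thesis by simp
qed

text \<open>The inverse transform is, up to the factor \<open>(2 * pi) ^ 3\<close>, the transform
  conjugated before and after. That the result has transform \<open>F\<close> is checked only
  against shifted Gaussians, where everything is explicit, and these are total.\<close>

lemma fourier_inversion:
  assumes F: "F \<in> L2"
  shows "\<exists>h. is_fourier h F \<and> L2_norm h \<le> L2_norm F / plancherel_const"
proof -
  obtain G where G: "is_fourier (\<lambda>\<xi>. cnj (F \<xi>)) G" using is_fourier_exists[OF L2_cnj(1)[OF F]] by blast
  define h where "h = (\<lambda>x. complex_of_real (1 / (2 * pi) ^ 3) * cnj (G x))"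
  have h: "h \<in> L2" unfolding h_def by (intro L2_scale L2_cnj is_fourierD[OF G])
  obtain H where H: "is_fourier h H" using is_fourier_exists[OF h] by blast
  note HL = is_fourierD[OF H]
  have "AE x in lborel. H x - F x = 0"
  proof (rule weakly_zero_shifted_gaussian[OF L2_diff(1)[OF HL(2) F]])
    fix c :: real and y :: "real ^ 3" assume c: "0 < c"
    let ?E = "\<lambda>x. complex_of_real (exp (- c * (norm (y - x))\<^sup>2))"
    let ?w = "gaussian_wave (1 / (4 * c)) y"
    let ?s = "complex_of_real (sqrt (pi / c) ^ 3)"
    have c': "0 < 1 / (4 * c)" using c by simp
    note E = shifted_gaussian_fourier[OF c, of y]
    note w = gaussian_wave_fourier[OF c', of y]
    have cnjF: "integrable lborel (\<lambda>x. cnj (F x) * ?E x)"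
      by (intro L2_mult_integrable L2_cnj F is_fourierD[OF E])
    have "(LINT \<xi>|lborel. H \<xi> * ?E \<xi>) = (LINT x|lborel. h x * (?s * cnj (?w x)))"
      by (rule is_fourier_integral_mult[OF H E])
    also have "\<dots> = (complex_of_real (1 / (2 * pi) ^ 3) * ?s) * (LINT x|lborel. cnj (G x * ?w x))"
      unfolding h_def by (subst integral_mult_right_zero[symmetric]) (simp add: mult_ac)
    also have "(LINT x|lborel. cnj (G x * ?w x)) = cnj (LINT x|lborel. G x * ?w x)"
      by (rule Bochner_Integration.integral_cnj)
    also have "(LINT x|lborel. G x * ?w x) = (LINT x|lborel. cnj (F x) * complex_of_real (sqrt (pi / (1 / (4 * c))) ^ 3 * exp (- (norm (y - x))\<^sup>2 / (4 * (1 / (4 * c))))))"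
      by (rule is_fourier_integral_mult[OF G w])
    also have "\<dots> = complex_of_real (sqrt (pi / (1 / (4 * c))) ^ 3) * (LINT x|lborel. cnj (F x) * ?E x)"
      using c by (subst integral_mult_right_zero[symmetric]) (simp add: mult_ac)
    also have "(LINT x|lborel. cnj (F x) * ?E x) = cnj (LINT x|lborel. F x * ?E x)"
      by (subst Bochner_Integration.integral_cnj[symmetric]) (simp del: of_real_exp)
    also have "(complex_of_real (1 / (2 * pi) ^ 3) * ?s) * cnj (complex_of_real (sqrt (pi / (1 / (4 * c))) ^ 3) * cnj (LINT x|lborel. F x * ?E x))
        = complex_of_real (1 / (2 * pi) ^ 3 * (sqrt (pi / c) * sqrt (pi / (1 / (4 * c)))) ^ 3) * (LINT x|lborel. F x * ?E x)"
      by (simp add: power_mult_distrib)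
    also have "sqrt (pi / c) * sqrt (pi / (1 / (4 * c))) = sqrt ((2 * pi)\<^sup>2)"
    proof -
      have "pi / c * (pi / (1 / (4 * c))) = (2 * pi)\<^sup>2" using c by (simp add: field_simps power2_eq_square)
      then show ?thesis by (simp only: real_sqrt_mult[symmetric])
    qed
    also have "sqrt ((2 * pi)\<^sup>2) = 2 * pi" by (rule real_sqrt_unique) auto
    finally have "(LINT \<xi>|lborel. H \<xi> * ?E \<xi>) = (LINT x|lborel. F x * ?E x)" by simp
    then show "(LINT x|lborel. (H x - F x) * ?E x) = 0"
      unfolding left_diff_distrib
      by (subst Bochner_Integration.integral_diff[OF L2_mult_integrable[OF HL(2) is_fourierD(1)[OF E]] L2_mult_integrable[OF F is_fourierD(1)[OF E]]]) simp
  qed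
  then have "AE \<xi> in lborel. F \<xi> = H \<xi>" by eventually_elim simp
  then have "is_fourier h F" by (rule is_fourier_cong_AE[OF H _ L2_measurable[OF F]])
  moreover have "L2_norm h \<le> L2_norm F / plancherel_const"
  proof -
    have "L2_norm h = 1 / (2 * pi) ^ 3 * L2_norm G"
      unfolding h_def by (simp add: L2_scale L2_cnj is_fourierD[OF G] del: of_real_divide of_real_power)
    also have "\<dots> \<le> 1 / (2 * pi) ^ 3 * (plancherel_const * L2_norm F)"
      using is_fourier_norm_le[OF G] by (intro mult_left_mono) (simp_all add: L2_cnj F)
    also have "\<dots> = L2_norm F / plancherel_const"
      unfolding plancherel_const_square[symmetric] using plancherel_const_pos by (simp add: power2_eq_square)
    finally show ?thesis .
  qed
  ultimately show ?thesis by blast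
qed

lemma is_fourier_unique_left:
  assumes h: "is_fourier h H" and h': "is_fourier h' H'" and eq: "AE \<xi> in lborel. H \<xi> = H' \<xi>"
  shows "AE x in lborel. h x = h' x"
proof -
  have "AE x in lborel. h x - h' x = 0"
  proof (rule is_fourier_AE_zero[OF is_fourier_diff[OF h h']])
    show "AE \<xi> in lborel. H \<xi> - H' \<xi> = 0" using eq by eventually_elim simp
  qed
  then show ?thesis by eventually_elim simp
qed

text \<open>By injectivity \<open>h\<close> is the function produced by inversion and inherits its
  norm bound. With \<open>is_fourier_norm_le\<close> this completes Plancherel's identity.\<close>

lemma is_fourier_norm_ge:
  assumes h: "is_fourier h H"
  shows "L2_norm h \<le> L2_norm H / plancherel_const"
proof -
  obtain k where k: "is_fourier k H" "L2_norm k \<le> L2_norm H / plancherel_const"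
    using fourier_inversion[OF is_fourierD(2)[OF h]] by blast
  have "AE x in lborel. h x = k x" by (rule is_fourier_unique_left[OF h k(1)]) simp
  then have "L2_norm h = L2_norm k"
    by (intro L2_cong_AE(2) is_fourierD[OF k(1)] L2_measurable is_fourierD[OF h])
  with k show ?thesis by simp
qed

lemma is_fourier_scale:
  assumes "is_fourier f F"
  shows "is_fourier (\<lambda>x. c * f x) (\<lambda>\<xi>. c * F \<xi>)"
proof -
  note D = is_fourierD[OF assms]
  have "L2_norm (\<lambda>\<xi>. FT (trunc R (\<lambda>x. c * f x)) \<xi> - c * F \<xi>) = cmod c * L2_norm (\<lambda>\<xi>. FT (trunc R f) \<xi> - F \<xi>)" for R
  proof -
    have "FT (trunc R (\<lambda>x. c * f x)) \<xi> = c * FT (trunc R f) \<xi>" for \<xi>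
      unfolding FT_def trunc_def by (subst integral_mult_right_zero[symmetric]) (simp add: mult_ac)
    then show ?thesis
      using L2_scale(2)[OF L2_diff(1)[OF FT_L2[OF D(1)] D(2)], of c R] by (simp add: right_diff_distrib)
  qed
  moreover have "((\<lambda>R. cmod c * L2_norm (\<lambda>\<xi>. FT (trunc R f) \<xi> - F \<xi>)) \<longlongrightarrow> 0) at_top"
    using tendsto_mult_left[OF D(3), of "cmod c"] by simp
  ultimately show ?thesis using D by (simp add: is_fourier_iff L2_scale)
qed

lemma L2_reflect:
  assumes "f \<in> L2" shows "(\<lambda>x. f (- x)) \<in> L2" "L2_norm (\<lambda>x. f (- x)) = L2_norm f"
proof -
  note [measurable] = L2_measurable[OF assms]
  have m: "(\<lambda>x. f (- x)) \<in> borel_measurable borel" by measurable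
  have "(\<integral>\<^sup>+x. ennreal (cmod (f (- x))) ^ 2 \<partial>lborel) = ennreal (L2_norm f) ^ 2"
    using nn_integral_reflect[of "\<lambda>x. ennreal (cmod (f x)) ^ 2" 0] by (simp add: nn_integral_L2[OF assms])
  then show L2: "(\<lambda>x. f (- x)) \<in> L2" by (intro L2_boundI(1)[OF m, of "L2_norm f"]) auto
  from nn_integral_L2[OF this] \<open>(\<integral>\<^sup>+x. ennreal (cmod (f (- x))) ^ 2 \<partial>lborel) = ennreal (L2_norm f) ^ 2\<close>
  have "(L2_norm (\<lambda>x. f (- x)))\<^sup>2 = (L2_norm f)\<^sup>2" by (simp add: ennreal_power)
  then show "L2_norm (\<lambda>x. f (- x)) = L2_norm f" by (simp add: power2_eq_iff_nonneg)
qed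

lemma is_fourier_cnj:
  assumes "is_fourier f F"
  shows "is_fourier (\<lambda>x. cnj (f x)) (\<lambda>\<xi>. cnj (F (- \<xi>)))"
proof -
  note D = is_fourierD[OF assms]
  have "L2_norm (\<lambda>\<xi>. FT (trunc R (\<lambda>x. cnj (f x))) \<xi> - cnj (F (- \<xi>))) = L2_norm (\<lambda>\<xi>. FT (trunc R f) \<xi> - F \<xi>)" for R
  proof -
    have "FT (trunc R (\<lambda>x. cnj (f x))) \<xi> = cnj (FT (trunc R f) (- \<xi>))" for \<xi>
      unfolding FT_def trunc_def
      by (subst Bochner_Integration.integral_cnj[symmetric], intro Bochner_Integration.integral_cong refl)
         (auto simp: cis_cnj indicator_def)
    then have "(\<lambda>\<xi>. FT (trunc R (\<lambda>x. cnj (f x))) \<xi> - cnj (F (- \<xi>))) = (\<lambda>\<xi>. cnj (FT (trunc R f) (- \<xi>) - F (- \<xi>)))" by simp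
    then show ?thesis
      using L2_cnj(2)[OF L2_reflect(1)[OF L2_diff(1)[OF FT_L2[OF D(1), of R] D(2)]]] L2_reflect(2)[OF L2_diff(1)[OF FT_L2[OF D(1), of R] D(2)]]
      by simp
  qed
  with D show ?thesis by (simp add: is_fourier_iff L2_cnj L2_reflect)
qed

text \<open>Inversion supplies the function whose existence the choice in the definition
  presupposes. The Plancherel constants of the two transforms cancel, so the operator norm is
  bounded by the supremum of the symbol.\<close>

lemma fourier_multiplier_properties:
  assumes [measurable]: "m \<in> borel_measurable borel" and m: "\<And>\<xi>. cmod (m \<xi>) \<le> B" and f: "f \<in> L2"
  shows "\<exists>F. is_fourier f F \<and> is_fourier (fourier_multiplier m f) (\<lambda>\<xi>. m \<xi> * F \<xi>)"
    and "fourier_multiplier m f \<in> L2" and "L2_norm (fourier_multiplier m f) \<le> B * L2_norm f"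
proof -
  have B: "0 \<le> B" using order.trans[OF norm_ge_zero m] .
  obtain F where F: "is_fourier f F" using is_fourier_exists[OF f] by blast
  have mF: "(\<lambda>\<xi>. m \<xi> * F \<xi>) \<in> L2" "L2_norm (\<lambda>\<xi>. m \<xi> * F \<xi>) \<le> B * L2_norm F" if F: "is_fourier f F" for F
  proof -
    note [measurable] = L2_measurable[OF is_fourierD(2)[OF F]]
    have "(\<lambda>\<xi>. m \<xi> * F \<xi>) \<in> borel_measurable borel" by measurable
    moreover have "AE \<xi> in lborel. cmod (m \<xi> * F \<xi>) \<le> B * cmod (F \<xi>)"
      using m by (intro AE_I2) (simp add: norm_mult mult_right_mono)
    ultimately show "(\<lambda>\<xi>. m \<xi> * F \<xi>) \<in> L2" "L2_norm (\<lambda>\<xi>. m \<xi> * F \<xi>) \<le> B * L2_norm F"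
      using is_fourierD(2)[OF F] B by (auto intro: L2_mono)
  qed
  have "\<exists>h F. is_fourier f F \<and> is_fourier h (\<lambda>\<xi>. m \<xi> * F \<xi>)"
    using fourier_inversion[OF mF(1)[OF F]] F by blast
  from someI_ex[OF this]
  show *: "\<exists>F. is_fourier f F \<and> is_fourier (fourier_multiplier m f) (\<lambda>\<xi>. m \<xi> * F \<xi>)"
    unfolding fourier_multiplier_def .
  then obtain F' where F': "is_fourier f F'" and h: "is_fourier (fourier_multiplier m f) (\<lambda>\<xi>. m \<xi> * F' \<xi>)" by blast
  show "fourier_multiplier m f \<in> L2" by (rule is_fourierD[OF h])
  have "L2_norm (fourier_multiplier m f) \<le> L2_norm (\<lambda>\<xi>. m \<xi> * F' \<xi>) / plancherel_const"
    by (rule is_fourier_norm_ge[OF h])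
  also have "\<dots> \<le> (B * (plancherel_const * L2_norm f)) / plancherel_const"
    using mF(2)[OF F'] is_fourier_norm_le[OF F'] B plancherel_const_pos
    by (intro divide_right_mono) (auto intro: order.trans mult_left_mono)
  finally show "L2_norm (fourier_multiplier m f) \<le> B * L2_norm f" using plancherel_const_pos by simp
qed

text \<open>Identifies the chosen representative, up to a null set, with any function having the
  right transform. Linearity and reality of multipliers then reduce to exhibiting such a
  function.\<close>

lemma fourier_multiplier_eqI:
  assumes m: "m \<in> borel_measurable borel" "\<And>\<xi>. cmod (m \<xi>) \<le> B"
    and f: "is_fourier f F" and h: "is_fourier h (\<lambda>\<xi>. m \<xi> * F \<xi>)"
  shows "AE x in lborel. fourier_multiplier m f x = h x"
proof -
  obtain F' where F': "is_fourier f F'" "is_fourier (fourier_multiplier m f) (\<lambda>\<xi>. m \<xi> * F' \<xi>)"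
    using fourier_multiplier_properties(1)[OF m is_fourierD(1)[OF f]] by blast
  show ?thesis
  proof (rule is_fourier_unique_left[OF F'(2) h])
    show "AE \<xi> in lborel. m \<xi> * F' \<xi> = m \<xi> * F \<xi>"
      using is_fourier_unique[OF F'(1) f] by eventually_elim simp
  qed
qed

lemma fourier_multiplier_diff:
  assumes m: "m \<in> borel_measurable borel" "\<And>\<xi>. cmod (m \<xi>) \<le> B" and f: "f \<in> L2" and g: "g \<in> L2"
  shows "AE x in lborel. fourier_multiplier m (\<lambda>x. f x - g x) x = fourier_multiplier m f x - fourier_multiplier m g x"
proof -
  obtain F where F: "is_fourier f F" "is_fourier (fourier_multiplier m f) (\<lambda>\<xi>. m \<xi> * F \<xi>)"
    using fourier_multiplier_properties(1)[OF m f] by blast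
  obtain G where G: "is_fourier g G" "is_fourier (fourier_multiplier m g) (\<lambda>\<xi>. m \<xi> * G \<xi>)"
    using fourier_multiplier_properties(1)[OF m g] by blast
  show ?thesis
    using is_fourier_diff[OF F(2) G(2)]
    by (intro fourier_multiplier_eqI[OF m is_fourier_diff[OF F(1) G(1)]]) (simp add: right_diff_distrib)
qed

lemma fourier_multiplier_scale:
  assumes m: "m \<in> borel_measurable borel" "\<And>\<xi>. cmod (m \<xi>) \<le> B" and f: "f \<in> L2"
  shows "AE x in lborel. fourier_multiplier m (\<lambda>x. c * f x) x = c * fourier_multiplier m f x"
proof -
  obtain F where F: "is_fourier f F" "is_fourier (fourier_multiplier m f) (\<lambda>\<xi>. m \<xi> * F \<xi>)"
    using fourier_multiplier_properties(1)[OF m f] by blast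
  show ?thesis
    using is_fourier_scale[OF F(2), of c]
    by (intro fourier_multiplier_eqI[OF m is_fourier_scale[OF F(1)]]) (simp add: mult_ac)
qed

text \<open>Conjugation in space is conjugation and reflection in frequency, under which the symbol
  is invariant.\<close>

lemma fourier_multiplier_real:
  assumes m: "m \<in> borel_measurable borel" "\<And>\<xi>. cmod (m \<xi>) \<le> B" "\<And>\<xi>. cnj (m (- \<xi>)) = m \<xi>"
    and f: "f \<in> L2" "\<And>x. cnj (f x) = f x"
  shows "AE x in lborel. cnj (fourier_multiplier m f x) = fourier_multiplier m f x"
proof -
  obtain F where F: "is_fourier f F" "is_fourier (fourier_multiplier m f) (\<lambda>\<xi>. m \<xi> * F \<xi>)"
    using fourier_multiplier_properties(1)[OF m(1,2) f(1)] by blast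
  have "is_fourier f (\<lambda>\<xi>. cnj (F (- \<xi>)))" using is_fourier_cnj[OF F(1)] f(2) by simp
  moreover have "is_fourier (\<lambda>x. cnj (fourier_multiplier m f x)) (\<lambda>\<xi>. m \<xi> * cnj (F (- \<xi>)))"
    using is_fourier_cnj[OF F(2)] m(3) by simp
  ultimately have "AE x in lborel. fourier_multiplier m f x = cnj (fourier_multiplier m f x)"
    by (rule fourier_multiplier_eqI[OF m(1,2)])
  then show ?thesis by eventually_elim simp
qed

subsection \<open>The nonlinearity\<close>

lemma dipolar_symbol_bound: "\<bar>dipolar_symbol \<xi>\<bar> \<le> 8 / 3 * pi"
proof -
  have n: "(norm \<xi>)\<^sup>2 = (\<xi> $ 1)\<^sup>2 + (\<xi> $ 2)\<^sup>2 + (\<xi> $ 3)\<^sup>2"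
    unfolding power2_norm_eq_inner inner_vec_3 by (simp add: power2_eq_square)
  have "\<bar>2 * (\<xi> $ 3)\<^sup>2 - (\<xi> $ 1)\<^sup>2 - (\<xi> $ 2)\<^sup>2\<bar> \<le> 2 * (norm \<xi>)\<^sup>2"
  proof -
    have "\<bar>2 * C - A - B\<bar> \<le> 2 * (A + B + C)" if "0 \<le> A" "0 \<le> B" "0 \<le> C" for A B C :: real
      using that by (smt (verit))
    then show ?thesis unfolding n by simp
  qed
  \<comment> \<open>At the origin the quotient is 0 by the convention for division by zero.\<close>
  then have "\<bar>(2 * (\<xi> $ 3)\<^sup>2 - (\<xi> $ 1)\<^sup>2 - (\<xi> $ 2)\<^sup>2) / (norm \<xi>)\<^sup>2\<bar> \<le> 2"
    by (cases "\<xi> = 0") (simp_all add: divide_le_eq)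
  then have "4 / 3 * pi * \<bar>(2 * (\<xi> $ 3)\<^sup>2 - (\<xi> $ 1)\<^sup>2 - (\<xi> $ 2)\<^sup>2) / (norm \<xi>)\<^sup>2\<bar> \<le> 4 / 3 * pi * 2"
    by (intro mult_left_mono) auto
  then show ?thesis unfolding dipolar_symbol_def abs_mult by simp
qed

lemma dipolar_symbol_conditions:
  "(\<lambda>\<xi>. complex_of_real (dipolar_symbol \<xi>)) \<in> borel_measurable borel"
  "cmod (complex_of_real (dipolar_symbol \<xi>)) \<le> 8 / 3 * pi"
  "cnj (complex_of_real (dipolar_symbol (- \<xi>))) = complex_of_real (dipolar_symbol \<xi>)"
proof -
  have [measurable]: "(\<lambda>\<xi>::real^3. \<xi> $ j) \<in> borel_measurable borel" for j
    unfolding inner_axis_one[symmetric] by measurable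
  show "(\<lambda>\<xi>. complex_of_real (dipolar_symbol \<xi>)) \<in> borel_measurable borel"
    unfolding dipolar_symbol_def by measurable
  show "cmod (complex_of_real (dipolar_symbol \<xi>)) \<le> 8 / 3 * pi"
    unfolding norm_of_real by (rule dipolar_symbol_bound)
qed (simp add: dipolar_symbol_def)

lemmas dipolar_conv_L2 = fourier_multiplier_properties(2,3)[OF dipolar_symbol_conditions(1,2), folded dipolar_conv_def]
lemmas dipolar_conv_diff = fourier_multiplier_diff[OF dipolar_symbol_conditions(1,2), folded dipolar_conv_def]
lemmas dipolar_conv_scale = fourier_multiplier_scale[OF dipolar_symbol_conditions(1,2), folded dipolar_conv_def]
lemmas dipolar_conv_real = fourier_multiplier_real[OF dipolar_symbol_conditions, folded dipolar_conv_def]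

text \<open>The convolution is a chosen representative and is real only almost everywhere. Taking
  its real part makes the potential real at every point, as the fixed point argument on real
  functions requires.\<close>

definition mean_field :: "real \<Rightarrow> real \<Rightarrow> field3 \<Rightarrow> field3" where
  "mean_field l1 l2 u x = complex_of_real (l1 * (cmod (u x))\<^sup>2 + l2 * Re (dipolar_conv (modulus_sq u) x))"

definition nonlinearity :: "real \<Rightarrow> real \<Rightarrow> field3 \<Rightarrow> field3" where
  "nonlinearity l1 l2 u x = mean_field l1 l2 u x * u x"

text \<open>A bound on L2 for the linear map from the density \<open>modulus_sq u\<close> to the
  potential; \<open>8 / 3 * pi\<close> is the largest absolute value of the dipolar symbol.\<close>

definition coupling :: "real \<Rightarrow> real \<Rightarrow> real" where
  "coupling l1 l2 = \<bar>l1\<bar> + \<bar>l2\<bar> * (8 / 3 * pi)"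

lemma coupling_nonneg: "0 \<le> coupling l1 l2"
  by (simp add: coupling_def)

text \<open>One of the two factors is estimated pointwise; without such a bound the density of an L2
  function would only be in L1, where the convolution is not controlled.\<close>

lemma modulus_sq_L2:
  assumes u: "u \<in> L2" and S: "\<And>x. cmod (u x) \<le> S"
  shows "modulus_sq u \<in> L2" "L2_norm (modulus_sq u) \<le> S * L2_norm u"
proof -
  note [measurable] = L2_measurable[OF u]
  have S0: "0 \<le> S" using order.trans[OF norm_ge_zero S] .
  have m: "modulus_sq u \<in> borel_measurable borel" unfolding modulus_sq_def[abs_def] by measurable
  have "AE x in lborel. cmod (modulus_sq u x) \<le> S * cmod (u x)"
    by (intro AE_I2) (simp add: modulus_sq_def power2_eq_square norm_mult mult_right_mono S)
  from L2_mono[OF m u S0 this]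
  show "modulus_sq u \<in> L2" "L2_norm (modulus_sq u) \<le> S * L2_norm u" by blast+
qed

lemma modulus_sq_diff_L2:
  assumes u: "u \<in> L2" "\<And>x. cmod (u x) \<le> S" and v: "v \<in> L2" "\<And>x. cmod (v x) \<le> S"
  shows "L2_norm (\<lambda>x. modulus_sq u x - modulus_sq v x) \<le> 2 * S * L2_norm (\<lambda>x. u x - v x)"
proof (rule L2_mono(2))
  show "0 \<le> 2 * S" using order.trans[OF norm_ge_zero u(2)] by simp
  show "(\<lambda>x. u x - v x) \<in> L2" by (rule L2_diff(1)[OF u(1) v(1)])
  show "(\<lambda>x. modulus_sq u x - modulus_sq v x) \<in> borel_measurable borel"
    by (rule L2_measurable[OF L2_diff(1)[OF modulus_sq_L2(1)[OF u] modulus_sq_L2(1)[OF v]]])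
  show "AE x in lborel. cmod (modulus_sq u x - modulus_sq v x) \<le> 2 * S * cmod (u x - v x)"
  proof (intro AE_I2)
    fix x
    have "cmod (modulus_sq u x - modulus_sq v x) = \<bar>cmod (u x) + cmod (v x)\<bar> * \<bar>cmod (u x) - cmod (v x)\<bar>"
    proof -
      have "modulus_sq u x - modulus_sq v x = complex_of_real ((cmod (u x) + cmod (v x)) * (cmod (u x) - cmod (v x)))"
        by (simp add: modulus_sq_def power2_eq_square algebra_simps)
      then show ?thesis by (simp only: norm_of_real abs_mult)
    qed
    also have "\<dots> \<le> (2 * S) * cmod (u x - v x)"
      using add_mono[OF u(2)[of x] v(2)[of x]] order.trans[OF norm_ge_zero u(2)[of x]]
      by (intro mult_mono norm_triangle_ineq3) auto
    finally show "cmod (modulus_sq u x - modulus_sq v x) \<le> 2 * S * cmod (u x - v x)" .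
  qed
qed

lemma L2_Re:
  assumes "f \<in> L2"
  shows "(\<lambda>x. complex_of_real (Re (f x))) \<in> L2" "L2_norm (\<lambda>x. complex_of_real (Re (f x))) \<le> L2_norm f"
proof -
  note [measurable] = L2_measurable[OF assms]
  have m: "(\<lambda>x. complex_of_real (Re (f x))) \<in> borel_measurable borel" by measurable
  have "AE x in lborel. cmod (complex_of_real (Re (f x))) \<le> 1 * cmod (f x)"
    by (intro AE_I2) (simp add: abs_Re_le_cmod)
  from L2_mono[OF m assms _ this]
  show "(\<lambda>x. complex_of_real (Re (f x))) \<in> L2" "L2_norm (\<lambda>x. complex_of_real (Re (f x))) \<le> L2_norm f" by auto
qed

lemma mean_field_split:
  "mean_field l1 l2 u x = complex_of_real l1 * modulus_sq u x + complex_of_real l2 * complex_of_real (Re (dipolar_conv (modulus_sq u) x))"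
  by (simp add: mean_field_def modulus_sq_def)

lemma mean_field_L2:
  assumes u: "u \<in> L2" "\<And>x. cmod (u x) \<le> S"
  shows "mean_field l1 l2 u \<in> L2" "L2_norm (mean_field l1 l2 u) \<le> coupling l1 l2 * (S * L2_norm u)"
proof -
  note m = modulus_sq_L2[OF u]
  note k = dipolar_conv_L2[OF m(1)]
  note r = L2_Re[OF k(1)]
  show "mean_field l1 l2 u \<in> L2"
    unfolding mean_field_split[abs_def] by (intro L2_add L2_scale m r)
  have "L2_norm (mean_field l1 l2 u) \<le> \<bar>l1\<bar> * L2_norm (modulus_sq u) + \<bar>l2\<bar> * L2_norm (\<lambda>x. complex_of_real (Re (dipolar_conv (modulus_sq u) x)))"
    unfolding mean_field_split[abs_def]
    using L2_add(2)[OF L2_scale(1)[OF m(1), of "complex_of_real l1"] L2_scale(1)[OF r(1), of "complex_of_real l2"]]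
    by (simp add: L2_scale(2)[OF m(1)] L2_scale(2)[OF r(1)])
  also have "\<dots> \<le> \<bar>l1\<bar> * (S * L2_norm u) + \<bar>l2\<bar> * (8 / 3 * pi * (S * L2_norm u))"
    using m(2) order.trans[OF r(2) order.trans[OF k(2) mult_left_mono[OF m(2)]]]
    by (intro add_mono mult_left_mono) auto
  finally show "L2_norm (mean_field l1 l2 u) \<le> coupling l1 l2 * (S * L2_norm u)"
    by (simp add: coupling_def algebra_simps)
qed

lemma mean_field_diff_L2:
  assumes u: "u \<in> L2" "\<And>x. cmod (u x) \<le> S" and v: "v \<in> L2" "\<And>x. cmod (v x) \<le> S"
  shows "L2_norm (\<lambda>x. mean_field l1 l2 u x - mean_field l1 l2 v x) \<le> coupling l1 l2 * (2 * S * L2_norm (\<lambda>x. u x - v x))"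
proof -
  note mu = modulus_sq_L2[OF u] and mv = modulus_sq_L2[OF v]
  let ?d = "\<lambda>x. modulus_sq u x - modulus_sq v x"
  have d: "?d \<in> L2" by (intro L2_diff mu mv)
  note r = L2_Re[OF dipolar_conv_L2(1)[OF d]]
  have sum: "(\<lambda>x. complex_of_real l1 * ?d x + complex_of_real l2 * complex_of_real (Re (dipolar_conv ?d x))) \<in> L2"
    by (intro L2_add L2_scale d r)
  have "L2_norm (\<lambda>x. mean_field l1 l2 u x - mean_field l1 l2 v x)
      = L2_norm (\<lambda>x. complex_of_real l1 * ?d x + complex_of_real l2 * complex_of_real (Re (dipolar_conv ?d x)))"
  proof (rule L2_cong_AE(2)[OF sum])
    show "(\<lambda>x. mean_field l1 l2 u x - mean_field l1 l2 v x) \<in> borel_measurable borel"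
      by (rule L2_measurable[OF L2_diff(1)[OF mean_field_L2(1)[OF u] mean_field_L2(1)[OF v]]])
    show "AE x in lborel. mean_field l1 l2 u x - mean_field l1 l2 v x
        = complex_of_real l1 * ?d x + complex_of_real l2 * complex_of_real (Re (dipolar_conv ?d x))"
      using dipolar_conv_diff[OF mu(1) mv(1)]
    proof eventually_elim
      case (elim x)
      show ?case unfolding mean_field_split elim by (simp add: algebra_simps)
    qed
  qed
  also have "\<dots> \<le> \<bar>l1\<bar> * L2_norm ?d + \<bar>l2\<bar> * L2_norm (\<lambda>x. complex_of_real (Re (dipolar_conv ?d x)))"
    using L2_add(2)[OF L2_scale(1)[OF d, of "complex_of_real l1"] L2_scale(1)[OF r(1), of "complex_of_real l2"]]
    by (simp add: L2_scale(2)[OF d] L2_scale(2)[OF r(1)])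
  also have "\<dots> \<le> \<bar>l1\<bar> * (2 * S * L2_norm (\<lambda>x. u x - v x)) + \<bar>l2\<bar> * (8 / 3 * pi * (2 * S * L2_norm (\<lambda>x. u x - v x)))"
    using modulus_sq_diff_L2[OF u v] order.trans[OF r(2) order.trans[OF dipolar_conv_L2(2)[OF d] mult_left_mono[OF modulus_sq_diff_L2[OF u v]]]]
    by (intro add_mono mult_left_mono) auto
  finally show ?thesis by (simp add: coupling_def algebra_simps)
qed

lemma L2_mult_bounded:
  assumes V: "V \<in> L2" and u: "u \<in> borel_measurable borel" and S: "\<And>x. cmod (u x) \<le> S"
  shows "(\<lambda>x. V x * u x) \<in> L2" "L2_norm (\<lambda>x. V x * u x) \<le> S * L2_norm V"
proof -
  note [measurable] = L2_measurable[OF V] u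
  have S0: "0 \<le> S" using order.trans[OF norm_ge_zero S] .
  have m: "(\<lambda>x. V x * u x) \<in> borel_measurable borel" by measurable
  have "AE x in lborel. cmod (V x * u x) \<le> S * cmod (V x)"
    by (intro AE_I2) (simp add: norm_mult mult.commute[of "cmod (V _)"] mult_right_mono S)
  from L2_mono[OF m V S0 this]
  show "(\<lambda>x. V x * u x) \<in> L2" "L2_norm (\<lambda>x. V x * u x) \<le> S * L2_norm V" by blast+
qed

lemma nonlinearity_L2:
  assumes u: "u \<in> L2" "\<And>x. cmod (u x) \<le> S"
  shows "nonlinearity l1 l2 u \<in> L2" "L2_norm (nonlinearity l1 l2 u) \<le> coupling l1 l2 * S\<^sup>2 * L2_norm u"
proof -
  note n = L2_mult_bounded[OF mean_field_L2(1)[OF u] L2_measurable[OF u(1)] u(2), of l1 l2]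
  have S0: "0 \<le> S" using order.trans[OF norm_ge_zero u(2)] .
  show "nonlinearity l1 l2 u \<in> L2" using n(1) by (simp add: nonlinearity_def[abs_def])
  have "L2_norm (nonlinearity l1 l2 u) \<le> S * L2_norm (mean_field l1 l2 u)"
    using n(2) by (simp add: nonlinearity_def[abs_def])
  also have "\<dots> \<le> S * (coupling l1 l2 * (S * L2_norm u))" by (intro mult_left_mono mean_field_L2 u S0)
  finally show "L2_norm (nonlinearity l1 l2 u) \<le> coupling l1 l2 * S\<^sup>2 * L2_norm u"
    by (simp add: power2_eq_square mult_ac)
qed

text \<open>With \<open>V\<close> for the potential, the difference is
  \<open>(V u - V v) * u + V v * (u - v)\<close>. Potentials are controlled in L2 only, so the
  second term asks for a pointwise bound on \<open>u - v\<close>, while the first asks for one in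
  L2. The terms contribute 2 and 1 to the factor 3.\<close>

lemma nonlinearity_diff_L2:
  assumes u: "u \<in> L2" "\<And>x. cmod (u x) \<le> S" and v: "v \<in> L2" "\<And>x. cmod (v x) \<le> S" "L2_norm v \<le> S"
    and d: "L2_norm (\<lambda>x. u x - v x) \<le> e" "\<And>x. cmod (u x - v x) \<le> e"
  shows "L2_norm (\<lambda>x. nonlinearity l1 l2 u x - nonlinearity l1 l2 v x) \<le> 3 * coupling l1 l2 * S\<^sup>2 * e"
proof -
  have S0: "0 \<le> S" using order.trans[OF norm_ge_zero u(2)] .
  have e0: "0 \<le> e" using order.trans[OF norm_ge_zero d(2)] .
  have D: "(\<lambda>x. u x - v x) \<in> L2" by (intro L2_diff u v)
  have M: "(\<lambda>x. mean_field l1 l2 u x - mean_field l1 l2 v x) \<in> L2"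
    by (rule L2_diff(1)[OF mean_field_L2(1)[OF u] mean_field_L2(1)[OF v(1,2)]])
  note n1 = L2_mult_bounded[OF M L2_measurable[OF u(1)] u(2)]
  note n2 = L2_mult_bounded[OF mean_field_L2(1)[OF v(1,2)] L2_measurable[OF D] d(2), of l1 l2]
  have "L2_norm (\<lambda>x. nonlinearity l1 l2 u x - nonlinearity l1 l2 v x)
      = L2_norm (\<lambda>x. (mean_field l1 l2 u x - mean_field l1 l2 v x) * u x + mean_field l1 l2 v x * (u x - v x))"
    by (simp add: nonlinearity_def algebra_simps)
  also have "\<dots> \<le> S * L2_norm (\<lambda>x. mean_field l1 l2 u x - mean_field l1 l2 v x) + e * L2_norm (mean_field l1 l2 v)"
    using L2_add(2)[OF n1(1) n2(1)] n1(2) n2(2) by linarith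
  also have "\<dots> \<le> S * (coupling l1 l2 * (2 * S * e)) + e * (coupling l1 l2 * (S * S))"
  proof (intro add_mono mult_left_mono)
    have "2 * S * L2_norm (\<lambda>x. u x - v x) \<le> 2 * S * e" using d(1) S0 by (intro mult_left_mono) auto
    then show "L2_norm (\<lambda>x. mean_field l1 l2 u x - mean_field l1 l2 v x) \<le> coupling l1 l2 * (2 * S * e)"
      using mean_field_diff_L2[OF u v(1,2), of l1 l2] mult_left_mono[OF _ coupling_nonneg[of l1 l2]] order.trans by blast
    have "S * L2_norm v \<le> S * S" using v(3) S0 by (intro mult_left_mono) auto
    then show "L2_norm (mean_field l1 l2 v) \<le> coupling l1 l2 * (S * S)"
      using mean_field_L2(2)[OF v(1,2), of l1 l2] mult_left_mono[OF _ coupling_nonneg[of l1 l2]] order.trans by blast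
  qed (use S0 e0 in auto)
  also have "\<dots> = 3 * coupling l1 l2 * S\<^sup>2 * e" by (simp add: power2_eq_square)
  finally show ?thesis .
qed

subsection \<open>A contraction principle\<close>

text \<open>Banach's fixed point theorem on the real-valued functions in the unit ball, iterating
  from 0. The fixed point equation holds almost everywhere, because the limit is a representative of
  an L2 class.\<close>

lemma L2_contraction:
  fixes \<Phi> :: "field3 \<Rightarrow> field3"
  assumes maps: "\<And>f. f \<in> L2 \<Longrightarrow> L2_norm f \<le> 1 \<Longrightarrow> (\<And>x. cnj (f x) = f x) \<Longrightarrow>
        \<Phi> f \<in> L2 \<and> L2_norm (\<Phi> f) \<le> 1 \<and> (\<forall>x. cnj (\<Phi> f x) = \<Phi> f x)"
    and contr: "\<And>f g. f \<in> L2 \<Longrightarrow> L2_norm f \<le> 1 \<Longrightarrow> g \<in> L2 \<Longrightarrow> L2_norm g \<le> 1 \<Longrightarrow>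
        L2_norm (\<lambda>x. \<Phi> f x - \<Phi> g x) \<le> 1 / 2 * L2_norm (\<lambda>x. f x - g x)"
  obtains f where "f \<in> L2" "L2_norm f \<le> 1" "\<And>x. cnj (f x) = f x" "AE x in lborel. f x = \<Phi> f x"
proof -
  define s where "s n = (\<Phi> ^^ n) (\<lambda>x. 0)" for n
  have s_Suc: "s (Suc n) = \<Phi> (s n)" for n by (simp add: s_def)
  have s: "s n \<in> L2 \<and> L2_norm (s n) \<le> 1 \<and> (\<forall>x. cnj (s n x) = s n x)" for n
  proof (induction n)
    case 0
    then show ?case by (simp add: s_def)
  next
    case (Suc n)
    then show ?case unfolding s_Suc using maps by blast
  qed
  \<comment> \<open>The initial constant 2 bounds the distance of two elements of the unit
    ball.\<close>
  have step: "L2_norm (\<lambda>x. s (Suc n) x - s n x) \<le> 2 * (1 / 2) ^ n" for n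
  proof (induction n)
    case 0
    have "L2_norm (\<lambda>x. s (Suc 0) x - s 0 x) \<le> L2_norm (s (Suc 0)) + L2_norm (s 0)"
      using s by (intro L2_diff) auto
    with s[of "Suc 0"] s[of 0] show ?case by simp
  next
    case (Suc n)
    have "L2_norm (\<lambda>x. s (Suc (Suc n)) x - s (Suc n) x) \<le> 1 / 2 * L2_norm (\<lambda>x. s (Suc n) x - s n x)"
      unfolding s_Suc[of "Suc n"] using contr[of "s (Suc n)" "s n"] s[of n] s[of "Suc n"] by (subst (2) s_Suc) blast
    with Suc show ?case by simp
  qed
  obtain F where F: "F \<in> L2" and lim: "\<And>n. L2_norm (\<lambda>x. s n x - F x) \<le> 2 * 2 * (1 / 2) ^ n"
    using L2_Cauchy_geometric[of s 2] s step by blast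
  \<comment> \<open>A limit in L2 of real functions may fail to be real on a null set; its real part
    is a limit as well and is real everywhere.\<close>
  define f where "f x = complex_of_real (Re (F x))" for x
  have f: "f \<in> L2" unfolding f_def[abs_def] by (rule L2_Re(1)[OF F])
  have conv: "L2_norm (\<lambda>x. s n x - f x) \<le> 4 * (1 / 2) ^ n" for n
  proof -
    have d: "(\<lambda>x. s n x - F x) \<in> L2" using s F by (intro L2_diff) auto
    have "s n x = complex_of_real (Re (s n x))" for x using s[of n] by (simp add: complex_eq_iff)
    then have "(\<lambda>x. s n x - f x) = (\<lambda>x. complex_of_real (Re (s n x - F x)))"
      by (auto simp: f_def fun_eq_iff)
    then show ?thesis using L2_Re(2)[OF d] lim[of n] by simp
  qed
  have null: "(\<lambda>n. 8 * (1 / 2) ^ n) \<longlonglongrightarrow> (0::real)"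
    using tendsto_mult_left[OF LIMSEQ_power_zero[of "1 / 2 :: real"], of 8] by simp
  have "L2_norm f \<le> 1 + 8 * (1 / 2) ^ n" for n
  proof -
    have "L2_norm f = L2_norm (\<lambda>x. s n x - (s n x - f x))" by simp
    also have "\<dots> \<le> L2_norm (s n) + L2_norm (\<lambda>x. s n x - f x)" using s f by (intro L2_diff) auto
    also have "\<dots> \<le> 1 + 4 * (1 / 2) ^ n" using s[of n] conv[of n] by linarith
    also have "\<dots> \<le> 1 + 8 * (1 / 2) ^ n" using zero_le_power[of "1 / 2 :: real" n] by simp
    finally show ?thesis .
  qed
  then have f1: "L2_norm f \<le> 1"
    using tendsto_add[OF tendsto_const[of 1] null] by (intro LIMSEQ_le_const[of _ 1]) auto
  have real: "cnj (f x) = f x" for x by (simp add: f_def)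
  have \<Phi>f: "\<Phi> f \<in> L2" using maps[OF f f1 real] by blast
  have "L2_norm (\<lambda>x. f x - \<Phi> f x) \<le> 8 * (1 / 2) ^ n" for n
  proof -
    have "L2_norm (\<lambda>x. f x - \<Phi> f x) \<le> L2_norm (\<lambda>x. f x - s (Suc n) x) + L2_norm (\<lambda>x. s (Suc n) x - \<Phi> f x)"
      using s f \<Phi>f by (intro L2_norm_triangle) auto
    also have "L2_norm (\<lambda>x. s (Suc n) x - \<Phi> f x) \<le> 1 / 2 * L2_norm (\<lambda>x. s n x - f x)"
      unfolding s_Suc using contr[of "s n" f] s[of n] f f1 by blast
    finally have "L2_norm (\<lambda>x. f x - \<Phi> f x) \<le> L2_norm (\<lambda>x. s (Suc n) x - f x) + 1 / 2 * L2_norm (\<lambda>x. s n x - f x)"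
      by (simp add: L2_norm_minus_commute[of f "s (Suc n)"])
    moreover have "L2_norm (\<lambda>x. s (Suc n) x - f x) \<le> 2 * (1 / 2) ^ n" using conv[of "Suc n"] by simp
    moreover have "0 \<le> (1 / 2 :: real) ^ n" by simp
    ultimately show ?thesis using conv[of n] by linarith
  qed
  then have "L2_norm (\<lambda>x. f x - \<Phi> f x) \<le> 0" by (intro LIMSEQ_le_const[OF null]) blast
  then have "L2_norm (\<lambda>x. f x - \<Phi> f x) = 0" by (simp add: order_antisym)
  from L2_norm_eq_0_AE[OF L2_diff(1)[OF f \<Phi>f] this] have "AE x in lborel. f x = \<Phi> f x"
    by eventually_elim simp
  with f f1 real show ?thesis by (rule that)
qed

subsection \<open>Weak derivatives\<close>

lemma weak_partial_unique:
  assumes u: "is_weak_partial j u g" "is_weak_partial j u h" and L2: "g \<in> L2" "h \<in> L2"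
  shows "AE x in lborel. g x = h x"
proof -
  have "AE x in lborel. g x - h x = 0"
  proof (rule weakly_zero_AE[OF L2_diff(1)[OF L2]])
    fix \<phi> assume \<phi>: "\<phi> \<in> test_functions"
    have "(LINT x|lborel. g x * \<phi> x) = (LINT x|lborel. h x * \<phi> x)"
      using u \<phi> by (force simp: is_weak_partial_def)
    then show "(LINT x|lborel. (g x - h x) * \<phi> x) = 0"
      unfolding left_diff_distrib
      by (subst Bochner_Integration.integral_diff[OF L2_mult_integrable[OF L2(1) test_L2[OF \<phi>]] L2_mult_integrable[OF L2(2) test_L2[OF \<phi>]]]) simp
  qed
  then show ?thesis by eventually_elim simp
qed

text \<open>\<open>weak_partial\<close> is a choice. Uniqueness up to null sets lets any known weak
  derivative stand in for it inside the norms.\<close>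

lemma L2_norm_weak_partial:
  assumes u: "is_weak_partial j u g" and g: "g \<in> L2"
  shows "L2_norm (weak_partial j u) = L2_norm g"
proof -
  have "weak_partial j u \<in> L2 \<and> is_weak_partial j u (weak_partial j u)"
    unfolding weak_partial_def by (rule someI[of _ g]) (use assms in simp)
  then show ?thesis
    by (intro L2_cong_AE(2)[OF g] weak_partial_unique[OF _ u _ g] L2_measurable) auto
qed

lemma is_weak_partial_scale:
  assumes "is_weak_partial j u g"
  shows "is_weak_partial j (\<lambda>x. c * u x) (\<lambda>x. c * g x)"
  unfolding is_weak_partial_def
proof
  fix \<phi> assume "\<phi> \<in> test_functions"
  with assms have "(LINT x|lborel. u x * partial j \<phi> x) = - (LINT x|lborel. g x * \<phi> x)"
    by (auto simp: is_weak_partial_def)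
  then show "(LINT x|lborel. c * u x * partial j \<phi> x) = - (LINT x|lborel. c * g x * \<phi> x)"
    by (simp add: mult.assoc)
qed

lemma is_weak_partial_add:
  assumes u: "is_weak_partial j u g" "u \<in> L2" "g \<in> L2" and v: "is_weak_partial j v h" "v \<in> L2" "h \<in> L2"
  shows "is_weak_partial j (\<lambda>x. u x + v x) (\<lambda>x. g x + h x)"
  unfolding is_weak_partial_def
proof
  fix \<phi> assume \<phi>: "\<phi> \<in> test_functions"
  note int = L2_mult_integrable[OF _ test_L2[OF \<phi>]] L2_mult_integrable[OF _ test_L2[OF test_partial[OF \<phi>]]]
  show "(LINT x|lborel. (u x + v x) * partial j \<phi> x) = - (LINT x|lborel. (g x + h x) * \<phi> x)"
    using u(1) v(1) \<phi> unfolding distrib_right is_weak_partial_def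
    by (simp add: Bochner_Integration.integral_add int u v)
qed

lemma H1_norm_scale:
  assumes u: "u \<in> H1"
  shows "(\<lambda>x. c * u x) \<in> H1" "H1_norm (\<lambda>x. c * u x) = cmod c * H1_norm u"
proof -
  have L2: "u \<in> L2" using u by (simp add: H1_def)
  have "\<exists>g. \<forall>j. g j \<in> L2 \<and> is_weak_partial j u (g j)"
    using u unfolding H1_def by (intro choice) blast
  then obtain g where g: "\<And>j. g j \<in> L2" "\<And>j. is_weak_partial j u (g j)" by blast
  have cg: "(\<lambda>x. c * g j x) \<in> L2" "is_weak_partial j (\<lambda>x. c * u x) (\<lambda>x. c * g j x)" for j
    by (auto intro: L2_scale is_weak_partial_scale g)
  show "(\<lambda>x. c * u x) \<in> H1" using cg L2_scale(1)[OF L2] unfolding H1_def by blast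
  have wp: "L2_norm (weak_partial j (\<lambda>x. c * u x)) = cmod c * L2_norm (weak_partial j u)" for j
    by (simp add: L2_norm_weak_partial[OF cg(2) cg(1)] L2_norm_weak_partial[OF g(2) g(1)] L2_scale(2)[OF g(1)])
  have "H1_norm (\<lambda>x. c * u x) = sqrt ((cmod c)\<^sup>2 * ((L2_norm u)\<^sup>2 + (\<Sum>j\<in>UNIV. (L2_norm (weak_partial j u))\<^sup>2)))"
    unfolding H1_norm_def wp L2_scale(2)[OF L2] by (simp add: power_mult_distrib sum_distrib_left distrib_left)
  then show "H1_norm (\<lambda>x. c * u x) = cmod c * H1_norm u"
    by (simp add: H1_norm_def real_sqrt_mult)
qed

lemma Sigma_norm_scale:
  assumes u: "u \<in> Sigma_space"
  shows "(\<lambda>x. c * u x) \<in> Sigma_space" "Sigma_norm (\<lambda>x. c * u x) = cmod c * Sigma_norm u"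
proof -
  have H: "u \<in> H1" and int: "integrable lborel (\<lambda>x. (norm x)\<^sup>2 * (cmod (u x))\<^sup>2)" using u by (auto simp: Sigma_space_def)
  have eq: "(norm x)\<^sup>2 * (cmod (c * u x))\<^sup>2 = (cmod c)\<^sup>2 * ((norm x)\<^sup>2 * (cmod (u x))\<^sup>2)" for x :: "real ^ 3"
    by (simp add: norm_mult power_mult_distrib)
  show "(\<lambda>x. c * u x) \<in> Sigma_space"
    unfolding Sigma_space_def mem_Collect_eq eq by (intro conjI H1_norm_scale(1) H integrable_mult_right int)
  have "Sigma_norm (\<lambda>x. c * u x) = sqrt ((cmod c)\<^sup>2 * ((H1_norm u)\<^sup>2 + (LINT x|lborel. (norm x)\<^sup>2 * (cmod (u x))\<^sup>2)))"
    unfolding Sigma_norm_def eq H1_norm_scale(2)[OF H] by (simp add: power_mult_distrib distrib_left)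
  then show "Sigma_norm (\<lambda>x. c * u x) = cmod c * Sigma_norm u"
    by (simp add: Sigma_norm_def real_sqrt_mult)
qed

lemma L2_norm_le_H1_norm: "L2_norm u \<le> H1_norm u"
  unfolding H1_norm_def by (rule real_le_rsqrt) (simp add: sum_nonneg)

text \<open>The squared norm has five terms, for the function, three derivatives and the weight,
  each at most the square of \<open>K\<close>. The factor 3 is a convenient upper bound for the
  square root of 5.\<close>

lemma Sigma_bound:
  assumes u: "u \<in> L2" "L2_norm u \<le> K" and g: "\<And>j. g j \<in> L2" "\<And>j. is_weak_partial j u (g j)" "\<And>j. L2_norm (g j) \<le> K"
    and x: "(\<lambda>x. complex_of_real (norm x) * u x) \<in> L2" "L2_norm (\<lambda>x. complex_of_real (norm x) * u x) \<le> K"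
  shows "u \<in> Sigma_space" "Sigma_norm u \<le> 3 * K"
proof -
  have K: "0 \<le> K" using order.trans[OF L2_norm_nonneg u(2)] .
  have eq: "(cmod (complex_of_real (norm x) * u x))\<^sup>2 = (norm x)\<^sup>2 * (cmod (u x))\<^sup>2" for x
    by (simp add: norm_mult power_mult_distrib)
  have H: "u \<in> H1" using u g unfolding H1_def by blast
  with L2_integrable[OF x(1)] show "u \<in> Sigma_space" unfolding Sigma_space_def eq by simp
  have sq: "r \<le> K \<Longrightarrow> 0 \<le> r \<Longrightarrow> r\<^sup>2 \<le> K\<^sup>2" for r by (intro power_mono) auto
  have "(H1_norm u)\<^sup>2 = (L2_norm u)\<^sup>2 + (\<Sum>j\<in>UNIV. (L2_norm (g j))\<^sup>2)"
    unfolding H1_norm_def by (simp add: sum_nonneg L2_norm_weak_partial[OF g(2) g(1)])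
  also have "\<dots> \<le> K\<^sup>2 + (K\<^sup>2 + K\<^sup>2 + K\<^sup>2)"
    unfolding sum_UNIV_3 by (intro add_mono sq u g L2_norm_nonneg)
  finally have "(H1_norm u)\<^sup>2 + (LINT x|lborel. (norm x)\<^sup>2 * (cmod (u x))\<^sup>2) \<le> (3 * K)\<^sup>2"
    using sq[OF x(2) L2_norm_nonneg] unfolding L2_norm_square[of "\<lambda>x. complex_of_real (norm x) * u x"] eq
    by (simp add: power_mult_distrib) (smt (verit) zero_le_power2)
  then show "Sigma_norm u \<le> 3 * K"
    unfolding Sigma_norm_def using K by (intro real_le_lsqrt) auto
qed

subsection \<open>The ground state and the reduced resolvent\<close>

definition ground :: "real \<Rightarrow> field3" where
  "ground a x = complex_of_real (ground_state a x)"

definition ground_x :: "real \<Rightarrow> 3 \<Rightarrow> field3" where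
  "ground_x a j x = complex_of_real (- a * x $ j * ground_state a x)"

lemma ground_state_has_derivative:
  "(ground_state a has_derivative (\<lambda>v. - a * (x \<bullet> v) * ground_state a x)) (at x)"
proof -
  have "((\<lambda>x. x \<bullet> x) has_derivative (\<lambda>v. 2 * (x \<bullet> v))) (at x)"
    by (auto intro!: derivative_eq_intros simp: inner_commute)
  from has_derivative_mult_right[OF has_derivative_exp[OF has_derivative_mult_right[OF this, of "- (a / 2)"]], of "sqrt (sqrt (a / pi) ^ 3)"]
  show ?thesis unfolding ground_state_def[abs_def] by (rule has_derivative_eq_rhs) (auto simp: algebra_simps)
qed

lemma ground_weak_partial: "is_weak_partial j (ground a) (ground_x a j)"
proof -
  have c: "continuous_on UNIV (ground_state a)"
    by (rule has_derivative_continuous_on[OF has_derivative_at_withinI[OF ground_state_has_derivative]])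
  have "continuous_on UNIV (\<lambda>x. - a * (x \<bullet> axis j 1) * ground_state a x)"
    by (intro continuous_intros c)
  then show ?thesis
    unfolding is_weak_partial_def ground_def ground_x_def
    using integral_by_parts_test[OF ground_state_has_derivative, of a j] by (auto simp: inner_axis_one)
qed

text \<open>Half of the Gaussian rate is spent on absorbing the quadratic weight; the other half
  remains as a square integrable Gaussian.\<close>

lemma weighted_ground_L2:
  assumes a: "0 < a" and m: "p \<in> borel_measurable borel" and p: "\<And>x. cmod (p x) \<le> c * (1 + x \<bullet> x)"
  shows "(\<lambda>x. p x * ground a x) \<in> L2"
proof -
  obtain C where C: "0 < C" "\<And>t. 0 \<le> t \<Longrightarrow> (1 + t) ^ 1 * exp (- (a / 2) * t) \<le> C * exp (- (a / 4) * t)"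
    using power_absorbed_by_exp[of "a / 4" "a / 2" 1] a by auto
  note [measurable] = m L2_measurable[OF ground_state_L2[OF a]]
  have c0: "0 \<le> c" using order.trans[OF norm_ge_zero p[of 0]] by simp
  let ?s = "sqrt (sqrt (a / pi) ^ 3)"
  show ?thesis
  proof (rule L2_mono(1)[OF _ gaussian_L2[of "a / 4" 0]])
    show "(\<lambda>x. p x * ground a x) \<in> borel_measurable borel" unfolding ground_def by measurable
    show "AE x in lborel. cmod (p x * ground a x) \<le> (c * ?s * C) * cmod (complex_of_real (exp (- (a / 4) * (norm x)\<^sup>2)) * cis (x \<bullet> 0))"
    proof (intro AE_I2)
      fix x :: "real ^ 3"
      have "cmod (p x * ground a x) = cmod (p x) * (?s * exp (- (a / 2) * (x \<bullet> x)))"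
        using a by (simp add: norm_mult ground_def ground_state_def)
      also have "\<dots> \<le> (c * (1 + x \<bullet> x)) * (?s * exp (- (a / 2) * (x \<bullet> x)))"
        using a by (intro mult_right_mono p) simp
      also have "\<dots> = c * ?s * ((1 + x \<bullet> x) * exp (- (a / 2) * (x \<bullet> x)))" by simp
      also have "\<dots> \<le> c * ?s * (C * exp (- (a / 4) * (x \<bullet> x)))"
        using C(2)[of "x \<bullet> x"] a c0 by (intro mult_left_mono) auto
      finally show "cmod (p x * ground a x) \<le> (c * ?s * C) * cmod (complex_of_real (exp (- (a / 4) * (norm x)\<^sup>2)) * cis (x \<bullet> 0))"
        by (simp add: power2_norm_eq_inner mult.assoc)
    qed
  qed (use a C c0 in auto)
qed

lemma norm_le_one_plus_square: "norm x \<le> 1 + x \<bullet> x" for x :: "real ^ 3"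
proof -
  have "0 \<le> (1 - norm x)\<^sup>2" by simp
  then have "2 * norm x \<le> 1 + (norm x)\<^sup>2" by (simp add: power2_diff)
  then show ?thesis using norm_ge_zero[of x] unfolding power2_norm_eq_inner by linarith
qed

lemma ground_L2:
  assumes a: "0 < a"
  shows "ground a \<in> L2" "ground_x a j \<in> L2" "(\<lambda>x. complex_of_real (norm x) * ground a x) \<in> L2"
proof -
  have [measurable]: "(\<lambda>x::real^3. x $ j) \<in> borel_measurable borel" for j
    unfolding inner_axis_one[symmetric] by measurable
  show "ground a \<in> L2" using ground_state_L2[OF a] by (simp add: ground_def[abs_def])
  have "(\<lambda>x. complex_of_real (- a * x $ j) * ground a x) \<in> L2"
  proof (rule weighted_ground_L2[OF a])
    show "cmod (complex_of_real (- a * x $ j)) \<le> a * (1 + x \<bullet> x)" for x :: "real ^ 3"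
      using order.trans[OF component_le_norm_cart norm_le_one_plus_square, of x j] a by (simp add: norm_mult abs_mult)
  qed measurable
  then show "ground_x a j \<in> L2" by (simp add: ground_x_def[abs_def] ground_def mult.assoc)
  show "(\<lambda>x. complex_of_real (norm x) * ground a x) \<in> L2"
    by (rule weighted_ground_L2[OF a, of _ 1]) (simp_all add: norm_le_one_plus_square)
qed

lemma ground_sup: "0 < a \<Longrightarrow> cmod (ground a x) \<le> sqrt (sqrt (a / pi) ^ 3)"
  unfolding ground_def norm_of_real by (simp add: ground_state_def abs_mult mult_left_le)

text \<open>The pairing is bilinear, which agrees with the L2 inner product because the ground state
  is real.\<close>

definition ground_coeff :: "real \<Rightarrow> field3 \<Rightarrow> complex" where
  "ground_coeff a f = (LINT x|lborel. f x * ground a x)"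

text \<open>Subtracting the component along the ground state gives the result coefficient 0 by
  construction. The weak equation is not disturbed, as the ground state lies in the kernel of the
  shifted oscillator.\<close>

definition reduced_resolvent :: "real \<Rightarrow> field3 \<Rightarrow> field3" where
  "reduced_resolvent a f x = resolvent a f x + - ground_coeff a (resolvent a f) * ground a x"

definition reduced_resolvent_x :: "real \<Rightarrow> 3 \<Rightarrow> field3 \<Rightarrow> field3" where
  "reduced_resolvent_x a j f x = resolvent_x a j f x + - ground_coeff a (resolvent a f) * ground_x a j x"

lemma ground_coeff_le: "0 < a \<Longrightarrow> f \<in> L2 \<Longrightarrow> cmod (ground_coeff a f) \<le> L2_norm f * L2_norm (ground a)"
  unfolding ground_coeff_def by (rule L2_Cauchy_Schwarz[OF _ ground_L2(1)])

lemma ground_coeff_diff: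
  assumes "0 < a" "f \<in> L2" "g \<in> L2"
  shows "ground_coeff a (\<lambda>x. f x - g x) = ground_coeff a f - ground_coeff a g"
  unfolding ground_coeff_def left_diff_distrib
  by (intro Bochner_Integration.integral_diff L2_mult_integrable assms ground_L2)

lemma ground_coeff_add:
  assumes "0 < a" "f \<in> L2" "g \<in> L2"
  shows "ground_coeff a (\<lambda>x. f x + g x) = ground_coeff a f + ground_coeff a g"
  unfolding ground_coeff_def distrib_right
  by (intro Bochner_Integration.integral_add L2_mult_integrable assms ground_L2)

lemma ground_coeff_scale: "ground_coeff a (\<lambda>x. c * f x) = c * ground_coeff a f"
  unfolding ground_coeff_def by (simp add: mult.assoc)

lemma ground_coeff_ground: "0 < a \<Longrightarrow> ground_coeff a (ground a) = 1"
  using ground_state_normalized[of a] by (simp add: ground_coeff_def ground_def)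

lemma cnj_ground: "cnj (ground a x) = ground a x"
  by (simp add: ground_def)

lemma cnj_ground_coeff:
  assumes "\<And>x. cnj (f x) = f x" shows "cnj (ground_coeff a f) = ground_coeff a f"
  unfolding ground_coeff_def by (subst Bochner_Integration.integral_cnj[symmetric]) (simp add: assms cnj_ground)

lemma reduced_resolvent_bounds:
  assumes a: "0 < a"
  shows "\<exists>S\<ge>0. \<forall>f\<in>L2. reduced_resolvent a f \<in> L2 \<and> L2_norm (reduced_resolvent a f) \<le> S * L2_norm f \<and>
    (\<lambda>x. complex_of_real (norm x) * reduced_resolvent a f x) \<in> L2 \<and>
    L2_norm (\<lambda>x. complex_of_real (norm x) * reduced_resolvent a f x) \<le> S * L2_norm f \<and>
    (\<forall>j. reduced_resolvent_x a j f \<in> L2 \<and> L2_norm (reduced_resolvent_x a j f) \<le> S * L2_norm f \<and>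
      is_weak_partial j (reduced_resolvent a f) (reduced_resolvent_x a j f)) \<and>
    (\<forall>x. cmod (reduced_resolvent a f x) \<le> S * L2_norm f)"
proof -
  obtain A where A: "0 \<le> A" and RA: "\<And>f j. f \<in> L2 \<Longrightarrow> resolvent a f \<in> L2 \<and> L2_norm (resolvent a f) \<le> A * L2_norm f \<and>
    (\<lambda>x. complex_of_real (norm x) * resolvent a f x) \<in> L2 \<and> L2_norm (\<lambda>x. complex_of_real (norm x) * resolvent a f x) \<le> A * L2_norm f \<and>
    resolvent_x a j f \<in> L2 \<and> L2_norm (resolvent_x a j f) \<le> A * L2_norm f"
    using resolvent_L2_bounds[OF a] by blast
  obtain B where B: "0 \<le> B" and RB: "\<And>f x. f \<in> L2 \<Longrightarrow> cmod (resolvent a f x) \<le> B * L2_norm f"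
    using resolvent_sup_bound[OF a] by blast
  define n where "n = L2_norm (ground a)"
  \<comment> \<open>A common bound for every norm of the ground state that the correction term can
    meet: L2, weighted, derivative and supremum norm.\<close>
  define M where "M = n + L2_norm (\<lambda>x. complex_of_real (norm x) * ground a x) + (\<Sum>j\<in>UNIV. L2_norm (ground_x a j)) + sqrt (sqrt (a / pi) ^ 3)"
  have sum_j: "L2_norm (ground_x a j) \<le> (\<Sum>j\<in>UNIV. L2_norm (ground_x a j))" for j
    by (rule member_le_sum) auto
  have root: "0 \<le> sqrt (sqrt (a / pi) ^ 3)" using a by simp
  have sum0: "0 \<le> (\<Sum>j\<in>UNIV. L2_norm (ground_x a j))" by (simp add: sum_nonneg)
  have M: "0 \<le> M" "n \<le> M" "L2_norm (\<lambda>x. complex_of_real (norm x) * ground a x) \<le> M" "L2_norm (ground_x a j) \<le> M" "cmod (ground a x) \<le> M" for j x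
    using sum0 root sum_j[of j] ground_sup[OF a, of x] L2_norm_nonneg[of "ground a"] L2_norm_nonneg[of "\<lambda>x. complex_of_real (norm x) * ground a x"]
    unfolding M_def n_def by linarith+
  have n0: "0 \<le> n" by (simp add: n_def)
  let ?S = "A + B + A * n * M"
  have "reduced_resolvent a f \<in> L2 \<and> L2_norm (reduced_resolvent a f) \<le> ?S * L2_norm f \<and>
    (\<lambda>x. complex_of_real (norm x) * reduced_resolvent a f x) \<in> L2 \<and>
    L2_norm (\<lambda>x. complex_of_real (norm x) * reduced_resolvent a f x) \<le> ?S * L2_norm f \<and>
    (\<forall>j. reduced_resolvent_x a j f \<in> L2 \<and> L2_norm (reduced_resolvent_x a j f) \<le> ?S * L2_norm f \<and>
      is_weak_partial j (reduced_resolvent a f) (reduced_resolvent_x a j f)) \<and>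
    (\<forall>x. cmod (reduced_resolvent a f x) \<le> ?S * L2_norm f)" if f: "f \<in> L2" for f
  proof -
    let ?c = "- ground_coeff a (resolvent a f)"
    let ?N = "L2_norm f"
    have c: "cmod ?c \<le> A * ?N * n"
      using ground_coeff_le[OF a conjunct1[OF RA[OF f]]] RA[OF f] mult_right_mono[OF _ n0] by (auto simp: n_def intro: order.trans)
    have N: "0 \<le> ?N" by simp
    have cM: "cmod ?c * m \<le> A * n * M * ?N" if "m \<le> M" "0 \<le> m" for m
    proof -
      have "cmod ?c * m \<le> (A * ?N * n) * M" using c that A N n0 by (intro mult_mono) auto
      then show ?thesis by (simp add: mult_ac)
    qed
    \<comment> \<open>All L2 estimates have the same shape: an image of the resolvent plus one and
      the same coefficient times a fixed function.\<close>
    have comb: "(\<lambda>x. p x + ?c * q x) \<in> L2 \<and> L2_norm (\<lambda>x. p x + ?c * q x) \<le> ?S * ?N"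
      if p: "p \<in> L2" "L2_norm p \<le> A * ?N" and q: "q \<in> L2" "L2_norm q \<le> M" for p q
    proof -
      have "L2_norm (\<lambda>x. p x + ?c * q x) \<le> A * ?N + A * n * M * ?N"
        using L2_add(2)[OF p(1) L2_scale(1)[OF q(1), of ?c]] p(2) cM[OF q(2)] unfolding L2_scale(2)[OF q(1)] by simp
      also have "\<dots> \<le> ?S * ?N" using B N by (simp add: distrib_right)
      finally show ?thesis using L2_add(1)[OF p(1) L2_scale(1)[OF q(1), of ?c]] by blast
    qed
    have 1: "reduced_resolvent a f \<in> L2 \<and> L2_norm (reduced_resolvent a f) \<le> ?S * ?N"
      unfolding reduced_resolvent_def[abs_def] using RA[OF f] ground_L2[OF a] M by (intro comb) (auto simp: n_def)
    have eq: "(\<lambda>x. complex_of_real (norm x) * reduced_resolvent a f x)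
        = (\<lambda>x. complex_of_real (norm x) * resolvent a f x + ?c * (complex_of_real (norm x) * ground a x))"
      by (auto simp: reduced_resolvent_def algebra_simps)
    have 2: "(\<lambda>x. complex_of_real (norm x) * reduced_resolvent a f x) \<in> L2 \<and> L2_norm (\<lambda>x. complex_of_real (norm x) * reduced_resolvent a f x) \<le> ?S * ?N"
      unfolding eq using RA[OF f] ground_L2[OF a] M by (intro comb) auto
    have 3: "reduced_resolvent_x a j f \<in> L2 \<and> L2_norm (reduced_resolvent_x a j f) \<le> ?S * ?N" for j
      unfolding reduced_resolvent_x_def[abs_def] using RA[OF f] ground_L2[OF a] M by (intro comb) auto
    have 4: "is_weak_partial j (reduced_resolvent a f) (reduced_resolvent_x a j f)" for j
      unfolding reduced_resolvent_x_def[abs_def] reduced_resolvent_def[abs_def] using RA[OF f] ground_L2[OF a]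
      by (intro is_weak_partial_add is_weak_partial_scale resolvent_weak_partial ground_weak_partial a f L2_scale) auto
    have 5: "cmod (reduced_resolvent a f x) \<le> ?S * ?N" for x
    proof -
      have "cmod (reduced_resolvent a f x) \<le> cmod (resolvent a f x) + cmod ?c * cmod (ground a x)"
        unfolding reduced_resolvent_def by (rule order.trans[OF norm_triangle_ineq]) (simp add: norm_mult)
      also have "\<dots> \<le> B * ?N + A * n * M * ?N" by (intro add_mono RB f cM M) simp
      also have "\<dots> \<le> ?S * ?N" using A N by (simp add: distrib_right)
      finally show ?thesis .
    qed
    show ?thesis using 1 2 3 4 5 by blast
  qed
  moreover have "0 \<le> ?S" using A B M n0 by simp
  ultimately show ?thesis by blast
qed

lemma resolvent_diff:
  assumes a: "0 < a" and f: "f \<in> L2" and g: "g \<in> L2"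
  shows "resolvent a (\<lambda>x. f x - g x) x = resolvent a f x - resolvent a g x"
proof -
  have "integrable lborel (\<lambda>y. complex_of_real (resolvent_kernel a x y) * f y)" "integrable lborel (\<lambda>y. complex_of_real (resolvent_kernel a x y) * g y)"
    using resolvent_sup_bound[OF a] f g by blast+
  then show ?thesis
    unfolding resolvent_def kernel_op_def right_diff_distrib by (rule Bochner_Integration.integral_diff)
qed

lemma reduced_resolvent_diff:
  assumes a: "0 < a" and f: "f \<in> L2" and g: "g \<in> L2"
  shows "reduced_resolvent a f x - reduced_resolvent a g x = reduced_resolvent a (\<lambda>x. f x - g x) x"
proof -
  have L2: "resolvent a f \<in> L2" "resolvent a g \<in> L2" using resolvent_L2_bounds[OF a] f g by blast+
  have "resolvent a (\<lambda>x. f x - g x) = (\<lambda>x. resolvent a f x - resolvent a g x)"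
    using resolvent_diff[OF a f g] by auto
  then show ?thesis
    unfolding reduced_resolvent_def by (simp add: ground_coeff_diff[OF a L2] algebra_simps)
qed

lemma cnj_reduced_resolvent:
  assumes "\<And>x. cnj (f x) = f x"
  shows "cnj (reduced_resolvent a f x) = reduced_resolvent a f x"
proof -
  have "cnj (resolvent a f x) = resolvent a f x" for x
    unfolding resolvent_def kernel_op_def
    by (subst Bochner_Integration.integral_cnj[symmetric]) (simp add: assms)
  then show ?thesis by (simp add: reduced_resolvent_def cnj_ground_coeff cnj_ground)
qed

lemma ground_coeff_reduced_resolvent:
  assumes a: "0 < a" and f: "f \<in> L2"
  shows "ground_coeff a (reduced_resolvent a f) = 0"
proof -
  have L2: "resolvent a f \<in> L2" using resolvent_L2_bounds[OF a] f by blast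
  show ?thesis
    unfolding reduced_resolvent_def[abs_def]
    by (simp only: ground_coeff_add[OF a L2 L2_scale(1)[OF ground_L2(1)[OF a]]] ground_coeff_scale ground_coeff_ground[OF a]) simp
qed

lemma reduced_resolvent_equation:
  assumes a: "0 < a" and f: "f \<in> L2" and \<phi>: "\<phi> \<in> test_functions"
  shows "(LINT x|lborel. (ground a x + reduced_resolvent a f x) * osc_operator a \<phi> x)
    = (LINT x|lborel. f x * \<phi> x) - ground_coeff a f * (LINT x|lborel. ground a x * \<phi> x)"
proof -
  let ?c = "- ground_coeff a (resolvent a f)"
  have L2: "resolvent a f \<in> L2" using resolvent_L2_bounds[OF a] f by blast
  note int = L2_mult_integrable[OF ground_L2(1)[OF a] osc_operator_L2[OF \<phi>, of a]] L2_mult_integrable[OF L2 osc_operator_L2[OF \<phi>, of a]]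
  have "(LINT x|lborel. (ground a x + reduced_resolvent a f x) * osc_operator a \<phi> x)
      = (LINT x|lborel. (1 + ?c) * (ground a x * osc_operator a \<phi> x) + resolvent a f x * osc_operator a \<phi> x)"
    by (simp add: reduced_resolvent_def algebra_simps)
  also have "\<dots> = (1 + ?c) * (LINT x|lborel. ground a x * osc_operator a \<phi> x) + (LINT x|lborel. resolvent a f x * osc_operator a \<phi> x)"
    using int by (subst Bochner_Integration.integral_add) auto
  also have "(LINT x|lborel. ground a x * osc_operator a \<phi> x) = 0"
    using ground_state_equation[OF a \<phi>] by (simp add: ground_def)
  finally show ?thesis
    using resolvent_equation[OF a f \<phi>] by (simp add: ground_coeff_def ground_def)
qed

subsection \<open>Standing waves\<close>

text \<open>The threshold is at most 1, so the square of \<open>e\<close> does not exceed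
  \<open>e\<close>, and \<open>Q / (1 + 2 * Q)\<close> never reaches 1/2.\<close>

lemma square_small:
  fixes e Q :: real
  assumes Q: "0 \<le> Q" and e: "0 \<le> e" "e \<le> 1 / (1 + 2 * Q)"
  shows "e\<^sup>2 * Q \<le> 1 / 2"
proof -
  have "1 / (1 + 2 * Q) \<le> 1" using Q by simp
  with e have "e \<le> 1" by linarith
  with e have "e\<^sup>2 \<le> 1 / (1 + 2 * Q)"
    using mult_left_le[of e e] by (simp add: power2_eq_square)
  then have "e\<^sup>2 * Q \<le> 1 / (1 + 2 * Q) * Q" using Q by (rule mult_right_mono)
  also have "\<dots> \<le> 1 / 2" using Q by (simp add: divide_le_eq)
  finally show ?thesis .
qed

text \<open>
  Lyapunov-Schmidt reduction: for the profile \<open>u = ground a + reduced_resolvent a f\<close> the stationary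
  equation becomes a fixed point equation for the source \<open>f\<close>, and the choice of \<open>\<mu>\<close> makes \<open>f\<close>
  orthogonal to the ground state.
\<close>

lemma stationary_profile:
  assumes a: "0 < a"
  obtains K e0 where "0 < e0" "\<And>e. 0 < e \<Longrightarrow> e \<le> e0 \<Longrightarrow> \<exists>u \<mu> S. u \<in> Sigma_space \<and> Sigma_norm u \<le> K \<and>
    (\<forall>x. cmod (u x) \<le> S) \<and> ground_coeff a u = 1 \<and>
    (\<forall>\<phi>\<in>test_functions. (LINT x|lborel. u x * osc_operator a \<phi> x)
      = complex_of_real (e\<^sup>2) * (LINT x|lborel. (complex_of_real \<mu> * u x - nonlinearity l1 l2 u x) * \<phi> x))"
proof -
  obtain R where R: "0 \<le> R" and RR: "\<And>f x j. f \<in> L2 \<Longrightarrow> reduced_resolvent a f \<in> L2 \<and> L2_norm (reduced_resolvent a f) \<le> R * L2_norm f \<and>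
    (\<lambda>x. complex_of_real (norm x) * reduced_resolvent a f x) \<in> L2 \<and>
    L2_norm (\<lambda>x. complex_of_real (norm x) * reduced_resolvent a f x) \<le> R * L2_norm f \<and>
    reduced_resolvent_x a j f \<in> L2 \<and> L2_norm (reduced_resolvent_x a j f) \<le> R * L2_norm f \<and>
    is_weak_partial j (reduced_resolvent a f) (reduced_resolvent_x a j f) \<and>
    cmod (reduced_resolvent a f x) \<le> R * L2_norm f"
    using reduced_resolvent_bounds[OF a] by blast
  define G where "G = L2_norm (ground a) + L2_norm (\<lambda>x. complex_of_real (norm x) * ground a x) + (\<Sum>j\<in>UNIV. L2_norm (ground_x a j)) + sqrt (sqrt (a / pi) ^ 3)"
  have sum_j: "L2_norm (ground_x a j) \<le> (\<Sum>j\<in>UNIV. L2_norm (ground_x a j))" for j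
    by (rule member_le_sum) auto
  have root: "0 \<le> sqrt (sqrt (a / pi) ^ 3)" using a by simp
  have sum0: "0 \<le> (\<Sum>j\<in>UNIV. L2_norm (ground_x a j))" by (simp add: sum_nonneg)
  have G: "0 \<le> G" "L2_norm (ground a) \<le> G" "L2_norm (\<lambda>x. complex_of_real (norm x) * ground a x) \<le> G" "L2_norm (ground_x a j) \<le> G" "cmod (ground a x) \<le> G" for j x
    using sum0 root sum_j[of j] ground_sup[OF a, of x] L2_norm_nonneg[of "ground a"] L2_norm_nonneg[of "\<lambda>x. complex_of_real (norm x) * ground a x"]
    unfolding G_def by linarith+
  \<comment> \<open>Bounds the profile in L2 and in supremum norm alike. The summand 1 makes the
    powers of \<open>S\<close> increasing, so that all estimates can be collected at the fifth
    power.\<close>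
  define S where "S = 1 + G + R"
  have S: "1 \<le> S" "0 \<le> S" "G \<le> S" "R \<le> S" "G + R \<le> S" using G(1) R by (auto simp: S_def)
  let ?C = "coupling l1 l2"
  note C = coupling_nonneg[of l1 l2]
  \<comment> \<open>The Lipschitz constant of the bracket in the fixed point map: the variation of
    \<mu> contributes 3, that of the profile multiplied by \<mu> contributes 1, and that of the
    nonlinearity 3.\<close>
  define Q where "Q = 7 * (?C * S ^ 5)"
  have CS: "0 \<le> ?C * S ^ n" for n using C S by simp
  have CS5: "?C * S ^ n \<le> ?C * S ^ 5" if "n \<le> 5" for n
    using that S C by (intro mult_left_mono power_increasing) auto
  have Q: "0 \<le> Q" using CS[of 5] by (simp add: Q_def)

  define U where "U f x = ground a x + reduced_resolvent a f x" for f x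
  define N where "N f = nonlinearity l1 l2 (U f)" for f
  \<comment> \<open>A Lagrange multiplier: the profile has ground state coefficient 1, so
    \<open>\<mu> f * U f - N f\<close> has coefficient 0 as soon as the coefficient of
    \<open>N f\<close> is real.\<close>
  define \<mu> where "\<mu> f = Re (ground_coeff a (N f))" for f
  have U: "U f \<in> L2 \<and> L2_norm (U f) \<le> S \<and> cmod (U f x) \<le> S" if f: "f \<in> L2" "L2_norm f \<le> 1" for f x
  proof -
    have r: "R * L2_norm f \<le> R" using f R by (simp add: mult_left_le)
    have "L2_norm (U f) \<le> G + R"
      unfolding U_def[abs_def] using L2_add(2)[OF ground_L2(1)[OF a] conjunct1[OF RR[OF f(1)]]] RR[OF f(1)] G(2) r by fastforce
    moreover have "cmod (U f x) \<le> G + R"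
      unfolding U_def by (rule order.trans[OF norm_triangle_ineq]) (use RR[OF f(1), of _ x] G(5)[of x] r in force)
    moreover have "U f \<in> L2" unfolding U_def[abs_def] by (intro L2_add ground_L2 a conjunct1[OF RR] f)
    ultimately show ?thesis using S by linarith
  qed
  have U_diff: "L2_norm (\<lambda>x. U f x - U g x) \<le> S * L2_norm (\<lambda>x. f x - g x) \<and> cmod (U f x - U g x) \<le> S * L2_norm (\<lambda>x. f x - g x)"
    if f: "f \<in> L2" and g: "g \<in> L2" for f g x
  proof -
    have eq: "U f x - U g x = reduced_resolvent a (\<lambda>x. f x - g x) x" for x
      using reduced_resolvent_diff[OF a f g, of x] by (simp add: U_def)
    have "R * L2_norm (\<lambda>x. f x - g x) \<le> S * L2_norm (\<lambda>x. f x - g x)"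
      using S by (intro mult_right_mono) auto
    then show ?thesis unfolding eq using RR[OF L2_diff(1)[OF f g], of _ x] by force
  qed
  have N: "N f \<in> L2 \<and> L2_norm (N f) \<le> ?C * S ^ 3" if f: "f \<in> L2" "L2_norm f \<le> 1" for f
  proof -
    have u: "U f \<in> L2" "\<And>x. cmod (U f x) \<le> S" "L2_norm (U f) \<le> S" using U[OF f] by auto
    have "?C * S\<^sup>2 * L2_norm (U f) \<le> ?C * S\<^sup>2 * S" using u(3) C S by (intro mult_left_mono) auto
    then show ?thesis
      using nonlinearity_L2[OF u(1,2), of l1 l2] by (auto simp: N_def power2_eq_square power3_eq_cube mult_ac)
  qed
  have N_diff: "L2_norm (\<lambda>x. N f x - N g x) \<le> 3 * (?C * S ^ 3) * L2_norm (\<lambda>x. f x - g x)"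
    if f: "f \<in> L2" "L2_norm f \<le> 1" and g: "g \<in> L2" "L2_norm g \<le> 1" for f g
  proof -
    have u: "U f \<in> L2" "\<And>x. cmod (U f x) \<le> S" using U[OF f] by auto
    have v: "U g \<in> L2" "\<And>x. cmod (U g x) \<le> S" "L2_norm (U g) \<le> S" using U[OF g] by auto
    show ?thesis
      using nonlinearity_diff_L2[OF u v conjunct1[OF U_diff[OF f(1) g(1)]] conjunct2[OF U_diff[OF f(1) g(1)]], of l1 l2]
      by (simp add: N_def power2_eq_square power3_eq_cube mult_ac)
  qed
  have mu_le: "\<bar>Re (ground_coeff a h)\<bar> \<le> S * B" if h: "h \<in> L2" "L2_norm h \<le> B" for h B
  proof -
    have "cmod (ground_coeff a h) \<le> L2_norm h * L2_norm (ground a)" by (rule ground_coeff_le[OF a h(1)])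
    also have "\<dots> \<le> B * S" using h(2) G(2) S by (intro mult_mono order.trans[OF L2_norm_nonneg h(2)]) auto
    finally show ?thesis using abs_Re_le_cmod[of "ground_coeff a h"] by (simp add: mult.commute)
  qed

  have main: "\<exists>u \<mu> S. u \<in> Sigma_space \<and> Sigma_norm u \<le> 3 * (G + R) \<and>
    (\<forall>x. cmod (u x) \<le> S) \<and> ground_coeff a u = 1 \<and>
    (\<forall>\<phi>\<in>test_functions. (LINT x|lborel. u x * osc_operator a \<phi> x)
      = complex_of_real (e\<^sup>2) * (LINT x|lborel. (complex_of_real \<mu> * u x - nonlinearity l1 l2 u x) * \<phi> x))"
    if e: "0 < e" "e \<le> 1 / (1 + 2 * Q)" for e
  proof -
    have eQ: "e\<^sup>2 * Q \<le> 1 / 2" using square_small[OF Q _ e(2)] e(1) by simp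
    \<comment> \<open>The factor is the squared amplitude, which the cubic term applied to
      \<open>e * u\<close> keeps after division of the equation by \<open>e\<close>.\<close>
    define \<Phi> where "\<Phi> f x = complex_of_real (e\<^sup>2) * (complex_of_real (\<mu> f) * U f x - N f x)" for f x
    have \<mu>: "\<bar>\<mu> f\<bar> \<le> ?C * S ^ 4" if f: "f \<in> L2" "L2_norm f \<le> 1" for f
      proof -
        have "S * (?C * S ^ 3) = ?C * S ^ 4" by (simp add: numeral_eq_Suc)
        then show ?thesis using mu_le[of "N f" "?C * S ^ 3"] N[OF f] unfolding \<mu>_def by metis
      qed
    have \<Phi>_L2: "\<Phi> f \<in> L2 \<and> L2_norm (\<Phi> f) \<le> 1" if f: "f \<in> L2" "L2_norm f \<le> 1" for f
    proof -
      have mU: "(\<lambda>x. complex_of_real (\<mu> f) * U f x) \<in> L2" using U[OF f] by (intro L2_scale) auto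
      have "L2_norm (\<lambda>x. complex_of_real (\<mu> f) * U f x) = \<bar>\<mu> f\<bar> * L2_norm (U f)"
        using L2_scale(2)[of "U f"] U[OF f] by simp
      also have "\<dots> \<le> ?C * S ^ 4 * S" using \<mu>[OF f] U[OF f] CS by (intro mult_mono) auto
      also have "\<dots> = ?C * S ^ 5" by (simp add: numeral_eq_Suc mult_ac)
      finally have 1: "L2_norm (\<lambda>x. complex_of_real (\<mu> f) * U f x) \<le> ?C * S ^ 5" .
      have d: "(\<lambda>x. complex_of_real (\<mu> f) * U f x - N f x) \<in> L2" using N[OF f] mU by (intro L2_diff) auto
      have "L2_norm (\<lambda>x. complex_of_real (\<mu> f) * U f x - N f x) \<le> L2_norm (\<lambda>x. complex_of_real (\<mu> f) * U f x) + L2_norm (N f)"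
        using N[OF f] mU by (intro L2_diff) auto
      also have "\<dots> \<le> Q" using 1 N[OF f] CS5[of 3] CS[of 5] unfolding Q_def by linarith
      finally have "e\<^sup>2 * L2_norm (\<lambda>x. complex_of_real (\<mu> f) * U f x - N f x) \<le> e\<^sup>2 * Q" by (rule mult_left_mono) simp
      then show ?thesis unfolding \<Phi>_def[abs_def] using L2_scale[OF d, of "complex_of_real (e\<^sup>2)"] eQ by (simp add: norm_power)
    qed
    have U_real: "cnj (U f x) = U f x" if "\<And>x. cnj (f x) = f x" for f x
      by (simp add: U_def cnj_ground cnj_reduced_resolvent that)
    have N_real: "cnj (N f x) = N f x" if "\<And>x. cnj (f x) = f x" for f x
      by (simp add: N_def nonlinearity_def mean_field_def U_real that)
    have \<Phi>_diff: "L2_norm (\<lambda>x. \<Phi> f x - \<Phi> g x) \<le> 1 / 2 * L2_norm (\<lambda>x. f x - g x)"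
      if f: "f \<in> L2" "L2_norm f \<le> 1" and g: "g \<in> L2" "L2_norm g \<le> 1" for f g
    proof -
      let ?d = "L2_norm (\<lambda>x. f x - g x)"
      have d0: "0 \<le> ?d" by simp
      have Nd: "(\<lambda>x. N f x - N g x) \<in> L2" using N f g by (intro L2_diff) auto
      have Ud: "(\<lambda>x. U f x - U g x) \<in> L2" using U f g by (intro L2_diff) auto
      have "\<mu> f - \<mu> g = Re (ground_coeff a (\<lambda>x. N f x - N g x))"
        using N[OF f] N[OF g] by (subst ground_coeff_diff[OF a]) (auto simp: \<mu>_def)
      then have \<mu>d: "\<bar>\<mu> f - \<mu> g\<bar> \<le> S * (3 * (?C * S ^ 3) * ?d)" using mu_le[OF Nd N_diff[OF f g]] by simp
      let ?p = "\<lambda>x. complex_of_real (\<mu> f - \<mu> g) * U f x" and ?q = "\<lambda>x. complex_of_real (\<mu> g) * (U f x - U g x)"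
      have p: "?p \<in> L2" using U[OF f] by (intro L2_scale) auto
      have q: "?q \<in> L2" by (intro L2_scale Ud)
      have "L2_norm ?p = \<bar>\<mu> f - \<mu> g\<bar> * L2_norm (U f)"
        using L2_scale(2)[of "U f" "complex_of_real (\<mu> f - \<mu> g)"] U[OF f] unfolding norm_of_real by blast
      also have "\<dots> \<le> S * (3 * (?C * S ^ 3) * ?d) * S"
        using \<mu>d U[OF f] S CS[of 3] d0 by (intro mult_mono) auto
      also have "\<dots> = 3 * (?C * S ^ 5) * ?d" by (simp add: numeral_eq_Suc mult_ac)
      finally have pn: "L2_norm ?p \<le> 3 * (?C * S ^ 5) * ?d" .
      have "L2_norm ?q = \<bar>\<mu> g\<bar> * L2_norm (\<lambda>x. U f x - U g x)"
        using L2_scale(2)[OF Ud, of "complex_of_real (\<mu> g)"] unfolding norm_of_real .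
      also have "\<dots> \<le> ?C * S ^ 4 * (S * ?d)"
        using \<mu>[OF g] U_diff[OF f(1) g(1)] CS by (intro mult_mono) auto
      also have "\<dots> = ?C * S ^ 5 * ?d" by (simp add: numeral_eq_Suc mult_ac)
      finally have qn: "L2_norm ?q \<le> ?C * S ^ 5 * ?d" .
      have "3 * (?C * S ^ 3) * ?d \<le> 3 * (?C * S ^ 5) * ?d" using CS5[of 3] d0 by (intro mult_right_mono) auto
      then have nn: "L2_norm (\<lambda>x. N f x - N g x) \<le> 3 * (?C * S ^ 5) * ?d" using N_diff[OF f g] by linarith
      have pq: "(\<lambda>x. ?p x + ?q x) \<in> L2" by (rule L2_add(1)[OF p q])
      have "L2_norm (\<lambda>x. (?p x + ?q x) - (N f x - N g x)) \<le> Q * ?d"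
        using L2_diff(2)[OF pq Nd] L2_add(2)[OF p q] pn qn nn unfolding Q_def by (simp add: algebra_simps)
      then have "e\<^sup>2 * L2_norm (\<lambda>x. (?p x + ?q x) - (N f x - N g x)) \<le> e\<^sup>2 * (Q * ?d)" by (rule mult_left_mono) simp
      also have "\<dots> \<le> 1 / 2 * ?d" using mult_right_mono[OF eQ d0] by (simp add: mult.assoc)
      finally have fin: "e\<^sup>2 * L2_norm (\<lambda>x. (?p x + ?q x) - (N f x - N g x)) \<le> 1 / 2 * ?d" .
      have eq: "\<Phi> f x - \<Phi> g x = complex_of_real (e\<^sup>2) * ((?p x + ?q x) - (N f x - N g x))" for x
        by (simp add: \<Phi>_def algebra_simps)
      show ?thesis
        unfolding eq L2_scale(2)[OF L2_diff(1)[OF pq Nd]] using fin by (simp add: norm_power)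
    qed
    obtain f where f: "f \<in> L2" "L2_norm f \<le> 1" and real: "\<And>x. cnj (f x) = f x" and fixpt: "AE x in lborel. f x = \<Phi> f x"
    proof (rule L2_contraction[of \<Phi>])
      show "\<Phi> f \<in> L2 \<and> L2_norm (\<Phi> f) \<le> 1 \<and> (\<forall>x. cnj (\<Phi> f x) = \<Phi> f x)"
        if "f \<in> L2" "L2_norm f \<le> 1" "\<And>x. cnj (f x) = f x" for f
        using \<Phi>_L2[OF that(1,2)] U_real[OF that(3)] N_real[OF that(3)] by (simp add: \<Phi>_def)
    qed (use \<Phi>_diff in auto)
    have UL: "U f \<in> L2" and NL: "N f \<in> L2" using U[OF f] N[OF f] by auto
    have coeff: "ground_coeff a (U f) = 1"
      unfolding U_def[abs_def] ground_coeff_add[OF a ground_L2(1)[OF a] conjunct1[OF RR[OF f(1)]]]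
      by (simp add: ground_coeff_ground[OF a] ground_coeff_reduced_resolvent[OF a f(1)])
    have \<Phi>f: "\<Phi> f \<in> L2" using \<Phi>_L2[OF f] by blast
    \<comment> \<open>The fixed point equation holds almost everywhere, so it is used only under
      integrals.\<close>
    have cong: "(LINT x|lborel. f x * h x) = (LINT x|lborel. \<Phi> f x * h x)" if h: "h \<in> L2" for h
    proof (rule integral_cong_AE)
      show "AE x in lborel. f x * h x = \<Phi> f x * h x" using fixpt by eventually_elim simp
    qed (use L2_mult_integrable[OF f(1) h] L2_mult_integrable[OF \<Phi>f h] in auto)
    have "ground_coeff a f = ground_coeff a (\<Phi> f)"
      unfolding ground_coeff_def by (rule cong[OF ground_L2(1)[OF a]])
    also have "\<dots> = complex_of_real (e\<^sup>2) * (complex_of_real (\<mu> f) - ground_coeff a (N f))"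
      unfolding \<Phi>_def[abs_def] ground_coeff_scale
      by (simp only: ground_coeff_diff[OF a L2_scale(1)[OF UL] NL] ground_coeff_scale coeff mult_1_right)
    \<comment> \<open>Here reality of \<open>f\<close> enters: the nonlinearity is then real, and
      its coefficient equals the real part that defines \<mu>.\<close>
    also have "complex_of_real (\<mu> f) = ground_coeff a (N f)"
      using cnj_ground_coeff[of "N f" a] N_real[OF real] by (simp add: \<mu>_def complex_eq_iff)
    finally have f0: "ground_coeff a f = 0" by simp
    have eqn: "(LINT x|lborel. U f x * osc_operator a \<phi> x)
      = complex_of_real (e\<^sup>2) * (LINT x|lborel. (complex_of_real (\<mu> f) * U f x - nonlinearity l1 l2 (U f) x) * \<phi> x)"
      if \<phi>: "\<phi> \<in> test_functions" for \<phi>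
      unfolding U_def reduced_resolvent_equation[OF a f(1) \<phi>] f0 cong[OF test_L2[OF \<phi>]]
      unfolding U_def[symmetric] U_def[abs_def, symmetric] \<Phi>_def N_def by (simp add: mult.assoc)
    have r: "R * L2_norm f \<le> R" using f R by (simp add: mult_left_le)
    have sum: "(\<lambda>x. p x + q x) \<in> L2 \<and> L2_norm (\<lambda>x. p x + q x) \<le> G + R"
      if "p \<in> L2" "L2_norm p \<le> G" "q \<in> L2" "L2_norm q \<le> R * L2_norm f" for p q
      using L2_add[OF that(1,3)] that(2,4) r by auto
    have s1: "U f \<in> L2 \<and> L2_norm (U f) \<le> G + R"
      unfolding U_def[abs_def] using RR[OF f(1)] ground_L2[OF a] G by (intro sum) auto
    have s2: "(\<lambda>x. ground_x a j x + reduced_resolvent_x a j f x) \<in> L2 \<and> L2_norm (\<lambda>x. ground_x a j x + reduced_resolvent_x a j f x) \<le> G + R" for j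
      using RR[OF f(1)] ground_L2[OF a] G by (intro sum) auto
    have s3: "(\<lambda>x. complex_of_real (norm x) * U f x) \<in> L2 \<and> L2_norm (\<lambda>x. complex_of_real (norm x) * U f x) \<le> G + R"
      unfolding U_def distrib_left using RR[OF f(1)] ground_L2[OF a] G by (intro sum) auto
    have s4: "is_weak_partial j (U f) (\<lambda>x. ground_x a j x + reduced_resolvent_x a j f x)" for j
      unfolding U_def[abs_def] using RR[OF f(1)] ground_L2[OF a]
      by (intro is_weak_partial_add ground_weak_partial) auto
    have "U f \<in> Sigma_space" "Sigma_norm (U f) \<le> 3 * (G + R)"
      using Sigma_bound[OF conjunct1[OF s1] conjunct2[OF s1] conjunct1[OF s2] s4 conjunct2[OF s2] conjunct1[OF s3] conjunct2[OF s3]] .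
    with U[OF f] coeff eqn show ?thesis by blast
  qed
  have "0 < 1 / (1 + 2 * Q)" using Q by simp
  from that[OF this main] show ?thesis by blast
qed

section \<open>From stationary profiles to solutions in time\<close>

lemma modulus_sq_scale: "modulus_sq (\<lambda>x. c * u x) = (\<lambda>x. complex_of_real ((cmod c)\<^sup>2) * modulus_sq u x)"
  by (simp add: fun_eq_iff modulus_sq_def norm_mult power_mult_distrib)

text \<open>The potential depends on the modulus only, so a phase passes through it and the
  amplitude enters as its square. Undoing the shift of the oscillator adds the energy
  \<open>3 * a / 2\<close> to the frequency.\<close>

lemma gp_rhs_standing_wave:
  assumes u: "u \<in> L2" "\<And>x. cmod (u x) \<le> S" and \<phi>: "\<phi> \<in> test_functions"
    and eq: "(LINT x|lborel. u x * osc_operator a \<phi> x)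
      = complex_of_real ((cmod c)\<^sup>2) * (LINT x|lborel. (complex_of_real \<mu> * u x - nonlinearity l1 l2 u x) * \<phi> x)"
  shows "gp_rhs a l1 l2 (\<lambda>x. c * u x) \<phi>
    = complex_of_real (3 * a / 2 + (cmod c)\<^sup>2 * \<mu>) * (c * (LINT x|lborel. u x * \<phi> x))"
proof -
  let ?D = "dipolar_conv (modulus_sq u)" and ?e = "complex_of_real ((cmod c)\<^sup>2)" and ?N = "nonlinearity l1 l2 u"
  note m = modulus_sq_L2(1)[OF u]
  note D = dipolar_conv_L2(1)[OF m]
  have D': "dipolar_conv (modulus_sq (\<lambda>x. c * u x)) \<in> L2"
    unfolding modulus_sq_scale by (rule dipolar_conv_L2(1)[OF L2_scale(1)[OF m]])
  have "AE x in lborel. dipolar_conv (modulus_sq (\<lambda>x. c * u x)) x = ?e * ?D x"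
    unfolding modulus_sq_scale by (rule dipolar_conv_scale[OF m])
  moreover have "AE x in lborel. cnj (?D x) = ?D x"
    by (rule dipolar_conv_real[OF m]) (simp add: modulus_sq_def)
  \<comment> \<open>Reconciles the representative of the convolution chosen in the equation with the
    real part used in \<open>mean_field\<close>; scaling and reality both hold almost
    everywhere.\<close>
  ultimately have DE: "AE x in lborel. dipolar_conv (modulus_sq (\<lambda>x. c * u x)) x = ?e * complex_of_real (Re (?D x))"
    by eventually_elim (simp add: complex_eq_iff)
  note [measurable] = L2_measurable[OF u(1)] L2_measurable[OF D'] L2_measurable[OF osc_operator_L2[OF \<phi>]] test_measurable[OF \<phi>]
    L2_measurable[OF nonlinearity_L2(1)[OF u]]
  have mD: "dipolar_conv (modulus_sq (\<lambda>x. c * u x)) \<in> borel_measurable borel" "modulus_sq (\<lambda>x. c * u x) \<in> borel_measurable borel"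
    using D' unfolding modulus_sq_scale by (auto intro!: L2_measurable L2_scale m)
  note [measurable] = mD
  \<comment> \<open>The Laplacian is traded for \<open>osc_operator\<close>, which leaves the trap
    potential with the opposite sign. It cancels against the trap term of the equation pointwise,
    under the integral.\<close>
  have lap: "- (1 / 2) * v * laplacian \<phi> x = v * osc_operator a \<phi> x - v * (complex_of_real (a\<^sup>2 / 2 * (norm x)\<^sup>2 - 3 * a / 2) * \<phi> x)" for v x
    by (simp add: osc_operator_def algebra_simps)
  have "gp_rhs a l1 l2 (\<lambda>x. c * u x) \<phi> = (LINT x|lborel.
      c * (u x * osc_operator a \<phi> x + (complex_of_real (3 * a / 2) * (u x * \<phi> x) + ?e * (?N x * \<phi> x))))"
    unfolding gp_rhs_def lap
  proof (rule integral_cong_AE)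
    show "AE x in lborel. c * u x * osc_operator a \<phi> x - c * u x * (complex_of_real (a\<^sup>2 / 2 * (norm x)\<^sup>2 - 3 * a / 2) * \<phi> x)
          + (complex_of_real (a\<^sup>2 / 2 * (norm x)\<^sup>2) * (c * u x)
          + complex_of_real l1 * modulus_sq (\<lambda>x. c * u x) x * (c * u x)
          + complex_of_real l2 * dipolar_conv (modulus_sq (\<lambda>x. c * u x)) x * (c * u x)) * \<phi> x
        = c * (u x * osc_operator a \<phi> x + (complex_of_real (3 * a / 2) * (u x * \<phi> x) + ?e * (?N x * \<phi> x)))"
      using DE
    proof eventually_elim
      case (elim x)
      show ?case unfolding elim
        by (simp add: modulus_sq_scale nonlinearity_def mean_field_def modulus_sq_def) (simp add: algebra_simps)
    qed
  qed measurable
  also have "\<dots> = c * ((LINT x|lborel. u x * osc_operator a \<phi> x) + (complex_of_real (3 * a / 2) * (LINT x|lborel. u x * \<phi> x) + ?e * (LINT x|lborel. ?N x * \<phi> x)))"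
    by (simp only: Bochner_Integration.integral_add integral_mult_right_zero integrable_mult_right Bochner_Integration.integrable_add
        L2_mult_integrable[OF u(1) osc_operator_L2[OF \<phi>]] L2_mult_integrable[OF u(1) test_L2[OF \<phi>]]
        L2_mult_integrable[OF nonlinearity_L2(1)[OF u] test_L2[OF \<phi>]])
  also have "(LINT x|lborel. u x * osc_operator a \<phi> x)
      = ?e * (complex_of_real \<mu> * (LINT x|lborel. u x * \<phi> x) - (LINT x|lborel. ?N x * \<phi> x))"
    unfolding eq left_diff_distrib mult.assoc
    by (simp only: Bochner_Integration.integral_diff integral_mult_right_zero integrable_mult_right
        L2_mult_integrable[OF u(1) test_L2[OF \<phi>]] L2_mult_integrable[OF nonlinearity_L2(1)[OF u] test_L2[OF \<phi>]])
  finally show ?thesis by (simp add: algebra_simps)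
qed

text \<open>A solution on the whole line has no proper extension, so maximality is immediate. In
  time the wave is a scalar factor of constant modulus, and both the continuity in \<Sigma> and the
  time derivative are those of that factor.\<close>

lemma standing_wave_solution:
  assumes u: "u \<in> Sigma_space" "\<And>x. cmod (u x) \<le> S" and e: "0 \<le> e"
    and eq: "\<And>\<phi>. \<phi> \<in> test_functions \<Longrightarrow> (LINT x|lborel. u x * osc_operator a \<phi> x)
      = complex_of_real (e\<^sup>2) * (LINT x|lborel. (complex_of_real \<mu> * u x - nonlinearity l1 l2 u x) * \<phi> x)"
    and \<omega>: "\<omega> = 3 * a / 2 + e\<^sup>2 * \<mu>"
  shows "maximal_gp_solution a l1 l2 (\<lambda>x. complex_of_real e * u x) UNIV (\<lambda>t x. complex_of_real e * cis (- \<omega> * t) * u x)"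
proof -
  let ?c = "\<lambda>t. complex_of_real e * cis (- \<omega> * t)"
  have uL2: "u \<in> L2" using u(1) by (simp add: Sigma_space_def H1_def)
  have c: "cmod (?c t) = e" for t using e by (simp add: norm_mult)
  have deriv: "(?c has_vector_derivative - \<i> * complex_of_real \<omega> * ?c t) (at t)" for t
  proof -
    have "(cis has_vector_derivative \<i> * cis (- \<omega> * t)) (at (- \<omega> * t))"
      unfolding has_vector_derivative_def
      by (rule has_derivative_eq_rhs[OF has_derivative_cis[OF has_derivative_ident]]) (simp add: scaleR_conv_of_real mult_ac)
    then have "((cis \<circ> (\<lambda>t. - \<omega> * t)) has_vector_derivative (- \<omega>) *\<^sub>R (\<i> * cis (- \<omega> * t))) (at t)"
      by (intro vector_diff_chain_at) (auto intro!: derivative_eq_intros simp flip: has_real_derivative_iff_has_vector_derivative)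
    from has_vector_derivative_mult_right[OF this, of "complex_of_real e"]
    show ?thesis by (simp add: o_def scaleR_conv_of_real mult_ac)
  qed
  have cont: "(?c \<longlongrightarrow> ?c t) (at t)" for t
    using has_vector_derivative_continuous[OF deriv, of t] by (simp only: continuous_at)
  have "gp_solution a l1 l2 (\<lambda>x. complex_of_real e * u x) UNIV (\<lambda>t x. ?c t * u x)"
    unfolding gp_solution_def
  proof (intro conjI ballI)
    show "(\<lambda>x. ?c t * u x) \<in> Sigma_space" for t by (rule Sigma_norm_scale(1)[OF u(1)])
    fix t
    have "Sigma_norm (\<lambda>x. ?c s * u x - ?c t * u x) = cmod (?c s - ?c t) * Sigma_norm u" for s
      unfolding left_diff_distrib[symmetric] by (rule Sigma_norm_scale(2)[OF u(1)])
    moreover have "((\<lambda>s. cmod (?c s - ?c t) * Sigma_norm u) \<longlongrightarrow> 0 * Sigma_norm u) (at t)"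
      by (intro tendsto_mult_right) (use tendsto_norm[OF LIM_zero[OF cont[of t]]] in \<open>simp only: norm_zero\<close>)
    ultimately show "((\<lambda>s. Sigma_norm (\<lambda>x. ?c s * u x - ?c t * u x)) \<longlongrightarrow> 0) (at t)" by simp
    fix \<phi> assume \<phi>: "\<phi> \<in> test_functions"
    let ?I = "LINT x|lborel. u x * \<phi> x"
    have I: "(\<lambda>s. LINT x|lborel. ?c s * u x * \<phi> x) = (\<lambda>s. ?c s * ?I)" by (simp add: mult.assoc)
    have "((\<lambda>s. LINT x|lborel. ?c s * u x * \<phi> x) has_vector_derivative - \<i> * complex_of_real \<omega> * ?c t * ?I) (at t)"
      unfolding I by (rule has_vector_derivative_mult_left[OF deriv])
    moreover have "\<i> * (- \<i> * z * z' * z'') = z * (z' * z'')" for z z' z'' :: complex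
      by (simp add: mult.assoc[symmetric])
    then have "\<i> * (- \<i> * complex_of_real \<omega> * ?c t * ?I) = gp_rhs a l1 l2 (\<lambda>x. ?c t * u x) \<phi>"
      using gp_rhs_standing_wave[OF uL2 u(2) \<phi>, of a "?c t" \<mu>, unfolded c, OF eq[OF \<phi>]] unfolding \<omega>[symmetric] by metis
    ultimately show "\<exists>d. ((\<lambda>s. LINT x|lborel. ?c s * u x * \<phi> x) has_vector_derivative d) (at t) \<and> \<i> * d = gp_rhs a l1 l2 (\<lambda>x. ?c t * u x) \<phi>"
      by blast
  qed auto
  then show ?thesis unfolding maximal_gp_solution_def by auto
qed

subsection \<open>Standing waves do not scatter\<close>

text \<open>The ground state is itself a Gaussian transform: rate \<open>1 / (2 * a)\<close> in
  space yields rate \<open>a / 2\<close> in frequency. The unsimplified form matches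
  \<open>gaussian_wave_fourier\<close> literally.\<close>

lemma ground_gaussian_wave:
  assumes a: "0 < a"
  obtains k where "\<And>\<xi>. ground a \<xi> = k * complex_of_real (sqrt (pi / (1 / (2 * a))) ^ 3 * exp (- (norm (0 - \<xi>))\<^sup>2 / (4 * (1 / (2 * a)))))"
proof
  fix \<xi>
  show "ground a \<xi> = complex_of_real (sqrt (sqrt (a / pi) ^ 3) / sqrt (pi / (1 / (2 * a))) ^ 3)
      * complex_of_real (sqrt (pi / (1 / (2 * a))) ^ 3 * exp (- (norm (0 - \<xi>))\<^sup>2 / (4 * (1 / (2 * a)))))"
    using a by (simp add: ground_def ground_state_def power2_norm_eq_inner mult.commute)
qed

text \<open>The multiplication formula carries the coefficient to the frequency side, where time
  enters only through the phase, and the remaining factor is integrable as a product of two L2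
  functions.\<close>

lemma ground_coeff_free_evolution:
  assumes a: "0 < a" and p: "p \<in> L2"
  obtains w :: field3 where "integrable lborel w"
    "\<And>t. free_evolution t p \<in> L2 \<and> ground_coeff a (free_evolution t p) = (LINT \<xi>|lborel. cis (- t * (norm \<xi>)\<^sup>2 / 2) * w \<xi>)"
proof -
  let ?c = "1 / (2 * a)"
  let ?g = "gaussian_wave ?c 0"
  obtain k where k: "\<And>\<xi>. ground a \<xi> = k * complex_of_real (sqrt (pi / ?c) ^ 3 * exp (- (norm (0 - \<xi>))\<^sup>2 / (4 * ?c)))"
    using ground_gaussian_wave[OF a] by blast
  have g: "is_fourier ?g (\<lambda>\<xi>. complex_of_real (sqrt (pi / ?c) ^ 3 * exp (- (norm (0 - \<xi>))\<^sup>2 / (4 * ?c))))"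
    using a by (intro gaussian_wave_fourier) simp
  have gk: "is_fourier (\<lambda>x. k * ?g x) (ground a)"
    using is_fourier_scale[OF g, of k] unfolding k[symmetric] .
  obtain F where F: "is_fourier p F" using is_fourier_exists[OF p] by blast
  have [measurable]: "F \<in> borel_measurable borel" by (rule L2_measurable[OF is_fourierD(2)[OF F]])
  show ?thesis
  proof (rule that[of "\<lambda>\<xi>. F \<xi> * (k * ?g \<xi>)"])
    show "integrable lborel (\<lambda>\<xi>. F \<xi> * (k * ?g \<xi>))"
      by (rule L2_mult_integrable[OF is_fourierD(2)[OF F] is_fourierD(1)[OF gk]])
    fix t
    let ?m = "\<lambda>\<xi>::real^3. cis (- t * (norm \<xi>)\<^sup>2 / 2)"
    have m: "?m \<in> borel_measurable borel" "cmod (?m \<xi>) \<le> 1" for \<xi> by simp_all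
    note [measurable] = m(1)
    have L2: "free_evolution t p \<in> L2"
      unfolding free_evolution_def by (rule fourier_multiplier_properties(2)[OF m p])
    \<comment> \<open>The transform behind the chosen multiplier may vary with \<open>t\<close>, but
      almost everywhere it agrees with the fixed \<open>F\<close>; this makes the factor
      \<open>w\<close> independent of time.\<close>
    obtain F' where F': "is_fourier p F'" "is_fourier (free_evolution t p) (\<lambda>\<xi>. ?m \<xi> * F' \<xi>)"
      using fourier_multiplier_properties(1)[OF m p] unfolding free_evolution_def by blast
    have "is_fourier (free_evolution t p) (\<lambda>\<xi>. ?m \<xi> * F \<xi>)"
    proof (rule is_fourier_cong_AE[OF F'(2)])
      show "AE \<xi> in lborel. ?m \<xi> * F \<xi> = ?m \<xi> * F' \<xi>"
        using is_fourier_unique[OF F F'(1)] by eventually_elim simp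
    qed measurable
    from is_fourier_integral_mult[OF this gk] L2
    show "free_evolution t p \<in> L2 \<and> ground_coeff a (free_evolution t p) = (LINT \<xi>|lborel. ?m \<xi> * (F \<xi> * (k * ?g \<xi>)))"
      by (simp add: ground_coeff_def mult.assoc)
  qed
qed

text \<open>The phase equals 1 on countably many spheres only, and spheres are null sets. Where the
  argument of the root is negative, so is the root, and the sphere is empty.\<close>

lemma AE_cis_norm_neq_1: "AE \<xi> in (lborel :: (real ^ 3) measure). cis (\<omega> - (norm \<xi>)\<^sup>2 / 2) \<noteq> 1"
proof -
  have "sphere (0::real^3) r \<in> null_sets lborel" for r
    using negligible_sphere[of "0::real^3" r] by (simp add: negligible_iff_null_sets null_sets_completion_iff)
  then have "AE \<xi> in lborel. \<forall>k::int. \<xi> \<notin> sphere (0::real^3) (sqrt (2 * (\<omega> - real_of_int k * 2 * pi)))"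
    unfolding AE_all_countable by (blast intro: AE_not_in)
  then show ?thesis
  proof eventually_elim
    case (elim \<xi>)
    show ?case
    proof
      assume "cis (\<omega> - (norm \<xi>)\<^sup>2 / 2) = 1"
      then have "cos (\<omega> - (norm \<xi>)\<^sup>2 / 2) = 1" by (simp add: complex_eq_iff)
      then obtain k :: int where k: "\<omega> - (norm \<xi>)\<^sup>2 / 2 = real_of_int k * 2 * pi" unfolding cos_one_2pi_int by blast
      then have "2 * (\<omega> - real_of_int k * 2 * pi) = (norm \<xi>)\<^sup>2" by (simp add: field_simps)
      then have "norm \<xi> = sqrt (2 * (\<omega> - real_of_int k * 2 * pi))" by simp
      with elim show False by simp
    qed
  qed
qed

text \<open>The geometric sums are bounded by \<open>2 / cmod (z - 1)\<close> independently of
  \<open>n\<close>, so division by \<open>n\<close> sends them to 0.\<close>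

lemma geometric_mean_tendsto_0:
  fixes z :: complex
  assumes z: "cmod z = 1" "z \<noteq> 1"
  shows "(\<lambda>n. (\<Sum>k<n. z ^ k) / of_nat n) \<longlonglongrightarrow> 0"
proof (rule Lim_null_comparison)
  have "cmod (\<Sum>k<n. z ^ k) \<le> 2 / cmod (z - 1)" for n
  proof -
    have "cmod (z ^ n - 1) \<le> 2" using norm_triangle_ineq4[of "z ^ n" 1] z(1) by (simp add: norm_power)
    then show ?thesis using z(2) by (simp add: geometric_sum norm_divide divide_right_mono)
  qed
  then show "\<forall>\<^sub>F n in sequentially. norm ((\<Sum>k<n. z ^ k) / of_nat n) \<le> 2 / cmod (z - 1) / real n"
    by (intro always_eventually allI) (simp add: norm_divide divide_right_mono del: divide_divide_eq_left)
  show "(\<lambda>n. 2 / cmod (z - 1) / real n) \<longlonglongrightarrow> 0" by (rule lim_const_over_n)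
qed

text \<open>The mean ergodic theorem in an elementary case: the means of the phases are bounded by 1
  and tend to 0 off a null set, so dominated convergence applies. Sampling at integer times turns
  the averages into geometric sums.\<close>

lemma phase_mean_tendsto_0:
  fixes w :: field3
  assumes w: "integrable lborel w"
  shows "(\<lambda>n. LINT \<xi>|lborel. (\<Sum>k<n. cis (\<omega> - (norm \<xi>)\<^sup>2 / 2) ^ k) / of_nat n * w \<xi>) \<longlonglongrightarrow> 0"
proof -
  have [measurable]: "w \<in> borel_measurable borel" using w by simp
  have "(\<lambda>n. LINT \<xi>|lborel. (\<Sum>k<n. cis (\<omega> - (norm \<xi>)\<^sup>2 / 2) ^ k) / of_nat n * w \<xi>) \<longlonglongrightarrow> (LINT \<xi>|(lborel :: (real ^ 3) measure). 0)"
  proof (rule integral_dominated_convergence)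
    show "integrable lborel (\<lambda>\<xi>. cmod (w \<xi>))" using w by simp
    show "AE \<xi> in lborel. (\<lambda>n. (\<Sum>k<n. cis (\<omega> - (norm \<xi>)\<^sup>2 / 2) ^ k) / of_nat n * w \<xi>) \<longlonglongrightarrow> 0"
      using AE_cis_norm_neq_1[of \<omega>]
    proof eventually_elim
      case (elim \<xi>)
      show ?case using tendsto_mult_right[OF geometric_mean_tendsto_0[OF _ elim], of "w \<xi>"] by simp
    qed
    fix n
    have "cmod ((\<Sum>k<n. cis (\<omega> - (norm \<xi>)\<^sup>2 / 2) ^ k) / of_nat n) \<le> 1" for \<xi> :: "real ^ 3"
    proof -
      have "cmod (\<Sum>k<n. cis (\<omega> - (norm \<xi>)\<^sup>2 / 2) ^ k) \<le> of_nat (card {..<n}) * 1"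
        by (rule sum_norm_bound) (simp add: norm_power)
      then show ?thesis by (cases "n = 0") (simp_all add: norm_divide)
    qed
    then show "AE \<xi> in lborel. norm ((\<Sum>k<n. cis (\<omega> - (norm \<xi>)\<^sup>2 / 2) ^ k) / of_nat n * w \<xi>) \<le> cmod (w \<xi>)"
      unfolding norm_mult by (intro AE_I2 mult_left_le_one_le) simp_all
    show "(\<lambda>\<xi>. (\<Sum>k<n. cis (\<omega> - (norm \<xi>)\<^sup>2 / 2) ^ k) / of_nat n * w \<xi>) \<in> borel_measurable lborel" by measurable
  qed simp
  then show ?thesis by simp
qed

text \<open>
  The coefficient of the standing wave along the ground state rotates with frequency \<open>\<omega>\<close>, while
  the time averages of that of a free wave, rotated back, tend to zero, since \<open>\<Delta>\<close> has no eigenvalues.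
\<close>

lemma standing_wave_not_asymptotically_free:
  assumes a: "0 < a" and u: "u \<in> L2" "ground_coeff a u = 1" and e: "0 < e" and p: "p \<in> L2"
  shows "\<not> ((\<lambda>t. L2_norm (\<lambda>x. complex_of_real e * cis (- \<omega> * t) * u x - free_evolution t p x)) \<longlongrightarrow> 0) at_top"
proof
  let ?d = "\<lambda>t x. complex_of_real e * cis (- \<omega> * t) * u x - free_evolution t p x"
  assume lim: "((\<lambda>t. L2_norm (?d t)) \<longlongrightarrow> 0) at_top"
  obtain w :: field3 where w: "integrable lborel w" and
    free: "\<And>t. free_evolution t p \<in> L2 \<and> ground_coeff a (free_evolution t p) = (LINT \<xi>|lborel. cis (- t * (norm \<xi>)\<^sup>2 / 2) * w \<xi>)"
    by (rule ground_coeff_free_evolution[OF a p]) blast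
  have [measurable]: "w \<in> borel_measurable borel" using w by simp
  \<comment> \<open>Multiplication by \<open>cis (\<omega> * t)\<close> freezes the coefficient of
    the standing wave at the number \<open>e\<close>. The error is controlled because pairing with
    the ground state is continuous on L2.\<close>
  have d: "cmod (e - cis (\<omega> * t) * ground_coeff a (free_evolution t p)) \<le> L2_norm (?d t) * L2_norm (ground a)" for t
  proof -
    have s: "(\<lambda>x. complex_of_real e * cis (- \<omega> * t) * u x) \<in> L2" by (rule L2_scale(1)[OF u(1)])
    have f: "free_evolution t p \<in> L2" using free by blast
    have "e - cis (\<omega> * t) * ground_coeff a (free_evolution t p) = cis (\<omega> * t) * ground_coeff a (?d t)"
      unfolding ground_coeff_diff[OF a s f] ground_coeff_scale u(2)
      by (simp add: right_diff_distrib mult.left_commute[of "cis (\<omega> * t)"] cis_mult)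
    then show ?thesis using ground_coeff_le[OF a L2_diff(1)[OF s f]] by (simp add: norm_mult)
  qed
  have "((\<lambda>t. L2_norm (?d t) * L2_norm (ground a)) \<longlongrightarrow> 0) at_top"
    using tendsto_mult_right[OF lim, of "L2_norm (ground a)"] by simp
  from order_tendstoD(2)[OF this, of "e / 2"] e
  obtain T where T: "\<And>t. T \<le> t \<Longrightarrow> L2_norm (?d t) * L2_norm (ground a) < e / 2"
    by (auto simp: eventually_at_top_linorder)
  obtain M where M: "T \<le> real M" using real_arch_simple by blast
  let ?q = "\<lambda>n. cis (\<omega> * real n) * ground_coeff a (free_evolution (real n) p)"
  have q: "cmod (e - ?q (M + k)) \<le> e / 2" for k
    using order.trans[OF d[of "real (M + k)"]] T[of "real (M + k)"] M by force
  \<comment> \<open>The averages start at time \<open>M\<close>. The corresponding power of the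
    phase is moved into the integrable factor, which leaves plain geometric means.\<close>
  let ?v = "\<lambda>\<xi>::real^3. cis (\<omega> - (norm \<xi>)\<^sup>2 / 2) ^ M * w \<xi>"
  have v_int: "integrable lborel (\<lambda>\<xi>::real^3. cis (\<omega> - (norm \<xi>)\<^sup>2 / 2) ^ k * w \<xi>)" for k
    by (rule Bochner_Integration.integrable_bound[OF w]) (auto simp: norm_mult norm_power)
  have "?q (M + k) = (LINT \<xi>|lborel. cis (\<omega> - (norm \<xi>)\<^sup>2 / 2) ^ (M + k) * w \<xi>)" for k
    unfolding conjunct2[OF free] integral_mult_right_zero[symmetric]
  proof (intro Bochner_Integration.integral_cong refl)
    fix \<xi> :: "real ^ 3"
    have "cis (\<omega> * real (M + k)) * cis (- real (M + k) * (norm \<xi>)\<^sup>2 / 2) = cis (\<omega> - (norm \<xi>)\<^sup>2 / 2) ^ (M + k)"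
      unfolding cis_mult Complex.DeMoivre by (rule arg_cong[of _ _ cis]) (simp add: field_simps)
    then show "cis (\<omega> * real (M + k)) * (cis (- real (M + k) * (norm \<xi>)\<^sup>2 / 2) * w \<xi>) = cis (\<omega> - (norm \<xi>)\<^sup>2 / 2) ^ (M + k) * w \<xi>"
      by (simp add: mult.assoc[symmetric])
  qed
  then have mean: "(\<Sum>k<n. ?q (M + k)) / of_nat n = (LINT \<xi>|lborel. (\<Sum>k<n. cis (\<omega> - (norm \<xi>)\<^sup>2 / 2) ^ k) / of_nat n * ?v \<xi>)" for n
  proof -
    assume eq: "\<And>k. ?q (M + k) = (LINT \<xi>|lborel. cis (\<omega> - (norm \<xi>)\<^sup>2 / 2) ^ (M + k) * w \<xi>)"
    have "(\<Sum>k<n. ?q (M + k)) / of_nat n = (LINT \<xi>|lborel. (\<Sum>k<n. cis (\<omega> - (norm \<xi>)\<^sup>2 / 2) ^ (M + k) * w \<xi>) / of_nat n)"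
      unfolding eq by (simp add: Bochner_Integration.integral_sum[OF v_int])
    moreover have "(\<Sum>k<n. cis (\<omega> - (norm \<xi>)\<^sup>2 / 2) ^ (M + k) * w \<xi>) / of_nat n
        = (\<Sum>k<n. cis (\<omega> - (norm \<xi>)\<^sup>2 / 2) ^ k) / of_nat n * ?v \<xi>" for \<xi>
      by (simp add: sum_distrib_left power_add mult_ac)
    ultimately show ?thesis by simp
  qed
  have "(\<lambda>n. (\<Sum>k<n. ?q (M + k)) / of_nat n) \<longlonglongrightarrow> 0"
    unfolding mean by (rule phase_mean_tendsto_0[OF v_int])
  then have lim0: "(\<lambda>n. cmod (e - (\<Sum>k<n. ?q (M + k)) / of_nat n)) \<longlonglongrightarrow> cmod (complex_of_real e - 0)"
    by (intro tendsto_intros)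
  \<comment> \<open>Every term of the average lies within \<open>e / 2\<close> of \<open>e\<close>,
    and so does the average, although the averages tend to 0.\<close>
  have "cmod (e - (\<Sum>k<n. ?q (M + k)) / of_nat n) \<le> e / 2" if n: "1 \<le> n" for n
  proof -
    have "e - (\<Sum>k<n. ?q (M + k)) / of_nat n = (\<Sum>k<n. e - ?q (M + k)) / of_nat n"
      using n by (simp add: sum_subtractf diff_divide_distrib)
    moreover have "cmod (\<Sum>k<n. e - ?q (M + k)) \<le> of_nat (card {..<n}) * (e / 2)"
      by (rule sum_norm_bound) (rule q)
    ultimately show ?thesis using n by (simp add: norm_divide divide_le_eq mult.commute)
  qed
  then have "cmod (complex_of_real e - 0) \<le> e / 2" by (intro LIMSEQ_le_const2[OF lim0]) blast
  with e show False by simp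
qed

theorem corollary1p1:
  fixes l1 l2 :: real
  assumes "unstable_regime l1 l2"
  shows "\<exists>a0::real. a0 > 0 \<and> (\<forall>a. 0 < a \<and> a \<le> a0 \<longrightarrow>
           \<not> (\<exists>\<delta>::real. \<delta> > 0 \<and>
                (\<forall>\<psi>0\<in>Sigma_space. Sigma_norm \<psi>0 < \<delta> \<longrightarrow>
                   (\<forall>I \<psi>. maximal_gp_solution a l1 l2 \<psi>0 I \<psi> \<longrightarrow> scatters I \<psi>))))"
\<comment> \<open>The standing waves are constructed for each positive \<open>a\<close>, so any
  positive threshold can serve as the witness.\<close>
proof (intro exI[of _ 1] conjI allI impI notI)
  fix a :: real assume "0 < a \<and> a \<le> 1"
  then have a: "0 < a" by blast
  assume "\<exists>\<delta>::real. \<delta> > 0 \<and> (\<forall>\<psi>0\<in>Sigma_space. Sigma_norm \<psi>0 < \<delta> \<longrightarrow>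
    (\<forall>I \<psi>. maximal_gp_solution a l1 l2 \<psi>0 I \<psi> \<longrightarrow> scatters I \<psi>))"
  then obtain \<delta> :: real where \<delta>: "0 < \<delta>" and scattering: "\<And>\<psi>0 I \<psi>. \<psi>0 \<in> Sigma_space \<Longrightarrow> Sigma_norm \<psi>0 < \<delta> \<Longrightarrow>
      maximal_gp_solution a l1 l2 \<psi>0 I \<psi> \<Longrightarrow> scatters I \<psi>"
    by blast
  obtain K e0 where e0: "0 < e0" and profile: "\<And>e. 0 < e \<Longrightarrow> e \<le> e0 \<Longrightarrow> \<exists>u \<mu> S. u \<in> Sigma_space \<and> Sigma_norm u \<le> K \<and>
    (\<forall>x. cmod (u x) \<le> S) \<and> ground_coeff a u = 1 \<and>
    (\<forall>\<phi>\<in>test_functions. (LINT x|lborel. u x * osc_operator a \<phi> x)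
      = complex_of_real (e\<^sup>2) * (LINT x|lborel. (complex_of_real \<mu> * u x - nonlinearity l1 l2 u x) * \<phi> x))"
    by (rule stationary_profile[OF a, of l1 l2]) blast
  \<comment> \<open>\<open>K\<close> bounds the profile in \<Sigma> independently of the amplitude,
    so \<open>e * K\<close> can be pushed below \<delta>. The denominator is positive whatever the
    sign of \<open>K\<close>.\<close>
  define e where "e = min e0 (\<delta> / (1 + \<bar>K\<bar>))"
  have e: "0 < e" "e \<le> e0" "e \<le> \<delta> / (1 + \<bar>K\<bar>)" using e0 \<delta> by (auto simp: e_def)
  obtain u \<mu> S where u: "u \<in> Sigma_space" "Sigma_norm u \<le> K" "\<And>x. cmod (u x) \<le> S" "ground_coeff a u = 1"
    and eq: "\<And>\<phi>. \<phi> \<in> test_functions \<Longrightarrow> (LINT x|lborel. u x * osc_operator a \<phi> x)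
      = complex_of_real (e\<^sup>2) * (LINT x|lborel. (complex_of_real \<mu> * u x - nonlinearity l1 l2 u x) * \<phi> x)"
    using profile[OF e(1,2)] by blast
  have "e * K < e * (1 + \<bar>K\<bar>)" using e(1) by (intro mult_strict_left_mono) auto
  also have "\<dots> \<le> \<delta>" using e(3) by (simp add: pos_le_divide_eq)
  finally have "e * K < \<delta>" .
  have "Sigma_norm (\<lambda>x. complex_of_real e * u x) = e * Sigma_norm u"
    using Sigma_norm_scale(2)[OF u(1), of "complex_of_real e"] e(1) by simp
  also have "\<dots> \<le> e * K" using u(2) e(1) by (intro mult_left_mono) auto
  also have "\<dots> < \<delta>" by (rule \<open>e * K < \<delta>\<close>)
  finally have small: "Sigma_norm (\<lambda>x. complex_of_real e * u x) < \<delta>" .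
  define \<omega> where "\<omega> = 3 * a / 2 + e\<^sup>2 * \<mu>"
  have "scatters UNIV (\<lambda>t x. complex_of_real e * cis (- \<omega> * t) * u x)"
    using e(1) by (intro scattering[OF Sigma_norm_scale(1)[OF u(1)] small] standing_wave_solution[OF u(1,3) _ eq \<omega>_def]) auto
  then obtain p where p: "p \<in> H1"
    and lim: "((\<lambda>t. H1_norm (\<lambda>x. complex_of_real e * cis (- \<omega> * t) * u x - free_evolution t p x)) \<longlongrightarrow> 0) at_top"
    unfolding scatters_def by blast
  \<comment> \<open>Convergence in H1 is weakened to convergence in L2, where the coefficient along
    the ground state is continuous.\<close>
  have "((\<lambda>t. L2_norm (\<lambda>x. complex_of_real e * cis (- \<omega> * t) * u x - free_evolution t p x)) \<longlongrightarrow> 0) at_top"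
    by (rule tendsto_sandwich[OF _ _ tendsto_const lim]) (auto simp: L2_norm_le_H1_norm)
  moreover have "u \<in> L2" "p \<in> L2" using u(1) p by (auto simp: Sigma_space_def H1_def)
  ultimately show False using standing_wave_not_asymptotically_free[OF a _ u(4) e(1)] by blast
qed simp

end
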